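(* Let $\mathcal{N}_{P\to P}$ be a depolarizing channel on $\mathcal{H}_P$ ($\dim\mathcal{H}_P=d_P$), let $\mathcal{H}_L$ be a code space with $\dim\mathcal{H}_L=d_L$, and let $F(\mathcal{N}_{P\to P},d_L)$ be the channel fidelity. Then the channel fidelity can be approximated with the semidefinite program with value $\mathrm{SDP}^\star_n$ defined in the context, where the state can be chosen out of the commutant $\mathcal{A}'_{S_{n_A}\times S_{n_B}\times\mathcal{U}(\mathcal{H}_L)\times\mathcal{U}(\mathcal{H}_P)}$ (here $n_A=n_B=n$, the subscripts only distinguishing the left and right copies of $S_n$), and one can restrict to the irreducibles $(n_A)\vdash n_A$ and $(n_B)\vdash n_B$, i.e. the symmetric subspaces. Furthermore, $$\mathrm{SDP}^\star_n-F(\mathcal{N}_{P\to P},d_L)\le4d_L^4d_P^4\,\frac{\sqrt{4\ln2\,(d_L^2d_P^2-1)\log(n+d_L^2d_P^2)}}{n}.$$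
   Context: $\log$ is base 2. A depolarizing channel is $\mathcal{N}(X)=(1-p)X+p\,\mathrm{tr}[X]\,1/d_P$ (with $p$ such that it is completely positive). $\Phi_{LL}$ denotes the maximally entangled state on $\mathcal{H}_L\otimes\mathcal{H}_L$, $\mathcal{F}(\rho,\sigma)=\lVert\sqrt\rho\sqrt\sigma\rVert_1^2$, and the channel fidelity is $$F(\mathcal{N},d_L)=\sup_{(\mathcal{E},\mathcal{D})}\mathcal{F}\big(\Phi_{LL},\,\mathcal{D}\circ\mathcal{N}\circ\mathcal{E}(\Phi_{LL})\big)$$ over all encoder channels $\mathcal{E}:\mathcal{B}(\mathcal{H}_L)\to\mathcal{B}(\mathcal{H}_P)$ and decoder channels $\mathcal{D}:\mathcal{B}(\mathcal{H}_P)\to\mathcal{B}(\mathcal{H}_L)$, where $\mathcal{D}\circ\mathcal{N}\circ\mathcal{E}$ acts on one half of $\Phi_{LL}$. Systems: for $i=1,\dots,n$ let $a^{(i)}=(PP_{\mathrm{copy}}LL_{\mathrm{copy}})^{(i)}$ and $b^{(i)}=(\bar P\bar P_{\mathrm{copy}}\bar L\bar L_{\mathrm{copy}})^{(i)}$, where all $P$-type systems (barred or not, copies or not) are isomorphic to $\mathcal{H}_P$ and all $L$-type systems are isomorphic to $\mathcal{H}_L$; each $a^{(i)}$, $b^{(i)}$ has dimension $d_L^2d_P^2$. The program: $\mathrm{SDP}^\star_n$ is the supremum of $\mathrm{tr}[(C_{PP}\otimes\Phi_{L\bar L})\,\rho_{P\bar PL\bar L}]$, where $\rho_{P\bar PL\bar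 L}$ is the marginal of $\rho$ on one copy each of $P,\bar P,L,\bar L$, and $C_{PP}$ is the operator on $P\bar P$ that encodes the channel $\mathcal{N}$ in the bilinear form of the channel fidelity problem, i.e. the Choi operator of $\mathcal{N}$ in the normalization for which $F(\mathcal{N},d_L)$ is the supremum of $\mathrm{tr}[(C_{PP}\otimes\Phi_{L\bar L})(\alpha_{PL}\otimes\beta_{\bar P\bar L})]$ over states $\alpha_{PL}$ with $\alpha_P=1_P/d_P$ and $\beta_{\bar P\bar L}$ with $\beta_{\bar L}=1_{\bar L}/d_L$. The supremum is over operators $\rho\ge0$ with $\mathrm{tr}[\rho]=1$ on $a^{(1)}\cdots a^{(n)}b^{(1)}\cdots b^{(n)}$ such that: (a) $\mathrm{tr}_{L^{(n)}(P_{\mathrm{copy}}L_{\mathrm{copy}})^{(n)}}[\rho]=\frac{1_{P^{(n)}}}{d_P}\otimes\rho_{a^{(1)}\cdots a^{(n-1)}b^{(1)}\cdots b^{(n)}}$; (b) $\mathrm{tr}_{\bar P^{(n)}(\bar P_{\mathrm{copy}}\bar L_{\mathrm{copy}})^{(n)}}[\rho]=\rho_{a^{(1)}\cdots a^{(n)}b^{(1)}\cdots b^{(n-1)}}\otimes\frac{1_{\bar L^{(n)}}}{d_L}$; (c) $\rho$ is Bose-symmetric over $a^{(1)},\dots,a^{(n)}$ with respect to the $b$-systems, and Bose-symmetric over $b^{(1)},\dots,b^{(n)}$ with respect to the $a$-systems, i.e. $U_a(\sigma)\rho=\rho$ and $U_b(\sigma)\rho=\rho$ for all $\sigma\in S_n$,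 where $U_a(\sigma),U_b(\sigma)$ permute the $n$ blocks $a^{(i)}$, respectively $b^{(i)}$. Group actions: $S_{n_A}$ and $S_{n_B}$ permute the $a$-blocks and the $b$-blocks, respectively. $U\in\mathcal{U}(\mathcal{H}_P)$ acts as $U\otimes\bar U$ ($\bar U$ the entrywise complex conjugate) on each $P\,P_{\mathrm{copy}}$ and similarly on each $\bar P\,\bar P_{\mathrm{copy}}$, so that the diagonal action on $(PP_{\mathrm{copy}})^{(1\ldots n)}(\bar P\bar P_{\mathrm{copy}})^{(1\ldots n)}$ is $(U\otimes\bar U)^{\otimes 2n}$; $\mathcal{U}(\mathcal{H}_L)$ acts in the same way on $(LL_{\mathrm{copy}})^{(1\ldots n)}(\bar L\bar L_{\mathrm{copy}})^{(1\ldots n)}$. $\mathcal{A}'_{\dots}$ is the commutant of the $*$-algebra generated by all these unitaries.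
   Formalization: On the barred blocks the unitaries act as Ū⊗U on P̄ P̄_copy (and likewise on L̄ L̄_copy) instead of U⊗Ū; with U on P̄ the commutant claim fails, e.g. for the identity channel with d_P=d_L≥2. *)

theory Defs
  imports "HOL-Analysis.Analysis"
begin

text \<open>
  A finite-dimensional Hilbert space is given by a finite index type labelling its standard basis,
  so that operators are complex matrices, and \<open>\<H>\<^sub>A \<otimes> \<H>\<^sub>B\<close> has basis labels in \<open>'a \<times> 'b\<close>.
\<close>

type_synonym 'a cop = "complex^'a^'a"

definition adj :: "complex^'a^'b \<Rightarrow> complex^'b^'a" where
  "adj A = (\<chi> i j. cnj (A $ j $ i))"

definition psd :: "'a::finite cop \<Rightarrow> bool" where
  "psd A \<longleftrightarrow> (\<forall>v. (\<Sum>i\<in>UNIV. cnj (v $ i) * (A *v v) $ i) \<in> \<real>\<^sub>\<ge>\<^sub>0)"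

definition unitary :: "'a::finite cop \<Rightarrow> bool" where
  "unitary U \<longleftrightarrow> adj U ** U = mat 1 \<and> U ** adj U = mat 1"

definition kron :: "'a::finite cop \<Rightarrow> 'b::finite cop \<Rightarrow> ('a \<times> 'b) cop" where
  "kron A B = (\<chi> r s. A $ fst r $ fst s * B $ snd r $ snd s)"

definition cscale :: "complex \<Rightarrow> 'a::finite cop \<Rightarrow> 'a cop" where
  "cscale c A = (\<chi> i j. c * A $ i $ j)"

definition op_sqrt :: "'a::finite cop \<Rightarrow> 'a cop" where
  "op_sqrt A = (THE B. psd B \<and> B ** B = A)"

definition trace_norm :: "'a::finite cop \<Rightarrow> real" where
  "trace_norm A = Re (trace (op_sqrt (adj A ** A)))"

definition fidelity :: "'a::finite cop \<Rightarrow> 'a cop \<Rightarrow> real" where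
  "fidelity \<rho> \<sigma> = (trace_norm (op_sqrt \<rho> ** op_sqrt \<sigma>))\<^sup>2"

definition max_entangled :: "('a::finite \<times> 'a) cop" where
  "max_entangled = (\<chi> r s. if fst r = snd r \<and> fst s = snd s then 1 / of_nat CARD('a) else 0)"


section \<open>Channels and channel fidelity\<close>

text \<open>Positivity of an \<open>m \<times> m\<close> block matrix of operators, i.e. of an operator on
  \<open>\<complex>\<^sup>m \<otimes> \<H>\<close>; this lets the ancilla dimension in complete positivity range over all naturals.\<close>

definition block_psd :: "nat \<Rightarrow> (nat \<Rightarrow> nat \<Rightarrow> 'a::finite cop) \<Rightarrow> bool" where
  "block_psd m X \<longleftrightarrow>
     (\<forall>v. (\<Sum>r<m. \<Sum>s<m. \<Sum>i\<in>UNIV. cnj (v r $ i) * (X r s *v v s) $ i) \<in> \<real>\<^sub>\<ge>\<^sub>0)"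

definition complex_linear_map :: "('a::finite cop \<Rightarrow> 'b::finite cop) \<Rightarrow> bool" where
  "complex_linear_map f \<longleftrightarrow>
     (\<forall>X Y. f (X + Y) = f X + f Y) \<and> (\<forall>c X. f (cscale c X) = cscale c (f X))"

definition completely_positive :: "('a::finite cop \<Rightarrow> 'b::finite cop) \<Rightarrow> bool" where
  "completely_positive f \<longleftrightarrow>
     (\<forall>m X. block_psd m X \<longrightarrow> block_psd m (\<lambda>r s. f (X r s)))"

definition quantum_channel :: "('a::finite cop \<Rightarrow> 'b::finite cop) \<Rightarrow> bool" where
  "quantum_channel f \<longleftrightarrow>
     complex_linear_map f \<and> completely_positive f \<and> (\<forall>X. trace (f X) = trace X)"

definition depolarizing :: "real \<Rightarrow> 'p::finite cop \<Rightarrow> 'p cop" where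
  "depolarizing p X =
     cscale (of_real (1 - p)) X + cscale (of_real p * trace X / of_nat CARD('p)) (mat 1)"

text \<open>\<open>f \<otimes> id\<close>.\<close>

definition apply_fst ::
    "('a::finite cop \<Rightarrow> 'b::finite cop) \<Rightarrow> ('a \<times> 'c::finite) cop \<Rightarrow> ('b \<times> 'c) cop" where
  "apply_fst f X = (\<chi> r s. f (\<chi> i j. X $ (i, snd r) $ (j, snd s)) $ fst r $ fst s)"

definition channel_fidelity :: "('p::finite cop \<Rightarrow> 'p cop) \<Rightarrow> 'l::finite itself \<Rightarrow> real" where
  "channel_fidelity N _ =
     Sup {fidelity (max_entangled :: ('l \<times> 'l) cop) (apply_fst (D \<circ> N \<circ> E) max_entangled) | E D.
            quantum_channel (E :: 'l cop \<Rightarrow> 'p cop) \<and> quantum_channel (D :: 'p cop \<Rightarrow> 'l cop)}"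

text \<open>
  The Choi operator on \<open>P \<otimes> P\<close>-bar (output first, input second), normalized to trace \<open>d\<^sub>P\<^sup>2\<close>.
  With \<open>\<alpha>\<^sub>P\<^sub>L\<close> the Choi state of the decoder and \<open>\<beta>\<close> on \<open>P\<close>-bar, \<open>L\<close>-bar that of the encoder,
  the fidelity of \<open>D \<circ> N \<circ> E\<close> is \<open>tr[(C\<^sup>T \<otimes> \<Phi>)(\<alpha> \<otimes> \<beta>)]\<close>. The transpose does not
  change the supremum (replace \<open>\<alpha>, \<beta>\<close> by their transposes), and \<open>C\<^sup>T = C\<close> for a depolarizing channel.
\<close>

definition choi_op :: "('p::finite cop \<Rightarrow> 'p cop) \<Rightarrow> ('p \<times> 'p) cop" where
  "choi_op N = cscale ((of_nat CARD('p))\<^sup>2) (apply_fst N max_entangled)"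


section \<open>The semidefinite program\<close>

text \<open>
  A block \<open>a\<^sup>(\<^sup>i\<^sup>)\<close> has basis labels \<open>(P, P\<^sub>c\<^sub>o\<^sub>p\<^sub>y, L, L\<^sub>c\<^sub>o\<^sub>p\<^sub>y)\<close>, and \<open>b\<^sup>(\<^sup>i\<^sup>)\<close> likewise with the barred
  systems. The block labels \<open>1, \<dots>, n\<close> are the elements of a finite linear order \<open>'n\<close>, so \<open>n = CARD('n)\<close>.
  A basis label of the whole system is a pair \<open>(x, y)\<close> with \<open>x i\<close> the label of \<open>a\<^sup>(\<^sup>i\<^sup>)\<close> and
  \<open>y i\<close> the label of \<open>b\<^sup>(\<^sup>i\<^sup>)\<close>.
\<close>

type_synonym ('p, 'l) block = "'p \<times> 'p \<times> 'l \<times> 'l"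
type_synonym ('p, 'l, 'n) sys = "('n \<Rightarrow> ('p, 'l) block) \<times> ('n \<Rightarrow> ('p, 'l) block)"

abbreviation last_block :: "'n::{finite, linorder}" where
  "last_block \<equiv> Max UNIV"

text \<open>
  The marginal over the traced systems together with the identity on block \<open>n\<close> is written
  entrywise: the labels \<open>x, x'\<close> of the remaining blocks enter only after being overwritten at block \<open>n\<close>.
\<close>

definition constraint_a :: "('p::finite, 'l::finite, 'n::{finite, linorder}) sys cop \<Rightarrow> bool" where
  "constraint_a \<rho> \<longleftrightarrow> (\<forall>i i' x x' y y'.
     (\<Sum>pc\<in>UNIV. \<Sum>l\<in>UNIV. \<Sum>lc\<in>UNIV.
        \<rho> $ (x(last_block := (i, pc, l, lc)), y) $ (x'(last_block := (i', pc, l, lc)), y'))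
     = (mat 1 :: 'p cop) $ i $ i' / of_nat CARD('p) *
       (\<Sum>t\<in>UNIV. \<rho> $ (x(last_block := t), y) $ (x'(last_block := t), y')))"

definition constraint_b :: "('p::finite, 'l::finite, 'n::{finite, linorder}) sys cop \<Rightarrow> bool" where
  "constraint_b \<rho> \<longleftrightarrow> (\<forall>l l' x x' y y'.
     (\<Sum>p\<in>UNIV. \<Sum>pc\<in>UNIV. \<Sum>lc\<in>UNIV.
        \<rho> $ (x, y(last_block := (p, pc, l, lc))) $ (x', y'(last_block := (p, pc, l', lc))))
     = (\<Sum>t\<in>UNIV. \<rho> $ (x, y(last_block := t)) $ (x', y'(last_block := t))) *
       (mat 1 :: 'l cop) $ l $ l' / of_nat CARD('l))"

definition perm_a :: "('n \<Rightarrow> 'n) \<Rightarrow> ('p::finite, 'l::finite, 'n::finite) sys cop" where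
  "perm_a \<sigma> = (\<chi> r s. if r = (fst s \<circ> inv \<sigma>, snd s) then 1 else 0)"

definition perm_b :: "('n \<Rightarrow> 'n) \<Rightarrow> ('p::finite, 'l::finite, 'n::finite) sys cop" where
  "perm_b \<sigma> = (\<chi> r s. if r = (fst s, snd s \<circ> inv \<sigma>) then 1 else 0)"

definition bose_symmetric :: "('p::finite, 'l::finite, 'n::finite) sys cop \<Rightarrow> bool" where
  "bose_symmetric \<rho> \<longleftrightarrow> (\<forall>\<sigma>. \<sigma> permutes UNIV \<longrightarrow> perm_a \<sigma> ** \<rho> = \<rho> \<and> perm_b \<sigma> ** \<rho> = \<rho>)"

definition sdp_feasible :: "('p::finite, 'l::finite, 'n::{finite, linorder}) sys cop \<Rightarrow> bool" where
  "sdp_feasible \<rho> \<longleftrightarrow>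
     psd \<rho> \<and> trace \<rho> = 1 \<and> constraint_a \<rho> \<and> constraint_b \<rho> \<and> bose_symmetric \<rho>"

text \<open>
  The marginal on one copy each of \<open>P\<close>, \<open>P\<close>-bar, \<open>L\<close>, \<open>L\<close>-bar, in this order, taken from the
  last blocks; by Bose symmetry the choice of blocks is immaterial. \<open>kept_labels\<close> reads these four
  labels off a basis label, \<open>set_labels\<close> overwrites them, and the sum in \<open>marginal\<close> thus runs over
  all values of the other labels.
\<close>

fun set_PL :: "'p \<Rightarrow> 'l \<Rightarrow> ('p, 'l) block \<Rightarrow> ('p, 'l) block" where
  "set_PL p l (p', pc, l', lc) = (p, pc, l, lc)"

fun get_P :: "('p, 'l) block \<Rightarrow> 'p" where "get_P (p, pc, l, lc) = p"
fun get_L :: "('p, 'l) block \<Rightarrow> 'l" where "get_L (p, pc, l, lc) = l"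

fun kept_labels :: "('p, 'l, 'n::{finite, linorder}) sys \<Rightarrow> ('p \<times> 'p) \<times> ('l \<times> 'l)" where
  "kept_labels (x, y) =
     ((get_P (x last_block), get_P (y last_block)), (get_L (x last_block), get_L (y last_block)))"

fun set_labels :: "('p \<times> 'p) \<times> ('l \<times> 'l) \<Rightarrow>
    ('p, 'l, 'n::{finite, linorder}) sys \<Rightarrow> ('p, 'l, 'n) sys" where
  "set_labels ((p, pb), (l, lb)) (x, y) =
     (x(last_block := set_PL p l (x last_block)), y(last_block := set_PL pb lb (y last_block)))"

definition marginal ::
    "('p::finite, 'l::finite, 'n::{finite, linorder}) sys cop \<Rightarrow> (('p \<times> 'p) \<times> ('l \<times> 'l)) cop" where
  "marginal \<rho> = (\<chi> r s. \<Sum>z | kept_labels z = r. \<rho> $ z $ set_labels s z)"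

definition sdp_objective ::
    "('p::finite cop \<Rightarrow> 'p cop) \<Rightarrow> ('p, 'l::finite, 'n::{finite, linorder}) sys cop \<Rightarrow> real" where
  "sdp_objective N \<rho> = Re (trace (kron (choi_op N) max_entangled ** marginal \<rho>))"

definition sdp_value ::
    "('p::finite cop \<Rightarrow> 'p cop) \<Rightarrow> 'l::finite itself \<Rightarrow> 'n::{finite, linorder} itself \<Rightarrow> real" where
  "sdp_value N _ _ = Sup {sdp_objective N \<rho> | \<rho> :: ('p, 'l, 'n) sys cop. sdp_feasible \<rho>}"


section \<open>Symmetry\<close>

definition block_unitary :: "'p::finite cop \<Rightarrow> 'l::finite cop \<Rightarrow> ('p, 'l) block cop" where
  "block_unitary U V = (\<chi> r s. case r of (p, pc, l, lc) \<Rightarrow> case s of (p', pc', l', lc') \<Rightarrow>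
     U $ p $ p' * cnj (U $ pc $ pc') * (V $ l $ l' * cnj (V $ lc $ lc')))"

text \<open>
  Every block pairs a factor on which \<open>U\<close> acts with one on which its entrywise conjugate acts. On a
  \<open>b\<close>-block the conjugate acts on \<open>P\<close>-bar and \<open>U\<close> on its copy (and likewise for \<open>L\<close>). This
  orientation is forced: the objective contains the maximally entangled states of \<open>P\<close>, \<open>P\<close>-bar and of
  \<open>L\<close>, \<open>L\<close>-bar, which are invariant under \<open>U\<close> tensor its conjugate, but not under \<open>U \<otimes> U\<close>.
\<close>

definition unitary_action ::
    "'p::finite cop \<Rightarrow> 'l::finite cop \<Rightarrow> ('p, 'l, 'n::finite) sys cop" where
  "unitary_action U V = (\<chi> r s.
     (\<Prod>i\<in>UNIV. block_unitary U V $ fst r i $ fst s i) *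
     (\<Prod>i\<in>UNIV. cnj (block_unitary U V $ snd r i $ snd s i)))"

inductive_set star_algebra :: "'a::finite cop set \<Rightarrow> 'a cop set" for G where
  gen: "A \<in> G \<Longrightarrow> A \<in> star_algebra G"
| one: "mat 1 \<in> star_algebra G"
| add: "A \<in> star_algebra G \<Longrightarrow> B \<in> star_algebra G \<Longrightarrow> A + B \<in> star_algebra G"
| scale: "A \<in> star_algebra G \<Longrightarrow> cscale c A \<in> star_algebra G"
| mult: "A \<in> star_algebra G \<Longrightarrow> B \<in> star_algebra G \<Longrightarrow> A ** B \<in> star_algebra G"
| adj: "A \<in> star_algebra G \<Longrightarrow> adj A \<in> star_algebra G"

definition commutant :: "'a::finite cop set \<Rightarrow> 'a cop set" where
  "commutant S = {X. \<forall>A\<in>S. A ** X = X ** A}"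

definition symmetry_unitaries :: "('p::finite, 'l::finite, 'n::finite) sys cop set" where
  "symmetry_unitaries =
     {perm_a \<sigma> | \<sigma>. \<sigma> permutes UNIV} \<union> {perm_b \<sigma> | \<sigma>. \<sigma> permutes UNIV} \<union>
     {unitary_action (mat 1) V | V. unitary V} \<union> {unitary_action U (mat 1) | U. unitary U}"

definition symmetry_commutant :: "('p::finite, 'l::finite, 'n::finite) sys cop set" where
  "symmetry_commutant = commutant (star_algebra symmetry_unitaries)"

text \<open>
  The isotypic projector of the irreducible \<open>(n)\<close> of \<open>S\<^sub>n\<close>, whose character is constantly one,
  i.e. the projector onto the symmetric subspace, on the \<open>a\<close>- and on the \<open>b\<close>-blocks.
\<close>

definition sym_proj_a :: "('p::finite, 'l::finite, 'n::finite) sys cop" where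
  "sym_proj_a = cscale (1 / fact CARD('n)) (\<Sum>\<sigma> | \<sigma> permutes UNIV. perm_a \<sigma>)"

definition sym_proj_b :: "('p::finite, 'l::finite, 'n::finite) sys cop" where
  "sym_proj_b = cscale (1 / fact CARD('n)) (\<Sum>\<sigma> | \<sigma> permutes UNIV. perm_b \<sigma>)"

definition on_symmetric_subspaces :: "('p::finite, 'l::finite, 'n::finite) sys cop \<Rightarrow> bool" where
  "on_symmetric_subspaces \<rho> \<longleftrightarrow>
     (sym_proj_a ** sym_proj_b) ** \<rho> ** (sym_proj_a ** sym_proj_b) = \<rho>"

end

theory Submission
  imports Defs "HOL-Combinatorics.Multiset_Permutations"
begin

text \<open>
  Let \<open>D = d\<^sub>L\<^sup>2 d\<^sub>P\<^sup>2\<close> be the dimension of a block. The choice of channels in the fidelity amounts to the choice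
  of two Choi states with one maximally mixed marginal each. Pure product states built from purifications
  of such a pair are feasible, whence \<open>F \<le> SDP\<close>.

  For the converse, project all but the last \<open>a\<close>- and \<open>b\<close>-block of a feasible \<open>\<rho>\<close> on coherent vectors
  \<open>v\<^sup>n\<^sup>-\<^sup>1\<close> and \<open>u\<^sup>n\<^sup>-\<^sup>1\<close>. The resulting state \<open>\<sigma>\<close> of the last two blocks has marginals obeying the channel
  constraints, so the objective at the product of its marginals is at most \<open>F\<close>. The objective at \<open>\<sigma>\<close>
  itself differs from this only by a multiple of the geometric mean of the probabilities that neither
  block is found in \<open>v\<close>, \<open>u\<close> and that anything is found, plus the probabilities that one block is not:
  the terms of first order in the amplitudes cancel. Averaging over Gaussian \<open>v\<close>, \<open>u\<close>, Bose symmetry makes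
  these probabilities \<open>\<epsilon>\<^sup>2\<close> and \<open>\<epsilon>\<close> with \<open>\<epsilon> = (D - 1) / (n + D - 1)\<close>, which gives the bound
  \<open>SDP - F \<le> 16 d\<^sub>P\<^sup>2 \<epsilon>\<close>; no entropies are needed, and the claimed rate is weaker.

  The inequalities averaged are polynomial in \<open>v\<close> and \<open>u\<close>, so that averaging reduces to the positivity of
  the Gaussian expectation on nonnegative polynomials.
\<close>

section \<open>Positive semidefinite matrices\<close>

text \<open>The first-order terms cancel through \<open>covX\<close>, which subtracts from X its
  compressions by \<phi> and by \<psi> and adds a scalar: its form vanishes on \<phi> \<otimes> B
  and on A \<otimes> \<psi>, while between two operators with the same marginals it changes exactly
  as X does. The obstacle is the averaging. A conditioned state is normalized by a probability, and
  the natural estimate contains the square root of a product; neither is polynomial in v, u. Hence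
  everything is multiplied by the trace and by the squared norms of v and u, and the square root is
  replaced by \<eta> s + t / \<eta> with a single \<eta> for all v, u, set to \<epsilon> only after
  averaging. The last pair of blocks is spared because (a) and (b) are operator identities on all
  other blocks and so survive any conditioning there. Bose symmetry, stronger than permutation
  invariance, puts \<rho> on the symmetric subspaces, where the Gaussian moments act as scalars. The
  constant: \<open>d\<^sub>P\<^sup>2\<close> bounds the objective operator, and 16 = 2 (1 + 1 + 6),
  the summands coming from \<eta>, from \<epsilon>^2 / \<eta> and from three times the two
  single-block probabilities.\<close>

definition ses :: "'a::finite cop \<Rightarrow> ('a \<Rightarrow> complex) \<Rightarrow> ('a \<Rightarrow> complex) \<Rightarrow> complex" where
  "ses A x y = (\<Sum>i\<in>UNIV. \<Sum>j\<in>UNIV. cnj (x i) * A $ i $ j * y j)"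

lemma nonneg_Reals_sum: "(\<And>i. i \<in> I \<Longrightarrow> f i \<in> \<real>\<^sub>\<ge>\<^sub>0) \<Longrightarrow> sum f I \<in> (\<real>\<^sub>\<ge>\<^sub>0 :: complex set)"
  by (induction I rule: infinite_finite_induct) auto

lemma cnj_mult_self: "cnj z * z = complex_of_real ((cmod z)\<^sup>2)" "z * cnj z = complex_of_real ((cmod z)\<^sup>2)"
  by (simp_all only: complex_norm_square mult.commute[of "cnj z" z])

lemma ses_vec: "(\<Sum>i\<in>UNIV. cnj (v $ i) * (A *v v) $ i) = ses A (($) v) (($) v)"
  by (simp add: ses_def matrix_vector_mult_def sum_distrib_left mult.assoc)

text \<open>Working with functions instead of vectors keeps tensor products, slices and reindexings
  of the arguments plain lambda terms.\<close>

lemma psd_iff_ses: "psd A \<longleftrightarrow> (\<forall>x. ses A x x \<in> \<real>\<^sub>\<ge>\<^sub>0)"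
proof -
  have "ses A x x = ses A (($) (vec_lambda x)) (($) (vec_lambda x))" for x
    by (simp add: ses_def)
  then show ?thesis
    unfolding psd_def ses_vec by metis
qed

lemma psd_ses_Re: "psd A \<Longrightarrow> 0 \<le> Re (ses A x x)" and psd_ses_Im: "psd A \<Longrightarrow> Im (ses A x x) = 0"
  by (simp_all add: psd_iff_ses complex_nonneg_Reals_iff)

lemma ses_add_left: "ses A (\<lambda>i. x i + y i) z = ses A x z + ses A y z"
  and ses_add_right: "ses A z (\<lambda>i. x i + y i) = ses A z x + ses A z y"
  and ses_diff_left: "ses A (\<lambda>i. x i - y i) z = ses A x z - ses A y z"
  and ses_diff_right: "ses A z (\<lambda>i. x i - y i) = ses A z x - ses A z y"
  by (simp_all add: ses_def algebra_simps sum.distrib sum_subtractf)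

lemma ses_scale_left: "ses A (\<lambda>i. c * x i) z = cnj c * ses A x z"
  and ses_scale_right: "ses A z (\<lambda>i. c * x i) = c * ses A z x"
  by (simp_all add: ses_def algebra_simps sum_distrib_left)

lemma ses_mat_add: "ses (A + B) x y = ses A x y + ses B x y"
  and ses_mat_diff: "ses (A - B) x y = ses A x y - ses B x y"
  by (simp_all add: ses_def algebra_simps sum.distrib sum_subtractf)

lemma ses_mat_scale: "ses (cscale c A) x y = c * ses A x y"
  by (simp add: ses_def cscale_def algebra_simps sum_distrib_left)

lemma ses_mat_1: "ses (mat 1) x y = (\<Sum>i\<in>UNIV. cnj (x i) * y i)"
proof -
  have "cnj (x i) * (mat 1 :: 'a cop) $ i $ j * y j = (if i = j then cnj (x i) * y j else 0)" for i j
    by (simp add: mat_def)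
  then show ?thesis by (simp add: ses_def)
qed

lemma ses_unit_left: "ses A (\<lambda>i. if i = a then 1 else 0) y = (\<Sum>j\<in>UNIV. A $ a $ j * y j)"
proof -
  have "(\<Sum>j\<in>UNIV. cnj (if i = a then 1 else 0) * A $ i $ j * y j)
     = (if i = a then (\<Sum>j\<in>UNIV. A $ i $ j * y j) else 0)" for i
    by simp
  then show ?thesis unfolding ses_def by simp
qed

lemma ses_unit: "ses A (\<lambda>i. if i = a then 1 else 0) (\<lambda>i. if i = b then 1 else 0) = A $ a $ b"
proof -
  have "A $ a $ j * (if j = b then 1 else 0) = (if j = b then A $ a $ j else 0)" for j by simp
  then show ?thesis unfolding ses_unit_left by simp
qed

lemma ses_unit_right: "ses A x (\<lambda>i. if i = a then 1 else 0) = (\<Sum>i\<in>UNIV. cnj (x i) * A $ i $ a)"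
proof -
  have "cnj (x i) * A $ i $ j * (if j = a then 1 else 0) = (if j = a then cnj (x i) * A $ i $ j else 0)" for i j
    by simp
  then show ?thesis unfolding ses_def by simp
qed

text \<open>Polarization: \<open>psd\<close> only demands real nonnegative values of the form.
  Reality at e_i + e_j and at e_i + i e_j fixes the imaginary and the real part of the difference
  between an entry and its mirrored conjugate.\<close>

lemma psd_herm:
  assumes "psd A"
  shows "A $ i $ j = cnj (A $ j $ i)"
proof -
  let ?e = "\<lambda>a i. if i = a then 1 else (0::complex)"
  have im: "Im (ses A x x) = 0" for x using psd_ses_Im[OF assms] .
  have ii: "Im (A $ a $ a) = 0" for a using im[of "?e a"] by (simp add: ses_unit)
  have *: "ses A (\<lambda>k. ?e i k + c * ?e j k) (\<lambda>k. ?e i k + c * ?e j k)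
     = A $ i $ i + c * A $ i $ j + cnj c * A $ j $ i + cnj c * c * A $ j $ j" for c
    unfolding ses_add_left ses_add_right ses_scale_left ses_scale_right ses_unit
    by (simp add: algebra_simps)
  have "Im (A $ i $ j + A $ j $ i) = 0"
    using im[of "\<lambda>k. ?e i k + 1 * ?e j k"] ii[of i] ii[of j] unfolding * by simp
  moreover have "Im (\<i> * A $ i $ j - \<i> * A $ j $ i) = 0"
    using im[of "\<lambda>k. ?e i k + \<i> * ?e j k"] ii[of i] ii[of j] unfolding * by simp
  ultimately show ?thesis
    by (simp add: complex_eq_iff)
qed

lemma ses_herm:
  assumes "\<And>i j. A $ i $ j = cnj (A $ j $ i)"
  shows "ses A y x = cnj (ses A x y)"
proof -
  have "cnj (ses A x y) = (\<Sum>i\<in>UNIV. \<Sum>j\<in>UNIV. x i * cnj (A $ i $ j) * cnj (y j))"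
    by (simp add: ses_def)
  also have "\<dots> = (\<Sum>j\<in>UNIV. \<Sum>i\<in>UNIV. x i * cnj (A $ i $ j) * cnj (y j))"
    by (rule sum.swap)
  also have "\<dots> = ses A y x"
    unfolding ses_def
  proof (intro sum.cong refl)
    fix i j
    show "x i * cnj (A $ i $ j) * cnj (y j) = cnj (y j) * A $ j $ i * x i"
      by (subst assms[of j i]) (simp add: mult_ac)
  qed
  finally show ?thesis ..
qed

lemma psd_diag: "psd A \<Longrightarrow> 0 \<le> Re (A $ i $ i)" "psd A \<Longrightarrow> Im (A $ i $ i) = 0"
  using psd_ses_Re[of A "\<lambda>k. if k = i then 1 else 0"] psd_ses_Im[of A "\<lambda>k. if k = i then 1 else 0"]
  by (simp_all add: ses_unit)

text \<open>Completing the square: the form of the Schur complement at x is the form of A at x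
  shifted along e_a, with the shift that minimizes it.\<close>

lemma psd_schur_complement:
  assumes A: "psd A" and pos: "0 < Re (A $ a $ a)"
  shows "psd (\<chi> i j. A $ i $ j - A $ i $ a * cnj (A $ j $ a) / A $ a $ a)"
proof -
  define \<alpha> where "\<alpha> = Re (A $ a $ a)"
  have aa: "A $ a $ a = of_real \<alpha>" and \<alpha>: "\<alpha> > 0"
    using psd_diag[OF A, of a] pos by (auto simp: \<alpha>_def complex_eq_iff)
  let ?e = "\<lambda>i. if i = a then 1 else (0::complex)"
  have "ses (\<chi> i j. A $ i $ j - A $ i $ a * cnj (A $ j $ a) / A $ a $ a) x x \<in> \<real>\<^sub>\<ge>\<^sub>0" for x
  proof -
    define c where "c = ses A x ?e"
    have c': "ses A ?e x = cnj c" unfolding c_def by (rule ses_herm) (rule psd_herm[OF A])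
    have c: "c = (\<Sum>i\<in>UNIV. cnj (x i) * A $ i $ a)" unfolding c_def ses_unit_right ..
    have "ses (\<chi> i j. A $ i $ j - A $ i $ a * cnj (A $ j $ a) / A $ a $ a) x x
      = ses A x x - (\<Sum>i\<in>UNIV. \<Sum>j\<in>UNIV. (cnj (x i) * A $ i $ a) * (x j * cnj (A $ j $ a)) / \<alpha>)"
      unfolding ses_def aa by (simp add: algebra_simps sum_subtractf)
    also have "(\<Sum>i\<in>UNIV. \<Sum>j\<in>UNIV. (cnj (x i) * A $ i $ a) * (x j * cnj (A $ j $ a)) / \<alpha>) = c * cnj c / \<alpha>"
      unfolding c by (simp add: sum_product sum_divide_distrib)
    also have "ses A x x - c * cnj c / \<alpha> = ses A (\<lambda>i. x i - (cnj c / \<alpha>) * ?e i) (\<lambda>i. x i - (cnj c / \<alpha>) * ?e i)"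
      unfolding ses_diff_left ses_diff_right ses_scale_left ses_scale_right c' c_def[symmetric] ses_unit aa
      using \<alpha> by (simp add: field_simps)
    also have "\<dots> \<in> \<real>\<^sub>\<ge>\<^sub>0" using A unfolding psd_iff_ses by blast
    finally show ?thesis .
  qed
  then show ?thesis unfolding psd_iff_ses by blast
qed

text \<open>Otherwise adding a suitable multiple of e_a to e_i would make the form negative, since
  it depends on that multiple without a quadratic term.\<close>

lemma psd_zero_diag:
  assumes A: "psd A" and z: "A $ a $ a = 0"
  shows "A $ i $ a = 0"
proof (rule ccontr)
  assume nz: "A $ i $ a \<noteq> 0"
  let ?e = "\<lambda>a i. if i = a then 1 else (0::complex)"
  \<comment> \<open>Chosen so that the form takes the value -1.\<close>
  define t where "t = - (Re (A $ i $ i) + 1) / (2 * (cmod (A $ i $ a))\<^sup>2)"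
  define c where "c = of_real t * cnj (A $ i $ a)"
  have "ses A (\<lambda>k. ?e i k + c * ?e a k) (\<lambda>k. ?e i k + c * ?e a k)
     = A $ i $ i + (c * A $ i $ a + cnj (c * A $ i $ a))"
    unfolding ses_add_left ses_add_right ses_scale_left ses_scale_right ses_unit z
    by (subst psd_herm[OF A, of a i]) (simp add: algebra_simps)
  also have "c * A $ i $ a = of_real (t * (cmod (A $ i $ a))\<^sup>2)"
    unfolding c_def mult.assoc cnj_mult_self by simp
  also have "t * (cmod (A $ i $ a))\<^sup>2 = - (Re (A $ i $ i) + 1) / 2"
    using nz by (simp add: t_def field_simps)
  finally have "Re (ses A (\<lambda>k. ?e i k + c * ?e a k) (\<lambda>k. ?e i k + c * ?e a k)) < 0"
    by simp
  with psd_ses_Re[OF A] show False by (simp add: not_less[symmetric])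
qed

text \<open>A Cholesky factorization by induction on the support: each step splits off one column
  through the Schur complement. It plays the role of the spectral theorem; most later positivity
  arguments start from these columns.\<close>

lemma psd_factor_on:
  fixes S :: "'a::finite set"
  assumes "psd (A :: 'a cop)" "\<And>i j. i \<notin> S \<or> j \<notin> S \<Longrightarrow> A $ i $ j = 0"
  shows "\<exists>T. \<forall>i j. A $ i $ j = (\<Sum>k\<in>S. T i k * cnj (T j k))"
  using finite[of S] assms
proof (induction S arbitrary: A rule: finite_induct)
  case empty
  then show ?case by simp
next
  case (insert a S)
  note A = \<open>psd A\<close>
  show ?case
  proof (cases "A $ a $ a = 0")
    case True
    have ca: "A $ i $ a = 0" for i by (rule psd_zero_diag[OF A True])
    have ra: "A $ a $ i = 0" for i by (subst psd_herm[OF A]) (simp add: ca)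
    have "\<exists>T. \<forall>i j. A $ i $ j = (\<Sum>k\<in>S. T i k * cnj (T j k))"
      by (rule insert.IH[OF A]) (metis ca ra insert.prems(2) insertE)
    then obtain T where "\<And>i j. A $ i $ j = (\<Sum>k\<in>S. T i k * cnj (T j k))" by blast
    then have "A $ i $ j = (\<Sum>k\<in>insert a S. (if k = a then 0 else T i k) * cnj (if k = a then 0 else T j k))" for i j
      using insert.hyps by (auto intro!: sum.cong)
    then show ?thesis by (intro exI[of _ "\<lambda>i k. if k = a then 0 else T i k"]) blast
  next
    case False
    define \<alpha> where "\<alpha> = Re (A $ a $ a)"
    have aa: "A $ a $ a = of_real \<alpha>" and \<alpha>: "\<alpha> > 0"
      using psd_diag[OF A, of a] False by (auto simp: \<alpha>_def complex_eq_iff)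
    define B :: "'a cop" where "B = (\<chi> i j. A $ i $ j - A $ i $ a * cnj (A $ j $ a) / A $ a $ a)"
    have B: "psd B" unfolding B_def using psd_schur_complement[OF A, of a] \<alpha> aa by simp
    have "\<exists>T. \<forall>i j. B $ i $ j = (\<Sum>k\<in>S. T i k * cnj (T j k))"
    proof (rule insert.IH[OF B])
      fix i j assume ij: "i \<notin> S \<or> j \<notin> S"
      show "B $ i $ j = 0"
      proof (cases "i \<notin> insert a S \<or> j \<notin> insert a S")
        case True
        then have "A $ i $ j = 0" "A $ i $ a * cnj (A $ j $ a) = 0"
          using insert.prems(2) by auto
        then show ?thesis by (simp add: B_def)
      next
        case False
        then have "i = a \<or> j = a" using ij by blast
        then show ?thesis
          using \<alpha> psd_herm[OF A, of a j] by (auto simp: B_def aa)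
      qed
    qed
    then obtain T where T: "\<And>i j. B $ i $ j = (\<Sum>k\<in>S. T i k * cnj (T j k))" by blast
    define T' where "T' i k = (if k = a then A $ i $ a / of_real (sqrt \<alpha>) else T i k)" for i k
    have "A $ i $ j = (\<Sum>k\<in>insert a S. T' i k * cnj (T' j k))" for i j
    proof -
      have "(\<Sum>k\<in>insert a S. T' i k * cnj (T' j k))
        = T' i a * cnj (T' j a) + (\<Sum>k\<in>S. T' i k * cnj (T' j k))"
        using insert.hyps by simp
      also have "(\<Sum>k\<in>S. T' i k * cnj (T' j k)) = B $ i $ j"
        unfolding T using insert.hyps by (intro sum.cong) (auto simp: T'_def)
      also have "T' i a * cnj (T' j a) = A $ i $ a * cnj (A $ j $ a) / A $ a $ a"
        using \<alpha> by (simp add: T'_def aa field_simps flip: of_real_mult)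
      finally show ?thesis by (simp add: B_def)
    qed
    then show ?thesis by blast
  qed
qed

lemma psd_factor:
  fixes A :: "'a::finite cop"
  assumes "psd A"
  obtains T :: "'a \<Rightarrow> 'a \<Rightarrow> complex" where "\<And>i j. A $ i $ j = (\<Sum>k\<in>UNIV. T i k * cnj (T j k))"
proof -
  have "\<exists>T. \<forall>i j. A $ i $ j = (\<Sum>k\<in>(UNIV :: 'a set). T i k * cnj (T j k))"
    by (rule psd_factor_on[OF assms]) simp
  then show thesis using that by blast
qed

lemma ses_factor:
  fixes A :: "'a::finite cop"
  assumes "\<And>i j. A $ i $ j = (\<Sum>k\<in>S. T i k * cnj (T j k))"
  shows "ses A x y = (\<Sum>k\<in>S. (\<Sum>i\<in>UNIV. cnj (x i) * T i k) * cnj (\<Sum>j\<in>UNIV. cnj (y j) * T j k))"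
proof -
  have "ses A x y = (\<Sum>i\<in>UNIV. \<Sum>j\<in>UNIV. \<Sum>k\<in>S. (cnj (x i) * T i k) * (y j * cnj (T j k)))"
    by (simp add: ses_def assms sum_distrib_left sum_distrib_right mult_ac)
  also have "\<dots> = (\<Sum>i\<in>UNIV. \<Sum>k\<in>S. \<Sum>j\<in>UNIV. (cnj (x i) * T i k) * (y j * cnj (T j k)))"
    by (intro sum.cong refl sum.swap)
  also have "\<dots> = (\<Sum>k\<in>S. \<Sum>i\<in>UNIV. \<Sum>j\<in>UNIV. (cnj (x i) * T i k) * (y j * cnj (T j k)))"
    by (rule sum.swap)
  also have "\<dots> = (\<Sum>k\<in>S. (\<Sum>i\<in>UNIV. cnj (x i) * T i k) * cnj (\<Sum>j\<in>UNIV. cnj (y j) * T j k))"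
    by (simp add: sum_product)
  finally show ?thesis .
qed

lemma psd_factorI:
  fixes A :: "'a::finite cop"
  assumes "\<And>i j. A $ i $ j = (\<Sum>k\<in>S. T i k * cnj (T j k))"
  shows "psd A"
proof -
  have "z * cnj z \<in> \<real>\<^sub>\<ge>\<^sub>0" for z
    unfolding cnj_mult_self by simp
  then show ?thesis
    unfolding psd_iff_ses ses_factor[OF assms] by (intro allI nonneg_Reals_sum)
qed

text \<open>The trace is a crude bound on the operator norm; Cauchy-Schwarz in each column of the
  factor yields it.\<close>

lemma psd_trace_ge:
  assumes A: "psd (A :: 'a::finite cop)"
  shows "Re (ses A x x) \<le> Re (trace A) * (\<Sum>i\<in>UNIV. (cmod (x i))\<^sup>2)"
proof -
  obtain T :: "'a \<Rightarrow> 'a \<Rightarrow> complex" where T: "\<And>i j. A $ i $ j = (\<Sum>k\<in>UNIV. T i k * cnj (T j k))"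
    using psd_factor[OF A] by blast
  have "Re (ses A x x) = (\<Sum>k\<in>UNIV. (cmod (\<Sum>i\<in>UNIV. cnj (x i) * T i k))\<^sup>2)"
    unfolding ses_factor[OF T] cnj_mult_self by simp
  also have "\<dots> \<le> (\<Sum>k\<in>UNIV. (\<Sum>i\<in>UNIV. (cmod (x i))\<^sup>2) * (\<Sum>i\<in>UNIV. (cmod (T i k))\<^sup>2))"
  proof (rule sum_mono)
    fix k
    have "cmod (\<Sum>i\<in>UNIV. cnj (x i) * T i k) \<le> (\<Sum>i\<in>UNIV. cmod (x i) * cmod (T i k))"
      by (rule order_trans[OF norm_sum]) (simp add: norm_mult)
    then have "(cmod (\<Sum>i\<in>UNIV. cnj (x i) * T i k))\<^sup>2 \<le> (\<Sum>i\<in>UNIV. cmod (x i) * cmod (T i k))\<^sup>2"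
      by (intro power_mono) auto
    also have "\<dots> \<le> (\<Sum>i\<in>UNIV. (cmod (x i))\<^sup>2) * (\<Sum>i\<in>UNIV. (cmod (T i k))\<^sup>2)"
      by (rule Cauchy_Schwarz_ineq_sum)
    finally show "(cmod (\<Sum>i\<in>UNIV. cnj (x i) * T i k))\<^sup>2 \<le> \<dots>" .
  qed
  also have "\<dots> = (\<Sum>i\<in>UNIV. (cmod (x i))\<^sup>2) * (\<Sum>k\<in>UNIV. \<Sum>i\<in>UNIV. (cmod (T i k))\<^sup>2)"
    by (simp add: sum_distrib_left)
  also have "(\<Sum>k\<in>UNIV. \<Sum>i\<in>UNIV. (cmod (T i k))\<^sup>2) = (\<Sum>i\<in>UNIV. \<Sum>k\<in>UNIV. (cmod (T i k))\<^sup>2)"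
    by (rule sum.swap)
  also have "\<dots> = Re (trace A)"
    by (simp add: trace_def T cnj_mult_self)
  finally show ?thesis by (simp add: mult.commute)
qed

section \<open>Square roots and fidelity\<close>

lemma adj_nth [simp]: "adj A $ i $ j = cnj (A $ j $ i)"
  by (simp add: adj_def)

lemma matmul_nth: "(A ** B) $ i $ j = (\<Sum>k\<in>UNIV. A $ i $ k * B $ k $ j)"
  by (simp add: matrix_matrix_mult_def)

lemma adj_matmul: "adj (A ** B) = adj B ** adj A"
  by (simp add: vec_eq_iff matmul_nth mult.commute)

lemma adj_adj [simp]: "adj (adj A) = A"
  by (simp add: vec_eq_iff)

lemma psd_adj: "psd A \<Longrightarrow> adj A = A"
  unfolding vec_eq_iff adj_nth by (intro allI psd_herm[symmetric])

lemma ses_matmul: "ses (A ** B) x y = ses A x (\<lambda>i. \<Sum>j\<in>UNIV. B $ i $ j * y j)"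
proof -
  have "ses (A ** B) x y = (\<Sum>i\<in>UNIV. \<Sum>j\<in>UNIV. \<Sum>k\<in>UNIV. cnj (x i) * A $ i $ k * (B $ k $ j * y j))"
    by (simp add: ses_def matmul_nth sum_distrib_left sum_distrib_right mult.assoc)
  also have "\<dots> = (\<Sum>i\<in>UNIV. \<Sum>k\<in>UNIV. \<Sum>j\<in>UNIV. cnj (x i) * A $ i $ k * (B $ k $ j * y j))"
    by (intro sum.cong refl sum.swap)
  finally show ?thesis by (simp add: ses_def sum_distrib_left)
qed

lemma ses_adj: "ses (adj A) x y = cnj (ses A y x)"
proof -
  have "cnj (ses A y x) = (\<Sum>i\<in>UNIV. \<Sum>j\<in>UNIV. cnj (x j) * cnj (A $ i $ j) * y i)"
    by (simp add: ses_def mult_ac)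
  also have "\<dots> = (\<Sum>j\<in>UNIV. \<Sum>i\<in>UNIV. cnj (x j) * cnj (A $ i $ j) * y i)"
    by (rule sum.swap)
  finally show ?thesis by (simp add: ses_def)
qed

lemma ses_eq_sum_left: "ses A x y = (\<Sum>i\<in>UNIV. cnj (x i) * (\<Sum>j\<in>UNIV. A $ i $ j * y j))"
  by (simp add: ses_def sum_distrib_left mult.assoc)

lemma bounded_entries:
  fixes S :: "('a::finite) cop set"
  assumes "\<And>A i j. A \<in> S \<Longrightarrow> cmod (A $ i $ j) \<le> c"
  shows "bounded S"
proof -
  have "norm A \<le> (\<Sum>i\<in>(UNIV::'a set). \<Sum>j\<in>(UNIV::'a set). c)" if "A \<in> S" for A
  proof -
    have "norm A \<le> (\<Sum>i\<in>UNIV. norm (A $ i))"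
      unfolding norm_vec_def by (rule L2_set_le_sum) simp
    also have "\<dots> \<le> (\<Sum>i\<in>UNIV. \<Sum>j\<in>UNIV. cmod (A $ i $ j))"
      unfolding norm_vec_def[of "A $ _"] by (intro sum_mono L2_set_le_sum) simp
    also have "\<dots> \<le> (\<Sum>i\<in>(UNIV::'a set). \<Sum>j\<in>(UNIV::'a set). c)"
      by (intro sum_mono assms that)
    finally show ?thesis .
  qed
  then show ?thesis unfolding bounded_iff by blast
qed

text \<open>Unit columns bound the entries. Compactness supplies the maximum from which the polar
  decomposition is read off.\<close>

lemma compact_unitary: "compact {U :: 'a::finite cop. unitary U}"
  unfolding compact_eq_bounded_closed
proof
  show "bounded {U :: 'a cop. unitary U}"
  proof (rule bounded_entries[where c = 1], clarify)
    fix U :: "'a cop" and i j assume "unitary U"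
    then have "(adj U ** U) $ j $ j = 1" by (simp add: unitary_def mat_def)
    then have "complex_of_real (\<Sum>k\<in>UNIV. (cmod (U $ k $ j))\<^sup>2) = of_real 1"
      by (simp add: matmul_nth cnj_mult_self del: of_real_power)
    then have "(\<Sum>k\<in>UNIV. (cmod (U $ k $ j))\<^sup>2) = 1" unfolding of_real_eq_iff .
    moreover have "(cmod (U $ i $ j))\<^sup>2 \<le> (\<Sum>k\<in>UNIV. (cmod (U $ k $ j))\<^sup>2)"
      by (rule member_le_sum) auto
    ultimately show "cmod (U $ i $ j) \<le> 1"
      by (simp add: power_le_one_iff)
  qed
  have "closed {U :: 'a cop. \<forall>i j. (\<Sum>k\<in>UNIV. cnj (U $ k $ i) * U $ k $ j) = (mat 1 :: 'a cop) $ i $ j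
      \<and> (\<Sum>k\<in>UNIV. U $ i $ k * cnj (U $ j $ k)) = (mat 1 :: 'a cop) $ i $ j}"
    by (intro closed_Collect_all closed_Collect_conj closed_Collect_eq continuous_intros)
  also have "\<dots> = {U :: 'a cop. unitary U}"
    by (auto simp: unitary_def vec_eq_iff matmul_nth)
  finally show "closed {U :: 'a cop. unitary U}" .
qed

lemma trace_nth: "trace A = (\<Sum>i\<in>UNIV. A $ i $ i)"
  by (simp add: trace_def)

lemma unitary_matmul: "unitary U \<Longrightarrow> unitary V \<Longrightarrow> unitary (U ** V)"
  unfolding unitary_def adj_matmul
  by (metis matrix_mul_assoc matrix_mul_rid)

lemma sum_mult_if_eq: 
  fixes f :: "'a::finite \<Rightarrow> 'b::semiring_1"
  shows "(\<Sum>k\<in>UNIV. (if i = k then 1 else 0) * f k) = f i" "(\<Sum>k\<in>UNIV. f k * (if k = i then 1 else 0)) = f i"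
    "(\<Sum>k\<in>UNIV. (if k = i then 1 else 0) * f k) = f i" "(\<Sum>k\<in>UNIV. f k * (if i = k then 1 else 0)) = f i"
  by (simp_all add: if_distrib[of "\<lambda>x. x * _"] if_distrib[of "\<lambda>x. _ * x"] cong: if_cong)

lemma cscale_nth [simp]: "cscale c A $ i $ j = c * A $ i $ j"
  by (simp add: cscale_def)

lemma matrix_add_rdistrib: "(A + B) ** C = A ** C + B ** (C :: complex^_^_)"
  and matrix_sub_ldistrib: "C ** (A - B) = C ** A - C ** (B :: complex^_^_)"
  and matrix_sub_rdistrib: "(A - B) ** C = A ** C - B ** (C :: complex^_^_)"
  by (simp_all add: vec_eq_iff matmul_nth algebra_simps sum.distrib sum_subtractf)

lemma cscale_matmul_left: "cscale c A ** B = cscale c (A ** B)"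
  and cscale_matmul_right: "A ** cscale c B = cscale c (A ** B)"
  by (simp_all add: vec_eq_iff matmul_nth sum_distrib_left mult_ac)

lemma cscale_cscale: "cscale a (cscale b A) = cscale (a * b) A"
  by (simp add: vec_eq_iff mult.assoc)

lemma cscale_add_right: "cscale c (A + B) = cscale c A + cscale c B"
  by (simp add: vec_eq_iff algebra_simps)

lemma cscale_1 [simp]: "cscale 1 A = A"
  by (simp add: vec_eq_iff)

lemma unitary_mat_1: "unitary (mat 1)"
proof -
  have "adj (mat 1) = (mat 1 :: 'a::finite cop)"
    by (simp add: vec_eq_iff mat_def)
  then show ?thesis by (simp add: unitary_def matrix_mul_lid)
qed

definition outer :: "('a \<Rightarrow> complex) \<Rightarrow> 'a::finite cop" where
  "outer x = (\<chi> i j. x i * cnj (x j))"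

lemma outer_nth [simp]: "outer x $ i $ j = x i * cnj (x j)"
  by (simp add: outer_def)

lemma outer_mult: "outer x ** outer x = cscale (of_real (\<Sum>i\<in>UNIV. (cmod (x i))\<^sup>2)) (outer x)"
proof -
  have *: "x i * cnj (x k) * (x k * cnj (x j)) = of_real ((cmod (x k))\<^sup>2) * (x i * cnj (x j))" for i j k
    unfolding cnj_mult_self[symmetric] by (simp only: mult_ac)
  then show ?thesis
    unfolding vec_eq_iff matmul_nth outer_nth * cscale_def vec_lambda_beta of_real_sum sum_distrib_right
    by simp
qed

lemma psd_outer: "psd (outer x)"
  by (rule psd_factorI[where S = "{()}" and T = "\<lambda>i _. x i"]) simp

lemma trace_outer_mult: "trace (outer x ** P) = ses P x x"
proof -
  have "trace (outer x ** P) = (\<Sum>i\<in>UNIV. \<Sum>k\<in>UNIV. cnj (x k) * P $ k $ i * x i)"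
    by (simp add: trace_nth matmul_nth mult_ac)
  also have "\<dots> = ses P x x" unfolding ses_def by (rule sum.swap)
  finally show ?thesis .
qed

text \<open>Multiplication by the phase c along x and the identity on the orthogonal complement of
  x; its adjoint is the same operator for the conjugate phase.\<close>

lemma unitary_phase:
  fixes x :: "'a::finite \<Rightarrow> complex"
  assumes c: "cmod c = 1" and s: "s = (\<Sum>i\<in>UNIV. (cmod (x i))\<^sup>2)" and s0: "s \<noteq> 0"
  shows "unitary (mat 1 + cscale ((c - 1) / of_real s) (outer x))"
proof -
  let ?W = "\<lambda>c. mat 1 + cscale ((c - 1) / of_real s) (outer x) :: 'a cop"
  have adjW: "adj (?W c) = ?W (cnj c)" for c
    by (auto simp: vec_eq_iff mat_def)
  have "?W a ** ?W b = mat 1" if "a * b = 1" for a b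
  proof -
    have "?W a ** ?W b = mat 1 + cscale ((b - 1) / of_real s) (outer x) + cscale ((a - 1) / of_real s) (outer x)
       + cscale ((a - 1) / of_real s * ((b - 1) / of_real s)) (outer x ** outer x)"
      by (simp add: matrix_add_ldistrib matrix_add_rdistrib matrix_mul_lid matrix_mul_rid
          cscale_matmul_left cscale_matmul_right cscale_cscale cscale_add_right add.assoc mult.commute)
    also have "\<dots> = mat 1"
    proof -
      have sc: "of_real s \<noteq> (0::complex)" using s0 by simp
      have "(b - 1) / of_real s + (a - 1) / of_real s
         + (a - 1) / of_real s * ((b - 1) / of_real s) * of_real s = (a * b - 1) / of_real s"
        using sc by (simp add: field_simps)
      then have z: "(b - 1) / of_real s + (a - 1) / of_real s
         + (a - 1) / of_real s * ((b - 1) / of_real s) * of_real s = 0" using that by simp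
      have "mat 1 + cscale ((b - 1) / of_real s) (outer x) + cscale ((a - 1) / of_real s) (outer x)
         + cscale ((a - 1) / of_real s * ((b - 1) / of_real s)) (cscale (of_real s) (outer x))
        = mat 1 + cscale ((b - 1) / of_real s + (a - 1) / of_real s
         + (a - 1) / of_real s * ((b - 1) / of_real s) * of_real s) (outer x)"
        unfolding vec_eq_iff by (simp add: distrib_right mult.assoc)
      then show ?thesis
        unfolding outer_mult s[symmetric] z by (simp add: vec_eq_iff)
    qed
    finally show ?thesis .
  qed
  moreover have "cnj c * c = 1" "c * cnj c = 1"
    using c by (simp_all add: cnj_mult_self)
  ultimately show ?thesis
    unfolding unitary_def adjW by blast
qed

text \<open>A polar decomposition: at a maximum of \<open>U \<mapsto> Re tr(U M)\<close> over the unitaries, no rank-one phase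
  can increase the trace, which says exactly that \<open>U M\<close> is positive.\<close>

lemma polar_decomposition:
  fixes M :: "'a::finite cop"
  obtains U where "unitary U" "psd (U ** M)"
proof -
  have "continuous_on {U :: 'a cop. unitary U} (\<lambda>U. Re (\<Sum>i\<in>UNIV. \<Sum>k\<in>UNIV. U $ i $ k * M $ k $ i))"
    by (intro continuous_intros)
  moreover have "unitary (mat 1 :: 'a cop)" by (rule unitary_mat_1)
  ultimately obtain U :: "'a cop" where U: "unitary U"
    and max: "\<And>V. unitary V \<Longrightarrow> Re (trace (V ** M)) \<le> Re (trace (U ** M))"
    using continuous_attains_sup[OF compact_unitary, of "\<lambda>U. Re (\<Sum>i\<in>UNIV. \<Sum>k\<in>UNIV. U $ i $ k * M $ k $ i)"]
    unfolding trace_nth matmul_nth by blast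
  have "ses (U ** M) x x \<in> \<real>\<^sub>\<ge>\<^sub>0" for x
  proof (cases "ses (U ** M) x x = 0")
    case False
    define m where "m = ses (U ** M) x x"
    define s where "s = (\<Sum>i\<in>UNIV. (cmod (x i))\<^sup>2)"
    \<comment> \<open>The phase that rotates m onto the positive axis; maximality then gives
      \<open>cmod m \<le> Re m\<close>.\<close>
    define c where "c = cnj m / of_real (cmod m)"
    have m: "m \<noteq> 0" using False by (simp add: m_def)
    have c1: "cmod c = 1" using m by (simp add: c_def norm_divide)
    have s0: "s > 0"
    proof (rule ccontr)
      assume "\<not> s > 0"
      moreover have "s \<ge> 0" unfolding s_def by (intro sum_nonneg) auto
      ultimately have "\<forall>i. x i = 0" unfolding s_def by (simp add: sum_nonneg_eq_0_iff)
      then show False using False by (simp add: ses_def)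
    qed
    let ?W = "mat 1 + cscale ((c - 1) / of_real s) (outer x) :: 'a cop"
    have "unitary ?W" by (rule unitary_phase[OF c1 s_def]) (use s0 in simp)
    then have "Re (trace ((?W ** U) ** M)) \<le> Re (trace (U ** M))"
      by (intro max unitary_matmul U)
    also have "(?W ** U) ** M = (U ** M) + cscale ((c - 1) / of_real s) (outer x ** (U ** M))"
    proof -
      have "(?W ** U) ** M = ?W ** (U ** M)" by (simp add: matrix_mul_assoc)
      also have "\<dots> = (U ** M) + cscale ((c - 1) / of_real s) (outer x ** (U ** M))"
        by (simp add: matrix_add_rdistrib matrix_mul_lid cscale_matmul_left)
      finally show ?thesis .
    qed
    also have "trace \<dots> = trace (U ** M) + (c - 1) / of_real s * m"
      unfolding m_def trace_outer_mult[symmetric]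
      by (simp add: trace_nth sum.distrib sum_distrib_left)
    finally have "Re ((c - 1) * m / of_real s) \<le> 0" by simp
    then have "Re ((c - 1) * m) \<le> 0" using s0 by (simp add: field_simps)
    moreover have "c * m = of_real (cmod m)"
      using m by (simp add: c_def cnj_mult_self field_simps power2_eq_square)
    ultimately have "cmod m \<le> Re m" by (simp add: left_diff_distrib)
    then have "Re m \<ge> 0 \<and> Im m = 0"
      using norm_ge_zero[of m] abs_Re_le_cmod[of m] cmod_power2[of m]
      by (smt (verit) power2_eq_square zero_eq_power2)
    then show ?thesis unfolding m_def complex_nonneg_Reals_iff .
  qed auto
  then have "psd (U ** M)" unfolding psd_iff_ses by blast
  with U show thesis by (rule that)
qed

text \<open>A factorization writes A as \<open>adj M ** M\<close>. The polar factor U makes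
  \<open>U ** M\<close> positive, in particular Hermitian, so its square is again
  \<open>adj M ** M\<close>.\<close>

lemma psd_sqrt_exists:
  assumes "psd (A :: 'a::finite cop)"
  shows "\<exists>B. psd B \<and> B ** B = A"
proof -
  obtain T :: "'a \<Rightarrow> 'a \<Rightarrow> complex" where T: "\<And>i j. A $ i $ j = (\<Sum>k\<in>UNIV. T i k * cnj (T j k))"
    using psd_factor[OF assms] by blast
  define M :: "'a cop" where "M = (\<chi> k i. cnj (T i k))"
  have AM: "A = adj M ** M" by (simp add: vec_eq_iff matmul_nth M_def T)
  obtain U where U: "unitary U" and P: "psd (U ** M)" using polar_decomposition[of M] by blast
  have "(U ** M) ** (U ** M) = adj (U ** M) ** (U ** M)" using psd_adj[OF P] by simp
  also have "\<dots> = adj M ** (adj U ** U) ** M" by (simp add: adj_matmul matrix_mul_assoc)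
  also have "\<dots> = A" using U by (simp add: unitary_def AM)
  finally show ?thesis using P by blast
qed

text \<open>The form is a sum of squares, one for each column of the factor, so each column is
  orthogonal to x.\<close>

lemma psd_form_zero:
  assumes A: "psd (A :: 'a::finite cop)" and z: "ses A x x = 0"
  shows "(\<Sum>j\<in>UNIV. A $ i $ j * x j) = 0"
proof -
  obtain T :: "'a \<Rightarrow> 'a \<Rightarrow> complex" where T: "\<And>i j. A $ i $ j = (\<Sum>k\<in>UNIV. T i k * cnj (T j k))"
    using psd_factor[OF A] by blast
  have "complex_of_real (\<Sum>k\<in>UNIV. (cmod (\<Sum>i\<in>UNIV. cnj (x i) * T i k))\<^sup>2) = of_real 0"
    using z unfolding ses_factor[OF T] cnj_mult_self by simp
  then have "(\<Sum>k\<in>UNIV. (cmod (\<Sum>i\<in>UNIV. cnj (x i) * T i k))\<^sup>2) = 0" unfolding of_real_eq_iff .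
  then have 0: "(\<Sum>i\<in>UNIV. cnj (x i) * T i k) = 0" for k by (simp add: sum_nonneg_eq_0_iff)
  have "(\<Sum>j\<in>UNIV. A $ i $ j * x j) = ses A (\<lambda>k. if k = i then 1 else 0) x" by (simp add: ses_unit_left)
  also have "\<dots> = 0" unfolding ses_factor[OF T] 0 by simp
  finally show ?thesis .
qed

text \<open>With H the difference, the trace of H (B + C) H vanishes. This is a sum of forms of B
  and C at the columns of H, so B and C annihilate these columns, and H H = 0 follows.\<close>

lemma psd_sqrt_unique:
  assumes B: "psd (B :: 'a::finite cop)" and C: "psd C" and eq: "B ** B = C ** C"
  shows "B = C"
proof -
  define H where "H = B - C"
  have H: "adj H = H" using psd_adj[OF B] psd_adj[OF C] by (simp add: H_def vec_eq_iff)
  define h where "h i = (\<lambda>k. H $ k $ i)" for i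
  have cnjH: "cnj (H $ i $ j) = H $ j $ i" for i j using H by (metis adj_nth)
  have diag: "(H ** (A ** H)) $ i $ i = ses A (h i) (h i)" for A i
    by (simp add: matmul_nth ses_eq_sum_left h_def cnjH)
  \<comment> \<open>The mixed products cancel and 2 (B B - C C) remains.\<close>
  have "H ** (B + C) + (B + C) ** H = 0"
    unfolding H_def by (simp add: matrix_add_ldistrib matrix_add_rdistrib matrix_sub_ldistrib matrix_sub_rdistrib eq)
  then have "trace (H ** (H ** (B + C)) + H ** ((B + C) ** H)) = 0"
    by (simp flip: matrix_add_ldistrib) (simp add: trace_nth matmul_nth)
  then have "trace (H ** (H ** (B + C))) + trace (H ** ((B + C) ** H)) = 0"
    by (simp add: trace_add)
  moreover have "trace (H ** (H ** (B + C))) = trace (H ** ((B + C) ** H))"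
    using trace_mul_sym[of H "H ** (B + C)"] by (simp add: matrix_mul_assoc)
  ultimately have "trace (H ** ((B + C) ** H)) = 0" by simp
  then have "(\<Sum>i\<in>UNIV. ses B (h i) (h i) + ses C (h i) (h i)) = 0"
    unfolding trace_nth diag ses_mat_add .
  then have "(\<Sum>i\<in>UNIV. Re (ses B (h i) (h i)) + Re (ses C (h i) (h i))) = 0"
    unfolding plus_complex.simps(1)[symmetric] Re_sum[symmetric] by simp
  then have "Re (ses B (h i) (h i)) + Re (ses C (h i) (h i)) = 0" for i
    using psd_ses_Re[OF B] psd_ses_Re[OF C] by (simp add: sum_nonneg_eq_0_iff)
  then have z: "ses B (h i) (h i) = 0" "ses C (h i) (h i) = 0" for i
    using psd_ses_Re[OF B, of "h i"] psd_ses_Re[OF C, of "h i"] psd_ses_Im[OF B, of "h i"] psd_ses_Im[OF C, of "h i"]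
    by (auto simp: complex_eq_iff) (metis add_nonneg_eq_0_iff)+
  have "(H ** H) $ i $ i = 0" for i
    using psd_form_zero[OF B z(1)[of i], of i] psd_form_zero[OF C z(2)[of i], of i]
    by (simp add: matmul_nth H_def h_def left_diff_distrib sum_subtractf)
  moreover have "complex_of_real (\<Sum>k\<in>UNIV. (cmod (H $ k $ i))\<^sup>2) = (H ** H) $ i $ i" for i
    unfolding of_real_sum cnj_mult_self[symmetric] matmul_nth cnjH ..
  ultimately have "complex_of_real (\<Sum>k\<in>UNIV. (cmod (H $ k $ i))\<^sup>2) = of_real 0" for i
    by simp
  then have "(\<Sum>k\<in>UNIV. (cmod (H $ k $ i))\<^sup>2) = 0" for i unfolding of_real_eq_iff .
  then have "H $ k $ i = 0" for i k by (simp add: sum_nonneg_eq_0_iff)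
  then show ?thesis by (simp add: H_def vec_eq_iff)
qed

lemma op_sqrt_eqI: "psd B \<Longrightarrow> B ** B = A \<Longrightarrow> op_sqrt A = B"
  unfolding op_sqrt_def by (rule the_equality) (auto intro: psd_sqrt_unique)

lemma op_sqrt: "psd A \<Longrightarrow> psd (op_sqrt A)" "psd A \<Longrightarrow> op_sqrt A ** op_sqrt A = A"
  using psd_sqrt_exists[of A] op_sqrt_eqI by metis+

text \<open>With R the root of \<sigma> and y = R f, the operator under the root in the trace norm
  is \<open>outer y\<close>. Its root is \<open>outer y\<close> divided by the norm of y, so the
  trace norm is the norm of R f.\<close>

lemma fidelity_pure:
  fixes f :: "'a::finite \<Rightarrow> complex"
  assumes \<sigma>: "psd \<sigma>" and f: "(\<Sum>i\<in>UNIV. (cmod (f i))\<^sup>2) = 1"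
  shows "fidelity (outer f) \<sigma> = Re (ses \<sigma> f f)"
proof -
  define R where "R = op_sqrt \<sigma>"
  have R: "psd R" "R ** R = \<sigma>" using op_sqrt[OF \<sigma>] by (simp_all add: R_def)
  have ff: "outer f ** outer f = outer f"
    unfolding outer_mult f by (simp add: vec_eq_iff)
  then have sq: "op_sqrt (outer f) = outer f" by (intro op_sqrt_eqI psd_outer)
  define y where "y i = (\<Sum>j\<in>UNIV. R $ i $ j * f j)" for i
  define s where "s = (\<Sum>i\<in>UNIV. (cmod (y i))\<^sup>2)"
  have s0: "s \<ge> 0" unfolding s_def by (intro sum_nonneg) auto
  have "adj (outer f ** R) ** (outer f ** R) = R ** (outer f ** outer f) ** R"
    using psd_adj[OF R(1)] psd_adj[OF psd_outer[of f]] by (simp add: adj_matmul matrix_mul_assoc)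
  also have "\<dots> = outer y"
  proof -
    have "(R ** outer f ** R) $ i $ j = y i * cnj (y j)" for i j
    proof -
      have "cnj (y j) = (\<Sum>k\<in>UNIV. cnj (f k) * R $ k $ j)"
        unfolding y_def cnj_sum by (intro sum.cong refl) (subst psd_herm[OF R(1)], simp)
      then show ?thesis
        by (simp add: matmul_nth y_def sum_distrib_left sum_distrib_right mult_ac)
    qed
    then show ?thesis unfolding ff by (simp add: vec_eq_iff)
  qed
  finally have Y: "adj (outer f ** R) ** (outer f ** R) = outer y" .
  have y0: "y i = 0" if "s = 0" for i
    using that unfolding s_def by (simp add: sum_nonneg_eq_0_iff)
  \<comment> \<open>For s = 0 the quotient is 0 by convention, which is right since then y =
    0.\<close>
  define B where "B = cscale (of_real (1 / sqrt s)) (outer y)"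
  have "psd B"
  proof (rule psd_factorI[where S = "{()}" and T = "\<lambda>i _. of_real (sqrt (1 / sqrt s)) * y i"])
    show "B $ i $ j = (\<Sum>k\<in>{()}. of_real (sqrt (1 / sqrt s)) * y i * cnj (of_real (sqrt (1 / sqrt s)) * y j))" for i j
    proof -
      have "complex_of_real (sqrt (1 / sqrt s)) * of_real (sqrt (1 / sqrt s)) = of_real (1 / sqrt s)"
        using s0 unfolding of_real_mult[symmetric] by (subst real_sqrt_mult_self) simp
      then have "(of_real (sqrt (1 / sqrt s)) * y i) * cnj (of_real (sqrt (1 / sqrt s)) * y j)
        = of_real (1 / sqrt s) * (y i * cnj (y j))"
        by (metis (no_types, opaque_lifting) complex_cnj_complex_of_real complex_cnj_mult mult.assoc mult.left_commute)
      then show ?thesis by (simp add: B_def)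
    qed
  qed
  moreover have "B ** B = outer y"
  proof -
    have "B ** B = cscale (of_real (1 / sqrt s * (1 / sqrt s))) (outer y ** outer y)"
      unfolding B_def cscale_matmul_left cscale_matmul_right cscale_cscale of_real_mult ..
    also have "\<dots> = outer y"
      unfolding outer_mult s_def[symmetric] using s0 y0
      by (cases "s = 0") (simp_all add: vec_eq_iff cscale_cscale flip: of_real_mult)
    finally show ?thesis .
  qed
  ultimately have "op_sqrt (outer y) = B" by (rule op_sqrt_eqI)
  then have "trace_norm (outer f ** R) = Re (trace B)"
    unfolding trace_norm_def Y by simp
  also have "\<dots> = 1 / sqrt s * s"
    unfolding s_def B_def trace_nth cscale_nth outer_nth cnj_mult_self
    by (simp add: sum_distrib_left)
  also have "\<dots> = sqrt s" using s0 by (simp add: real_div_sqrt)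
  finally have "fidelity (outer f) \<sigma> = s"
    unfolding fidelity_def sq R_def[symmetric] using s0 by simp
  also have "s = Re (ses \<sigma> f f)"
  proof -
    have "ses \<sigma> f f = ses R f y" unfolding R(2)[symmetric] ses_matmul y_def ..
    also have "\<dots> = cnj (ses R y f)" by (rule ses_herm) (rule psd_herm[OF R(1)])
    also have "ses R y f = (\<Sum>i\<in>UNIV. cnj (y i) * y i)" unfolding ses_eq_sum_left y_def ..
    finally show ?thesis by (simp add: s_def cnj_mult_self)
  qed
  finally show ?thesis .
qed

section \<open>Deviation of a bipartite state from a product state\<close>

lemma sum_UNIV_prod: "(\<Sum>r\<in>UNIV. f r) = (\<Sum>s\<in>UNIV. \<Sum>t\<in>UNIV. f (s, t))"
  for f :: "'a::finite \<times> 'b::finite \<Rightarrow> 'c::comm_monoid_add"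
  by (simp add: sum.cartesian_product)

definition nsq :: "('a::finite \<Rightarrow> complex) \<Rightarrow> real" where
  "nsq x = (\<Sum>i\<in>UNIV. (cmod (x i))\<^sup>2)"

definition tv :: "('a \<Rightarrow> complex) \<Rightarrow> ('b \<Rightarrow> complex) \<Rightarrow> 'a \<times> 'b \<Rightarrow> complex" where
  "tv a b = (\<lambda>r. a (fst r) * b (snd r))"

definition ip :: "('a::finite \<Rightarrow> complex) \<Rightarrow> ('a \<Rightarrow> complex) \<Rightarrow> complex" where
  "ip x y = (\<Sum>i\<in>UNIV. cnj (x i) * y i)"

lemma nsq_nonneg: "0 \<le> nsq x"
  unfolding nsq_def by (intro sum_nonneg) auto

lemma ip_self: "ip x x = of_real (nsq x)"
  by (simp add: ip_def nsq_def cnj_mult_self)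

lemma ip_cnj: "ip y x = cnj (ip x y)"
  by (simp add: ip_def mult.commute)

lemma ses_mat_1_ip: "ses (mat 1) x y = ip x y"
  by (simp add: ses_mat_1 ip_def)

lemma nsq_scale: "nsq (\<lambda>i. c * x i) = (cmod c)\<^sup>2 * nsq x"
  by (simp add: nsq_def norm_mult power_mult_distrib sum_distrib_left)

lemma nsq_tv: "nsq (tv a b) = nsq a * nsq b"
  unfolding nsq_def sum_UNIV_prod tv_def by (simp add: norm_mult power_mult_distrib sum_product)

lemma ip_tv: "ip (tv a b) (tv a' b') = ip a a' * ip b b'"
  unfolding ip_def sum_UNIV_prod tv_def by (simp add: sum_product mult_ac)

lemma nsq_parallelogram: "nsq (\<lambda>i. x i + y i) + nsq (\<lambda>i. x i - y i) = 2 * nsq x + 2 * nsq y"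
proof -
  have "(cmod (a + b))\<^sup>2 + (cmod (a - b))\<^sup>2 = 2 * (cmod a)\<^sup>2 + 2 * (cmod b)\<^sup>2" for a b
    unfolding cmod_power2 by (simp add: power2_eq_square algebra_simps)
  then show ?thesis
    unfolding nsq_def by (simp flip: sum.distrib add: sum_distrib_left)
qed

text \<open>Polarization and the parallelogram law for x stretched and y shrunk by the root of
  \<eta>. The free weight replaces the square root of \<open>nsq x * nsq y\<close> by an expression
  linear in both, which can be summed and averaged.\<close>

lemma herm_form_bound:
  fixes H :: "'a::finite cop"
  assumes herm: "\<And>i j. H $ i $ j = cnj (H $ j $ i)"
    and bd: "\<And>x. \<bar>Re (ses H x x)\<bar> \<le> M * nsq x" and \<eta>: "\<eta> > 0"
  shows "2 * \<bar>Re (ses H x y)\<bar> \<le> M * (\<eta> * nsq x + nsq y / \<eta>)"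
proof -
  define r where "r = sqrt \<eta>"
  have r: "r > 0" "r * r = \<eta>" using \<eta> by (simp_all add: r_def)
  define x' where "x' i = of_real r * x i" for i
  define y' where "y' i = of_real (1 / r) * y i" for i
  have "ses H x' y' = ses H x y"
    using r(1) unfolding x'_def y'_def ses_scale_left ses_scale_right by simp
  moreover have "ses H y' x' = cnj (ses H x' y')" by (rule ses_herm[OF herm])
  ultimately have "4 * Re (ses H x y) = Re (ses H (\<lambda>i. x' i + y' i) (\<lambda>i. x' i + y' i)) - Re (ses H (\<lambda>i. x' i - y' i) (\<lambda>i. x' i - y' i))"
    unfolding ses_add_left ses_add_right ses_diff_left ses_diff_right by simp
  then have "4 * \<bar>Re (ses H x y)\<bar> \<le> M * nsq (\<lambda>i. x' i + y' i) + M * nsq (\<lambda>i. x' i - y' i)"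
    using bd[of "\<lambda>i. x' i + y' i"] bd[of "\<lambda>i. x' i - y' i"] by linarith
  also have "\<dots> = M * (2 * nsq x' + 2 * nsq y')"
    unfolding nsq_parallelogram[symmetric] by (simp add: distrib_left)
  also have "nsq x' = \<eta> * nsq x" unfolding x'_def nsq_scale using r by (simp add: power2_eq_square)
  also have "nsq y' = nsq y / \<eta>" unfolding y'_def nsq_scale using r
    by (simp add: norm_divide power2_eq_square)
  finally have "2 * (2 * \<bar>Re (ses H x y)\<bar>) \<le> 2 * (M * (\<eta> * nsq x + nsq y / \<eta>))"
    by (simp add: algebra_simps)
  then show ?thesis by (simp only: mult_le_cancel_left_pos zero_less_numeral)
qed

definition ptrA :: "('a::finite \<times> 'b::finite) cop \<Rightarrow> 'b cop" where
  "ptrA \<sigma> = (\<chi> t t'. \<Sum>s\<in>UNIV. \<sigma> $ (s, t) $ (s, t'))"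

definition ptrB :: "('a::finite \<times> 'b::finite) cop \<Rightarrow> 'a cop" where
  "ptrB \<sigma> = (\<chi> s s'. \<Sum>t\<in>UNIV. \<sigma> $ (s, t) $ (s', t))"

text \<open>The partial matrix element of X at \<phi> on the first factor, an operator on the
  second; \<open>compB\<close> is its mirror image.\<close>

definition compA :: "('a::finite \<Rightarrow> complex) \<Rightarrow> ('a \<times> 'b::finite) cop \<Rightarrow> 'b cop" where
  "compA \<phi> X = (\<chi> t t'. \<Sum>s\<in>UNIV. \<Sum>s'\<in>UNIV. cnj (\<phi> s) * X $ (s, t) $ (s', t') * \<phi> s')"

definition compB :: "('b::finite \<Rightarrow> complex) \<Rightarrow> ('a::finite \<times> 'b) cop \<Rightarrow> 'a cop" where
  "compB \<psi> X = (\<chi> s s'. \<Sum>t\<in>UNIV. \<Sum>t'\<in>UNIV. cnj (\<psi> t) * X $ (s, t) $ (s', t') * \<psi> t')"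

lemma kron_nth [simp]: "kron A B $ r $ s = A $ fst r $ fst s * B $ snd r $ snd s"
  by (simp add: kron_def)

lemma ses_compA: "ses (compA \<phi> X) b b' = ses X (tv \<phi> b) (tv \<phi> b')"
proof -
  have "ses X (tv \<phi> b) (tv \<phi> b') = (\<Sum>s\<in>UNIV. \<Sum>t\<in>UNIV. \<Sum>s'\<in>UNIV. \<Sum>t'\<in>UNIV.
      cnj (b t) * (cnj (\<phi> s) * X $ (s, t) $ (s', t') * \<phi> s') * b' t')"
    unfolding ses_def sum_UNIV_prod tv_def by (simp add: mult_ac)
  also have "\<dots> = (\<Sum>t\<in>UNIV. \<Sum>s\<in>UNIV. \<Sum>t'\<in>UNIV. \<Sum>s'\<in>UNIV.
      cnj (b t) * (cnj (\<phi> s) * X $ (s, t) $ (s', t') * \<phi> s') * b' t')"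
    by (subst sum.swap) (intro sum.cong refl sum.swap)
  also have "\<dots> = (\<Sum>t\<in>UNIV. \<Sum>t'\<in>UNIV. \<Sum>s\<in>UNIV. \<Sum>s'\<in>UNIV.
      cnj (b t) * (cnj (\<phi> s) * X $ (s, t) $ (s', t') * \<phi> s') * b' t')"
    by (intro sum.cong refl sum.swap)
  also have "\<dots> = ses (compA \<phi> X) b b'"
    by (simp add: ses_def compA_def sum_distrib_left sum_distrib_right)
  finally show ?thesis ..
qed

lemma ses_compB: "ses (compB \<psi> X) a a' = ses X (tv a \<psi>) (tv a' \<psi>)"
proof -
  have "ses X (tv a \<psi>) (tv a' \<psi>) = (\<Sum>s\<in>UNIV. \<Sum>t\<in>UNIV. \<Sum>s'\<in>UNIV. \<Sum>t'\<in>UNIV.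
      cnj (a s) * (cnj (\<psi> t) * X $ (s, t) $ (s', t') * \<psi> t') * a' s')"
    unfolding ses_def sum_UNIV_prod tv_def by (simp add: mult_ac)
  also have "\<dots> = (\<Sum>s\<in>UNIV. \<Sum>s'\<in>UNIV. \<Sum>t\<in>UNIV. \<Sum>t'\<in>UNIV.
      cnj (a s) * (cnj (\<psi> t) * X $ (s, t) $ (s', t') * \<psi> t') * a' s')"
    by (intro sum.cong refl sum.swap)
  also have "\<dots> = ses (compB \<psi> X) a a'"
    by (simp add: ses_def compB_def sum_distrib_left sum_distrib_right)
  finally show ?thesis ..
qed

lemma ses_kron_tv: "ses (kron A B) (tv a b) (tv a' b') = ses A a a' * ses B b b'"
proof -
  have "ses (kron A B) (tv a b) (tv a' b') = (\<Sum>s\<in>UNIV. \<Sum>t\<in>UNIV. \<Sum>s'\<in>UNIV. \<Sum>t'\<in>UNIV.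
      (cnj (a s) * A $ s $ s' * a' s') * (cnj (b t) * B $ t $ t' * b' t'))"
    unfolding ses_def sum_UNIV_prod tv_def by (simp add: mult_ac)
  also have "\<dots> = (\<Sum>s\<in>UNIV. \<Sum>s'\<in>UNIV. \<Sum>t\<in>UNIV. \<Sum>t'\<in>UNIV.
      (cnj (a s) * A $ s $ s' * a' s') * (cnj (b t) * B $ t $ t' * b' t'))"
    by (intro sum.cong refl sum.swap)
  also have "\<dots> = ses A a a' * ses B b b'"
    unfolding ses_def sum_distrib_right unfolding sum_distrib_left ..
  finally show ?thesis .
qed

lemma ses_kron_1_left: "ses (kron (mat 1) B) x y = (\<Sum>s\<in>UNIV. ses B (\<lambda>t. x (s, t)) (\<lambda>t. y (s, t)))"
proof -
  have "(\<Sum>s'\<in>UNIV. \<Sum>t'\<in>UNIV. cnj (x (s, t)) * (mat 1 $ s $ s' * B $ t $ t') * y (s', t'))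
    = (\<Sum>s'\<in>UNIV. if s = s' then \<Sum>t'\<in>UNIV. cnj (x (s, t)) * B $ t $ t' * y (s', t') else 0)" for s t
    by (intro sum.cong refl) (simp add: mat_def)
  then show ?thesis unfolding ses_def sum_UNIV_prod by simp
qed

lemma ses_kron_1_right: "ses (kron A (mat 1)) x y = (\<Sum>t\<in>UNIV. ses A (\<lambda>s. x (s, t)) (\<lambda>s. y (s, t)))"
proof -
  have "(\<Sum>t'\<in>UNIV. cnj (x (s, t)) * (A $ s $ s' * mat 1 $ t $ t') * y (s', t'))
    = (\<Sum>t'\<in>UNIV. if t = t' then cnj (x (s, t)) * A $ s $ s' * y (s', t') else 0)" for s t s'
    by (intro sum.cong refl) (simp add: mat_def)
  then have "ses (kron A (mat 1)) x y = (\<Sum>s\<in>UNIV. \<Sum>t\<in>UNIV. \<Sum>s'\<in>UNIV. cnj (x (s, t)) * A $ s $ s' * y (s', t))"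
    unfolding ses_def sum_UNIV_prod by simp
  also have "\<dots> = (\<Sum>t\<in>UNIV. \<Sum>s\<in>UNIV. \<Sum>s'\<in>UNIV. cnj (x (s, t)) * A $ s $ s' * y (s', t))"
    by (rule sum.swap)
  finally show ?thesis by (simp add: ses_def)
qed

lemma trace_kron_1_left: "trace (kron (mat 1) Y ** \<sigma>) = trace (Y ** ptrA \<sigma>)"
proof -
  have "(\<Sum>s'\<in>UNIV. \<Sum>t'\<in>UNIV. mat 1 $ s $ s' * Y $ t $ t' * \<sigma> $ (s', t') $ (s, t))
    = (\<Sum>s'\<in>UNIV. if s = s' then \<Sum>t'\<in>UNIV. Y $ t $ t' * \<sigma> $ (s', t') $ (s, t) else 0)" for s t
    by (intro sum.cong refl) (simp add: mat_def)
  then have "trace (kron (mat 1) Y ** \<sigma>) = (\<Sum>s\<in>UNIV. \<Sum>t\<in>UNIV. \<Sum>t'\<in>UNIV. Y $ t $ t' * \<sigma> $ (s, t') $ (s, t))"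
    unfolding trace_nth matmul_nth sum_UNIV_prod by simp
  also have "\<dots> = (\<Sum>t\<in>UNIV. \<Sum>s\<in>UNIV. \<Sum>t'\<in>UNIV. Y $ t $ t' * \<sigma> $ (s, t') $ (s, t))"
    by (rule sum.swap)
  also have "\<dots> = (\<Sum>t\<in>UNIV. \<Sum>t'\<in>UNIV. \<Sum>s\<in>UNIV. Y $ t $ t' * \<sigma> $ (s, t') $ (s, t))"
    by (intro sum.cong refl sum.swap)
  finally show ?thesis by (simp add: trace_nth matmul_nth ptrA_def sum_distrib_left)
qed

lemma trace_kron_1_right: "trace (kron X (mat 1) ** \<sigma>) = trace (X ** ptrB \<sigma>)"
proof -
  have "(\<Sum>t'\<in>UNIV. X $ s $ s' * mat 1 $ t $ t' * \<sigma> $ (s', t') $ (s, t))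
    = (\<Sum>t'\<in>UNIV. if t = t' then X $ s $ s' * \<sigma> $ (s', t') $ (s, t) else 0)" for s t s'
    by (intro sum.cong refl) (simp add: mat_def)
  then have "trace (kron X (mat 1) ** \<sigma>) = (\<Sum>s\<in>UNIV. \<Sum>t\<in>UNIV. \<Sum>s'\<in>UNIV. X $ s $ s' * \<sigma> $ (s', t) $ (s, t))"
    unfolding trace_nth matmul_nth sum_UNIV_prod by simp
  also have "\<dots> = (\<Sum>s\<in>UNIV. \<Sum>s'\<in>UNIV. \<Sum>t\<in>UNIV. X $ s $ s' * \<sigma> $ (s', t) $ (s, t))"
    by (intro sum.cong refl sum.swap)
  finally show ?thesis by (simp add: trace_nth matmul_nth ptrB_def sum_distrib_left)
qed

lemma ptrA_kron: "ptrA (kron A B) = cscale (trace A) B"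
  and ptrB_kron: "ptrB (kron A B) = cscale (trace B) A"
  by (simp_all add: vec_eq_iff ptrA_def ptrB_def trace_nth sum_distrib_left sum_distrib_right mult.commute)

lemma trace_ptrA: "trace (ptrA \<sigma>) = trace \<sigma>" and trace_ptrB: "trace (ptrB \<sigma>) = trace \<sigma>"
proof -
  show "trace (ptrB \<sigma>) = trace \<sigma>"
    by (simp add: trace_nth ptrB_def sum_UNIV_prod)
  show "trace (ptrA \<sigma>) = trace \<sigma>"
    unfolding trace_nth ptrA_def sum_UNIV_prod by simp (rule sum.swap)
qed

lemma trace_kron: "trace (kron A B) = trace A * trace B"
  unfolding trace_nth sum_UNIV_prod by (simp add: sum_product)

lemma trace_mult_factor:
  fixes \<sigma> :: "'a::finite cop"
  assumes "\<And>i j. \<sigma> $ i $ j = (\<Sum>k\<in>S. T i k * cnj (T j k))"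
  shows "trace (X ** \<sigma>) = (\<Sum>k\<in>S. ses X (\<lambda>i. T i k) (\<lambda>i. T i k))"
proof -
  have "trace (X ** \<sigma>) = (\<Sum>i\<in>UNIV. \<Sum>j\<in>UNIV. \<Sum>k\<in>S. cnj (T i k) * X $ i $ j * T j k)"
    by (simp add: trace_nth matmul_nth assms sum_distrib_left mult_ac)
  also have "\<dots> = (\<Sum>i\<in>UNIV. \<Sum>k\<in>S. \<Sum>j\<in>UNIV. cnj (T i k) * X $ i $ j * T j k)"
    by (intro sum.cong refl sum.swap)
  also have "\<dots> = (\<Sum>k\<in>S. \<Sum>i\<in>UNIV. \<Sum>j\<in>UNIV. cnj (T i k) * X $ i $ j * T j k)"
    by (rule sum.swap)
  finally show ?thesis by (simp add: ses_def)
qed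

lemma trace_factor:
  fixes \<sigma> :: "'a::finite cop"
  assumes "\<And>i j. \<sigma> $ i $ j = (\<Sum>k\<in>S. T i k * cnj (T j k))"
  shows "trace \<sigma> = of_real (\<Sum>k\<in>S. nsq (\<lambda>i. T i k))"
proof -
  have "trace \<sigma> = trace (mat 1 ** \<sigma>)" by (simp add: matrix_mul_lid)
  also have "\<dots> = of_real (\<Sum>k\<in>S. nsq (\<lambda>i. T i k))"
    unfolding trace_mult_factor[OF assms] by (simp add: ses_mat_1_ip ip_self)
  finally show ?thesis .
qed

lemma psd_ptrB: "psd \<sigma> \<Longrightarrow> psd (ptrB \<sigma>)" and psd_ptrA: "psd \<sigma> \<Longrightarrow> psd (ptrA \<sigma>)"
  for \<sigma> :: "('a::finite \<times> 'b::finite) cop"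
proof -
  assume \<sigma>: "psd \<sigma>"
  obtain T :: "'a \<times> 'b \<Rightarrow> 'a \<times> 'b \<Rightarrow> complex" where T: "\<And>i j. \<sigma> $ i $ j = (\<Sum>k\<in>UNIV. T i k * cnj (T j k))"
    using psd_factor[OF \<sigma>] by blast
  have "ptrB \<sigma> $ s $ s' = (\<Sum>j\<in>UNIV. T (s, fst j) (snd j) * cnj (T (s', fst j) (snd j)))" for s s'
    unfolding ptrB_def by (simp add: T sum.cartesian_product case_prod_beta)
  then show "psd (ptrB \<sigma>)" by (rule psd_factorI)
  have "ptrA \<sigma> $ s $ s' = (\<Sum>j\<in>UNIV. T (fst j, s) (snd j) * cnj (T (fst j, s') (snd j)))" for s s'
    unfolding ptrA_def by (simp add: T sum.cartesian_product case_prod_beta)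
  then show "psd (ptrA \<sigma>)" by (rule psd_factorI)
qed

section \<open>The covariance form of an operator relative to a product vector\<close>

locale cov_form =
  fixes X :: "('a::finite \<times> 'b::finite) cop" and \<phi> :: "'a \<Rightarrow> complex" and \<psi> :: "'b \<Rightarrow> complex" and K :: real
  assumes psdX: "psd X" and X_le: "\<And>x. Re (ses X x x) \<le> K * nsq x"
    and \<phi>: "nsq \<phi> = 1" and \<psi>: "nsq \<psi> = 1"
begin

text \<open>A covariance: the parts of X that act on one factor alone, with the other factor held in
  its reference vector, are removed. The scalar is added back because both subtractions contain
  it.\<close>

definition covX :: "('a \<times> 'b) cop" where
  "covX = X - kron (mat 1) (compA \<phi> X) - kron (compB \<psi> X) (mat 1) + cscale (ses X (tv \<phi> \<psi>) (tv \<phi> \<psi>)) (mat 1)"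

lemma ses_covX: "ses covX x y = ses X x y - (\<Sum>s\<in>UNIV. ses (compA \<phi> X) (\<lambda>t. x (s, t)) (\<lambda>t. y (s, t)))
   - (\<Sum>t\<in>UNIV. ses (compB \<psi> X) (\<lambda>s. x (s, t)) (\<lambda>s. y (s, t))) + ses X (tv \<phi> \<psi>) (tv \<phi> \<psi>) * ip x y"
  unfolding covX_def ses_mat_add ses_mat_diff ses_mat_scale ses_kron_1_left ses_kron_1_right ses_mat_1_ip ..

lemma psd_comp: "psd (compA \<phi> X)" "psd (compB \<psi> X)"
  using psdX unfolding psd_iff_ses ses_compA ses_compB by blast+

lemma comp_le: "Re (ses (compA \<phi> X) b b) \<le> K * nsq b" "Re (ses (compB \<psi> X) a a) \<le> K * nsq a"
  using X_le[of "tv \<phi> b"] X_le[of "tv a \<psi>"] unfolding ses_compA ses_compB nsq_tv by (simp_all add: \<phi> \<psi>)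

lemma covX_herm: "covX $ i $ j = cnj (covX $ j $ i)"
proof -
  have "Im (ses X (tv \<phi> \<psi>) (tv \<phi> \<psi>)) = 0" by (rule psd_ses_Im[OF psdX])
  then have "cnj (ses X (tv \<phi> \<psi>) (tv \<phi> \<psi>)) = ses X (tv \<phi> \<psi>) (tv \<phi> \<psi>)"
    by (simp add: complex_eq_iff)
  moreover have "(mat 1 :: 'c::finite cop) $ k $ l = cnj (mat 1 $ l $ k)" for k l
    by (simp add: mat_def)
  ultimately show ?thesis
    unfolding covX_def
    by (simp add: psd_herm[OF psdX, symmetric] psd_herm[OF psd_comp(1), symmetric]
        psd_herm[OF psd_comp(2), symmetric] mat_def)
qed

text \<open>Two terms enter with each sign and each lies between 0 and \<open>K * nsq x\<close>,
  whence the factor 2.\<close>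

lemma covX_bound: "\<bar>Re (ses covX x x)\<bar> \<le> 2 * K * nsq x"
proof -
  let ?A = "\<Sum>s\<in>UNIV. Re (ses (compA \<phi> X) (\<lambda>t. x (s, t)) (\<lambda>t. x (s, t)))"
  let ?B = "\<Sum>t\<in>UNIV. Re (ses (compB \<psi> X) (\<lambda>s. x (s, t)) (\<lambda>s. x (s, t)))"
  let ?o = "Re (ses X (tv \<phi> \<psi>) (tv \<phi> \<psi>))"
  have "?A \<le> (\<Sum>s\<in>UNIV. K * nsq (\<lambda>t. x (s, t)))"
    by (intro sum_mono comp_le)
  also have "\<dots> = K * nsq x" by (simp add: nsq_def sum_UNIV_prod sum_distrib_left)
  finally have A: "?A \<le> K * nsq x" .
  have "?B \<le> (\<Sum>t\<in>UNIV. K * nsq (\<lambda>s. x (s, t)))"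
    by (intro sum_mono comp_le)
  also have "\<dots> = K * (\<Sum>t\<in>UNIV. \<Sum>s\<in>UNIV. (cmod (x (s, t)))\<^sup>2)" by (simp add: nsq_def sum_distrib_left)
  also have "\<dots> = K * nsq x" unfolding nsq_def sum_UNIV_prod by (subst sum.swap) (rule refl)
  finally have B: "?B \<le> K * nsq x" .
  have A0: "0 \<le> ?A" and B0: "0 \<le> ?B" by (intro sum_nonneg psd_ses_Re psd_comp)+
  have o: "0 \<le> ?o" "?o \<le> K" using psd_ses_Re[OF psdX] X_le[of "tv \<phi> \<psi>"] by (simp_all add: nsq_tv \<phi> \<psi>)
  have o': "0 \<le> ?o * nsq x" "?o * nsq x \<le> K * nsq x"
    using o nsq_nonneg[of x] by (auto intro: mult_right_mono)
  have "Re (ses covX x x) = Re (ses X x x) - ?A - ?B + ?o * nsq x"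
    unfolding ses_covX ip_self by simp
  then show ?thesis using A B A0 B0 o' psd_ses_Re[OF psdX, of x] X_le[of x] by linarith
qed

text \<open>On \<phi> \<otimes> B the term with \<open>compA\<close> reproduces X and the term with
  \<open>compB\<close> reproduces the scalar, so the four terms cancel in pairs.\<close>

lemma covX_A: "ses covX (tv \<phi> b) (tv \<phi> b') = 0"
proof -
  have "(\<Sum>s\<in>UNIV. ses (compA \<phi> X) (\<lambda>t. tv \<phi> b (s, t)) (\<lambda>t. tv \<phi> b' (s, t))) = ses X (tv \<phi> b) (tv \<phi> b')"
    unfolding ses_kron_1_left[symmetric, of "compA \<phi> X" "tv \<phi> b" "tv \<phi> b'"]
    unfolding ses_kron_tv ses_mat_1_ip ip_self \<phi> ses_compA by simp
  moreover have "(\<Sum>t\<in>UNIV. ses (compB \<psi> X) (\<lambda>s. tv \<phi> b (s, t)) (\<lambda>s. tv \<phi> b' (s, t)))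
     = ses X (tv \<phi> \<psi>) (tv \<phi> \<psi>) * ip b b'"
    unfolding ses_kron_1_right[symmetric, of "compB \<psi> X" "tv \<phi> b" "tv \<phi> b'"]
    unfolding ses_kron_tv ses_mat_1_ip ses_compB ..
  moreover have "ip (tv \<phi> b) (tv \<phi> b') = ip b b'"
    unfolding ip_tv ip_self \<phi> by simp
  ultimately show ?thesis unfolding ses_covX by simp
qed

lemma covX_B: "ses covX (tv a \<psi>) (tv a' \<psi>) = 0"
proof -
  have "(\<Sum>s\<in>UNIV. ses (compA \<phi> X) (\<lambda>t. tv a \<psi> (s, t)) (\<lambda>t. tv a' \<psi> (s, t)))
     = ip a a' * ses X (tv \<phi> \<psi>) (tv \<phi> \<psi>)"
    unfolding ses_kron_1_left[symmetric, of "compA \<phi> X" "tv a \<psi>" "tv a' \<psi>"]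
    unfolding ses_kron_tv ses_mat_1_ip ses_compA ..
  moreover have "(\<Sum>t\<in>UNIV. ses (compB \<psi> X) (\<lambda>s. tv a \<psi> (s, t)) (\<lambda>s. tv a' \<psi> (s, t))) = ses X (tv a \<psi>) (tv a' \<psi>)"
    unfolding ses_kron_1_right[symmetric, of "compB \<psi> X" "tv a \<psi>" "tv a' \<psi>"]
    unfolding ses_kron_tv ses_mat_1_ip ip_self \<psi> ses_compB by simp
  moreover have "ip (tv a \<psi>) (tv a' \<psi>) = ip a a'"
    unfolding ip_tv ip_self \<psi> by simp
  ultimately show ?thesis unfolding ses_covX by simp
qed

definition cA :: "('a \<times> 'b \<Rightarrow> complex) \<Rightarrow> 'b \<Rightarrow> complex" where
  "cA x t = (\<Sum>s\<in>UNIV. cnj (\<phi> s) * x (s, t))"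

definition cB :: "('a \<times> 'b \<Rightarrow> complex) \<Rightarrow> 'a \<Rightarrow> complex" where
  "cB x s = (\<Sum>t\<in>UNIV. cnj (\<psi> t) * x (s, t))"

text \<open>The squared norm of the part of x orthogonal to \<phi> \<otimes> B: an unnormalized
  probability that the projection of the first factor on \<phi> fails.\<close>

definition infA :: "('a \<times> 'b \<Rightarrow> complex) \<Rightarrow> real" where
  "infA x = nsq x - nsq (cA x)"

definition infB :: "('a \<times> 'b \<Rightarrow> complex) \<Rightarrow> real" where
  "infB x = nsq x - nsq (cB x)"

text \<open>By inclusion-exclusion, the squared norm of the component of x in the product of the two
  orthogonal complements.\<close>

definition infAB :: "('a \<times> 'b \<Rightarrow> complex) \<Rightarrow> real" where
  "infAB x = nsq x - nsq (cA x) - nsq (cB x) + (cmod (ip (tv \<phi> \<psi>) x))\<^sup>2"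

lemma ip_tv_left: "ip (tv a \<psi>) x = ip a (cB x)" "ip (tv \<phi> b) x = ip b (cA x)"
proof -
  show "ip (tv a \<psi>) x = ip a (cB x)"
    unfolding ip_def sum_UNIV_prod tv_def cB_def by (simp add: sum_distrib_left mult_ac)
  have "ip (tv \<phi> b) x = (\<Sum>s\<in>UNIV. \<Sum>t\<in>UNIV. cnj (b t) * (cnj (\<phi> s) * x (s, t)))"
    unfolding ip_def sum_UNIV_prod tv_def by (simp add: mult_ac)
  also have "\<dots> = ip b (cA x)" unfolding ip_def cA_def sum_distrib_left by (rule sum.swap)
  finally show "ip (tv \<phi> b) x = ip b (cA x)" .
qed

lemma nsq_diff: "nsq (\<lambda>i. x i - y i) = nsq x + nsq y - 2 * Re (ip x y)"
  unfolding nsq_def ip_def Re_sum cmod_power2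
  by (simp add: sum.distrib sum_subtractf sum_distrib_left power2_eq_square algebra_simps)

lemma ip_diff_right: "ip x (\<lambda>i. y i - z i) = ip x y - ip x z"
  and ip_scale_right: "ip x (\<lambda>i. c * y i) = c * ip x y"
  and ip_scale_left: "ip (\<lambda>i. c * x i) y = cnj c * ip x y"
  by (simp_all add: ip_def algebra_simps sum.distrib sum_subtractf sum_distrib_left)

text \<open>The components of \<open>x\<close> along \<open>\<phi>\<psi>\<close>, \<open>\<phi>\<^sup>\<bottom>\<psi>\<close>, \<open>\<phi>\<psi>\<^sup>\<bottom>\<close>, \<open>\<phi>\<^sup>\<bottom>\<psi>\<^sup>\<bottom>\<close>: by
  \<open>covX_A\<close> and \<open>covX_B\<close> only the couplings to the last one and between the two middle ones survive.\<close>

lemma covX_split: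
  obtains q r e where
    "Re (ses covX x x) = 2 * Re (ses covX e x) - Re (ses covX e e) + 2 * Re (ses covX q r)"
    "nsq e = infAB x" "nsq e + nsq q = infA x" "nsq e + nsq r = infB x"
proof -
  define c where "c = ip (tv \<phi> \<psi>) x"
  define q where "q = tv (\<lambda>s. cB x s - c * \<phi> s) \<psi>"
  define r where "r = tv \<phi> (\<lambda>t. cA x t - c * \<psi> t)"
  define p where "p = tv (\<lambda>s. c * \<phi> s) \<psi>"
  have p': "p = tv \<phi> (\<lambda>t. c * \<psi> t)" by (simp add: p_def tv_def fun_eq_iff)
  have c: "ip \<phi> (cB x) = c" "ip \<psi> (cA x) = c" unfolding c_def by (rule ip_tv_left[symmetric])+
  define e where "e i = x i - (p i + q i + r i)" for i
  let ?B = "ses covX"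
  have pq: "(\<lambda>i. p i + q i) = tv (cB x) \<psi>" by (simp add: p_def q_def tv_def fun_eq_iff algebra_simps)
  have z: "?B p p = 0" "?B p q = 0" "?B q p = 0" "?B q q = 0"
    unfolding p_def q_def by (rule covX_B)+
  have z': "?B p r = 0" "?B r p = 0" "?B r r = 0"
    unfolding p' r_def by (rule covX_A)+
  define y where "y i = p i + q i + r i" for i
  have x: "x = (\<lambda>i. y i + e i)" by (simp add: e_def y_def)
  \<comment> \<open>The cross terms with e are taken against all of x instead of y, hence the
    correction by the value at e. The weight \<eta> will then multiply \<open>nsq x\<close>, whose
    sum over the columns of a factor is a trace.\<close>
  have B: "?B x x = ?B q r + ?B r q + ?B e x + ?B x e - ?B e e"
  proof -
    have "?B y y = ?B q r + ?B r q"
      unfolding y_def by (simp add: ses_add_left ses_add_right z z')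
    then show ?thesis
      unfolding x ses_add_left ses_add_right by simp
  qed
  have "?B r q = cnj (?B q r)" "?B x e = cnj (?B e x)" by (rule ses_herm[OF covX_herm])+
  then have 1: "Re (?B x x) = 2 * Re (?B e x) - Re (?B e e) + 2 * Re (?B q r)"
    unfolding B by simp
  have nc: "nsq (\<lambda>s. c * \<phi> s) = (cmod c)\<^sup>2" "nsq (\<lambda>t. c * \<psi> t) = (cmod c)\<^sup>2" by (simp_all add: nsq_scale \<phi> \<psi>)
  have ccRe: "Re (c * cnj c) = (cmod c)\<^sup>2" by (simp add: cnj_mult_self)
  have nq: "nsq q = nsq (cB x) - (cmod c)\<^sup>2"
    unfolding q_def nsq_tv \<psi> nsq_diff nc ip_scale_right
    by (subst ip_cnj) (simp add: c ccRe del: times_complex.sel)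
  have nr: "nsq r = nsq (cA x) - (cmod c)\<^sup>2"
    unfolding r_def nsq_tv \<phi> nsq_diff nc ip_scale_right
    by (subst ip_cnj) (simp add: c ccRe del: times_complex.sel)
  have ne: "nsq e = infAB x"
  proof -
    have e': "e = (\<lambda>i. (x i - tv (cB x) \<psi> i) - r i)"
      unfolding pq[symmetric] by (simp add: e_def fun_eq_iff)
    have "ip (tv (cB x) \<psi>) r = cnj (ip r (tv (cB x) \<psi>))" by (rule ip_cnj)
    have i1: "ip r x = of_real (nsq r)"
    proof -
      have "ip r x = ip (\<lambda>t. cA x t - c * \<psi> t) (cA x)" unfolding r_def ip_tv_left ..
      moreover have "ip (\<lambda>t. cA x t - c * \<psi> t) (\<lambda>t. c * \<psi> t) = 0"
      proof -
        have "ip (\<lambda>t. c * \<psi> t) (\<lambda>t. cA x t - c * \<psi> t) = 0"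
          unfolding ip_diff_right ip_scale_left ip_scale_right c ip_self \<psi> by simp
        then show ?thesis by (subst ip_cnj) simp
      qed
      ultimately have "ip r x = ip (\<lambda>t. cA x t - c * \<psi> t) (\<lambda>t. cA x t - c * \<psi> t)"
        unfolding ip_diff_right[of _ "cA x"] by simp
      then show ?thesis unfolding ip_self by (simp add: r_def nsq_tv \<phi>)
    qed
    have i2: "ip r (tv (cB x) \<psi>) = 0"
    proof -
      have "ip \<psi> (\<lambda>t. cA x t - c * \<psi> t) = 0"
        unfolding ip_diff_right ip_scale_right c ip_self \<psi> by simp
      then have "ip (\<lambda>t. cA x t - c * \<psi> t) \<psi> = 0" by (subst ip_cnj) simp
      then show ?thesis unfolding r_def ip_tv by simp
    qed
    have i3: "ip x (tv (cB x) \<psi>) = of_real (nsq (cB x))"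
      by (subst ip_cnj) (simp add: ip_tv_left ip_self)
    have "nsq e = nsq (\<lambda>i. x i - tv (cB x) \<psi> i) + nsq r - 2 * Re (ip (\<lambda>i. x i - tv (cB x) \<psi> i) r)"
      unfolding e' nsq_diff ..
    also have "ip (\<lambda>i. x i - tv (cB x) \<psi> i) r = cnj (ip r x - ip r (tv (cB x) \<psi>))"
      unfolding ip_diff_right[symmetric] by (rule ip_cnj)
    also have "\<dots> = of_real (nsq r)" unfolding i1 i2 by simp
    also have "nsq (\<lambda>i. x i - tv (cB x) \<psi> i) = nsq x - nsq (cB x)"
      unfolding nsq_diff nsq_tv \<psi> i3 by simp
    finally show ?thesis unfolding nr infAB_def c_def by simp
  qed
  show thesis
    by (rule that[OF 1 ne]) (simp_all add: ne nq nr infA_def infB_def infAB_def c_def)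
qed

lemma K_nonneg: "0 \<le> K"
  using psd_ses_Re[OF psdX, of "tv \<phi> \<psi>"] X_le[of "tv \<phi> \<psi>"] by (simp add: nsq_tv \<phi> \<psi>)

lemma inf_nonneg: "0 \<le> infA x" "0 \<le> infB x" "0 \<le> infAB x"
  using covX_split[of x] nsq_nonneg by (metis add_nonneg_nonneg)+

text \<open>Only the coupling of x to the component e needs the weight \<eta>; the squared norms of
  the two middle components are themselves bounded by \<open>infA\<close> and
  \<open>infB\<close>.\<close>

lemma covX_le:
  assumes \<eta>: "\<eta> > 0"
  shows "\<bar>Re (ses covX x x)\<bar> \<le> 2 * K * (\<eta> * nsq x + infAB x / \<eta> + infA x + infB x)"
proof -
  obtain q r e where *: "Re (ses covX x x) = 2 * Re (ses covX e x) - Re (ses covX e e) + 2 * Re (ses covX q r)"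
    "nsq e = infAB x" "nsq e + nsq q = infA x" "nsq e + nsq r = infB x"
    using covX_split[of x] .
  have "ses covX e x = cnj (ses covX x e)" by (rule ses_herm[OF covX_herm])
  then have 1: "2 * \<bar>Re (ses covX e x)\<bar> \<le> 2 * K * (\<eta> * nsq x + nsq e / \<eta>)"
    using herm_form_bound[OF covX_herm covX_bound \<eta>, of x e] by simp
  have 2: "\<bar>Re (ses covX e e)\<bar> \<le> 2 * K * nsq e" by (rule covX_bound)
  have 3: "2 * \<bar>Re (ses covX q r)\<bar> \<le> 2 * K * (nsq q + nsq r)"
    using herm_form_bound[OF covX_herm covX_bound zero_less_one, of q r] by simp
  have "\<bar>Re (ses covX x x)\<bar> \<le> 2 * K * (\<eta> * nsq x + nsq e / \<eta>) + 2 * K * nsq e + 2 * K * (nsq q + nsq r)"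
    using *(1) 1 2 3 by linarith
  also have "\<dots> = 2 * K * (\<eta> * nsq x + nsq e / \<eta> + nsq e + nsq q + nsq r)" by (simp add: distrib_left)
  also have "\<dots> \<le> 2 * K * (\<eta> * nsq x + infAB x / \<eta> + infA x + infB x)"
    using *(2-4) nsq_nonneg[of e] K_nonneg by (intro mult_left_mono) auto
  finally show ?thesis .
qed

lemma inf_tv:
  "infA (tv a b) = (nsq a - (cmod (ip \<phi> a))\<^sup>2) * nsq b"
  "infB (tv a b) = nsq a * (nsq b - (cmod (ip \<psi> b))\<^sup>2)"
  "infAB (tv a b) = (nsq a - (cmod (ip \<phi> a))\<^sup>2) * (nsq b - (cmod (ip \<psi> b))\<^sup>2)"
proof -
  have "cA (tv a b) = (\<lambda>t. ip \<phi> a * b t)"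
    by (rule ext) (simp add: cA_def tv_def ip_def sum_distrib_right mult.assoc)
  then have A: "nsq (cA (tv a b)) = (cmod (ip \<phi> a))\<^sup>2 * nsq b" by (simp add: nsq_scale)
  have "cB (tv a b) = (\<lambda>s. ip \<psi> b * a s)"
    by (rule ext) (simp add: cB_def tv_def ip_def sum_distrib_left mult_ac)
  then have B: "nsq (cB (tv a b)) = (cmod (ip \<psi> b))\<^sup>2 * nsq a" by (simp add: nsq_scale)
  show "infA (tv a b) = (nsq a - (cmod (ip \<phi> a))\<^sup>2) * nsq b"
    "infB (tv a b) = nsq a * (nsq b - (cmod (ip \<psi> b))\<^sup>2)"
    "infAB (tv a b) = (nsq a - (cmod (ip \<phi> a))\<^sup>2) * (nsq b - (cmod (ip \<psi> b))\<^sup>2)"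
    unfolding infA_def infB_def infAB_def A B nsq_tv ip_tv norm_mult power_mult_distrib
    by (simp_all add: algebra_simps)
qed

text \<open>For a product vector the product of \<open>nsq\<close> and \<open>infAB\<close> equals
  that of \<open>infA\<close> and \<open>infB\<close>, so taking \<eta> as the quotient of
  \<open>infA\<close> by \<open>nsq\<close> turns the two weighted terms into \<open>infA\<close>
  and \<open>infB\<close>, and no free weight remains.\<close>

lemma covX_tv_le: "\<bar>Re (ses covX (tv a b) (tv a b))\<bar> \<le> 4 * K * (infA (tv a b) + infB (tv a b))"
proof (cases "nsq a = 0 \<or> nsq b = 0")
  case True
  then have "nsq (tv a b) = 0" by (auto simp: nsq_tv)
  then have "\<bar>Re (ses covX (tv a b) (tv a b))\<bar> \<le> 0" using covX_bound[of "tv a b"] by simp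
  also have "0 \<le> 4 * K * (infA (tv a b) + infB (tv a b))"
    using K_nonneg inf_nonneg by simp
  finally show ?thesis .
next
  case False
  then have pos: "nsq a > 0" "nsq b > 0" using nsq_nonneg[of a] nsq_nonneg[of b] by auto
  define a1 where "a1 = nsq a - (cmod (ip \<phi> a))\<^sup>2"
  define b1 where "b1 = nsq b - (cmod (ip \<psi> b))\<^sup>2"
  have A: "infA (tv a b) = a1 * nsq b" and B: "infB (tv a b) = nsq a * b1" and AB: "infAB (tv a b) = a1 * b1"
    by (simp_all add: inf_tv a1_def b1_def)
  have a1: "a1 \<ge> 0" and b1: "b1 \<ge> 0" using inf_nonneg[of "tv a b"] pos unfolding A B by (auto simp: zero_le_mult_iff)
  show ?thesis
  proof (rule field_le_epsilon)
    fix \<epsilon> :: real assume \<epsilon>: "\<epsilon> > 0"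
    \<comment> \<open>The ideal weight \<open>a1 / nsq a\<close> may be 0; \<delta> keeps \<eta>
      positive and is small enough to cost at most the slack \<epsilon>.\<close>
    define \<delta> where "\<delta> = \<epsilon> / (2 * K * nsq b + 1)"
    have den: "2 * K * nsq b + 1 > 0" using K_nonneg pos by (simp add: add_nonneg_pos)
    have \<delta>: "\<delta> > 0" unfolding \<delta>_def using \<epsilon> den by simp
    have "(2 * K * nsq b) * \<delta> \<le> (2 * K * nsq b + 1) * \<delta>" using \<delta> by (intro mult_right_mono) auto
    also have "\<dots> = \<epsilon>" using den by (simp add: \<delta>_def)
    finally have \<delta>\<epsilon>: "2 * K * (\<delta> * nsq b) \<le> \<epsilon>" by (simp add: mult_ac)
    define \<eta> where "\<eta> = (a1 + \<delta>) / nsq a"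
    have \<eta>: "\<eta> > 0" unfolding \<eta>_def using a1 \<delta> pos by (simp add: add_nonneg_pos)
    have f1: "\<eta> * nsq (tv a b) = a1 * nsq b + \<delta> * nsq b"
      using pos by (simp add: \<eta>_def nsq_tv field_simps)
    have f2: "a1 * b1 / \<eta> \<le> nsq a * b1"
    proof -
      have "a1 * b1 / \<eta> = (a1 / (a1 + \<delta>)) * (nsq a * b1)" using pos a1 \<delta> by (simp add: \<eta>_def)
      also have "\<dots> \<le> 1 * (nsq a * b1)"
        using a1 b1 \<delta> pos by (intro mult_right_mono) (auto simp: divide_simps)
      finally show ?thesis by simp
    qed
    have "\<eta> * nsq (tv a b) + a1 * b1 / \<eta> + a1 * nsq b + nsq a * b1
        \<le> (a1 * nsq b + \<delta> * nsq b) + nsq a * b1 + a1 * nsq b + nsq a * b1"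
      unfolding f1 using f2 by (intro add_mono order_refl)
    also have "\<dots> = 2 * (a1 * nsq b + nsq a * b1) + \<delta> * nsq b" by simp
    finally have "\<eta> * nsq (tv a b) + a1 * b1 / \<eta> + a1 * nsq b + nsq a * b1
        \<le> 2 * (a1 * nsq b + nsq a * b1) + \<delta> * nsq b" .
    then have "2 * K * (\<eta> * nsq (tv a b) + a1 * b1 / \<eta> + a1 * nsq b + nsq a * b1)
      \<le> 2 * K * (2 * (a1 * nsq b + nsq a * b1) + \<delta> * nsq b)"
      using K_nonneg by (intro mult_left_mono) auto
    then show "\<bar>Re (ses covX (tv a b) (tv a b))\<bar> \<le> 4 * K * (infA (tv a b) + infB (tv a b)) + \<epsilon>"
      using covX_le[OF \<eta>, of "tv a b"] \<delta>\<epsilon> unfolding A B AB by (simp add: algebra_simps)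
  qed
qed

text \<open>Unnormalized probabilities that \<sigma> is not found in \<phi> on the first factor;
  \<open>nB\<close> is the same for \<psi> on the second, and \<open>nAB\<close> for both failures
  at once.\<close>

definition nA :: "('a \<times> 'b) cop \<Rightarrow> real" where
  "nA \<sigma> = Re (trace \<sigma>) - Re (ses (ptrB \<sigma>) \<phi> \<phi>)"

definition nB :: "('a \<times> 'b) cop \<Rightarrow> real" where
  "nB \<sigma> = Re (trace \<sigma>) - Re (ses (ptrA \<sigma>) \<psi> \<psi>)"

definition nAB :: "('a \<times> 'b) cop \<Rightarrow> real" where
  "nAB \<sigma> = Re (trace \<sigma>) - Re (ses (ptrB \<sigma>) \<phi> \<phi>) - Re (ses (ptrA \<sigma>) \<psi> \<psi>) + Re (ses \<sigma> (tv \<phi> \<psi>) (tv \<phi> \<psi>))"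

text \<open>Lets the estimates for single vectors be summed over the columns of a factorization of
  \<sigma>.\<close>

lemma n_factor:
  assumes T: "\<And>i j. \<sigma> $ i $ j = (\<Sum>k\<in>S. T i k * cnj (T j k))"
  shows "nA \<sigma> = (\<Sum>k\<in>S. infA (\<lambda>i. T i k))" "nB \<sigma> = (\<Sum>k\<in>S. infB (\<lambda>i. T i k))" "nAB \<sigma> = (\<Sum>k\<in>S. infAB (\<lambda>i. T i k))"
proof -
  have w: "Re (trace \<sigma>) = (\<Sum>k\<in>S. nsq (\<lambda>i. T i k))" unfolding trace_factor[OF T] by simp
  have "ptrB \<sigma> $ s $ s' = (\<Sum>j\<in>UNIV \<times> S. T (s, fst j) (snd j) * cnj (T (s', fst j) (snd j)))" for s s'
    by (simp add: ptrB_def T sum.cartesian_product case_prod_beta)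
  from ses_factor[OF this, of \<phi> \<phi>]
  have "Re (ses (ptrB \<sigma>) \<phi> \<phi>) = (\<Sum>j\<in>UNIV \<times> S. (cmod (\<Sum>s\<in>UNIV. cnj (\<phi> s) * T (s, fst j) (snd j)))\<^sup>2)"
    unfolding cnj_mult_self by simp
  also have "\<dots> = (\<Sum>t\<in>UNIV. \<Sum>k\<in>S. (cmod (cA (\<lambda>i. T i k) t))\<^sup>2)"
    by (simp add: sum.cartesian_product case_prod_beta cA_def)
  also have "\<dots> = (\<Sum>k\<in>S. nsq (cA (\<lambda>i. T i k)))"
    unfolding nsq_def by (rule sum.swap)
  finally have A: "Re (ses (ptrB \<sigma>) \<phi> \<phi>) = (\<Sum>k\<in>S. nsq (cA (\<lambda>i. T i k)))" .
  have "ptrA \<sigma> $ t $ t' = (\<Sum>j\<in>UNIV \<times> S. T (fst j, t) (snd j) * cnj (T (fst j, t') (snd j)))" for t t'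
    by (simp add: ptrA_def T sum.cartesian_product case_prod_beta)
  from ses_factor[OF this, of \<psi> \<psi>]
  have "Re (ses (ptrA \<sigma>) \<psi> \<psi>) = (\<Sum>j\<in>UNIV \<times> S. (cmod (\<Sum>t\<in>UNIV. cnj (\<psi> t) * T (fst j, t) (snd j)))\<^sup>2)"
    unfolding cnj_mult_self by simp
  also have "\<dots> = (\<Sum>s\<in>UNIV. \<Sum>k\<in>S. (cmod (cB (\<lambda>i. T i k) s))\<^sup>2)"
    by (simp add: sum.cartesian_product case_prod_beta cB_def)
  also have "\<dots> = (\<Sum>k\<in>S. nsq (cB (\<lambda>i. T i k)))"
    unfolding nsq_def by (rule sum.swap)
  finally have B: "Re (ses (ptrA \<sigma>) \<psi> \<psi>) = (\<Sum>k\<in>S. nsq (cB (\<lambda>i. T i k)))" .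
  have AB: "Re (ses \<sigma> (tv \<phi> \<psi>) (tv \<phi> \<psi>)) = (\<Sum>k\<in>S. (cmod (ip (tv \<phi> \<psi>) (\<lambda>i. T i k)))\<^sup>2)"
    unfolding ses_factor[OF T] cnj_mult_self by (simp add: ip_def)
  show "nA \<sigma> = (\<Sum>k\<in>S. infA (\<lambda>i. T i k))" "nB \<sigma> = (\<Sum>k\<in>S. infB (\<lambda>i. T i k))" "nAB \<sigma> = (\<Sum>k\<in>S. infAB (\<lambda>i. T i k))"
    unfolding nA_def nB_def nAB_def infA_def infB_def infAB_def A B AB w
    by (simp_all add: sum.distrib sum_subtractf)
qed

lemma trace_covX:
  "trace (covX ** \<sigma>) = trace (X ** \<sigma>) - trace (compA \<phi> X ** ptrA \<sigma>) - trace (compB \<psi> X ** ptrB \<sigma>)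
     + ses X (tv \<phi> \<psi>) (tv \<phi> \<psi>) * trace \<sigma>"
proof -
  have "trace (covX ** \<sigma>) = trace (X ** \<sigma>) - trace (kron (mat 1) (compA \<phi> X) ** \<sigma>)
      - trace (kron (compB \<psi> X) (mat 1) ** \<sigma>) + trace (cscale (ses X (tv \<phi> \<psi>) (tv \<phi> \<psi>)) (mat 1) ** \<sigma>)"
    unfolding covX_def matrix_add_rdistrib matrix_sub_rdistrib by (simp add: trace_nth sum.distrib sum_subtractf)
  also have "trace (cscale c (mat 1) ** \<sigma>) = c * trace \<sigma>" for c
    unfolding cscale_matmul_left matrix_mul_lid by (simp add: trace_nth sum_distrib_left)
  finally show ?thesis unfolding trace_kron_1_left trace_kron_1_right .
qed

lemma trace_cscale_right: "trace (A ** cscale c B) = c * trace (A ** B)"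
  unfolding cscale_matmul_right by (simp add: trace_nth sum_distrib_left)

text \<open>The product of the marginals has trace w squared, so it is compared with w \<sigma>. The
  covariance is small on both: \<open>covX_le\<close> contributes one copy of \<open>nA + nB\<close>
  and \<open>covX_tv_le\<close> two, which makes the 3.\<close>

lemma trace_le_product:
  assumes \<sigma>: "psd \<sigma>" and \<eta>: "\<eta> > 0"
    and F: "Re (trace (X ** kron (ptrB \<sigma>) (ptrA \<sigma>))) \<le> F * (Re (trace \<sigma>))\<^sup>2"
  shows "Re (trace (X ** \<sigma>)) \<le> F * Re (trace \<sigma>) + 2 * K * (\<eta> * Re (trace \<sigma>) + nAB \<sigma> / \<eta> + 3 * (nA \<sigma> + nB \<sigma>))"
proof -
  obtain T :: "'a \<times> 'b \<Rightarrow> 'a \<times> 'b \<Rightarrow> complex" where T: "\<And>i j. \<sigma> $ i $ j = (\<Sum>k\<in>UNIV. T i k * cnj (T j k))"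
    using psd_factor[OF \<sigma>] by blast
  define w where "w = Re (trace \<sigma>)"
  have w: "w = (\<Sum>k\<in>UNIV. nsq (\<lambda>i. T i k))" unfolding w_def trace_factor[OF T] by simp
  have trw: "trace \<sigma> = of_real w" unfolding w trace_factor[OF T] ..
  note n = n_factor[OF T]
  have n0: "0 \<le> nA \<sigma>" "0 \<le> nB \<sigma>" "0 \<le> nAB \<sigma>" unfolding n by (intro sum_nonneg inf_nonneg)+
  have w0: "w \<ge> 0" unfolding w by (intro sum_nonneg nsq_nonneg)
  show ?thesis
  proof (cases "w = 0")
    case True
    have "Re (trace (X ** \<sigma>)) \<le> (\<Sum>k\<in>UNIV. K * nsq (\<lambda>i. T i k))"
      unfolding trace_mult_factor[OF T] Re_sum by (intro sum_mono X_le)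
    also have "\<dots> = 0" using True unfolding w by (simp flip: sum_distrib_left)
    also have "0 \<le> 2 * K * (nAB \<sigma> / \<eta> + 3 * (nA \<sigma> + nB \<sigma>))"
      using K_nonneg n0 \<eta> by simp
    finally show ?thesis using True unfolding w_def by simp
  next
    case False
    then have wpos: "w > 0" using w0 by simp
    define \<alpha> where "\<alpha> = ptrB \<sigma>"
    define \<beta> where "\<beta> = ptrA \<sigma>"
    define \<tau> where "\<tau> = kron \<alpha> \<beta>"
    have tr: "trace \<alpha> = of_real w" "trace \<beta> = of_real w" unfolding \<alpha>_def \<beta>_def trace_ptrA trace_ptrB trw by simp_all
    have pA: "ptrA \<tau> = cscale (of_real w) \<beta>" and pB: "ptrB \<tau> = cscale (of_real w) \<alpha>"
      unfolding \<tau>_def ptrA_kron ptrB_kron tr by simp_all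
    have trt: "trace \<tau> = of_real w * of_real w" unfolding \<tau>_def trace_kron tr ..
    \<comment> \<open>Both w \<sigma> and \<tau> have the same marginals and trace, so the one-sided
      terms of \<open>covX\<close> drop out of the difference.\<close>
    have "of_real w * trace (X ** \<sigma>) = trace (X ** \<tau>) + of_real w * trace (covX ** \<sigma>) - trace (covX ** \<tau>)"
      unfolding trace_covX pA pB trace_cscale_right trt trw \<alpha>_def[symmetric] \<beta>_def[symmetric]
      by (simp add: algebra_simps)
    then have "Re (of_real w * trace (X ** \<sigma>)) = Re (trace (X ** \<tau>)) + Re (of_real w * trace (covX ** \<sigma>)) - Re (trace (covX ** \<tau>))"
      by simp
    then have eq: "w * Re (trace (X ** \<sigma>)) = Re (trace (X ** \<tau>)) + w * Re (trace (covX ** \<sigma>)) - Re (trace (covX ** \<tau>))"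
      by simp
    have 1: "Re (trace (X ** \<tau>)) \<le> F * w * w"
      using F by (simp add: \<tau>_def \<alpha>_def \<beta>_def w_def power2_eq_square mult.assoc)
    have "Re (trace (covX ** \<sigma>)) \<le> (\<Sum>k\<in>UNIV. 2 * K * (\<eta> * nsq (\<lambda>i. T i k) + infAB (\<lambda>i. T i k) / \<eta> + infA (\<lambda>i. T i k) + infB (\<lambda>i. T i k)))"
      unfolding trace_mult_factor[OF T] Re_sum by (intro sum_mono order_trans[OF abs_ge_self covX_le[OF \<eta>]])
    also have "\<dots> = 2 * K * (\<eta> * w + nAB \<sigma> / \<eta> + nA \<sigma> + nB \<sigma>)"
      unfolding n w by (simp add: sum_distrib_left[symmetric] sum.distrib sum_divide_distrib)
    finally have 2: "Re (trace (covX ** \<sigma>)) \<le> 2 * K * (\<eta> * w + nAB \<sigma> / \<eta> + nA \<sigma> + nB \<sigma>)" .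
    have ps\<alpha>: "psd \<alpha>" and ps\<beta>: "psd \<beta>"
      unfolding \<alpha>_def \<beta>_def by (rule psd_ptrB[OF \<sigma>], rule psd_ptrA[OF \<sigma>])
    obtain A :: "'a \<Rightarrow> 'a \<Rightarrow> complex" where A: "\<And>i j. \<alpha> $ i $ j = (\<Sum>k\<in>UNIV. A i k * cnj (A j k))"
      using psd_factor[OF ps\<alpha>] by blast
    obtain B :: "'b \<Rightarrow> 'b \<Rightarrow> complex" where B: "\<And>i j. \<beta> $ i $ j = (\<Sum>k\<in>UNIV. B i k * cnj (B j k))"
      using psd_factor[OF ps\<beta>] by blast
    define S where "S i k = tv (\<lambda>s. A s (fst k)) (\<lambda>t. B t (snd k)) i" for i k
    have S: "\<tau> $ i $ j = (\<Sum>k\<in>UNIV. S i k * cnj (S j k))" for i j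
      unfolding \<tau>_def kron_nth A B sum_UNIV_prod S_def tv_def by (simp add: sum_product mult_ac)
    have S': "(\<lambda>i. S i k) = tv (\<lambda>s. A s (fst k)) (\<lambda>t. B t (snd k))" for k unfolding S_def ..
    have "- Re (trace (covX ** \<tau>)) \<le> (\<Sum>k\<in>UNIV. 4 * K * (infA (\<lambda>i. S i k) + infB (\<lambda>i. S i k)))"
      unfolding trace_mult_factor[OF S] Re_sum sum_negf[symmetric] S'
      by (intro sum_mono order_trans[OF abs_ge_minus_self covX_tv_le])
    also have "\<dots> = 4 * K * (nA \<tau> + nB \<tau>)"
      unfolding n_factor[OF S] by (simp add: sum_distrib_left[symmetric] sum.distrib)
    also have "nA \<tau> = w * nA \<sigma>"
      unfolding nA_def pB ses_mat_scale trt trw \<alpha>_def[symmetric] by (simp add: algebra_simps)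
    also have "nB \<tau> = w * nB \<sigma>"
      unfolding nB_def pA ses_mat_scale trt trw \<beta>_def[symmetric] by (simp add: algebra_simps)
    finally have 3: "- Re (trace (covX ** \<tau>)) \<le> 4 * K * (w * nA \<sigma> + w * nB \<sigma>)" .
    have "w * Re (trace (X ** \<sigma>)) \<le> F * w * w + w * (2 * K * (\<eta> * w + nAB \<sigma> / \<eta> + nA \<sigma> + nB \<sigma>))
       + 4 * K * (w * nA \<sigma> + w * nB \<sigma>)"
      using eq 1 3 mult_left_mono[OF 2 w0] by linarith
    also have "\<dots> = w * (F * w + 2 * K * (\<eta> * w + nAB \<sigma> / \<eta> + 3 * (nA \<sigma> + nB \<sigma>)))"
      by (simp add: algebra_simps)
    finally show ?thesis using wpos unfolding w_def[symmetric] by simp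
  qed
qed

end

lemma nsq_eq_0: "nsq x = 0 \<Longrightarrow> x = (\<lambda>_. 0)"
  by (auto simp: nsq_def sum_nonneg_eq_0_iff fun_eq_iff)

text \<open>Clears the denominators that come from normalizing v and u: for \<sigma> depending
  polynomially on v, u and their conjugates all quantities of the inequality but the hypothesis are
  then polynomials, ready to be averaged, and zero vectors do no harm.\<close>

lemma trace_le_product_unnormalized:
  fixes X \<sigma> :: "('a::finite \<times> 'b::finite) cop" and v :: "'a \<Rightarrow> complex" and u :: "'b \<Rightarrow> complex"
  assumes psdX: "psd X" and X_le: "\<And>x. Re (ses X x x) \<le> K * nsq x"
    and \<sigma>: "psd \<sigma>" and \<eta>: "\<eta> > 0"
    and F: "Re (trace (X ** kron (ptrB \<sigma>) (ptrA \<sigma>))) \<le> F * (Re (trace \<sigma>))\<^sup>2"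
  defines "w \<equiv> nsq v * nsq u * Re (trace \<sigma>)"
    and "a \<equiv> nsq u * Re (ses (ptrB \<sigma>) v v)" and "b \<equiv> nsq v * Re (ses (ptrA \<sigma>) u u)"
    and "c \<equiv> Re (ses \<sigma> (tv v u) (tv v u))"
  shows "nsq v * nsq u * Re (trace (X ** \<sigma>)) \<le> F * w + 2 * K * (\<eta> * w + (w - a - b + c) / \<eta> + 3 * ((w - a) + (w - b)))"
proof (cases "nsq v = 0 \<or> nsq u = 0")
  case True
  have z: "ses Y (\<lambda>_. 0) (\<lambda>_. 0) = 0" for Y :: "'c::finite cop" by (simp add: ses_def)
  from True have w: "w = 0" unfolding w_def by auto
  from True have abc: "a = 0 \<and> b = 0 \<and> c = 0"
  proof
    assume v: "nsq v = 0"
    have "tv v u = (\<lambda>_. 0)" unfolding nsq_eq_0[OF v] tv_def by simp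
    then show ?thesis unfolding a_def b_def c_def v by (simp add: nsq_eq_0[OF v] z)
  next
    assume u: "nsq u = 0"
    have "tv v u = (\<lambda>_. 0)" unfolding nsq_eq_0[OF u] tv_def by simp
    then show ?thesis unfolding a_def b_def c_def u by (simp add: nsq_eq_0[OF u] z)
  qed
  from True have VU: "nsq v * nsq u = 0" by auto
  from abc have abc': "a = 0" "b = 0" "c = 0" by auto
  show ?thesis unfolding VU w abc' by simp
next
  case False
  define V where "V = nsq v"
  define U where "U = nsq u"
  have pos: "V > 0" "U > 0" using False nsq_nonneg[of v] nsq_nonneg[of u] by (auto simp: V_def U_def)
  define \<phi> where "\<phi> i = of_real (1 / sqrt V) * v i" for i
  define \<psi> where "\<psi> i = of_real (1 / sqrt U) * u i" for i
  have sq: "cmod (of_real (1 / sqrt V)) ^ 2 = 1 / V" "cmod (of_real (1 / sqrt U)) ^ 2 = 1 / U"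
    using pos by (simp_all add: norm_divide power_divide)
  interpret cov_form X \<phi> \<psi> K
  proof
    show "nsq \<phi> = 1" "nsq \<psi> = 1"
      unfolding \<phi>_def \<psi>_def nsq_scale sq using pos by (simp_all add: V_def U_def)
  qed (fact psdX X_le)+
  have cc: "cnj (complex_of_real (1 / sqrt V)) * complex_of_real (1 / sqrt V) = of_real (1 / V)"
    "cnj (complex_of_real (1 / sqrt U)) * complex_of_real (1 / sqrt U) = of_real (1 / U)"
    unfolding cnj_mult_self sq by simp_all
  have tv: "tv \<phi> \<psi> = (\<lambda>i. of_real (1 / sqrt V) * (of_real (1 / sqrt U) * tv v u i))"
    by (simp add: tv_def \<phi>_def \<psi>_def fun_eq_iff)
  have 1: "ses Y \<phi> \<phi> = of_real (1 / V) * ses Y v v" for Y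
    unfolding \<phi>_def ses_scale_left ses_scale_right by (simp only: mult.assoc[symmetric] cc)
  have 2: "ses Y \<psi> \<psi> = of_real (1 / U) * ses Y u u" for Y
    unfolding \<psi>_def ses_scale_left ses_scale_right by (simp only: mult.assoc[symmetric] cc)
  have 3: "ses Y (tv \<phi> \<psi>) (tv \<phi> \<psi>) = of_real (1 / V) * (of_real (1 / U) * ses Y (tv v u) (tv v u))" for Y
  proof -
    have "ses Y (tv \<phi> \<psi>) (tv \<phi> \<psi>) = (cnj (complex_of_real (1 / sqrt V)) * complex_of_real (1 / sqrt V))
       * ((cnj (complex_of_real (1 / sqrt U)) * complex_of_real (1 / sqrt U)) * ses Y (tv v u) (tv v u))"
      unfolding tv ses_scale_left ses_scale_right by (simp only: mult_ac)
    then show ?thesis unfolding cc .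
  qed
  have VU: "V * U > 0" using pos by simp
  have a: "V * U * Re (ses (ptrB \<sigma>) \<phi> \<phi>) = a" unfolding 1 using pos by (simp add: a_def V_def U_def)
  have b: "V * U * Re (ses (ptrA \<sigma>) \<psi> \<psi>) = b" unfolding 2 using pos by (simp add: b_def V_def U_def)
  have c: "V * U * Re (ses \<sigma> (tv \<phi> \<psi>) (tv \<phi> \<psi>)) = c" unfolding 3 using pos by (simp add: c_def V_def U_def)
  have w: "V * U * Re (trace \<sigma>) = w" by (simp add: w_def V_def U_def)
  have n: "V * U * nAB \<sigma> = w - a - b + c" "V * U * nA \<sigma> = w - a" "V * U * nB \<sigma> = w - b"
    unfolding nAB_def nA_def nB_def distrib_left right_diff_distrib a b c w by simp_all
  have "V * U * Re (trace (X ** \<sigma>)) \<le> V * U * (F * Re (trace \<sigma>) + 2 * K * (\<eta> * Re (trace \<sigma>) + nAB \<sigma> / \<eta> + 3 * (nA \<sigma> + nB \<sigma>)))"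
    using trace_le_product[OF \<sigma> \<eta> F] VU by (intro mult_left_mono) auto
  also have "\<dots> = F * (V * U * Re (trace \<sigma>)) + 2 * K * (\<eta> * (V * U * Re (trace \<sigma>)) + (V * U * nAB \<sigma>) / \<eta>
      + 3 * (V * U * nA \<sigma> + V * U * nB \<sigma>))"
    by (simp add: algebra_simps)
  finally show ?thesis unfolding w n unfolding V_def U_def .
qed

section \<open>Channels and Choi states\<close>

definition unit_mat :: "'a \<Rightarrow> 'a \<Rightarrow> 'a::finite cop" where
  "unit_mat i j = (\<chi> a b. if a = i \<and> b = j then 1 else 0)"

lemma cscale_0: "cscale 0 A = 0"
  by (simp add: vec_eq_iff)

lemma linear_map_zero: "complex_linear_map f \<Longrightarrow> f 0 = 0"
proof -
  assume "complex_linear_map f"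
  then have "f (cscale 0 0) = cscale 0 (f 0)" unfolding complex_linear_map_def by blast
  then show "f 0 = 0" by (simp add: cscale_0)
qed

lemma linear_map_sum: "complex_linear_map f \<Longrightarrow> f (\<Sum>i\<in>I. g i) = (\<Sum>i\<in>I. f (g i))"
  by (induction I rule: infinite_finite_induct)
    (simp_all add: linear_map_zero, simp add: complex_linear_map_def)

lemma linear_map_unit_mat:
  fixes f :: "'a::finite cop \<Rightarrow> 'b::finite cop"
  assumes "complex_linear_map f"
  shows "f X $ a $ b = (\<Sum>i\<in>UNIV. \<Sum>j\<in>UNIV. X $ i $ j * f (unit_mat i j) $ a $ b)"
proof -
  have "X = (\<Sum>i\<in>UNIV. \<Sum>j\<in>UNIV. cscale (X $ i $ j) (unit_mat i j))"
  proof -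
    have "(\<Sum>i\<in>UNIV. \<Sum>j\<in>UNIV. cscale (X $ i $ j) (unit_mat i j)) $ a $ b = X $ a $ b" for a b
    proof -
      have "(\<Sum>j\<in>UNIV. X $ i $ j * unit_mat i j $ a $ b) = (if a = i then X $ i $ b else 0)" for i
        by (simp add: unit_mat_def if_distrib cong: if_cong)
      then show ?thesis by (simp add: sum_component)
    qed
    then show ?thesis by (simp add: vec_eq_iff)
  qed
  then have "f X = f (\<Sum>i\<in>UNIV. \<Sum>j\<in>UNIV. cscale (X $ i $ j) (unit_mat i j))" by simp
  also have "\<dots> = (\<Sum>i\<in>UNIV. \<Sum>j\<in>UNIV. cscale (X $ i $ j) (f (unit_mat i j)))"
    unfolding linear_map_sum[OF assms] using assms unfolding complex_linear_map_def by simp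
  finally show ?thesis by (simp add: sum_component)
qed

lemma block_psd_ses:
  "block_psd m X \<longleftrightarrow> (\<forall>x. (\<Sum>r<m. \<Sum>s<m. ses (X r s) (x r) (x s)) \<in> \<real>\<^sub>\<ge>\<^sub>0)"
proof -
  have 1: "(\<Sum>i\<in>UNIV. cnj (v r $ i) * (X r s *v v s) $ i) = ses (X r s) (($) (v r)) (($) (v s))" for v r s
    by (simp add: ses_def matrix_vector_mult_def sum_distrib_left mult.assoc)
  have 2: "ses (X r s) (x r) (x s) = ses (X r s) (($) (vec_lambda (x r))) (($) (vec_lambda (x s)))" for x r s
    by (simp add: ses_def)
  show ?thesis unfolding block_psd_def 1
  proof safe
    fix x assume "\<forall>v. (\<Sum>r<m. \<Sum>s<m. ses (X r s) (($) (v r)) (($) (v s))) \<in> \<real>\<^sub>\<ge>\<^sub>0"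
    from this[rule_format, of "\<lambda>r. vec_lambda (x r)"]
    show "(\<Sum>r<m. \<Sum>s<m. ses (X r s) (x r) (x s)) \<in> \<real>\<^sub>\<ge>\<^sub>0" by (simp add: ses_def)
  next
    fix v assume "\<forall>x. (\<Sum>r<m. \<Sum>s<m. ses (X r s) (x r) (x s)) \<in> \<real>\<^sub>\<ge>\<^sub>0"
    from this[rule_format, of "\<lambda>r. ($) (v r)"]
    show "(\<Sum>r<m. \<Sum>s<m. ses (X r s) (($) (v r)) (($) (v s))) \<in> \<real>\<^sub>\<ge>\<^sub>0" .
  qed
qed

text \<open>Complete positivity is phrased with numbered blocks, \<open>psd\<close> with index
  types; an enumeration of the second factor translates between them.\<close>

lemma ses_blocks:
  fixes A :: "('a::finite \<times> 'c::finite) cop"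
  assumes e: "bij_betw e {..<m} (UNIV :: 'c set)"
  shows "ses A x y = (\<Sum>r<m. \<Sum>s<m. ses (\<chi> i j. A $ (i, e r) $ (j, e s)) (\<lambda>i. x (i, e r)) (\<lambda>j. y (j, e s)))"
proof -
  have "ses A x y = (\<Sum>i\<in>UNIV. \<Sum>c\<in>UNIV. \<Sum>j\<in>UNIV. \<Sum>c'\<in>UNIV. cnj (x (i, c)) * A $ (i, c) $ (j, c') * y (j, c'))"
    unfolding ses_def sum_UNIV_prod ..
  also have "\<dots> = (\<Sum>c\<in>UNIV. \<Sum>i\<in>UNIV. \<Sum>c'\<in>UNIV. \<Sum>j\<in>UNIV. cnj (x (i, c)) * A $ (i, c) $ (j, c') * y (j, c'))"
    by (subst sum.swap) (intro sum.cong refl sum.swap)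
  also have "\<dots> = (\<Sum>c\<in>UNIV. \<Sum>c'\<in>UNIV. \<Sum>i\<in>UNIV. \<Sum>j\<in>UNIV. cnj (x (i, c)) * A $ (i, c) $ (j, c') * y (j, c'))"
    by (intro sum.cong refl sum.swap)
  also have "\<dots> = (\<Sum>c\<in>UNIV. \<Sum>c'\<in>UNIV. ses (\<chi> i j. A $ (i, c) $ (j, c')) (\<lambda>i. x (i, c)) (\<lambda>j. y (j, c')))"
    by (simp add: ses_def)
  also have "\<dots> = (\<Sum>r<m. \<Sum>s<m. ses (\<chi> i j. A $ (i, e r) $ (j, e s)) (\<lambda>i. x (i, e r)) (\<lambda>j. y (j, e s)))"
    by (simp only: sum.reindex_bij_betw[OF e, symmetric])
  finally show ?thesis .
qed

lemma completely_positive_apply_fst: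
  fixes X :: "('a::finite \<times> 'c::finite) cop" and f :: "'a cop \<Rightarrow> 'b::finite cop"
  assumes f: "completely_positive f" and X: "psd X"
  shows "psd (apply_fst f X)"
proof -
  obtain e where e: "bij_betw e {..<CARD('c)} (UNIV :: 'c set)"
    using ex_bij_betw_nat_finite[of "UNIV :: 'c set"] by (auto simp: atLeast0LessThan)
  define Z where "Z r s = (\<chi> i j. X $ (i, e r) $ (j, e s))" for r s
  have inv: "e (inv_into {..<CARD('c)} e c) = c" for c
    using e by (simp add: bij_betw_def f_inv_into_f)
  have inv': "inv_into {..<CARD('c)} e (e r) = r" if "r < CARD('c)" for r
    using e that by (simp add: bij_betw_def inv_into_f_f)
  have "block_psd (CARD('c)) Z"
    unfolding block_psd_ses
  proof
    fix x :: "nat \<Rightarrow> 'a \<Rightarrow> complex"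
    define y where "y = (\<lambda>ic. x (inv_into {..<CARD('c)} e (snd ic)) (fst ic))"
    have "(\<Sum>r<CARD('c). \<Sum>s<CARD('c). ses (Z r s) (x r) (x s)) = ses X y y"
      unfolding ses_blocks[OF e, of X] Z_def y_def by (intro sum.cong refl) (simp add: inv')
    also have "\<dots> \<in> \<real>\<^sub>\<ge>\<^sub>0" using X unfolding psd_iff_ses by blast
    finally show "(\<Sum>r<CARD('c). \<Sum>s<CARD('c). ses (Z r s) (x r) (x s)) \<in> \<real>\<^sub>\<ge>\<^sub>0" .
  qed
  then have *: "block_psd (CARD('c)) (\<lambda>r s. f (Z r s))" using f unfolding completely_positive_def by blast
  have "ses (apply_fst f X) y y \<in> \<real>\<^sub>\<ge>\<^sub>0" for y
  proof -
    have "(\<chi> i j. apply_fst f X $ (i, e r) $ (j, e s)) = f (Z r s)" for r s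
      by (simp add: vec_eq_iff apply_fst_def Z_def)
    then have "ses (apply_fst f X) y y = (\<Sum>r<CARD('c). \<Sum>s<CARD('c). ses (f (Z r s)) (\<lambda>i. y (i, e r)) (\<lambda>j. y (j, e s)))"
      unfolding ses_blocks[OF e, of "apply_fst f X"] by simp
    also have "\<dots> \<in> \<real>\<^sub>\<ge>\<^sub>0"
      using *[unfolded block_psd_ses, rule_format, of "\<lambda>r i. y (i, e r)"] .
    finally show ?thesis .
  qed
  then show ?thesis unfolding psd_iff_ses by blast
qed

text \<open>The hypothesis is a Kraus decomposition, T for fixed k being an adjoint Kraus operator:
  the form of the image is a sum over k of forms of the argument at transformed vectors.\<close>

lemma completely_positive_kraus:
  fixes f :: "'a::finite cop \<Rightarrow> 'b::finite cop" and T :: "'a \<Rightarrow> 'b \<Rightarrow> 'k::finite \<Rightarrow> complex"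
  assumes f: "\<And>Y l l'. f Y $ l $ l' = (\<Sum>p\<in>UNIV. \<Sum>p'\<in>UNIV. \<Sum>k\<in>UNIV. Y $ p $ p' * (cnj (T p l k) * T p' l' k))"
  shows "completely_positive f"
proof -
  define Y where "Y k x p = (\<Sum>l\<in>UNIV. T p l k * x l)" for k p and x :: "'b \<Rightarrow> complex"
  have ses_f: "ses (f Z) x y = (\<Sum>k\<in>UNIV. ses Z (Y k x) (Y k y))" for Z x y
  proof -
    have "ses (f Z) x y = (\<Sum>(l, l', p, p', k)\<in>UNIV. (cnj (T p l k) * cnj (x l)) * Z $ p $ p' * (T p' l' k * y l'))"
      unfolding ses_def f
      by (simp add: sum_distrib_left sum_distrib_right mult_ac sum_UNIV_prod case_prod_beta)
    also have "\<dots> = (\<Sum>(k, p, p', l', l)\<in>UNIV. (cnj (T p l k) * cnj (x l)) * Z $ p $ p' * (T p' l' k * y l'))"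
      by (rule sum.reindex_bij_witness[of _ "\<lambda>(k, p, p', l', l). (l, l', p, p', k)" "\<lambda>(l, l', p, p', k). (k, p, p', l', l)"]) auto
    also have "\<dots> = (\<Sum>k\<in>UNIV. ses Z (Y k x) (Y k y))"
      unfolding ses_def Y_def
      by (simp add: sum_distrib_left sum_distrib_right sum_UNIV_prod case_prod_beta)
    finally show ?thesis .
  qed
  show ?thesis
    unfolding completely_positive_def block_psd_ses
  proof (intro allI impI)
    fix m and X :: "nat \<Rightarrow> nat \<Rightarrow> 'a cop" and x :: "nat \<Rightarrow> 'b \<Rightarrow> complex"
    assume *: "\<forall>x. (\<Sum>r<m. \<Sum>s<m. ses (X r s) (x r) (x s)) \<in> \<real>\<^sub>\<ge>\<^sub>0"
    have "(\<Sum>r<m. \<Sum>s<m. ses (f (X r s)) (x r) (x s)) = (\<Sum>r<m. \<Sum>k\<in>UNIV. \<Sum>s<m. ses (X r s) (Y k (x r)) (Y k (x s)))"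
      unfolding ses_f by (intro sum.cong refl sum.swap)
    also have "\<dots> = (\<Sum>k\<in>UNIV. \<Sum>r<m. \<Sum>s<m. ses (X r s) (Y k (x r)) (Y k (x s)))"
      by (rule sum.swap)
    also have "\<dots> \<in> \<real>\<^sub>\<ge>\<^sub>0"
      by (intro nonneg_Reals_sum *[rule_format])
    finally show "(\<Sum>r<m. \<Sum>s<m. ses (f (X r s)) (x r) (x s)) \<in> \<real>\<^sub>\<ge>\<^sub>0" .
  qed
qed

section \<open>Choi states, and the channel fidelity as a bilinear optimization\<close>

definition decoder_state :: "('p::finite \<times> 'l::finite) cop \<Rightarrow> bool" where
  "decoder_state \<alpha> \<longleftrightarrow> psd \<alpha> \<and> (\<forall>p p'. (\<Sum>l\<in>UNIV. \<alpha> $ (p, l) $ (p', l)) = (if p = p' then 1 / of_nat CARD('p) else 0))"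

text \<open>Like \<open>decoder_state\<close>, a Choi state in the order P, L and of trace 1. Trace
  preservation fixes the marginal on the input side, which is P for the decoder and L for the
  encoder.\<close>

definition encoder_state :: "('p::finite \<times> 'l::finite) cop \<Rightarrow> bool" where
  "encoder_state \<beta> \<longleftrightarrow> psd \<beta> \<and> (\<forall>l l'. (\<Sum>p\<in>UNIV. \<beta> $ (p, l) $ (p, l')) = (if l = l' then 1 / of_nat CARD('l) else 0))"

text \<open>The bilinear form of the program in coordinates; the prefactor is
  \<open>CARD('p)\<close> from the Choi operator of N times \<open>1 / CARD('l)\<close> from the
  maximally entangled state.\<close>

definition pairing :: "('p::finite cop \<Rightarrow> 'p cop) \<Rightarrow> ('p \<times> 'l::finite) cop \<Rightarrow> ('p \<times> 'l) cop \<Rightarrow> complex" where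
  "pairing N \<alpha> \<beta> = of_nat CARD('p) / of_nat CARD('l) * (\<Sum>(p, p', q, q', l, l')\<in>UNIV.
     N (unit_mat q q') $ p $ p' * \<alpha> $ (p', l') $ (p, l) * \<beta> $ (q', l') $ (q, l))"

text \<open>The states carry the transposed indices of the usual Choi operators, which is why the
  Choi operator of N enters \<open>pairing\<close> without a transpose.\<close>

definition choi_pair :: "('l::finite cop \<Rightarrow> 'p::finite cop) \<Rightarrow> ('p cop \<Rightarrow> 'l cop) \<Rightarrow> ('p \<times> 'l) cop \<Rightarrow> ('p \<times> 'l) cop \<Rightarrow> bool" where
  "choi_pair E D \<alpha> \<beta> \<longleftrightarrow>
     (\<forall>p p' l l'. D (unit_mat p p') $ l $ l' = of_nat CARD('p) * \<alpha> $ (p', l') $ (p, l)) \<and>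
     (\<forall>p p' l l'. E (unit_mat l l') $ p $ p' = of_nat CARD('l) * \<beta> $ (p', l') $ (p, l))"

definition maxvec :: "'l::finite \<times> 'l \<Rightarrow> complex" where
  "maxvec r = (if fst r = snd r then of_real (1 / sqrt (real CARD('l))) else 0)"

lemma of_real_inverse_sqrt_mult:
  "complex_of_real (1 / sqrt (real n)) * complex_of_real (1 / sqrt (real n)) = 1 / of_nat n"
proof -
  have "1 / sqrt (real n) * (1 / sqrt (real n)) = 1 / real n" by simp
  then have "complex_of_real (1 / sqrt (real n) * (1 / sqrt (real n))) = complex_of_real (1 / real n)"
    by (simp only:)
  then show ?thesis unfolding of_real_mult of_real_divide of_real_1 of_real_of_nat_eq .
qed

lemma max_entangled_outer: "(max_entangled :: ('l::finite \<times> 'l) cop) = outer maxvec"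
proof -
  have "max_entangled $ r $ s = outer maxvec $ r $ s" for r s :: "'l \<times> 'l"
    unfolding max_entangled_def outer_nth maxvec_def vec_lambda_beta complex_cnj_complex_of_real if_distrib[of cnj]
    using of_real_inverse_sqrt_mult[of "CARD('l)"] by (auto split: if_splits)
  then show ?thesis by (simp add: vec_eq_iff)
qed

lemma nsq_maxvec: "nsq (maxvec :: 'l::finite \<times> 'l \<Rightarrow> complex) = 1"
proof -
  have "(\<Sum>j\<in>UNIV. (cmod (maxvec (i :: 'l, j)))\<^sup>2) = 1 / real CARD('l)" for i
  proof -
    have "(cmod (maxvec (i, j)))\<^sup>2 = (if i = j then 1 / real CARD('l) else 0)" for j :: 'l
      by (simp add: maxvec_def power_divide norm_divide)
    then show ?thesis by simp
  qed
  then show ?thesis unfolding nsq_def sum_UNIV_prod by simp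
qed

lemma psd_max_entangled: "psd max_entangled"
  unfolding max_entangled_outer by (rule psd_outer)

text \<open>The reference state is pure, so the fidelity is a matrix element. One factor
  \<open>1 / CARD('l)\<close> comes from the state that is sent, the other from the state it is
  compared with.\<close>

lemma fidelity_max_entangled:
  fixes T :: "'l::finite cop \<Rightarrow> 'l cop"
  assumes lin: "complex_linear_map T" and cp: "completely_positive T"
  shows "fidelity max_entangled (apply_fst T max_entangled)
     = Re (\<Sum>i\<in>UNIV. \<Sum>j\<in>UNIV. T (unit_mat i j) $ i $ j) / (real CARD('l))\<^sup>2"
proof -
  define \<sigma> where "\<sigma> = apply_fst T max_entangled"
  have \<sigma>: "psd \<sigma>" unfolding \<sigma>_def by (rule completely_positive_apply_fst[OF cp psd_max_entangled])
  have "fidelity max_entangled \<sigma> = Re (ses \<sigma> maxvec maxvec)"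
    unfolding max_entangled_outer by (rule fidelity_pure[OF \<sigma>]) (use nsq_maxvec in \<open>simp add: nsq_def\<close>)
  also have "ses \<sigma> maxvec maxvec = (\<Sum>i\<in>UNIV. \<Sum>j\<in>UNIV. \<sigma> $ (i, i) $ (j, j)) / of_nat CARD('l)"
  proof -
    have "(\<Sum>i2\<in>UNIV. \<Sum>j1\<in>UNIV. \<Sum>j2\<in>UNIV. cnj (maxvec (i1, i2)) * \<sigma> $ (i1, i2) $ (j1, j2) * maxvec (j1, j2))
       = (\<Sum>j1\<in>UNIV. \<sigma> $ (i1, i1) $ (j1, j1)) / of_nat CARD('l)" for i1
    proof -
      have "cnj (maxvec (i1, i2)) * \<sigma> $ (i1, i2) $ (j1, j2) * maxvec (j1, j2)
        = (if i1 = i2 then if j1 = j2 then \<sigma> $ (i1, i2) $ (j1, j2) / of_nat CARD('l) else 0 else 0)" for i2 j1 j2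
      proof -
        have "c * X * c = X / of_nat CARD('l)" if "c * c = 1 / of_nat CARD('l)" for c X :: complex
          using that by (metis mult.commute mult.assoc times_divide_eq_right mult_1_right)
        from this[OF of_real_inverse_sqrt_mult] show ?thesis
          unfolding maxvec_def if_distrib[of cnj] complex_cnj_complex_of_real by simp
      qed
      then have "(\<Sum>j1\<in>UNIV. \<Sum>j2\<in>UNIV. cnj (maxvec (i1, i2)) * \<sigma> $ (i1, i2) $ (j1, j2) * maxvec (j1, j2))
        = (if i1 = i2 then (\<Sum>j1\<in>UNIV. \<sigma> $ (i1, i2) $ (j1, j1)) / of_nat CARD('l) else 0)" for i2
        by (simp add: sum_divide_distrib)
      then show ?thesis by simp
    qed
    then show ?thesis unfolding ses_def sum_UNIV_prod by (simp add: sum_divide_distrib)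
  qed
  also have "(\<Sum>i\<in>UNIV. \<Sum>j\<in>UNIV. \<sigma> $ (i, i) $ (j, j)) = (\<Sum>i\<in>UNIV. \<Sum>j\<in>UNIV. T (unit_mat i j) $ i $ j) / of_nat CARD('l)"
  proof -
    have "(\<chi> a b. (max_entangled :: ('l \<times> 'l) cop) $ (a, i) $ (b, j)) = cscale (1 / of_nat CARD('l)) (unit_mat i j)" for i j
      by (simp add: vec_eq_iff max_entangled_def unit_mat_def)
    then have "\<sigma> $ (i, i) $ (j, j) = T (cscale (1 / of_nat CARD('l)) (unit_mat i j)) $ i $ j" for i j
      by (simp add: \<sigma>_def apply_fst_def)
    then have "\<sigma> $ (i, i) $ (j, j) = T (unit_mat i j) $ i $ j / of_nat CARD('l)" for i j
      using lin unfolding complex_linear_map_def by simp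
    then show ?thesis by (simp add: sum_divide_distrib)
  qed
  finally show ?thesis
    unfolding \<sigma>_def[symmetric] by (simp add: power2_eq_square Re_divide_of_nat)
qed

lemma completely_positive_comp: "completely_positive f \<Longrightarrow> completely_positive g \<Longrightarrow> completely_positive (f \<circ> g)"
  unfolding completely_positive_def by auto

lemma complex_linear_map_comp: "complex_linear_map f \<Longrightarrow> complex_linear_map g \<Longrightarrow> complex_linear_map (f \<circ> g)"
  unfolding complex_linear_map_def by auto

text \<open>Expansion of D and N on matrix units. The two Choi states contribute
  \<open>CARD('p) * CARD('l)\<close>, the fidelity a division by the square of
  \<open>CARD('l)\<close>; together this is the prefactor of \<open>pairing\<close>.\<close>

lemma fidelity_choi_pair:
  fixes E :: "'l::finite cop \<Rightarrow> 'p::finite cop" and D :: "'p cop \<Rightarrow> 'l cop"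
  assumes E: "quantum_channel E" and D: "quantum_channel D" and N: "quantum_channel N"
    and ch: "choi_pair E D \<alpha> \<beta>"
  shows "fidelity max_entangled (apply_fst (D \<circ> N \<circ> E) max_entangled) = Re (pairing N \<alpha> \<beta>)"
proof -
  let ?T = "D \<circ> N \<circ> E"
  have lin: "complex_linear_map D" "complex_linear_map N" "complex_linear_map E"
    using assms unfolding quantum_channel_def by blast+
  have "complex_linear_map ?T" "completely_positive ?T"
    using assms unfolding quantum_channel_def by (auto intro!: complex_linear_map_comp completely_positive_comp)
  note fid = fidelity_max_entangled[OF this]
  have T: "?T (unit_mat l l') $ l $ l' = (\<Sum>p\<in>UNIV. \<Sum>p'\<in>UNIV. \<Sum>q\<in>UNIV. \<Sum>q'\<in>UNIV.
      of_nat CARD('p) * of_nat CARD('l) * (N (unit_mat q q') $ p $ p' * \<alpha> $ (p', l') $ (p, l) * \<beta> $ (q', l') $ (q, l)))" for l l'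
  proof -
    have "?T (unit_mat l l') $ l $ l' = (\<Sum>p\<in>UNIV. \<Sum>p'\<in>UNIV. N (E (unit_mat l l')) $ p $ p' * D (unit_mat p p') $ l $ l')"
      unfolding o_def by (rule linear_map_unit_mat[OF lin(1)])
    also have "\<dots> = (\<Sum>p\<in>UNIV. \<Sum>p'\<in>UNIV. (\<Sum>q\<in>UNIV. \<Sum>q'\<in>UNIV. E (unit_mat l l') $ q $ q' * N (unit_mat q q') $ p $ p') * D (unit_mat p p') $ l $ l')"
      by (subst linear_map_unit_mat[OF lin(2), of "E (unit_mat l l')"]) (rule refl)
    also have "\<dots> = (\<Sum>p\<in>UNIV. \<Sum>p'\<in>UNIV. \<Sum>q\<in>UNIV. \<Sum>q'\<in>UNIV.
      of_nat CARD('p) * of_nat CARD('l) * (N (unit_mat q q') $ p $ p' * \<alpha> $ (p', l') $ (p, l) * \<beta> $ (q', l') $ (q, l)))"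
      using ch unfolding choi_pair_def by (simp add: sum_distrib_left sum_distrib_right mult_ac)
    finally show ?thesis .
  qed
  let ?f = "\<lambda>p p' q q' l l'. N (unit_mat q q') $ p $ p' * \<alpha> $ (p', l') $ (p, l) * \<beta> $ (q', l') $ (q, l)"
  have "(\<Sum>l\<in>UNIV. \<Sum>l'\<in>UNIV. ?T (unit_mat l l') $ l $ l') = of_nat CARD('p) * of_nat CARD('l) * (\<Sum>(l, l', p, p', q, q')\<in>UNIV. ?f p p' q q' l l')"
    unfolding T by (simp add: sum_distrib_left sum_UNIV_prod case_prod_beta)
  also have "(\<Sum>(l, l', p, p', q, q')\<in>UNIV. ?f p p' q q' l l') = (\<Sum>(p, p', q, q', l, l')\<in>UNIV. ?f p p' q q' l l')"
    by (rule sum.reindex_bij_witness[of _ "\<lambda>(p, p', q, q', l, l'). (l, l', p, p', q, q')" "\<lambda>(l, l', p, p', q, q'). (p, p', q, q', l, l')"]) auto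
  also have "of_nat CARD('p) * of_nat CARD('l) * \<dots> = (of_nat CARD('l))\<^sup>2 * pairing N \<alpha> \<beta>"
    by (simp add: pairing_def power2_eq_square)
  also have "\<dots> = of_real ((real CARD('l))\<^sup>2) * pairing N \<alpha> \<beta>" by simp
  finally show ?thesis unfolding fid by (simp del: of_real_power)
qed

lemma unit_mat_nth: "unit_mat i j $ a $ b = (if a = i \<and> b = j then 1 else 0)"
  by (simp add: unit_mat_def)

lemma sum_unit_mat_diag: "(\<Sum>a\<in>UNIV. \<Sum>b\<in>UNIV. unit_mat i j $ a $ b * f a b) = f i j"
proof -
  have "(\<Sum>b\<in>UNIV. unit_mat i j $ a $ b * f a b) = (if a = i then f a j else 0)" for a
  proof -
    have "unit_mat i j $ a $ b * f a b = (if b = j then if a = i then f a b else 0 else 0)" for b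
      by (simp add: unit_mat_nth)
    then show ?thesis by simp
  qed
  then show ?thesis by simp
qed

lemma complex_linear_map_sum_form:
  fixes f :: "'a::finite cop \<Rightarrow> 'b::finite cop"
  assumes f: "\<And>Y l l'. f Y $ l $ l' = (\<Sum>p\<in>UNIV. \<Sum>p'\<in>UNIV. Y $ p $ p' * c p p' l l')"
  shows "complex_linear_map f"
  unfolding complex_linear_map_def vec_eq_iff
  by (simp add: f distrib_right sum.distrib sum_distrib_left mult.assoc)

lemma trace_preserving_sum_form:
  fixes f :: "'a::finite cop \<Rightarrow> 'b::finite cop"
  assumes f: "\<And>Y l l'. f Y $ l $ l' = (\<Sum>p\<in>UNIV. \<Sum>p'\<in>UNIV. Y $ p $ p' * c p p' l l')"
    and c: "\<And>p p'. (\<Sum>l\<in>UNIV. c p p' l l) = (if p = p' then 1 else 0)"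
  shows "trace (f Y) = trace Y"
proof -
  have "trace (f Y) = (\<Sum>l\<in>UNIV. \<Sum>p\<in>UNIV. \<Sum>p'\<in>UNIV. Y $ p $ p' * c p p' l l)"
    by (simp add: trace_nth f)
  also have "\<dots> = (\<Sum>p\<in>UNIV. \<Sum>l\<in>UNIV. \<Sum>p'\<in>UNIV. Y $ p $ p' * c p p' l l)"
    by (rule sum.swap)
  also have "\<dots> = (\<Sum>p\<in>UNIV. \<Sum>p'\<in>UNIV. \<Sum>l\<in>UNIV. Y $ p $ p' * c p p' l l)"
    by (intro sum.cong refl sum.swap)
  also have "\<dots> = (\<Sum>p\<in>UNIV. \<Sum>p'\<in>UNIV. Y $ p $ p' * (if p = p' then 1 else 0))"
    by (simp add: c flip: sum_distrib_left)
  also have "\<dots> = trace Y"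
    by (simp add: trace_nth sum_mult_if_eq)
  finally show ?thesis .
qed

text \<open>The columns of a factorization of the states are Kraus operators once the dimension is
  absorbed as a square root, and the prescribed marginals are exactly trace preservation.\<close>

lemma channels_of_states:
  fixes \<alpha> \<beta> :: "('p::finite \<times> 'l::finite) cop"
  assumes \<alpha>: "decoder_state \<alpha>" and \<beta>: "encoder_state \<beta>"
  obtains E D where "quantum_channel E" "quantum_channel D" "choi_pair E D \<alpha> \<beta>"
proof -
  have ps: "psd \<alpha>" "psd \<beta>" using \<alpha> \<beta> by (auto simp: decoder_state_def encoder_state_def)
  obtain A :: "'p \<times> 'l \<Rightarrow> 'p \<times> 'l \<Rightarrow> complex" where A: "\<And>i j. \<alpha> $ i $ j = (\<Sum>k\<in>UNIV. A i k * cnj (A j k))"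
    using psd_factor[OF ps(1)] by blast
  obtain B :: "'p \<times> 'l \<Rightarrow> 'p \<times> 'l \<Rightarrow> complex" where B: "\<And>i j. \<beta> $ i $ j = (\<Sum>k\<in>UNIV. B i k * cnj (B j k))"
    using psd_factor[OF ps(2)] by blast
  define D :: "'p cop \<Rightarrow> 'l cop" where
    "D Y = (\<chi> l l'. \<Sum>p\<in>UNIV. \<Sum>p'\<in>UNIV. Y $ p $ p' * (of_nat CARD('p) * \<alpha> $ (p', l') $ (p, l)))" for Y
  define E :: "'l cop \<Rightarrow> 'p cop" where
    "E Y = (\<chi> p p'. \<Sum>l\<in>UNIV. \<Sum>l'\<in>UNIV. Y $ l $ l' * (of_nat CARD('l) * \<beta> $ (p', l') $ (p, l)))" for Y
  have D: "D Y $ l $ l' = (\<Sum>p\<in>UNIV. \<Sum>p'\<in>UNIV. Y $ p $ p' * (of_nat CARD('p) * \<alpha> $ (p', l') $ (p, l)))" for Y l l'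
    by (simp add: D_def)
  have E: "E Y $ p $ p' = (\<Sum>l\<in>UNIV. \<Sum>l'\<in>UNIV. Y $ l $ l' * (of_nat CARD('l) * \<beta> $ (p', l') $ (p, l)))" for Y p p'
    by (simp add: E_def)
  have sq: "of_nat c * (a * cnj b) = cnj (of_real (sqrt (real c)) * b) * (of_real (sqrt (real c)) * a)" for c a b
  proof -
    have sc: "complex_of_real (sqrt (real c)) * of_real (sqrt (real c)) = of_nat c"
      unfolding of_real_mult[symmetric] by simp
    have "C * (a * cnj b) = cnj (s * b) * (s * a)" if "s * s = C" "cnj s = s" for s C
      unfolding that(1)[symmetric] complex_cnj_mult that(2) by (simp only: mult_ac)
    from this[OF sc complex_cnj_complex_of_real] show ?thesis .
  qed
  have "completely_positive D"
    by (rule completely_positive_kraus[where T = "\<lambda>p l k. of_real (sqrt (real CARD('p))) * A (p, l) k"])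
      (simp only: D A sum_distrib_left sq)
  moreover have "completely_positive E"
    by (rule completely_positive_kraus[where T = "\<lambda>l p k. of_real (sqrt (real CARD('l))) * B (p, l) k"])
      (simp only: E B sum_distrib_left sq)
  moreover have "complex_linear_map D" "complex_linear_map E"
    by (rule complex_linear_map_sum_form[OF D] complex_linear_map_sum_form[OF E])+
  moreover have "trace (D Y) = trace Y" for Y
  proof (rule trace_preserving_sum_form[OF D])
    fix p p'
    have "(\<Sum>l\<in>UNIV. \<alpha> $ (p', l) $ (p, l)) = (if p' = p then 1 / of_nat CARD('p) else 0)"
      using \<alpha> unfolding decoder_state_def by blast
    then show "(\<Sum>l\<in>UNIV. of_nat CARD('p) * \<alpha> $ (p', l) $ (p, l)) = (if p = p' then 1 else 0)"
      unfolding sum_distrib_left[symmetric] by simp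
  qed
  moreover have "trace (E Y) = trace Y" for Y
  proof (rule trace_preserving_sum_form[OF E])
    fix l l'
    have "(\<Sum>p\<in>UNIV. \<beta> $ (p, l') $ (p, l)) = (if l' = l then 1 / of_nat CARD('l) else 0)"
      using \<beta> unfolding encoder_state_def by blast
    then show "(\<Sum>p\<in>UNIV. of_nat CARD('l) * \<beta> $ (p, l') $ (p, l)) = (if l = l' then 1 else 0)"
      unfolding sum_distrib_left[symmetric] by simp
  qed
  moreover have "choi_pair E D \<alpha> \<beta>"
    unfolding choi_pair_def D E by (simp add: sum_unit_mat_diag)
  ultimately show thesis using that[of E D] unfolding quantum_channel_def by blast
qed

text \<open>The operator fed into f \<otimes> id is the rank-one operator of the unnormalized
  maximally entangled vector, whose blocks are the matrix units.\<close>

lemma psd_choi: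
  fixes f :: "'a::finite cop \<Rightarrow> 'b::finite cop"
  assumes lin: "complex_linear_map f" and cp: "completely_positive f"
  shows "psd (\<chi> r s. f (unit_mat (snd r) (snd s)) $ fst r $ fst s)"
proof -
  define M :: "('a \<times> 'a) cop" where "M = outer (\<lambda>r. if fst r = snd r then 1 else 0)"
  have "(\<chi> i j. M $ (i, snd r) $ (j, snd s)) = unit_mat (snd r) (snd s)" for r s :: "'b \<times> 'a"
    by (auto simp: vec_eq_iff M_def unit_mat_nth)
  then have "apply_fst f M = (\<chi> r s. f (unit_mat (snd r) (snd s)) $ fst r $ fst s)"
    by (simp add: vec_eq_iff apply_fst_def)
  moreover have "psd (apply_fst f M)"
    by (rule completely_positive_apply_fst[OF cp]) (simp add: M_def psd_outer)
  ultimately show ?thesis by simp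
qed

lemma ses_reindex:
  fixes A :: "'b::finite cop" and f :: "'a::finite \<Rightarrow> 'b"
  assumes f: "bij f"
  shows "ses (\<chi> r s. A $ f r $ f s) x y = ses A (x \<circ> inv f) (y \<circ> inv f)"
proof -
  have "ses A (x \<circ> inv f) (y \<circ> inv f) = (\<Sum>r\<in>UNIV. \<Sum>s\<in>UNIV. cnj ((x \<circ> inv f) (f r)) * A $ f r $ f s * (y \<circ> inv f) (f s))"
    unfolding ses_def by (simp only: sum.reindex_bij_betw[OF f, symmetric])
  then show ?thesis using f by (simp add: ses_def bij_is_inj)
qed

lemma nsq_reindex:
  fixes f :: "'a::finite \<Rightarrow> 'b::finite"
  assumes f: "bij f"
  shows "nsq (x \<circ> inv f) = nsq x"
  unfolding nsq_def using sum.reindex_bij_betw[OF f, of "\<lambda>i. (cmod ((x \<circ> inv f) i))\<^sup>2"] f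
  by (simp add: bij_is_inj)

lemma psd_reindex: "bij f \<Longrightarrow> psd A \<Longrightarrow> psd (\<chi> r s. A $ f r $ f s)"
  unfolding psd_iff_ses ses_reindex by blast

lemma psd_transpose: "psd A \<Longrightarrow> psd (\<chi> r s. A $ s $ r)"
proof -
  assume A: "psd A"
  have "ses (\<chi> r s. A $ s $ r) x x = ses A (\<lambda>i. cnj (x i)) (\<lambda>i. cnj (x i))" for x
    unfolding ses_def by (subst sum.swap) (simp add: mult_ac)
  then show ?thesis using A unfolding psd_iff_ses by simp
qed

lemma psd_cscale: "psd A \<Longrightarrow> c \<ge> 0 \<Longrightarrow> psd (cscale (of_real c) A)"
  unfolding psd_iff_ses ses_mat_scale by (simp add: nonneg_Reals_mult_I)

lemma trace_channel_unit_mat: "quantum_channel f \<Longrightarrow> (\<Sum>l\<in>UNIV. f (unit_mat p p') $ l $ l) = (if p = p' then 1 else 0)"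
proof -
  assume "quantum_channel f"
  then have "trace (f (unit_mat p p')) = trace (unit_mat p p')" unfolding quantum_channel_def by blast
  also have "\<dots> = (\<Sum>i\<in>UNIV. if i = p then if p = p' then 1 else 0 else 0)"
    unfolding trace_nth unit_mat_nth by (intro sum.cong refl) auto
  finally show ?thesis by (simp add: trace_nth)
qed

text \<open>In \<open>psd_choi\<close> the output factor comes first, so the decoder state needs a
  swap besides the transpose demanded by \<open>choi_pair\<close>; the encoder state needs only the
  transpose.\<close>

lemma states_of_channels:
  fixes E :: "'l::finite cop \<Rightarrow> 'p::finite cop" and D :: "'p cop \<Rightarrow> 'l cop"
  assumes E: "quantum_channel E" and D: "quantum_channel D"
  obtains \<alpha> \<beta> where "decoder_state \<alpha>" "encoder_state \<beta>" "choi_pair E D \<alpha> \<beta>"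
proof -
  define a where "a = 1 / real CARD('p)"
  define b where "b = 1 / real CARD('l)"
  define \<alpha> :: "('p \<times> 'l) cop" where "\<alpha> = cscale (of_real a) (\<chi> r s. D (unit_mat (fst s) (fst r)) $ snd s $ snd r)"
  define \<beta> :: "('p \<times> 'l) cop" where "\<beta> = cscale (of_real b) (\<chi> r s. E (unit_mat (snd s) (snd r)) $ fst s $ fst r)"
  have Dl: "complex_linear_map D" "completely_positive D" and El: "complex_linear_map E" "completely_positive E"
    using E D unfolding quantum_channel_def by blast+
  have "psd \<alpha>"
  proof -
    let ?C = "(\<chi> r s. D (unit_mat (snd r) (snd s)) $ fst r $ fst s) :: ('l \<times> 'p) cop"
    have "psd (\<chi> r s. ?C $ prod.swap r $ prod.swap s)"
      by (rule psd_reindex[OF _ psd_choi[OF Dl]]) (auto intro!: bijI' simp: prod.swap_def)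
    then have "psd (\<chi> r s. (\<chi> r s. ?C $ prod.swap r $ prod.swap s) $ s $ r)" by (rule psd_transpose)
    then have "psd (cscale (of_real a) (\<chi> r s. (\<chi> r s. ?C $ prod.swap r $ prod.swap s) $ s $ r))"
      by (rule psd_cscale) (simp add: a_def)
    then show ?thesis by (simp add: \<alpha>_def)
  qed
  moreover have "psd \<beta>"
  proof -
    let ?C = "(\<chi> r s. E (unit_mat (snd r) (snd s)) $ fst r $ fst s) :: ('p \<times> 'l) cop"
    have "psd (\<chi> r s. ?C $ s $ r)" by (rule psd_transpose[OF psd_choi[OF El]])
    then have "psd (cscale (of_real b) (\<chi> r s. ?C $ s $ r))"
      by (rule psd_cscale) (simp add: b_def)
    then show ?thesis by (simp add: \<beta>_def)
  qed
  moreover have "(\<Sum>l\<in>UNIV. \<alpha> $ (p, l) $ (p', l)) = (if p = p' then 1 / of_nat CARD('p) else 0)" for p p'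
    using trace_channel_unit_mat[OF D, of p' p] by (auto simp: \<alpha>_def a_def simp flip: sum_divide_distrib sum_distrib_left)
  moreover have "(\<Sum>p\<in>UNIV. \<beta> $ (p, l) $ (p, l')) = (if l = l' then 1 / of_nat CARD('l) else 0)" for l l'
    using trace_channel_unit_mat[OF E, of l' l] by (auto simp: \<beta>_def b_def simp flip: sum_divide_distrib sum_distrib_left)
  ultimately have "decoder_state \<alpha>" "encoder_state \<beta>" unfolding decoder_state_def encoder_state_def by blast+
  moreover have "choi_pair E D \<alpha> \<beta>" unfolding choi_pair_def \<alpha>_def \<beta>_def a_def b_def by simp
  ultimately show thesis by (rule that)
qed

text \<open>Turns the supremum over channels into one over pairs of states, the form of which the
  program is a relaxation.\<close>

lemma channel_fidelity_eq:
  fixes N :: "'p::finite cop \<Rightarrow> 'p cop"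
  assumes N: "quantum_channel N"
  shows "channel_fidelity N TYPE('l::finite)
    = Sup {Re (pairing N \<alpha> \<beta>) | \<alpha> \<beta> :: ('p \<times> 'l) cop. decoder_state \<alpha> \<and> encoder_state \<beta>}"
proof -
  have "{fidelity (max_entangled :: ('l \<times> 'l) cop) (apply_fst (D \<circ> N \<circ> E) max_entangled) | E D.
            quantum_channel (E :: 'l cop \<Rightarrow> 'p cop) \<and> quantum_channel (D :: 'p cop \<Rightarrow> 'l cop)}
    = {Re (pairing N \<alpha> \<beta>) | \<alpha> \<beta> :: ('p \<times> 'l) cop. decoder_state \<alpha> \<and> encoder_state \<beta>}" (is "?A = ?B")
  proof
    show "?A \<subseteq> ?B"
    proof
      fix z assume "z \<in> ?A"
      then obtain E :: "'l cop \<Rightarrow> 'p cop" and D :: "'p cop \<Rightarrow> 'l cop" where ED: "quantum_channel E" "quantum_channel D"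
        and z: "z = fidelity max_entangled (apply_fst (D \<circ> N \<circ> E) max_entangled)" by blast
      obtain \<alpha> \<beta> where *: "decoder_state \<alpha>" "encoder_state \<beta>" "choi_pair E D \<alpha> \<beta>" using states_of_channels[OF ED] .
      have "z = Re (pairing N \<alpha> \<beta>)" unfolding z by (rule fidelity_choi_pair[OF ED N *(3)])
      with * show "z \<in> ?B" by blast
    qed
    show "?B \<subseteq> ?A"
    proof
      fix z assume "z \<in> ?B"
      then obtain \<alpha> \<beta> :: "('p \<times> 'l) cop" where *: "decoder_state \<alpha>" "encoder_state \<beta>" and z: "z = Re (pairing N \<alpha> \<beta>)" by blast
      obtain E D where ED: "quantum_channel E" "quantum_channel D" "choi_pair E D \<alpha> \<beta>" using channels_of_states[OF *] .
      have "z = fidelity max_entangled (apply_fst (D \<circ> N \<circ> E) max_entangled)"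
        unfolding z by (rule fidelity_choi_pair[OF ED(1,2) N ED(3), symmetric])
      with ED show "z \<in> ?A" by blast
    qed
  qed
  then show ?thesis unfolding channel_fidelity_def by simp
qed

lemma cscale_mat_1_nth: "cscale c (mat 1) $ i $ j = (if i = j then c else 0)"
  by (simp add: mat_def)

lemma psd_mat_1: "psd (mat 1)"
  unfolding psd_iff_ses ses_mat_1_ip ip_self by (simp add: nsq_nonneg)

text \<open>The maximally mixed state has both marginals; it shows that the suprema range over
  nonempty sets.\<close>

lemma states_exist:
  obtains \<alpha> \<beta> :: "('p::finite \<times> 'l::finite) cop" where "decoder_state \<alpha>" "encoder_state \<beta>"
proof -
  define \<alpha> :: "('p \<times> 'l) cop" where "\<alpha> = cscale (of_real (1 / (real CARD('p) * real CARD('l)))) (mat 1)"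
  have "psd \<alpha>" unfolding \<alpha>_def by (intro psd_cscale psd_mat_1) simp
  moreover have "(\<Sum>l\<in>UNIV. \<alpha> $ (p, l) $ (p', l)) = (if p = p' then 1 / of_nat CARD('p) else 0)"
    "(\<Sum>p\<in>UNIV. \<alpha> $ (p, l) $ (p, l')) = (if l = l' then 1 / of_nat CARD('l) else 0)" for p p' l l'
    unfolding \<alpha>_def cscale_mat_1_nth by simp_all
  ultimately have "decoder_state \<alpha>" "encoder_state \<alpha>" unfolding decoder_state_def encoder_state_def by blast+
  then show thesis by (rule that)
qed

lemma trace_cscale: "trace (cscale c A) = c * trace A"
  by (simp add: trace_nth sum_distrib_left)

lemma complex_linear_depolarizing: "complex_linear_map (depolarizing p :: 'p::finite cop \<Rightarrow> 'p cop)"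
  unfolding complex_linear_map_def depolarizing_def trace_add trace_cscale
  by (simp add: vec_eq_iff algebra_simps add_divide_distrib)

lemma quantum_channel_depolarizing:
  assumes "completely_positive (depolarizing p :: 'p::finite cop \<Rightarrow> 'p cop)"
  shows "quantum_channel (depolarizing p :: 'p cop \<Rightarrow> 'p cop)"
proof -
  have "trace (depolarizing p X) = trace X" for X :: "'p cop"
  proof -
    have "trace (mat 1 :: 'p cop) = of_nat CARD('p)" by (simp add: trace_nth mat_def)
    then show ?thesis unfolding depolarizing_def trace_add trace_cscale by (simp add: algebra_simps)
  qed
  then show ?thesis using assms complex_linear_depolarizing unfolding quantum_channel_def by blast
qed

lemma choi_op_nth:
  fixes N :: "'p::finite cop \<Rightarrow> 'p cop"
  assumes "complex_linear_map N"
  shows "choi_op N $ (p, q) $ (p', q') = of_nat CARD('p) * N (unit_mat q q') $ p $ p'"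
proof -
  have "(\<chi> i j. (max_entangled :: ('p \<times> 'p) cop) $ (i, q) $ (j, q')) = cscale (1 / of_nat CARD('p)) (unit_mat q q')"
    by (auto simp: vec_eq_iff max_entangled_def unit_mat_nth)
  then show ?thesis
    using assms by (simp add: choi_op_def apply_fst_def complex_linear_map_def power2_eq_square)
qed

lemma psd_choi_op:
  assumes "quantum_channel N"
  shows "psd (choi_op N)"
proof -
  have "psd (cscale (of_real ((real CARD('a))\<^sup>2)) (apply_fst N (max_entangled :: ('a \<times> 'a) cop)))"
    using assms unfolding quantum_channel_def
    by (intro psd_cscale completely_positive_apply_fst psd_max_entangled) auto
  then show ?thesis by (simp add: choi_op_def)
qed

lemma trace_choi_op:
  fixes N :: "'p::finite cop \<Rightarrow> 'p cop"
  assumes "quantum_channel N"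
  shows "trace (choi_op N) = (of_nat CARD('p))\<^sup>2"
proof -
  have lin: "complex_linear_map N" using assms by (simp add: quantum_channel_def)
  have "trace (choi_op N) = (\<Sum>p\<in>UNIV. \<Sum>q\<in>UNIV. of_nat CARD('p) * N (unit_mat q q) $ p $ p)"
    unfolding trace_nth sum_UNIV_prod choi_op_nth[OF lin] ..
  also have "\<dots> = (\<Sum>q\<in>UNIV. \<Sum>p\<in>UNIV. of_nat CARD('p) * N (unit_mat q q) $ p $ p)" by (rule sum.swap)
  also have "\<dots> = (\<Sum>q\<in>(UNIV :: 'p set). of_nat CARD('p))"
    unfolding sum_distrib_left[symmetric] trace_channel_unit_mat[OF assms] by simp
  finally show ?thesis by (simp add: power2_eq_square)
qed

lemma psd_kron:
  fixes A :: "'a::finite cop" and B :: "'b::finite cop"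
  assumes "psd A" "psd B"
  shows "psd (kron A B)"
proof -
  obtain S :: "'a \<Rightarrow> 'a \<Rightarrow> complex" where S: "\<And>i j. A $ i $ j = (\<Sum>k\<in>UNIV. S i k * cnj (S j k))"
    using psd_factor[OF assms(1)] by blast
  obtain T :: "'b \<Rightarrow> 'b \<Rightarrow> complex" where T: "\<And>i j. B $ i $ j = (\<Sum>k\<in>UNIV. T i k * cnj (T j k))"
    using psd_factor[OF assms(2)] by blast
  show ?thesis
  proof (rule psd_factorI[where S = UNIV and T = "\<lambda>i k. S (fst i) (fst k) * T (snd i) (snd k)"])
    show "kron A B $ i $ j = (\<Sum>k\<in>UNIV. S (fst i) (fst k) * T (snd i) (snd k) * cnj (S (fst j) (fst k) * T (snd j) (snd k)))" for i j
      unfolding kron_nth S T sum_UNIV_prod by (simp add: sum_product mult_ac)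
  qed
qed

section \<open>The objective as an operator on one pair of blocks\<close>

fun split_blocks :: "('p, 'l) block \<times> ('p, 'l) block \<Rightarrow> (('p \<times> 'p) \<times> ('l \<times> 'l)) \<times> (('p \<times> 'p) \<times> ('l \<times> 'l))" where
  "split_blocks ((p, pc, l, lc), (q, qc, m, mc)) = (((p, q), (l, m)), ((pc, qc), (lc, mc)))"

lemma bij_split_blocks: "bij split_blocks"
  by (rule o_bij[where g = "\<lambda>(((p, q), (l, m)), ((pc, qc), (lc, mc))). ((p, pc, l, lc), (q, qc, m, mc))"]) auto

text \<open>It is the identity on the four copies, so the objective sees only the marginal on the
  four other systems.\<close>

definition block_objective :: "('p::finite cop \<Rightarrow> 'p cop) \<Rightarrow> (('p, 'l::finite) block \<times> ('p, 'l) block) cop" where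
  "block_objective N = (\<chi> r s. kron (kron (choi_op N) max_entangled) (mat 1) $ split_blocks r $ split_blocks s)"

lemma psd_block_objective: "quantum_channel N \<Longrightarrow> psd (block_objective N)"
  unfolding block_objective_def
  by (intro psd_reindex bij_split_blocks psd_kron psd_choi_op psd_max_entangled psd_mat_1)

lemma trace_max_entangled: "trace (max_entangled :: ('l::finite \<times> 'l) cop) = 1"
proof -
  have "trace (max_entangled :: ('l \<times> 'l) cop) = of_real (nsq (maxvec :: 'l \<times> 'l \<Rightarrow> complex))"
    unfolding max_entangled_outer trace_nth outer_nth nsq_def cnj_mult_self by simp
  then show ?thesis by (simp add: nsq_maxvec)
qed

text \<open>A positive operator is at most its trace, which for the Choi operator tensor the
  maximally entangled state is the square of \<open>CARD('p)\<close>. This is the value of K in the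
  final bound.\<close>

lemma block_objective_le:
  fixes N :: "'p::finite cop \<Rightarrow> 'p cop" and x :: "('p, 'l::finite) block \<times> ('p, 'l) block \<Rightarrow> complex"
  assumes N: "quantum_channel N"
  shows "Re (ses (block_objective N) x x) \<le> (real CARD('p))\<^sup>2 * nsq x"
proof -
  let ?G = "kron (choi_op N) (max_entangled :: ('l \<times> 'l) cop)"
  have "trace ?G = of_real ((real CARD('p))\<^sup>2)"
    unfolding trace_kron trace_choi_op[OF N] trace_max_entangled by simp
  then have "Re (trace ?G) = (real CARD('p))\<^sup>2" by (simp only: Re_complex_of_real)
  then have le: "Re (ses ?G y y) \<le> (real CARD('p))\<^sup>2 * nsq y" for y
    using psd_trace_ge[OF psd_kron[OF psd_choi_op[OF N] psd_max_entangled], of y] unfolding nsq_def by simp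
  let ?x = "x \<circ> inv split_blocks"
  have "Re (ses (block_objective N) x x) = (\<Sum>c\<in>UNIV. Re (ses ?G (\<lambda>g. ?x (g, c)) (\<lambda>g. ?x (g, c))))"
    unfolding block_objective_def ses_reindex[OF bij_split_blocks] ses_kron_1_right by simp
  also have "\<dots> \<le> (\<Sum>c\<in>UNIV. (real CARD('p))\<^sup>2 * nsq (\<lambda>g. ?x (g, c)))" by (intro sum_mono le)
  also have "\<dots> = (real CARD('p))\<^sup>2 * (\<Sum>c\<in>UNIV. \<Sum>g\<in>UNIV. (cmod (?x (g, c)))\<^sup>2)"
    by (simp add: nsq_def sum_distrib_left)
  also have "(\<Sum>c\<in>UNIV. \<Sum>g\<in>UNIV. (cmod (?x (g, c)))\<^sup>2) = nsq ?x"
    unfolding nsq_def sum_UNIV_prod[of "\<lambda>i. (cmod (?x i))\<^sup>2"] by (rule sum.swap)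
  also have "nsq ?x = nsq x" by (rule nsq_reindex[OF bij_split_blocks])
  finally show ?thesis .
qed

definition drop_copies :: "('p::finite, 'l::finite) block cop \<Rightarrow> ('p \<times> 'l) cop" where
  "drop_copies A = (\<chi> r s. \<Sum>pc\<in>UNIV. \<Sum>lc\<in>UNIV. A $ (fst r, pc, snd r, lc) $ (fst s, pc, snd s, lc))"

lemma block_objective_nth:
  fixes N :: "'p::finite cop \<Rightarrow> 'p cop" and l m l' m' :: "'l::finite"
  assumes "complex_linear_map N"
  shows "block_objective N $ ((p, pc, l, lc), (q, qc, m, mc)) $ ((p', pc', l', lc'), (q', qc', m', mc'))
    = (if l = m \<and> l' = m' \<and> pc = pc' \<and> qc = qc' \<and> lc = lc' \<and> mc = mc'
       then of_nat CARD('p) * N (unit_mat q q') $ p $ p' / of_nat CARD('l) else 0)"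
  by (auto simp: block_objective_def choi_op_nth[OF assms] max_entangled_def mat_def)

lemma trace_block_objective_kron:
  fixes N :: "'p::finite cop \<Rightarrow> 'p cop" and A B :: "('p, 'l::finite) block cop"
  assumes "complex_linear_map N"
  shows "trace (block_objective N ** kron A B) = pairing N (drop_copies A) (drop_copies B)"
proof -
  let ?g = "\<lambda>p p' q q' l l' pc lc qc mc. of_nat CARD('p) / of_nat CARD('l) *
      (N (unit_mat q q') $ p $ p' * A $ (p', pc, l', lc) $ (p, pc, l, lc) * B $ (q', qc, l', mc) $ (q, qc, l, mc))"
  let ?h = "\<lambda>(p, p', q, q', l, l', pc, lc, qc, mc). ?g p p' q q' l l' pc lc qc mc"
  have "trace (block_objective N ** kron A B)
    = (\<Sum>j\<in>UNIV. block_objective N $ (fst j) $ (snd j) * kron A B $ (snd j) $ (fst j))"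
    by (simp add: trace_nth matmul_nth sum_UNIV_prod)
  also have "\<dots> = (\<Sum>j\<in>UNIV. ?h j)"
  proof -
    \<comment> \<open>Enumerates the index pairs at which the objective is not forced to vanish: L
      and L-bar agree on each side, and the copies agree across the two sides.\<close>
    define i :: "'p \<times> 'p \<times> 'p \<times> 'p \<times> 'l \<times> 'l \<times> 'p \<times> 'l \<times> 'p \<times> 'l \<Rightarrow> _"
      where "i = (\<lambda>(p, p', q, q', l, l', pc, lc, qc, mc).
        (((p, pc, l, lc), (q, qc, l, mc)), ((p', pc, l', lc), (q', qc, l', mc))))"
    have inj: "inj i" by (auto simp: inj_def i_def)
    have "(\<Sum>j\<in>UNIV. block_objective N $ (fst j) $ (snd j) * kron A B $ (snd j) $ (fst j))
      = (\<Sum>j\<in>range i. block_objective N $ (fst j) $ (snd j) * kron A B $ (snd j) $ (fst j))"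
    proof (rule sum.mono_neutral_right)
      show "\<forall>j\<in>UNIV - range i. block_objective N $ (fst j) $ (snd j) * kron A B $ (snd j) $ (fst j) = 0"
      proof
        fix j assume j: "j \<in> UNIV - range i"
        obtain p pc l lc q qc m mc p' pc' l' lc' q' qc' m' mc' where
          jj: "j = (((p, pc, l, lc), (q, qc, m, mc)), ((p', pc', l', lc'), (q', qc', m', mc')))"
          by (metis surj_pair)
        have "\<not> (l = m \<and> l' = m' \<and> pc = pc' \<and> qc = qc' \<and> lc = lc' \<and> mc = mc')"
        proof
          assume "l = m \<and> l' = m' \<and> pc = pc' \<and> qc = qc' \<and> lc = lc' \<and> mc = mc'"
          then have "j = i (p, p', q, q', l, l', pc, lc, qc, mc)" unfolding jj i_def by simp
          then show False using j by blast
        qed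
        then show "block_objective N $ (fst j) $ (snd j) * kron A B $ (snd j) $ (fst j) = 0"
          unfolding jj fst_conv snd_conv block_objective_nth[OF assms] by auto
      qed
    qed auto
    also have "\<dots> = (\<Sum>j\<in>UNIV. ?h j)"
      unfolding sum.reindex[OF inj] by (intro sum.cong refl) (auto simp: i_def block_objective_nth[OF assms])
    finally show ?thesis .
  qed
  also have "\<dots> = pairing N (drop_copies A) (drop_copies B)"
    unfolding pairing_def drop_copies_def
    by (simp add: sum_UNIV_prod sum_distrib_left sum_distrib_right mult_ac)
  finally show ?thesis .
qed

section \<open>Gaussian expectations of polynomials\<close>

text \<open>A finite substitute for averaging over the phase of a complex variable, exact for
  exponents below N.\<close>

lemma roots_of_unity_orthogonal:
  assumes "a < N" "b < N"
  shows "(\<Sum>m<N. (exp (2 * of_real pi * \<i> * of_nat m / of_nat N)) ^ a *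
           cnj (exp (2 * of_real pi * \<i> * of_nat m / of_nat N)) ^ b) = (if a = b then of_nat N else 0)"
proof -
  define \<omega> where "\<omega> j = exp (2 * of_real pi * \<i> * of_nat j / of_nat N :: complex)" for j :: nat
  have N: "N \<ge> 1" using assms by simp
  have pow: "\<omega> m = \<omega> 1 ^ m" for m
    unfolding \<omega>_def exp_of_nat_mult[symmetric] by (simp add: mult_ac)
  have unit: "\<omega> j * cnj (\<omega> j) = 1" for j
  proof -
    have "\<omega> j = cis (2 * pi * real j / real N)"
      unfolding \<omega>_def cis_conv_exp by (simp add: mult_ac)
    then show ?thesis by (simp add: cis_cnj cis_mult)
  qed
  define \<zeta> where "\<zeta> = \<omega> a * cnj (\<omega> b)"
  have trm: "\<omega> m ^ a * cnj (\<omega> m) ^ b = \<zeta> ^ m" for m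
    unfolding \<zeta>_def pow[of a] pow[of b] pow[of m]
    by (simp add: power_mult_distrib mult.commute flip: power_mult)
  have "\<omega> j ^ N = 1" for j unfolding \<omega>_def by (rule complex_root_unity) (use N in simp)
  then have zN: "\<zeta> ^ N = 1"
    unfolding \<zeta>_def power_mult_distrib complex_cnj_power[symmetric] by simp
  show ?thesis
  proof (cases "a = b")
    case True
    then have "\<zeta> = 1" unfolding \<zeta>_def by (simp add: unit)
    then show ?thesis using True unfolding \<omega>_def[symmetric] trm by simp
  next
    case False
    have "\<zeta> \<noteq> 1"
    proof
      assume "\<zeta> = 1"
      then have "\<omega> a * (cnj (\<omega> b) * \<omega> b) = \<omega> b" unfolding \<zeta>_def by (simp add: mult.assoc[symmetric])
      then have "\<omega> a = \<omega> b" using unit[of b] by (simp add: mult.commute)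
      then have "a mod N = b mod N" unfolding \<omega>_def complex_root_unity_eq[OF N] .
      then show False using assms False by simp
    qed
    then have "(\<Sum>m<N. \<zeta> ^ m) = 0" using zN by (simp add: sum_gp_strict)
    then show ?thesis using False unfolding \<omega>_def[symmetric] trm by simp
  qed
qed

text \<open>The squared modulus of a standard complex Gaussian variable is exponentially
  distributed, and these are its moments.\<close>

lemma has_integral_power_exp:
  "((\<lambda>t::real. t ^ k / exp t) has_integral fact k) {0..}"
proof -
  have "((\<lambda>t. t powr (real k + 1 - 1) / exp t) has_integral Gamma (real k + 1)) {0..}"
    by (rule Gamma_integral_real) simp
  moreover have "Gamma (real k + 1) = fact k"
    using Gamma_fact[of k, where 'a = real] by (simp add: add.commute)
  ultimately have "((\<lambda>t. t powr (real k) / exp t) has_integral fact k) {0..}" by simp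
  then show ?thesis
    by (rule has_integral_spike_finite[where S = "{0}", rotated 2]) (auto simp: powr_realpow)
qed

text \<open>Polar coordinates: averaging over phases keeps the terms with equal exponents and leaves
  a polynomial in the squared modulus t that is nonnegative for t \<ge> 0; integration against the
  exponential density turns its powers into factorials.\<close>

lemma gauss_positivity_1:
  fixes c :: "'j \<Rightarrow> complex" and a b :: "'j \<Rightarrow> nat"
  assumes J: "finite J" and pos: "\<And>z. 0 \<le> Re (\<Sum>j\<in>J. c j * (z ^ a j * cnj z ^ b j))"
  shows "0 \<le> Re (\<Sum>j\<in>J. c j * (if a j = b j then fact (a j) else 0))"
proof -
  \<comment> \<open>Larger than every exponent that occurs, so that N phases separate all of
    them.\<close>
  define N where "N = Suc (\<Sum>j\<in>J. a j + b j)"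
  have N: "a j < N" "b j < N" if "j \<in> J" for j
    using member_le_sum[of j J "\<lambda>j. a j + b j"] that J by (auto simp: N_def)
  have N0: "N > 0" by (simp add: N_def)
  have poly: "0 \<le> (\<Sum>j\<in>J. (if a j = b j then Re (c j) else 0) * t ^ a j)" if t: "t \<ge> 0" for t :: real
  proof -
    define \<omega> where "\<omega> m = exp (2 * of_real pi * \<i> * of_nat m / of_nat N :: complex)" for m :: nat
    define z where "z m = of_real (sqrt t) * \<omega> m" for m
    have "0 \<le> (\<Sum>m<N. Re (\<Sum>j\<in>J. c j * (z m ^ a j * cnj (z m) ^ b j)))"
      by (intro sum_nonneg pos)
    also have "\<dots> = Re (\<Sum>m<N. \<Sum>j\<in>J. c j * (z m ^ a j * cnj (z m) ^ b j))" by simp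
    also have "(\<Sum>m<N. \<Sum>j\<in>J. c j * (z m ^ a j * cnj (z m) ^ b j))
      = (\<Sum>j\<in>J. \<Sum>m<N. c j * of_real (sqrt t) ^ (a j + b j) * (\<omega> m ^ a j * cnj (\<omega> m) ^ b j))"
      by (subst sum.swap) (simp add: z_def power_mult_distrib power_add mult_ac)
    also have "\<dots> = (\<Sum>j\<in>J. c j * of_real (sqrt t) ^ (a j + b j) * (if a j = b j then of_nat N else 0))"
      unfolding sum_distrib_left[symmetric] \<omega>_def
      by (intro sum.cong refl) (simp only: roots_of_unity_orthogonal[OF N])
    also have "\<dots> = (\<Sum>j\<in>J. of_real (real N * t ^ a j) * (if a j = b j then c j else 0))"
    proof (intro sum.cong refl)
      fix j
      have "sqrt t ^ (a j + a j) = t ^ a j"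
        using t by (simp add: power_add flip: power_mult_distrib)
      then have "complex_of_real (sqrt t) ^ (a j + a j) = of_real (t ^ a j)"
        by (metis of_real_power)
      then show "c j * of_real (sqrt t) ^ (a j + b j) * (if a j = b j then of_nat N else 0)
        = of_real (real N * t ^ a j) * (if a j = b j then c j else 0)"
        by auto
    qed
    also have "Re \<dots> = real N * (\<Sum>j\<in>J. (if a j = b j then Re (c j) else 0) * t ^ a j)"
      by (simp add: sum_distrib_left) (intro sum.cong refl, simp)
    finally show ?thesis using N0 by (simp add: zero_le_mult_iff)
  qed
  have "((\<lambda>t. \<Sum>j\<in>J. (if a j = b j then Re (c j) else 0) * (t ^ a j / exp t)) has_integral
     (\<Sum>j\<in>J. (if a j = b j then Re (c j) else 0) * fact (a j))) {0..}"
    by (intro has_integral_sum J has_integral_mult_right has_integral_power_exp)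
  moreover have "0 \<le> (\<Sum>j\<in>J. (if a j = b j then Re (c j) else 0) * (t ^ a j / exp t))" if "t \<in> {0..}" for t
    using poly[of t] that by (simp add: sum_divide_distrib[symmetric])
  ultimately have "0 \<le> (\<Sum>j\<in>J. (if a j = b j then Re (c j) else 0) * fact (a j))"
    by (rule has_integral_nonneg)
  also have "\<dots> = Re (\<Sum>j\<in>J. c j * (if a j = b j then of_nat (fact (a j)) else 0))"
    unfolding Re_sum by (intro sum.cong refl) (simp del: of_nat_fact, simp)
  finally show ?thesis unfolding of_nat_fact .
qed

text \<open>The right-hand side is the expectation of the polynomial over independent standard complex
  Gaussian variables.\<close>

lemma gauss_positivity:
  fixes c :: "'j \<Rightarrow> complex" and a b :: "'j \<Rightarrow> 'k \<Rightarrow> nat"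
  assumes "finite K" "finite J"
    and "\<And>v. 0 \<le> Re (\<Sum>j\<in>J. c j * (\<Prod>k\<in>K. v k ^ a j k * cnj (v k) ^ b j k))"
  shows "0 \<le> Re (\<Sum>j\<in>J. c j * (\<Prod>k\<in>K. if a j k = b j k then fact (a j k) else 0))"
  using assms(1,3)
proof (induction K arbitrary: c rule: finite_induct)
  case empty
  then show ?case by simp
next
  case (insert k K)
  \<comment> \<open>One variable is averaged while the others are frozen; their monomials count as
    part of the coefficients.\<close>
  have "0 \<le> Re (\<Sum>j\<in>J. (c j * (if a j k = b j k then fact (a j k) else 0)) * (\<Prod>k\<in>K. v k ^ a j k * cnj (v k) ^ b j k))" for v
  proof -
    have "0 \<le> Re (\<Sum>j\<in>J. (c j * (\<Prod>k\<in>K. v k ^ a j k * cnj (v k) ^ b j k)) * (z ^ a j k * cnj z ^ b j k))" for z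
    proof -
      have "(\<Prod>l\<in>insert k K. (v(k := z)) l ^ a j l * cnj ((v(k := z)) l) ^ b j l)
        = (\<Prod>k\<in>K. v k ^ a j k * cnj (v k) ^ b j k) * (z ^ a j k * cnj z ^ b j k)" for j
      proof -
        have "(\<Prod>l\<in>K. (v(k := z)) l ^ a j l * cnj ((v(k := z)) l) ^ b j l) = (\<Prod>k\<in>K. v k ^ a j k * cnj (v k) ^ b j k)"
          using insert.hyps by (intro prod.cong) auto
        then show ?thesis using insert.hyps by (simp add: mult.commute)
      qed
      then show ?thesis using insert.prems[of "v(k := z)"] by (simp add: mult.assoc)
    qed
    from gauss_positivity_1[OF assms(2) this] show ?thesis by (simp add: mult_ac)
  qed
  from insert.IH[OF this] show ?case using insert.hyps by (simp add: mult.assoc)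
qed

section \<open>Wick moments and the symmetric projector\<close>

definition occ :: "'n set \<Rightarrow> ('n \<Rightarrow> 'k) \<Rightarrow> 'k \<Rightarrow> nat" where
  "occ I x k = card {i \<in> I. x i = k}"

text \<open>The Gaussian moment of the monomial in v along x and in its conjugate along x', which by
  Wick's formula counts the permutations carrying x to x'. As a matrix it is the factorial of n
  times the projector on the symmetric subspace.\<close>

definition wick :: "('n::finite \<Rightarrow> 'k::finite) \<Rightarrow> ('n \<Rightarrow> 'k) \<Rightarrow> complex" where
  "wick x x' = (\<Prod>k\<in>UNIV. if occ UNIV x k = occ UNIV x' k then fact (occ UNIV x k) else 0)"

lemma prod_occ:
  fixes v :: "'k::finite \<Rightarrow> 'c::comm_monoid_mult"
  assumes "finite I"
  shows "(\<Prod>i\<in>I. v (x i)) = (\<Prod>k\<in>UNIV. v k ^ occ I x k)"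
proof -
  have "(\<Prod>i\<in>I. v (x i)) = (\<Prod>k\<in>UNIV. \<Prod>i\<in>{i \<in> I. x i = k}. v (x i))"
    using prod.group[of I UNIV x "\<lambda>i. v (x i)"] assms by simp
  also have "\<dots> = (\<Prod>k\<in>UNIV. v k ^ occ I x k)"
    by (intro prod.cong refl) (simp add: occ_def)
  finally show ?thesis .
qed

lemma wick_nonneg:
  fixes c :: "('n::finite \<Rightarrow> 'k::finite) \<Rightarrow> ('n \<Rightarrow> 'k) \<Rightarrow> complex"
  assumes "\<And>v. 0 \<le> Re (\<Sum>x\<in>UNIV. \<Sum>x'\<in>UNIV. c x x' * ((\<Prod>i\<in>UNIV. v (x i)) * (\<Prod>i\<in>UNIV. cnj (v (x' i)))))"
  shows "0 \<le> Re (\<Sum>x\<in>UNIV. \<Sum>x'\<in>UNIV. c x x' * wick x x')"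
proof -
  have "(\<Sum>x\<in>UNIV. \<Sum>x'\<in>UNIV. c x x' * ((\<Prod>i\<in>UNIV. v (x i)) * (\<Prod>i\<in>UNIV. cnj (v (x' i)))))
     = (\<Sum>j\<in>UNIV. c (fst j) (snd j) * (\<Prod>k\<in>UNIV. v k ^ occ UNIV (fst j) k * cnj (v k) ^ occ UNIV (snd j) k))" for v
    unfolding prod_occ[OF finite, of v] prod_occ[OF finite, of "\<lambda>k. cnj (v k)"] prod.distrib
    by (simp add: sum.cartesian_product case_prod_beta)
  then have "0 \<le> Re (\<Sum>j\<in>UNIV. c (fst j) (snd j) * (\<Prod>k\<in>UNIV. v k ^ occ UNIV (fst j) k * cnj (v k) ^ occ UNIV (snd j) k))" for v
    using assms[of v] by metis
  from gauss_positivity[OF finite finite this]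
  have "0 \<le> Re (\<Sum>j\<in>UNIV. c (fst j) (snd j) * wick (fst j) (snd j))"
    unfolding wick_def .
  also have "(\<Sum>j\<in>UNIV. c (fst j) (snd j) * wick (fst j) (snd j)) = (\<Sum>x\<in>UNIV. \<Sum>x'\<in>UNIV. c x x' * wick x x')"
    by (simp add: sum.cartesian_product case_prod_beta)
  finally show ?thesis .
qed

text \<open>The orbit of x under the permutations of I, described by occupation numbers.\<close>

definition same_occ :: "'n set \<Rightarrow> ('n \<Rightarrow> 'k) \<Rightarrow> ('n \<Rightarrow> 'k) set" where
  "same_occ I x = {x'. (\<forall>i. i \<notin> I \<longrightarrow> x' i = x i) \<and> (\<forall>k. occ I x' k = occ I x k)}"

lemma count_image_mset_set:
  "finite I \<Longrightarrow> count (image_mset x (mset_set I)) k = occ I x k"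
  unfolding count_image_mset' occ_def by (simp add: eq_commute cong: conj_cong)

lemma same_occ_mset:
  "finite I \<Longrightarrow> (\<forall>k. occ I x' k = occ I x k) \<longleftrightarrow> image_mset x' (mset_set I) = image_mset x (mset_set I)"
  by (simp add: multiset_eq_iff count_image_mset_set)

lemma same_occ_permutes:
  assumes "finite I" "x' \<in> same_occ I x"
  obtains \<pi> where "\<pi> permutes I" "x' = x \<circ> \<pi>"
proof -
  have "image_mset x' (mset_set I) = image_mset x (mset_set I)"
    using assms same_occ_mset unfolding same_occ_def by blast
  then obtain \<pi> where \<pi>: "\<pi> permutes I" "\<forall>i\<in>I. x' i = x (\<pi> i)"
    using image_mset_eq_implies_permutes[OF assms(1)] by blast
  have "x' = x \<circ> \<pi>"
    using \<pi> assms(2) permutes_not_in[OF \<pi>(1)] by (auto simp: same_occ_def fun_eq_iff)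
  with \<pi>(1) show thesis by (rule that)
qed

text \<open>The size of the orbit is a multinomial coefficient: listing values along an enumeration
  of I identifies the orbit with the arrangements of a multiset.\<close>

lemma card_same_occ:
  fixes x :: "'n::finite \<Rightarrow> 'k::finite"
  shows "card (same_occ I x) * (\<Prod>k\<in>UNIV. fact (occ I x k)) = fact (card I)"
proof -
  obtain xs where xs: "set xs = I" "distinct xs" using finite_distinct_list[of I] by auto
  have mxs: "mset xs = mset_set I" using xs by (metis mset_set_set)
  define M where "M = image_mset x (mset_set I)"
  have "bij_betw (\<lambda>x'. map x' xs) (same_occ I x) (permutations_of_multiset M)"
    unfolding bij_betw_def
  proof
    show "inj_on (\<lambda>x'. map x' xs) (same_occ I x)"
    proof (rule inj_onI)
      fix y z assume *: "y \<in> same_occ I x" "z \<in> same_occ I x" "map y xs = map z xs"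
      then have "y i = z i" if "i \<in> I" for i using xs that by auto
      with * show "y = z" by (auto simp: same_occ_def fun_eq_iff) metis
    qed
    show "(\<lambda>x'. map x' xs) ` same_occ I x = permutations_of_multiset M"
    proof
      show "(\<lambda>x'. map x' xs) ` same_occ I x \<subseteq> permutations_of_multiset M"
        by (auto simp: permutations_of_multiset_def same_occ_def mxs M_def same_occ_mset)
      show "permutations_of_multiset M \<subseteq> (\<lambda>x'. map x' xs) ` same_occ I x"
      proof
        fix ys assume "ys \<in> permutations_of_multiset M"
        then have ys: "mset ys = M" by (simp add: permutations_of_multiset_def)
        then have "size (mset ys) = size (mset xs)" unfolding M_def mxs by simp
        then have len: "length ys = length xs" by simp
        \<comment> \<open>Outside I the values of x are kept, as membership in
          \<open>same_occ\<close> demands.\<close>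
        define y where "y i = (if i \<in> I then the (map_of (zip xs ys) i) else x i)" for i
        have m: "map y xs = ys"
        proof (rule nth_equalityI)
          fix j assume "j < length (map y xs)"
          then have j: "j < length xs" by simp
          then have "map_of (zip xs ys) (xs ! j) = Some (ys ! j)"
            using xs len by (simp add: map_of_zip_nth)
          then show "map y xs ! j = ys ! j" using j xs by (auto simp: y_def)
        qed (simp add: len)
        then have "image_mset y (mset_set I) = image_mset x (mset_set I)"
          using ys by (metis M_def mset_map mxs)
        then have "y \<in> same_occ I x"
          using same_occ_mset[of I y x] by (simp add: same_occ_def y_def)
        then show "ys \<in> (\<lambda>x'. map x' xs) ` same_occ I x" using m by (metis image_eqI)
      qed
    qed
  qed
  then have "card (same_occ I x) = card (permutations_of_multiset M)" by (rule bij_betw_same_card)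
  moreover have "(\<Prod>k\<in>set_mset M. fact (count M k)) = (\<Prod>k\<in>UNIV. fact (occ I x k) :: nat)"
  proof (intro prod.mono_neutral_cong_left ballI)
    fix k assume "k \<in> UNIV - set_mset M"
    then have "count M k = 0" by (simp add: not_in_iff)
    then show "fact (occ I x k) = (1 :: nat)" by (simp add: M_def count_image_mset_set)
  qed (simp_all add: M_def count_image_mset_set)
  moreover have "size M = card I" by (simp add: M_def)
  ultimately show ?thesis using card_permutations_of_multiset_aux[of M] by simp
qed

lemma sum_same_occ:
  fixes x :: "'n::finite \<Rightarrow> 'k::finite" and g :: "('n \<Rightarrow> 'k) \<Rightarrow> complex"
  assumes "\<And>\<pi>. \<pi> permutes I \<Longrightarrow> g (x \<circ> \<pi>) = g x"
  shows "(\<Sum>x'\<in>same_occ I x. (\<Prod>k\<in>UNIV. fact (occ I x k)) * g x') = fact (card I) * g x"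
proof -
  have "g x' = g x" if "x' \<in> same_occ I x" for x'
    using same_occ_permutes[OF _ that] assms by auto
  then have "(\<Sum>x'\<in>same_occ I x. (\<Prod>k\<in>UNIV. fact (occ I x k)) * g x')
    = of_nat (card (same_occ I x) * (\<Prod>k\<in>UNIV. fact (occ I x k))) * g x"
    by (simp add: mult.assoc)
  then show ?thesis unfolding card_same_occ by simp
qed

lemma wick_altdef:
  "wick x x' = (if x' \<in> same_occ UNIV x then (\<Prod>k\<in>UNIV. fact (occ UNIV x k)) else 0)"
proof (cases "x' \<in> same_occ UNIV x")
  case True
  then show ?thesis by (simp add: wick_def same_occ_def)
next
  case False
  then obtain k where "occ UNIV x k \<noteq> occ UNIV x' k" by (auto simp: same_occ_def eq_commute)
  then have "wick x x' = 0" unfolding wick_def by (intro prod_zero) auto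
  with False show ?thesis by simp
qed

text \<open>The weight is constant on the orbit of x and zero off it, and weight times orbit size is
  the factorial of n.\<close>

lemma sum_wick_symmetric:
  fixes x :: "'n::finite \<Rightarrow> 'k::finite" and g :: "('n \<Rightarrow> 'k) \<Rightarrow> complex"
  assumes "\<And>\<pi>. \<pi> permutes UNIV \<Longrightarrow> g (x \<circ> \<pi>) = g x"
  shows "(\<Sum>x'\<in>UNIV. wick x x' * g x') = fact CARD('n) * g x"
proof -
  have "(\<Sum>x'\<in>UNIV. wick x x' * g x') = (\<Sum>x'\<in>same_occ UNIV x. wick x x' * g x')"
    by (rule sum.mono_neutral_right) (auto simp: wick_altdef)
  also have "\<dots> = (\<Sum>x'\<in>same_occ UNIV x. (\<Prod>k\<in>UNIV. fact (occ UNIV x k)) * g x')"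
    by (intro sum.cong refl) (simp add: wick_altdef)
  also have "\<dots> = fact CARD('n) * g x" by (rule sum_same_occ[OF assms])
  finally show ?thesis .
qed

lemma occ_UNIV_split:
  fixes x :: "'n::finite \<Rightarrow> 'k"
  shows "occ UNIV x k = occ (UNIV - {L}) x k + (if x L = k then 1 else 0)"
proof -
  have "{i. x i = k} = (if x L = k then insert L {i \<in> UNIV - {L}. x i = k} else {i \<in> UNIV - {L}. x i = k})"
    by auto
  then show ?thesis by (simp add: occ_def)
qed

text \<open>With the label at L fixed only the rearrangements of the other places remain. The
  additional factor is the quotient of the factorials of the occupation numbers of
  \<open>x L\<close> with and without the place L.\<close>

lemma sum_wick_fix:
  fixes x :: "'n::finite \<Rightarrow> 'k::finite" and g :: "('n \<Rightarrow> 'k) \<Rightarrow> complex"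
  assumes "\<And>\<pi>. \<pi> permutes (UNIV - {L}) \<Longrightarrow> g (x \<circ> \<pi>) = g x"
  shows "(\<Sum>x'\<in>UNIV. if x L = x' L then wick x x' * g x' else 0)
     = of_nat (occ (UNIV - {L}) x (x L) + 1) * fact (CARD('n) - 1) * g x"
proof -
  let ?I = "UNIV - {L}"
  have mem: "x' \<in> same_occ ?I x \<longleftrightarrow> x L = x' L \<and> x' \<in> same_occ UNIV x" for x'
  proof -
    have "(\<forall>k. occ ?I x' k = occ ?I x k) \<longleftrightarrow> (\<forall>k. occ UNIV x' k = occ UNIV x k)" if "x L = x' L"
      using occ_UNIV_split[of x' _ L] occ_UNIV_split[of x _ L] that by simp
    moreover have "(\<forall>i. i \<notin> ?I \<longrightarrow> x' i = x i) \<longleftrightarrow> x L = x' L"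
      by (simp add: eq_commute)
    ultimately show ?thesis unfolding same_occ_def mem_Collect_eq by blast
  qed
  have "(\<Prod>k\<in>UNIV. fact (occ UNIV x k)) = (\<Prod>k\<in>UNIV. fact (occ ?I x k) * (if x L = k then of_nat (occ ?I x k + 1) else 1))"
    unfolding occ_UNIV_split[of x _ L] by (intro prod.cong refl) (auto simp: algebra_simps)
  also have "\<dots> = (\<Prod>k\<in>UNIV. fact (occ ?I x k)) * (of_nat (occ ?I x (x L) + 1) :: complex)"
    by (simp add: prod.distrib)
  finally have fact: "(\<Prod>k\<in>UNIV. fact (occ UNIV x k)) = (\<Prod>k\<in>UNIV. fact (occ ?I x k)) * (of_nat (occ ?I x (x L) + 1) :: complex)" .
  have "(\<Sum>x'\<in>UNIV. if x L = x' L then wick x x' * g x' else 0)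
     = (\<Sum>x'\<in>same_occ ?I x. if x L = x' L then wick x x' * g x' else 0)"
    by (rule sum.mono_neutral_right) (auto simp: wick_altdef mem)
  also have "\<dots> = (\<Sum>x'\<in>same_occ ?I x. of_nat (occ ?I x (x L) + 1) * ((\<Prod>k\<in>UNIV. fact (occ ?I x k)) * g x'))"
    by (intro sum.cong refl) (simp add: wick_altdef mem fact mult_ac)
  also have "\<dots> = of_nat (occ ?I x (x L) + 1) * (fact (card ?I) * g x)"
    using sum_same_occ[of ?I g x, OF assms] unfolding sum_distrib_left[symmetric] by simp
  also have "card ?I = CARD('n) - 1" by simp
  finally show ?thesis by (simp add: mult.assoc)
qed

lemma sum_occ: "finite I \<Longrightarrow> (\<Sum>k\<in>UNIV. occ I x k) = card I"
  for x :: "'n \<Rightarrow> 'k::finite"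
  unfolding occ_def using sum.group[of I UNIV x "\<lambda>_. 1::nat"] by simp

section \<open>Coherent-state conditioning\<close>

text \<open>The placeholder at L lets these functions stand for labels of the remaining blocks
  without leaving the type.\<close>

definition rest_funs :: "'n \<Rightarrow> ('n \<Rightarrow> 'k) set" where
  "rest_funs L = {x. x L = undefined}"

lemma bij_betw_upd: "bij_betw (\<lambda>(x, s). x(L := s)) (rest_funs L \<times> UNIV) UNIV"
  by (rule bij_betw_byWitness[where f' = "\<lambda>x. (x(L := undefined), x L)"])
    (auto simp: rest_funs_def fun_eq_iff)

lemma sum_rest_funs:
  fixes f :: "('n::finite \<Rightarrow> 'k::finite) \<Rightarrow> 'b::comm_monoid_add"
  shows "(\<Sum>x\<in>UNIV. f x) = (\<Sum>x\<in>rest_funs L. \<Sum>s\<in>UNIV. f (x(L := s)))"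
  unfolding sum.reindex_bij_betw[OF bij_betw_upd[of L], symmetric]
  by (simp add: sum.cartesian_product case_prod_beta)

section \<open>Averages of polynomials in which one block is left out\<close>

definition mono_full :: "('k \<Rightarrow> complex) \<Rightarrow> ('n::finite \<Rightarrow> 'k) \<Rightarrow> ('n \<Rightarrow> 'k) \<Rightarrow> complex" where
  "mono_full v x x' = (\<Prod>i\<in>UNIV. v (x i)) * (\<Prod>i\<in>UNIV. cnj (v (x' i)))"

text \<open>On a monomial this replaces the factors at L by the squared norm of the vector. Terms
  conditioned on n - 1 blocks thereby get the same degree n as the others, so that one Gaussian
  moment \<open>wick\<close> serves for all.\<close>

definition vary :: "'n \<Rightarrow> (('n \<Rightarrow> 'k::finite) \<Rightarrow> ('n \<Rightarrow> 'k) \<Rightarrow> complex) \<Rightarrow> ('n \<Rightarrow> 'k) \<Rightarrow> ('n \<Rightarrow> 'k) \<Rightarrow> complex" where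
  "vary L m x x' = (\<Sum>k\<in>UNIV. m (x(L := k)) (x'(L := k)))"

text \<open>A summation by parts: the summed-out label moves from the kernel to the coefficients,
  after which positivity for plain monomials applies.\<close>

lemma sum_vary:
  fixes b :: "('n::finite \<Rightarrow> 'k::finite) \<Rightarrow> ('n \<Rightarrow> 'k) \<Rightarrow> complex"
  shows "(\<Sum>x\<in>UNIV. \<Sum>x'\<in>UNIV. b x x' * vary L m x x')
    = (\<Sum>x\<in>UNIV. \<Sum>x'\<in>UNIV. (if x L = x' L then \<Sum>k\<in>UNIV. \<Sum>k'\<in>UNIV. b (x(L := k)) (x'(L := k')) else 0) * m x x')"
proof -
  have "(\<Sum>x\<in>UNIV. \<Sum>x'\<in>UNIV. b x x' * vary L m x x')
    = (\<Sum>x\<in>rest_funs L. \<Sum>k\<in>UNIV. \<Sum>x'\<in>rest_funs L. \<Sum>k'\<in>UNIV. \<Sum>j\<in>UNIV. b (x(L := k)) (x'(L := k')) * m (x(L := j)) (x'(L := j)))"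
    unfolding sum_rest_funs[of _ L] vary_def by (simp add: sum_distrib_left)
  also have "\<dots> = (\<Sum>x\<in>rest_funs L. \<Sum>x'\<in>rest_funs L. \<Sum>k\<in>UNIV. \<Sum>k'\<in>UNIV. \<Sum>j\<in>UNIV. b (x(L := k)) (x'(L := k')) * m (x(L := j)) (x'(L := j)))"
    by (intro sum.cong refl sum.swap)
  also have "\<dots> = (\<Sum>x\<in>rest_funs L. \<Sum>x'\<in>rest_funs L. \<Sum>j\<in>UNIV. \<Sum>k\<in>UNIV. \<Sum>k'\<in>UNIV. b (x(L := k)) (x'(L := k')) * m (x(L := j)) (x'(L := j)))"
  proof (rule sum.cong[OF refl], rule sum.cong[OF refl])
    fix x x'
    let ?f = "\<lambda>k k' j. b (x(L := k)) (x'(L := k')) * m (x(L := j)) (x'(L := j))"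
    have "(\<Sum>k\<in>UNIV. \<Sum>k'\<in>UNIV. \<Sum>j\<in>UNIV. ?f k k' j) = (\<Sum>k\<in>UNIV. \<Sum>j\<in>UNIV. \<Sum>k'\<in>UNIV. ?f k k' j)"
      by (intro sum.cong refl sum.swap)
    also have "\<dots> = (\<Sum>j\<in>UNIV. \<Sum>k\<in>UNIV. \<Sum>k'\<in>UNIV. ?f k k' j)" by (rule sum.swap)
    finally show "(\<Sum>k\<in>UNIV. \<Sum>k'\<in>UNIV. \<Sum>j\<in>UNIV. ?f k k' j) = (\<Sum>j\<in>UNIV. \<Sum>k\<in>UNIV. \<Sum>k'\<in>UNIV. ?f k k' j)" .
  qed
  also have "\<dots> = (\<Sum>x\<in>rest_funs L. \<Sum>x'\<in>rest_funs L. \<Sum>j\<in>UNIV. \<Sum>j'\<in>UNIV.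
      (if j = j' then \<Sum>k\<in>UNIV. \<Sum>k'\<in>UNIV. b (x(L := k)) (x'(L := k')) else 0) * m (x(L := j)) (x'(L := j')))"
    by (simp add: sum_distrib_right if_distrib[of "\<lambda>z. z * _"] cong: if_cong)
  also have "\<dots> = (\<Sum>x\<in>rest_funs L. \<Sum>j\<in>UNIV. \<Sum>x'\<in>rest_funs L. \<Sum>j'\<in>UNIV.
      (if j = j' then \<Sum>k\<in>UNIV. \<Sum>k'\<in>UNIV. b (x(L := k)) (x'(L := k')) else 0) * m (x(L := j)) (x'(L := j')))"
    by (intro sum.cong refl sum.swap)
  finally show ?thesis unfolding sum_rest_funs[of _ L] by (simp cong: if_cong)
qed

lemma wick_vary_nonneg:
  fixes b c :: "('n::finite \<Rightarrow> 'k::finite) \<Rightarrow> ('n \<Rightarrow> 'k) \<Rightarrow> complex"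
  assumes "\<And>v. 0 \<le> Re ((\<Sum>x\<in>UNIV. \<Sum>x'\<in>UNIV. b x x' * vary L (mono_full v) x x')
     + (\<Sum>x\<in>UNIV. \<Sum>x'\<in>UNIV. c x x' * mono_full v x x'))"
  shows "0 \<le> Re ((\<Sum>x\<in>UNIV. \<Sum>x'\<in>UNIV. b x x' * vary L wick x x')
     + (\<Sum>x\<in>UNIV. \<Sum>x'\<in>UNIV. c x x' * wick x x'))"
proof -
  define d where "d x x' = (if x L = x' L then \<Sum>k\<in>UNIV. \<Sum>k'\<in>UNIV. b (x(L := k)) (x'(L := k')) else 0) + c x x'" for x x'
  have "(\<Sum>x\<in>UNIV. \<Sum>x'\<in>UNIV. b x x' * vary L m x x') + (\<Sum>x\<in>UNIV. \<Sum>x'\<in>UNIV. c x x' * m x x')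
     = (\<Sum>x\<in>UNIV. \<Sum>x'\<in>UNIV. d x x' * m x x')" for m
    unfolding sum_vary d_def by (simp add: sum.distrib distrib_right)
  note eq = this
  show ?thesis
    unfolding eq
  proof (rule wick_nonneg)
    show "0 \<le> Re (\<Sum>x\<in>UNIV. \<Sum>x'\<in>UNIV. d x x' * ((\<Prod>i\<in>UNIV. v (x i)) * (\<Prod>i\<in>UNIV. cnj (v (x' i)))))" for v
      using assms[of v] unfolding eq unfolding mono_full_def .
  qed
qed

text \<open>The vectors are averaged one after the other: for fixed u the expression has the shape
  required by \<open>wick_vary_nonneg\<close> in v, and its average over v has that shape in
  u.\<close>

lemma wick_vary_nonneg2:
  fixes a11 a12 a21 a22 :: "('n::finite \<Rightarrow> 'k::finite) \<Rightarrow> ('n \<Rightarrow> 'k) \<Rightarrow> ('n \<Rightarrow> 'k) \<Rightarrow> ('n \<Rightarrow> 'k) \<Rightarrow> complex"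
  assumes pos: "\<And>v u. 0 \<le> Re (\<Sum>x\<in>UNIV. \<Sum>x'\<in>UNIV. \<Sum>y\<in>UNIV. \<Sum>y'\<in>UNIV.
      a11 x x' y y' * (vary L (mono_full v) x x' * vary L (mono_full u) y y')
    + a21 x x' y y' * (mono_full v x x' * vary L (mono_full u) y y')
    + a12 x x' y y' * (vary L (mono_full v) x x' * mono_full u y y')
    + a22 x x' y y' * (mono_full v x x' * mono_full u y y'))"
  shows "0 \<le> Re (\<Sum>x\<in>UNIV. \<Sum>x'\<in>UNIV. \<Sum>y\<in>UNIV. \<Sum>y'\<in>UNIV.
      a11 x x' y y' * (vary L wick x x' * vary L wick y y')
    + a21 x x' y y' * (wick x x' * vary L wick y y')
    + a12 x x' y y' * (vary L wick x x' * wick y y')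
    + a22 x x' y y' * (wick x x' * wick y y'))"
proof -
  \<comment> \<open>Linear in the pair p, P and in the pair q, Q; each pair stands for a kernel
    together with its version in which the label at L is summed out.\<close>
  define f where "f p P q Q = (\<Sum>x\<in>UNIV. \<Sum>x'\<in>UNIV. \<Sum>y\<in>UNIV. \<Sum>y'\<in>UNIV.
      a11 x x' y y' * (P x x' * Q y y') + a21 x x' y y' * (p x x' * Q y y')
    + a12 x x' y y' * (P x x' * q y y') + a22 x x' y y' * (p x x' * q y y'))"
    for p P q Q :: "('n \<Rightarrow> 'k) \<Rightarrow> ('n \<Rightarrow> 'k) \<Rightarrow> complex"
  have f1: "f p P q Q = (\<Sum>x\<in>UNIV. \<Sum>x'\<in>UNIV. (\<Sum>y\<in>UNIV. \<Sum>y'\<in>UNIV. a11 x x' y y' * Q y y' + a12 x x' y y' * q y y') * P x x')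
     + (\<Sum>x\<in>UNIV. \<Sum>x'\<in>UNIV. (\<Sum>y\<in>UNIV. \<Sum>y'\<in>UNIV. a21 x x' y y' * Q y y' + a22 x x' y y' * q y y') * p x x')" for p P q Q
    unfolding f_def sum.distrib[symmetric] sum_distrib_right distrib_right
    by (intro sum.cong refl) (simp add: mult_ac)
  have f2: "f p P q Q = (\<Sum>y\<in>UNIV. \<Sum>y'\<in>UNIV. (\<Sum>x\<in>UNIV. \<Sum>x'\<in>UNIV. a11 x x' y y' * P x x' + a21 x x' y y' * p x x') * Q y y')
     + (\<Sum>y\<in>UNIV. \<Sum>y'\<in>UNIV. (\<Sum>x\<in>UNIV. \<Sum>x'\<in>UNIV. a12 x x' y y' * P x x' + a22 x x' y y' * p x x') * q y y')" for p P q Q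
  proof -
    have "f p P q Q = (\<Sum>(x, x', y, y')\<in>UNIV. a11 x x' y y' * (P x x' * Q y y') + a21 x x' y y' * (p x x' * Q y y')
      + a12 x x' y y' * (P x x' * q y y') + a22 x x' y y' * (p x x' * q y y'))"
      unfolding f_def sum_UNIV_prod by (simp add: case_prod_beta)
    also have "\<dots> = (\<Sum>(y, y', x, x')\<in>UNIV. a11 x x' y y' * (P x x' * Q y y') + a21 x x' y y' * (p x x' * Q y y')
      + a12 x x' y y' * (P x x' * q y y') + a22 x x' y y' * (p x x' * q y y'))"
      by (rule sum.reindex_bij_witness[of _ "\<lambda>(y, y', x, x'). (x, x', y, y')" "\<lambda>(x, x', y, y'). (y, y', x, x')"]) auto
    also have "\<dots> = (\<Sum>y\<in>UNIV. \<Sum>y'\<in>UNIV. \<Sum>x\<in>UNIV. \<Sum>x'\<in>UNIV. a11 x x' y y' * (P x x' * Q y y') + a21 x x' y y' * (p x x' * Q y y')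
      + a12 x x' y y' * (P x x' * q y y') + a22 x x' y y' * (p x x' * q y y'))"
      unfolding sum_UNIV_prod by (simp add: case_prod_beta)
    also have "\<dots> = (\<Sum>y\<in>UNIV. \<Sum>y'\<in>UNIV. (\<Sum>x\<in>UNIV. \<Sum>x'\<in>UNIV. a11 x x' y y' * P x x' + a21 x x' y y' * p x x') * Q y y')
     + (\<Sum>y\<in>UNIV. \<Sum>y'\<in>UNIV. (\<Sum>x\<in>UNIV. \<Sum>x'\<in>UNIV. a12 x x' y y' * P x x' + a22 x x' y y' * p x x') * q y y')"
      unfolding sum.distrib[symmetric] sum_distrib_right distrib_right
      by (intro sum.cong refl) (simp add: mult_ac)
    finally show ?thesis .
  qed
  have "0 \<le> Re (f wick (vary L wick) (mono_full u) (vary L (mono_full u)))" for u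
    unfolding f1 by (rule wick_vary_nonneg) (use pos[of _ u] in \<open>simp only: f1[symmetric] f_def\<close>)
  then have "0 \<le> Re (f wick (vary L wick) wick (vary L wick))"
    unfolding f2 by (rule wick_vary_nonneg)
  then show ?thesis unfolding f_def .
qed

text \<open>The partial trace of the symmetric projector of n factors is a multiple of that of n - 1
  factors. The multiple is a sum of occupation numbers plus one over all labels: the numbers add up
  to n - 1 and the ones to \<open>CARD('k)\<close>.\<close>

lemma sum_vary_wick:
  fixes x :: "'n::finite \<Rightarrow> 'k::finite" and h :: "('n \<Rightarrow> 'k) \<Rightarrow> complex"
  assumes h: "\<And>\<pi> y. \<pi> permutes (UNIV - {L}) \<Longrightarrow> h (y \<circ> \<pi>) = h y"
  shows "(\<Sum>x'\<in>UNIV. vary L wick x x' * h x')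
     = of_nat (CARD('n) - 1 + CARD('k)) * fact (CARD('n) - 1) * (\<Sum>s\<in>UNIV. h (x(L := s)))"
proof -
  have "(\<Sum>x'\<in>UNIV. vary L wick x x' * h x')
     = (\<Sum>x'\<in>rest_funs L. \<Sum>s\<in>UNIV. \<Sum>k\<in>UNIV. wick (x(L := k)) (x'(L := k)) * h (x'(L := s)))"
    unfolding sum_rest_funs[of _ L] vary_def by (simp add: sum_distrib_right)
  also have "\<dots> = (\<Sum>s\<in>UNIV. \<Sum>x'\<in>rest_funs L. \<Sum>k\<in>UNIV. wick (x(L := k)) (x'(L := k)) * h (x'(L := s)))"
    by (rule sum.swap)
  also have "\<dots> = (\<Sum>s\<in>UNIV. \<Sum>k\<in>UNIV. \<Sum>x'\<in>rest_funs L. wick (x(L := k)) (x'(L := k)) * h (x'(L := s)))"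
    by (intro sum.cong refl sum.swap)
  also have "\<dots> = (\<Sum>s\<in>UNIV. \<Sum>k\<in>UNIV. of_nat (occ (UNIV - {L}) x k + 1) * fact (CARD('n) - 1) * h (x(L := s)))"
  proof (intro sum.cong refl)
    fix s k
    let ?x = "x(L := k)"
    have occ: "occ (UNIV - {L}) ?x k = occ (UNIV - {L}) x k"
      unfolding occ_def by (rule arg_cong[where f = card]) auto
    have "(\<Sum>x'\<in>rest_funs L. wick ?x (x'(L := k)) * h (x'(L := s)))
      = (\<Sum>x'\<in>rest_funs L. \<Sum>j\<in>UNIV. if k = j then wick ?x (x'(L := j)) * h (x'(L := s)) else 0)"
      by simp
    also have "\<dots> = (\<Sum>x'\<in>UNIV. if ?x L = x' L then wick ?x x' * h (x'(L := s)) else 0)"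
      unfolding sum_rest_funs[of "\<lambda>x'. if ?x L = x' L then wick ?x x' * h (x'(L := s)) else 0" L] by simp
    also have "\<dots> = of_nat (occ (UNIV - {L}) ?x (?x L) + 1) * fact (CARD('n) - 1) * h (?x(L := s))"
    proof (rule sum_wick_fix)
      fix \<pi> assume \<pi>: "\<pi> permutes (UNIV - {L})"
      then have L: "\<pi> L = L" by (simp add: permutes_not_in)
      have ne: "\<pi> i \<noteq> L" if "i \<noteq> L" for i using permutes_inj[OF \<pi>] that L by (metis injD)
      have "(?x \<circ> \<pi>)(L := s) = (?x(L := s)) \<circ> \<pi>" using L ne by (auto simp: fun_eq_iff)
      then show "h ((?x \<circ> \<pi>)(L := s)) = h (?x(L := s))" using h[OF \<pi>, of "?x(L := s)"] by simp
    qed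
    finally show "(\<Sum>x'\<in>rest_funs L. wick ?x (x'(L := k)) * h (x'(L := s)))
      = of_nat (occ (UNIV - {L}) x k + 1) * fact (CARD('n) - 1) * h (x(L := s))"
      by (simp add: occ)
  qed
  also have "\<dots> = (\<Sum>k\<in>UNIV. of_nat (occ (UNIV - {L}) x k + 1)) * fact (CARD('n) - 1) * (\<Sum>s\<in>UNIV. h (x(L := s)))"
    by (simp only: sum_distrib_left[symmetric] sum_distrib_right[symmetric])
  also have "(\<Sum>k\<in>UNIV. of_nat (occ (UNIV - {L}) x k + 1)) = (of_nat (CARD('n) - 1 + CARD('k)) :: complex)"
  proof -
    have "(\<Sum>k\<in>UNIV. occ (UNIV - {L}) x k + 1) = CARD('n) - 1 + CARD('k)"
      unfolding sum.distrib sum_occ[OF finite] by simp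
    then show ?thesis unfolding of_nat_sum[symmetric] by simp
  qed
  finally show ?thesis .
qed

text \<open>This is \<rho> between K and its adjoint, for the operator K that sends the basis vector
  z to the conjugate of \<open>\<gamma> z\<close> times the basis vector \<open>l z\<close>.\<close>

definition compress :: "('z \<Rightarrow> complex) \<Rightarrow> ('z \<Rightarrow> 'r) \<Rightarrow> 'z::finite cop \<Rightarrow> 'r::finite cop" where
  "compress \<gamma> l \<rho> = (\<chi> r r'. \<Sum>z\<in>UNIV. \<Sum>z'\<in>UNIV.
     (if l z = r then 1 else 0) * (if l z' = r' then 1 else 0) * (cnj (\<gamma> z) * \<rho> $ z $ z' * \<gamma> z'))"

lemma trace_compress:
  "trace (X ** compress \<gamma> l \<rho>) = (\<Sum>z\<in>UNIV. \<Sum>z'\<in>UNIV. X $ l z $ l z' * (\<gamma> z * cnj (\<gamma> z') * \<rho> $ z' $ z))"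
proof -
  have "trace (X ** compress \<gamma> l \<rho>) = (\<Sum>r\<in>UNIV. \<Sum>r'\<in>UNIV. \<Sum>z'\<in>UNIV. \<Sum>z\<in>UNIV.
     (if l z' = r' then 1 else 0) * (if l z = r then 1 else 0) * (X $ r $ r' * (cnj (\<gamma> z') * \<rho> $ z' $ z * \<gamma> z)))"
    by (simp add: trace_nth matmul_nth compress_def sum_distrib_left mult_ac)
  also have "\<dots> = (\<Sum>(r, r', z', z)\<in>UNIV. 
     (if l z' = r' then 1 else 0) * (if l z = r then 1 else 0) * (X $ r $ r' * (cnj (\<gamma> z') * \<rho> $ z' $ z * \<gamma> z)))"
    by (simp add: sum.cartesian_product case_prod_beta)
  also have "\<dots> = (\<Sum>(z, z', r', r)\<in>UNIV. 
     (if l z' = r' then 1 else 0) * (if l z = r then 1 else 0) * (X $ r $ r' * (cnj (\<gamma> z') * \<rho> $ z' $ z * \<gamma> z)))"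
    by (rule sum.reindex_bij_witness[of _ "\<lambda>(z, z', r', r). (r, r', z', z)" "\<lambda>(r, r', z', z). (z, z', r', r)"]) auto
  also have "\<dots> = (\<Sum>z\<in>UNIV. \<Sum>z'\<in>UNIV. \<Sum>r'\<in>UNIV. \<Sum>r\<in>UNIV.
     (if l z' = r' then 1 else 0) * ((if l z = r then 1 else 0) * (X $ r $ r' * (cnj (\<gamma> z') * \<rho> $ z' $ z * \<gamma> z))))"
    by (simp add: sum.cartesian_product case_prod_beta mult.assoc)
  also have "\<dots> = (\<Sum>z\<in>UNIV. \<Sum>z'\<in>UNIV. X $ l z $ l z' * (cnj (\<gamma> z') * \<rho> $ z' $ z * \<gamma> z))"
    unfolding sum_distrib_left[symmetric] sum_mult_if_eq ..
  finally show ?thesis by (simp add: mult_ac)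
qed

lemma psd_compress:
  fixes \<rho> :: "'z::finite cop"
  assumes "psd \<rho>"
  shows "psd (compress \<gamma> l \<rho>)"
proof -
  obtain T :: "'z \<Rightarrow> 'z \<Rightarrow> complex" where T: "\<And>i j. \<rho> $ i $ j = (\<Sum>k\<in>UNIV. T i k * cnj (T j k))"
    using psd_factor[OF assms] by blast
  define S where "S r k = (\<Sum>z\<in>UNIV. (if l z = r then 1 else 0) * (cnj (\<gamma> z) * T z k))" for r k
  show ?thesis
  proof (rule psd_factorI[where S = UNIV and T = S])
    fix r r'
    have "compress \<gamma> l \<rho> $ r $ r' = (\<Sum>z\<in>UNIV. \<Sum>z'\<in>UNIV. \<Sum>k\<in>UNIV.
       ((if l z = r then 1 else 0) * (cnj (\<gamma> z) * T z k)) * ((if l z' = r' then 1 else 0) * (\<gamma> z' * cnj (T z' k))))"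
      by (simp add: compress_def T sum_distrib_left sum_distrib_right mult_ac)
    also have "\<dots> = (\<Sum>z\<in>UNIV. \<Sum>k\<in>UNIV. \<Sum>z'\<in>UNIV.
       ((if l z = r then 1 else 0) * (cnj (\<gamma> z) * T z k)) * ((if l z' = r' then 1 else 0) * (\<gamma> z' * cnj (T z' k))))"
      by (intro sum.cong refl sum.swap)
    also have "\<dots> = (\<Sum>k\<in>UNIV. \<Sum>z\<in>UNIV. \<Sum>z'\<in>UNIV.
       ((if l z = r then 1 else 0) * (cnj (\<gamma> z) * T z k)) * ((if l z' = r' then 1 else 0) * (\<gamma> z' * cnj (T z' k))))"
      by (rule sum.swap)
    also have "\<dots> = (\<Sum>k\<in>UNIV. S r k * cnj (S r' k))"
      unfolding S_def cnj_sum sum_product by (intro sum.cong refl) auto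
    finally show "compress \<gamma> l \<rho> $ r $ r' = (\<Sum>k\<in>UNIV. S r k * cnj (S r' k))" .
  qed
qed

definition last_labels :: "('n::{finite,linorder} \<Rightarrow> 'k) \<times> ('n \<Rightarrow> 'k) \<Rightarrow> 'k \<times> 'k" where
  "last_labels z = (fst z last_block, snd z last_block)"

definition rest_prod :: "('k \<Rightarrow> complex) \<Rightarrow> ('n::{finite,linorder} \<Rightarrow> 'k) \<Rightarrow> complex" where
  "rest_prod v x = (\<Prod>i\<in>UNIV - {last_block}. v (x i))"

definition weight :: "('k \<Rightarrow> complex) \<Rightarrow> ('k \<Rightarrow> complex) \<Rightarrow> ('n::{finite,linorder} \<Rightarrow> 'k) \<times> ('n \<Rightarrow> 'k) \<Rightarrow> complex" where
  "weight v u z = rest_prod v (fst z) * rest_prod u (snd z)"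

lemma prod_split_last: "(\<Prod>i\<in>UNIV. f i) = f last_block * (\<Prod>i\<in>UNIV - {last_block}. f i)"
  for f :: "'n::{finite,linorder} \<Rightarrow> complex"
  by (rule prod.remove) auto

lemma rest_prod_upd [simp]: "rest_prod v (x(last_block := s)) = rest_prod v x"
  unfolding rest_prod_def by (intro prod.cong) auto

lemma mono_full_rest: "mono_full v x x' = v (x last_block) * cnj (v (x' last_block)) * (rest_prod v x * cnj (rest_prod v x'))"
  for x x' :: "'n::{finite,linorder} \<Rightarrow> 'k"
  unfolding mono_full_def prod_split_last rest_prod_def cnj_prod by (simp add: mult_ac)

text \<open>The last block enters only through the squared norm, and what remains is the kernel of
  the projection of the other blocks on copies of v.\<close>

lemma vary_mono_full: "vary last_block (mono_full v) x x' = of_real (nsq v) * (rest_prod v x * cnj (rest_prod v x'))"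
  for x x' :: "'n::{finite,linorder} \<Rightarrow> 'k::finite"
  unfolding vary_def mono_full_rest rest_prod_upd fun_upd_same
  by (simp add: nsq_def cnj_mult_self sum_distrib_right)

lemma trace_compress_weight:
  fixes \<rho> :: "(('n::{finite,linorder} \<Rightarrow> 'k::finite) \<times> ('n \<Rightarrow> 'k)) cop"
  shows "trace (X ** compress (weight v u) last_labels \<rho>) = (\<Sum>x\<in>UNIV. \<Sum>x'\<in>UNIV. \<Sum>y\<in>UNIV. \<Sum>y'\<in>UNIV.
     X $ (x last_block, y last_block) $ (x' last_block, y' last_block) * \<rho> $ (x', y') $ (x, y) *
     ((rest_prod v x * cnj (rest_prod v x')) * (rest_prod u y * cnj (rest_prod u y'))))"
proof -
  have "trace (X ** compress (weight v u) last_labels \<rho>) = (\<Sum>x\<in>UNIV. \<Sum>y\<in>UNIV. \<Sum>x'\<in>UNIV. \<Sum>y'\<in>UNIV.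
     X $ (x last_block, y last_block) $ (x' last_block, y' last_block) * \<rho> $ (x', y') $ (x, y) *
     ((rest_prod v x * cnj (rest_prod v x')) * (rest_prod u y * cnj (rest_prod u y'))))"
    unfolding trace_compress sum_UNIV_prod last_labels_def weight_def by (simp add: mult_ac)
  also have "\<dots> = (\<Sum>x\<in>UNIV. \<Sum>x'\<in>UNIV. \<Sum>y\<in>UNIV. \<Sum>y'\<in>UNIV.
     X $ (x last_block, y last_block) $ (x' last_block, y' last_block) * \<rho> $ (x', y') $ (x, y) *
     ((rest_prod v x * cnj (rest_prod v x')) * (rest_prod u y * cnj (rest_prod u y'))))"
    by (intro sum.cong refl sum.swap)
  finally show ?thesis .
qed

section \<open>Evaluation of the averages on a Bose-symmetric operator\<close>

definition sym_under :: "(('n \<Rightarrow> 'n) \<Rightarrow> bool) \<Rightarrow> (('n::finite \<Rightarrow> 'k::finite) \<times> ('n \<Rightarrow> 'k)) cop \<Rightarrow> bool" where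
  "sym_under P \<rho> \<longleftrightarrow> (\<forall>\<pi> x y z. P \<pi> \<longrightarrow> \<rho> $ (x \<circ> \<pi>, y) $ z = \<rho> $ (x, y) $ z \<and> \<rho> $ (x, y \<circ> \<pi>) $ z = \<rho> $ (x, y) $ z)"

text \<open>The trace of \<rho> against X on the last pair of blocks and the identity on all
  others.\<close>

definition last_trace :: "('k \<times> 'k) cop \<Rightarrow> (('n::{finite,linorder} \<Rightarrow> 'k::finite) \<times> ('n \<Rightarrow> 'k)) cop \<Rightarrow> complex" where
  "last_trace X \<rho> = (\<Sum>x\<in>UNIV. \<Sum>y\<in>UNIV. \<Sum>s\<in>UNIV. \<Sum>t\<in>UNIV.
     X $ (x last_block, y last_block) $ (s, t) * \<rho> $ (x(last_block := s), y(last_block := t)) $ (x, y))"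

lemma sum4_rearrange: "(\<Sum>x\<in>A. \<Sum>x'\<in>B. \<Sum>y\<in>C. \<Sum>y'\<in>D. f x x' y y') = (\<Sum>x\<in>A. \<Sum>y\<in>C. \<Sum>x'\<in>B. \<Sum>y'\<in>D. f x x' y y')"
  by (intro sum.cong refl sum.swap)

text \<open>On either side the summed-out kernel acts on the remaining blocks as the scalar of
  \<open>sum_vary_wick\<close>, because \<rho> is symmetric there; this is the average of the
  expectation of X in the conditioned operator.\<close>

lemma wick_eval_11:
  fixes \<rho> :: "(('n::{finite,linorder} \<Rightarrow> 'k::finite) \<times> ('n \<Rightarrow> 'k)) cop"
  assumes sym: "sym_under (\<lambda>\<pi>. \<pi> permutes UNIV) \<rho>"
  shows "(\<Sum>x\<in>UNIV. \<Sum>x'\<in>UNIV. \<Sum>y\<in>UNIV. \<Sum>y'\<in>UNIV.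
     X $ (x last_block, y last_block) $ (x' last_block, y' last_block) * \<rho> $ (x', y') $ (x, y) *
     (vary last_block wick x x' * vary last_block wick y y'))
   = (of_nat (CARD('n) - 1 + CARD('k)) * fact (CARD('n) - 1))\<^sup>2 * last_trace X \<rho>"
proof -
  let ?L = "last_block :: 'n"
  let ?c = "of_nat (CARD('n) - 1 + CARD('k)) * fact (CARD('n) - 1) :: complex"
  have s: "\<rho> $ (x \<circ> \<pi>, y) $ z = \<rho> $ (x, y) $ z" "\<rho> $ (x, y \<circ> \<pi>) $ z = \<rho> $ (x, y) $ z" if "\<pi> permutes (UNIV - {?L})" for x y z \<pi>
    using sym permutes_subset[OF that, of UNIV] unfolding sym_under_def by blast+
  have L: "\<pi> ?L = ?L" if "\<pi> permutes (UNIV - {?L})" for \<pi>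
    using that by (simp add: permutes_not_in)
  have "(\<Sum>x\<in>UNIV. \<Sum>x'\<in>UNIV. \<Sum>y\<in>UNIV. \<Sum>y'\<in>UNIV.
     X $ (x ?L, y ?L) $ (x' ?L, y' ?L) * \<rho> $ (x', y') $ (x, y) * (vary ?L wick x x' * vary ?L wick y y'))
   = (\<Sum>x\<in>UNIV. \<Sum>y\<in>UNIV. \<Sum>x'\<in>UNIV. vary ?L wick x x' * (\<Sum>y'\<in>UNIV. vary ?L wick y y' *
       (X $ (x ?L, y ?L) $ (x' ?L, y' ?L) * \<rho> $ (x', y') $ (x, y))))"
    by (subst sum4_rearrange) (simp add: sum_distrib_left mult_ac)
  also have "\<dots> = (\<Sum>x\<in>UNIV. \<Sum>y\<in>UNIV. \<Sum>x'\<in>UNIV. vary ?L wick x x' * (?c * (\<Sum>t\<in>UNIV.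
       X $ (x ?L, y ?L) $ (x' ?L, t) * \<rho> $ (x', y(?L := t)) $ (x, y))))"
  proof (rule sum.cong[OF refl], rule sum.cong[OF refl], rule sum.cong[OF refl], rule arg_cong[where f = "(*) _"])
    fix x y x'
    show "(\<Sum>y'\<in>UNIV. vary ?L wick y y' * (X $ (x ?L, y ?L) $ (x' ?L, y' ?L) * \<rho> $ (x', y') $ (x, y)))
      = ?c * (\<Sum>t\<in>UNIV. X $ (x ?L, y ?L) $ (x' ?L, t) * \<rho> $ (x', y(?L := t)) $ (x, y))"
      using sum_vary_wick[of ?L "\<lambda>y'. X $ (x ?L, y ?L) $ (x' ?L, y' ?L) * \<rho> $ (x', y') $ (x, y)" y]
      by (simp add: s L)
  qed
  also have "\<dots> = (\<Sum>x\<in>UNIV. \<Sum>y\<in>UNIV. ?c * (\<Sum>x'\<in>UNIV. vary ?L wick x x' * (\<Sum>t\<in>UNIV.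
       X $ (x ?L, y ?L) $ (x' ?L, t) * \<rho> $ (x', y(?L := t)) $ (x, y))))"
    by (simp add: sum_distrib_left mult_ac)
  also have "\<dots> = (\<Sum>x\<in>UNIV. \<Sum>y\<in>UNIV. ?c * (?c * (\<Sum>s\<in>UNIV. \<Sum>t\<in>UNIV.
       X $ (x ?L, y ?L) $ (s, t) * \<rho> $ (x(?L := s), y(?L := t)) $ (x, y))))"
  proof (rule sum.cong[OF refl], rule sum.cong[OF refl], rule arg_cong[where f = "(*) _"])
    fix x y
    show "(\<Sum>x'\<in>UNIV. vary ?L wick x x' * (\<Sum>t\<in>UNIV. X $ (x ?L, y ?L) $ (x' ?L, t) * \<rho> $ (x', y(?L := t)) $ (x, y)))
      = ?c * (\<Sum>s\<in>UNIV. \<Sum>t\<in>UNIV. X $ (x ?L, y ?L) $ (s, t) * \<rho> $ (x(?L := s), y(?L := t)) $ (x, y))"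
      using sum_vary_wick[of ?L "\<lambda>x'. \<Sum>t\<in>UNIV. X $ (x ?L, y ?L) $ (x' ?L, t) * \<rho> $ (x', y(?L := t)) $ (x, y)" x]
      by (simp add: s L)
  qed
  finally show ?thesis unfolding last_trace_def power2_eq_square mult.assoc sum_distrib_left .
qed

text \<open>The indicator is the identity on the last block and selects the one summand that leaves
  x unchanged.\<close>

lemma sum_vary_wick_diag:
  fixes x :: "'n::{finite,linorder} \<Rightarrow> 'k::finite"
  assumes h: "\<And>\<pi> y. \<pi> permutes UNIV \<Longrightarrow> h (y \<circ> \<pi>) = h y"
  shows "(\<Sum>x'\<in>UNIV. vary last_block wick x x' * ((if x last_block = x' last_block then 1 else 0) * h x'))
    = of_nat (CARD('n) - 1 + CARD('k)) * fact (CARD('n) - 1) * h x"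
proof -
  let ?L = "last_block :: 'n"
  have "(if x ?L = (y \<circ> \<pi>) ?L then 1 else 0) * h (y \<circ> \<pi>) = (if x ?L = y ?L then 1 else 0) * h y"
    if "\<pi> permutes (UNIV - {?L})" for \<pi> y
  proof -
    have "\<pi> ?L = ?L" using that by (simp add: permutes_not_in)
    then show ?thesis using h[OF permutes_subset[OF that, of UNIV]] by simp
  qed
  from sum_vary_wick[of ?L "\<lambda>x'. (if x ?L = x' ?L then 1 else 0) * h x'" x, OF this]
  show ?thesis by (simp add: sum_mult_if_eq)
qed

text \<open>One side is projected on all n blocks and contributes the full factorial, the other only
  on n - 1 blocks.\<close>

lemma wick_eval_21:
  fixes \<rho> :: "(('n::{finite,linorder} \<Rightarrow> 'k::finite) \<times> ('n \<Rightarrow> 'k)) cop"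
  assumes sym: "sym_under (\<lambda>\<pi>. \<pi> permutes UNIV) \<rho>"
  shows "(\<Sum>x\<in>UNIV. \<Sum>x'\<in>UNIV. \<Sum>y\<in>UNIV. \<Sum>y'\<in>UNIV.
     (if y last_block = y' last_block then 1 else 0) * \<rho> $ (x', y') $ (x, y) * (wick x x' * vary last_block wick y y'))
   = of_nat (CARD('n) - 1 + CARD('k)) * fact (CARD('n) - 1) * fact CARD('n) * trace \<rho>"
proof -
  let ?L = "last_block :: 'n"
  let ?c = "of_nat (CARD('n) - 1 + CARD('k)) * fact (CARD('n) - 1) :: complex"
  have s: "\<rho> $ (x \<circ> \<pi>, y) $ z = \<rho> $ (x, y) $ z" "\<rho> $ (x, y \<circ> \<pi>) $ z = \<rho> $ (x, y) $ z" if "\<pi> permutes UNIV" for x y z \<pi>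
    using sym that unfolding sym_under_def by blast+
  have wa: "(\<Sum>x'\<in>UNIV. wick x x' * \<rho> $ (x', y) $ z) = fact CARD('n) * \<rho> $ (x, y) $ z" for x y z
    by (rule sum_wick_symmetric) (rule s)
  have wb: "(\<Sum>y'\<in>UNIV. wick y y' * \<rho> $ (x, y') $ z) = fact CARD('n) * \<rho> $ (x, y) $ z" for x y z
    by (rule sum_wick_symmetric) (rule s)
  have "(\<Sum>x\<in>UNIV. \<Sum>x'\<in>UNIV. \<Sum>y\<in>UNIV. \<Sum>y'\<in>UNIV.
     (if y ?L = y' ?L then 1 else 0) * \<rho> $ (x', y') $ (x, y) * (wick x x' * vary ?L wick y y'))
   = (\<Sum>x\<in>UNIV. \<Sum>y\<in>UNIV. \<Sum>x'\<in>UNIV. wick x x' * (\<Sum>y'\<in>UNIV. vary ?L wick y y' *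
      ((if y ?L = y' ?L then 1 else 0) * \<rho> $ (x', y') $ (x, y))))"
    by (subst sum4_rearrange) (simp add: sum_distrib_left mult_ac)
  also have "\<dots> = (\<Sum>x\<in>UNIV. \<Sum>y\<in>UNIV. ?c * (\<Sum>x'\<in>UNIV. wick x x' * \<rho> $ (x', y) $ (x, y)))"
  proof -
    have "(\<Sum>y'\<in>UNIV. vary ?L wick y y' * ((if y ?L = y' ?L then 1 else 0) * \<rho> $ (x', y') $ z)) = ?c * \<rho> $ (x', y) $ z" for x' y z
      by (rule sum_vary_wick_diag) (rule s)
    then show ?thesis by (simp add: sum_distrib_left mult_ac)
  qed
  also have "\<dots> = (\<Sum>x\<in>UNIV. \<Sum>y\<in>UNIV. ?c * (fact CARD('n) * \<rho> $ (x, y) $ (x, y)))"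
    unfolding wa ..
  finally show ?thesis by (simp add: trace_nth sum_UNIV_prod sum_distrib_left mult.assoc)
qed

lemma wick_eval_12:
  fixes \<rho> :: "(('n::{finite,linorder} \<Rightarrow> 'k::finite) \<times> ('n \<Rightarrow> 'k)) cop"
  assumes sym: "sym_under (\<lambda>\<pi>. \<pi> permutes UNIV) \<rho>"
  shows "(\<Sum>x\<in>UNIV. \<Sum>x'\<in>UNIV. \<Sum>y\<in>UNIV. \<Sum>y'\<in>UNIV.
     (if x last_block = x' last_block then 1 else 0) * \<rho> $ (x', y') $ (x, y) * (vary last_block wick x x' * wick y y'))
   = of_nat (CARD('n) - 1 + CARD('k)) * fact (CARD('n) - 1) * fact CARD('n) * trace \<rho>"
proof -
  let ?L = "last_block :: 'n"
  let ?c = "of_nat (CARD('n) - 1 + CARD('k)) * fact (CARD('n) - 1) :: complex"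
  have s: "\<rho> $ (x \<circ> \<pi>, y) $ z = \<rho> $ (x, y) $ z" "\<rho> $ (x, y \<circ> \<pi>) $ z = \<rho> $ (x, y) $ z" if "\<pi> permutes UNIV" for x y z \<pi>
    using sym that unfolding sym_under_def by blast+
  have wa: "(\<Sum>x'\<in>UNIV. wick x x' * \<rho> $ (x', y) $ z) = fact CARD('n) * \<rho> $ (x, y) $ z" for x y z
    by (rule sum_wick_symmetric) (rule s)
  have wb: "(\<Sum>y'\<in>UNIV. wick y y' * \<rho> $ (x, y') $ z) = fact CARD('n) * \<rho> $ (x, y) $ z" for x y z
    by (rule sum_wick_symmetric) (rule s)
  have "(\<Sum>x\<in>UNIV. \<Sum>x'\<in>UNIV. \<Sum>y\<in>UNIV. \<Sum>y'\<in>UNIV.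
     (if x ?L = x' ?L then 1 else 0) * \<rho> $ (x', y') $ (x, y) * (vary ?L wick x x' * wick y y'))
   = (\<Sum>x\<in>UNIV. \<Sum>y\<in>UNIV. \<Sum>x'\<in>UNIV. vary ?L wick x x' * ((if x ?L = x' ?L then 1 else 0) *
      (\<Sum>y'\<in>UNIV. wick y y' * \<rho> $ (x', y') $ (x, y))))"
    by (subst sum4_rearrange) (simp add: sum_distrib_left mult_ac)
  also have "\<dots> = (\<Sum>x\<in>UNIV. \<Sum>y\<in>UNIV. \<Sum>x'\<in>UNIV. vary ?L wick x x' * ((if x ?L = x' ?L then 1 else 0) *
      (fact CARD('n) * \<rho> $ (x', y) $ (x, y))))"
    unfolding wb ..
  also have "\<dots> = (\<Sum>x\<in>UNIV. \<Sum>y\<in>UNIV. ?c * (fact CARD('n) * \<rho> $ (x, y) $ (x, y)))"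
  proof -
    have "(\<Sum>x'\<in>UNIV. vary ?L wick x x' * ((if x ?L = x' ?L then 1 else 0) * (fact CARD('n) * \<rho> $ (x', y) $ z)))
      = ?c * (fact CARD('n) * \<rho> $ (x, y) $ z)" for x y z
      by (rule sum_vary_wick_diag) (simp add: s)
    then show ?thesis by simp
  qed
  finally show ?thesis by (simp add: trace_nth sum_UNIV_prod sum_distrib_left mult.assoc)
qed

lemma wick_eval_22:
  fixes \<rho> :: "(('n::{finite,linorder} \<Rightarrow> 'k::finite) \<times> ('n \<Rightarrow> 'k)) cop"
  assumes sym: "sym_under (\<lambda>\<pi>. \<pi> permutes UNIV) \<rho>"
  shows "(\<Sum>x\<in>UNIV. \<Sum>x'\<in>UNIV. \<Sum>y\<in>UNIV. \<Sum>y'\<in>UNIV. \<rho> $ (x', y') $ (x, y) * (wick x x' * wick y y'))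
   = (fact CARD('n))\<^sup>2 * trace \<rho>"
proof -
  have s: "\<rho> $ (x \<circ> \<pi>, y) $ z = \<rho> $ (x, y) $ z" "\<rho> $ (x, y \<circ> \<pi>) $ z = \<rho> $ (x, y) $ z" if "\<pi> permutes UNIV" for x y z \<pi>
    using sym that unfolding sym_under_def by blast+
  have wa: "(\<Sum>x'\<in>UNIV. wick x x' * \<rho> $ (x', y) $ z) = fact CARD('n) * \<rho> $ (x, y) $ z" for x y z
    by (rule sum_wick_symmetric) (rule s)
  have wb: "(\<Sum>y'\<in>UNIV. wick y y' * \<rho> $ (x, y') $ z) = fact CARD('n) * \<rho> $ (x, y) $ z" for x y z
    by (rule sum_wick_symmetric) (rule s)
  have "(\<Sum>x\<in>UNIV. \<Sum>x'\<in>UNIV. \<Sum>y\<in>UNIV. \<Sum>y'\<in>UNIV. \<rho> $ (x', y') $ (x, y) * (wick x x' * wick y y'))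
   = (\<Sum>x\<in>UNIV. \<Sum>y\<in>UNIV. \<Sum>x'\<in>UNIV. wick x x' * (\<Sum>y'\<in>UNIV. wick y y' * \<rho> $ (x', y') $ (x, y)))"
    by (subst sum4_rearrange) (simp add: sum_distrib_left mult_ac)
  also have "\<dots> = (\<Sum>x\<in>UNIV. \<Sum>y\<in>UNIV. \<Sum>x'\<in>UNIV. wick x x' * (fact CARD('n) * \<rho> $ (x', y) $ (x, y)))"
    unfolding wb ..
  also have "\<dots> = (\<Sum>x\<in>UNIV. \<Sum>y\<in>UNIV. fact CARD('n) * (fact CARD('n) * \<rho> $ (x, y) $ (x, y)))"
    unfolding mult.left_commute[of "wick _ _" "fact CARD('n)"] sum_distrib_left[symmetric] wa ..
  finally show ?thesis by (simp add: trace_nth sum_UNIV_prod sum_distrib_left mult.assoc power2_eq_square)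
qed

lemma trace_kron_outer_left: "trace (kron (outer v) (mat 1) ** \<sigma>) = ses (ptrB \<sigma>) v v"
  and trace_kron_outer_right: "trace (kron (mat 1) (outer u) ** \<sigma>) = ses (ptrA \<sigma>) u u"
  and trace_kron_outer_both: "trace (kron (outer v) (outer u) ** \<sigma>) = ses \<sigma> (tv v u) (tv v u)"
proof -
  show "trace (kron (outer v) (mat 1) ** \<sigma>) = ses (ptrB \<sigma>) v v"
    "trace (kron (mat 1) (outer u) ** \<sigma>) = ses (ptrA \<sigma>) u u"
    unfolding trace_kron_1_right trace_kron_1_left trace_outer_mult by simp_all
  have "kron (outer v) (outer u) = outer (tv v u)" by (simp add: vec_eq_iff tv_def mult_ac)
  then show "trace (kron (outer v) (outer u) ** \<sigma>) = ses \<sigma> (tv v u) (tv v u)"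
    by (simp add: trace_outer_mult)
qed

text \<open>The inequality for the conditioned operators, averaged. Up to a common scale the
  averages of w, a, b and c in \<open>trace_le_product_unnormalized\<close> are 1, 1 - \<epsilon>, 1
  - \<epsilon> and (1 - \<epsilon>)^2, so that w - a becomes \<epsilon> and w - a - b + c becomes
  \<epsilon>^2.\<close>

lemma de_finetti_last_trace:
  fixes \<rho> :: "(('n::{finite,linorder} \<Rightarrow> 'k::finite) \<times> ('n \<Rightarrow> 'k)) cop" and X :: "('k \<times> 'k) cop"
  assumes psdX: "psd X" and X_le: "\<And>x. Re (ses X x x) \<le> K * nsq x"
    and \<rho>: "psd \<rho>" "trace \<rho> = 1" and sym: "sym_under (\<lambda>\<pi>. \<pi> permutes UNIV) \<rho>" and \<eta>: "\<eta> > 0"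
    and F: "\<And>v u. Re (trace (X ** kron (ptrB (compress (weight v u) last_labels \<rho>)) (ptrA (compress (weight v u) last_labels \<rho>))))
      \<le> F * (Re (trace (compress (weight v u) last_labels \<rho>)))\<^sup>2"
    and \<epsilon>: "\<epsilon> = (real CARD('k) - 1) / (real CARD('n) - 1 + real CARD('k))"
  shows "Re (last_trace X \<rho>) \<le> F + 2 * K * (\<eta> + \<epsilon>\<^sup>2 / \<eta> + 6 * \<epsilon>)"
proof -
  let ?L = "last_block :: 'n"
  \<comment> \<open>The coefficients of w, of a and b (these with a minus sign) and of c in the
    expanded right-hand side of \<open>trace_le_product_unnormalized\<close>.\<close>
  define \<kappa>w where "\<kappa>w = F + 2 * K * (\<eta> + 1 / \<eta> + 6)"
  define \<kappa>a where "\<kappa>a = 2 * K * (1 / \<eta> + 3)"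
  define \<kappa>c where "\<kappa>c = 2 * K / \<eta>"
  define s11 where "s11 Y P Q = (\<Sum>x\<in>UNIV. \<Sum>x'\<in>UNIV. \<Sum>y\<in>UNIV. \<Sum>y'\<in>UNIV.
     Y $ (x ?L, y ?L) $ (x' ?L, y' ?L) * \<rho> $ (x', y') $ (x, y) * (P x x' * Q y y'))"
    for Y :: "('k \<times> 'k) cop" and P Q :: "('n \<Rightarrow> 'k) \<Rightarrow> ('n \<Rightarrow> 'k) \<Rightarrow> complex"
  define s21 where "s21 p Q = (\<Sum>x\<in>UNIV. \<Sum>x'\<in>UNIV. \<Sum>y\<in>UNIV. \<Sum>y'\<in>UNIV.
     (if y ?L = y' ?L then 1 else 0) * \<rho> $ (x', y') $ (x, y) * (p x x' * Q y y'))"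
    for p Q :: "('n \<Rightarrow> 'k) \<Rightarrow> ('n \<Rightarrow> 'k) \<Rightarrow> complex"
  define s12 where "s12 P q = (\<Sum>x\<in>UNIV. \<Sum>x'\<in>UNIV. \<Sum>y\<in>UNIV. \<Sum>y'\<in>UNIV.
     (if x ?L = x' ?L then 1 else 0) * \<rho> $ (x', y') $ (x, y) * (P x x' * q y y'))"
    for P q :: "('n \<Rightarrow> 'k) \<Rightarrow> ('n \<Rightarrow> 'k) \<Rightarrow> complex"
  define s22 where "s22 p q = (\<Sum>x\<in>UNIV. \<Sum>x'\<in>UNIV. \<Sum>y\<in>UNIV. \<Sum>y'\<in>UNIV. \<rho> $ (x', y') $ (x, y) * (p x x' * q y y'))"
    for p q :: "('n \<Rightarrow> 'k) \<Rightarrow> ('n \<Rightarrow> 'k) \<Rightarrow> complex"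
  let ?a11 = "\<lambda>x x' y y'. (of_real \<kappa>w * mat 1 $ (x ?L, y ?L) $ (x' ?L, y' ?L) - X $ (x ?L, y ?L) $ (x' ?L, y' ?L)) * \<rho> $ (x', y') $ (x, y)"
  let ?a21 = "\<lambda>x x' y y'. - (of_real \<kappa>a * (if y ?L = y' ?L then 1 else 0) * \<rho> $ (x', y') $ (x, y))"
  let ?a12 = "\<lambda>x x' y y'. - (of_real \<kappa>a * (if x ?L = x' ?L then 1 else 0) * \<rho> $ (x', y') $ (x, y))"
  let ?a22 = "\<lambda>x x' y y'. of_real \<kappa>c * \<rho> $ (x', y') $ (x, y)"
  have split: "(\<Sum>x\<in>UNIV. \<Sum>x'\<in>UNIV. \<Sum>y\<in>UNIV. \<Sum>y'\<in>UNIV.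
      ?a11 x x' y y' * (P x x' * Q y y') + ?a21 x x' y y' * (p x x' * Q y y')
    + ?a12 x x' y y' * (P x x' * q y y') + ?a22 x x' y y' * (p x x' * q y y'))
    = of_real \<kappa>w * s11 (mat 1) P Q - s11 X P Q - of_real \<kappa>a * s21 p Q - of_real \<kappa>a * s12 P q + of_real \<kappa>c * s22 p q"
    for p P q Q :: "('n \<Rightarrow> 'k) \<Rightarrow> ('n \<Rightarrow> 'k) \<Rightarrow> complex"
    unfolding s11_def s21_def s12_def s22_def sum_distrib_left sum_subtractf[symmetric] sum.distrib[symmetric]
    by (intro sum.cong refl) (simp only: diff_conv_add_uminus distrib_right mult_minus_left mult.assoc)
  have pos: "0 \<le> Re (of_real \<kappa>w * s11 (mat 1) P Q - s11 X P Q - of_real \<kappa>a * s21 p Q - of_real \<kappa>a * s12 P q + of_real \<kappa>c * s22 p q)"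
    if "p = mono_full v" "P = vary ?L (mono_full v)" "q = mono_full u" "Q = vary ?L (mono_full u)" for p P q Q v u
  proof -
    define \<sigma> where "\<sigma> = compress (weight v u) last_labels \<rho>"
    have s11: "s11 Y P Q = of_real (nsq v * nsq u) * trace (Y ** \<sigma>)" for Y
      unfolding s11_def that vary_mono_full \<sigma>_def trace_compress_weight sum_distrib_left of_real_mult
      by (intro sum.cong refl) (simp only: mult_ac)
    have s21: "s21 p Q = of_real (nsq u) * trace (kron (outer v) (mat 1) ** \<sigma>)"
      unfolding s21_def that vary_mono_full mono_full_rest \<sigma>_def trace_compress_weight sum_distrib_left kron_nth outer_nth mat_def vec_lambda_beta fst_conv snd_conv
      by (intro sum.cong refl) (simp only: mult_ac)
    have s12: "s12 P q = of_real (nsq v) * trace (kron (mat 1) (outer u) ** \<sigma>)"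
      unfolding s12_def that vary_mono_full mono_full_rest \<sigma>_def trace_compress_weight sum_distrib_left kron_nth outer_nth mat_def vec_lambda_beta fst_conv snd_conv
      by (intro sum.cong refl) (simp only: mult_ac)
    have s22: "s22 p q = trace (kron (outer v) (outer u) ** \<sigma>)"
      unfolding s22_def that mono_full_rest \<sigma>_def trace_compress_weight kron_nth outer_nth fst_conv snd_conv
      by (intro sum.cong refl) (simp only: mult_ac)
    have \<sigma>: "psd \<sigma>" unfolding \<sigma>_def by (rule psd_compress[OF \<rho>(1)])
    \<comment> \<open>The vectors on which the other blocks were projected are also the reference
      vectors for the last pair.\<close>
    note le = trace_le_product_unnormalized[OF psdX X_le \<sigma> \<eta> F[of v u, folded \<sigma>_def], of v u]
    have "Re (of_real \<kappa>w * s11 (mat 1) P Q - s11 X P Q - of_real \<kappa>a * s21 p Q - of_real \<kappa>a * s12 P q + of_real \<kappa>c * s22 p q)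
      = \<kappa>w * (nsq v * nsq u * Re (trace \<sigma>)) - nsq v * nsq u * Re (trace (X ** \<sigma>))
        - \<kappa>a * (nsq u * Re (ses (ptrB \<sigma>) v v)) - \<kappa>a * (nsq v * Re (ses (ptrA \<sigma>) u u)) + \<kappa>c * Re (ses \<sigma> (tv v u) (tv v u))"
      unfolding s11 s21 s12 s22 trace_kron_outer_left trace_kron_outer_right trace_kron_outer_both matrix_mul_lid
      by (simp add: mult.assoc)
    also have "\<dots> \<ge> 0"
      using le unfolding \<kappa>w_def \<kappa>a_def \<kappa>c_def by (simp add: algebra_simps diff_divide_distrib add_divide_distrib)
    finally show ?thesis .
  qed
  let ?c = "(of_nat (CARD('n) - 1 + CARD('k)) * fact (CARD('n) - 1)) :: complex"
  define c where "c = real (CARD('n) - 1 + CARD('k)) * fact (CARD('n) - 1)"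
  define f where "f = (fact CARD('n) :: real)"
  have c: "?c = of_real c" and f: "(fact CARD('n) :: complex) = of_real f"
    unfolding c_def f_def by simp_all
  have "0 \<le> Re (\<Sum>x\<in>UNIV. \<Sum>x'\<in>UNIV. \<Sum>y\<in>UNIV. \<Sum>y'\<in>UNIV.
      ?a11 x x' y y' * (vary ?L wick x x' * vary ?L wick y y') + ?a21 x x' y y' * (wick x x' * vary ?L wick y y')
    + ?a12 x x' y y' * (vary ?L wick x x' * wick y y') + ?a22 x x' y y' * (wick x x' * wick y y'))"
    by (rule wick_vary_nonneg2) (unfold split, rule pos[OF refl refl refl refl])
  also have "(\<Sum>x\<in>UNIV. \<Sum>x'\<in>UNIV. \<Sum>y\<in>UNIV. \<Sum>y'\<in>UNIV.
      ?a11 x x' y y' * (vary ?L wick x x' * vary ?L wick y y') + ?a21 x x' y y' * (wick x x' * vary ?L wick y y')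
    + ?a12 x x' y y' * (vary ?L wick x x' * wick y y') + ?a22 x x' y y' * (wick x x' * wick y y'))
    = of_real \<kappa>w * (?c\<^sup>2 * last_trace (mat 1) \<rho>) - ?c\<^sup>2 * last_trace X \<rho> - of_real \<kappa>a * (?c * fact CARD('n)) - of_real \<kappa>a * (?c * fact CARD('n))
       + of_real \<kappa>c * (fact CARD('n))\<^sup>2"
    unfolding split unfolding s11_def s21_def s12_def s22_def wick_eval_11[OF sym] wick_eval_21[OF sym] wick_eval_12[OF sym] wick_eval_22[OF sym] \<rho>(2) mult_1_right ..
  also have "last_trace (mat 1) \<rho> = 1"
  proof -
    have "(\<Sum>s\<in>UNIV. \<Sum>t\<in>UNIV. (mat 1 :: ('k \<times> 'k) cop) $ (x ?L, y ?L) $ (s, t) * \<rho> $ (x(?L := s), y(?L := t)) $ (x, y)) = \<rho> $ (x, y) $ (x, y)" for x y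
    proof -
      have "(\<Sum>t\<in>UNIV. (mat 1 :: ('k \<times> 'k) cop) $ (x ?L, y ?L) $ (s, t) * \<rho> $ (x(?L := s), y(?L := t)) $ (x, y))
        = (if x ?L = s then \<rho> $ (x(?L := s), y) $ (x, y) else 0)" for s
      proof -
        have "(mat 1 :: ('k \<times> 'k) cop) $ (x ?L, y ?L) $ (s, t) * \<rho> $ (x(?L := s), y(?L := t)) $ (x, y)
          = (if y ?L = t then if x ?L = s then \<rho> $ (x(?L := s), y(?L := t)) $ (x, y) else 0 else 0)" for t
          by (simp add: mat_def)
        then show ?thesis by simp
      qed
      then show ?thesis by simp
    qed
    then show ?thesis using \<rho>(2) unfolding last_trace_def trace_nth sum_UNIV_prod by simp
  qed
  finally have "0 \<le> \<kappa>w * c\<^sup>2 - c\<^sup>2 * Re (last_trace X \<rho>) - 2 * \<kappa>a * (c * f) + \<kappa>c * f\<^sup>2"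
    unfolding c f of_real_mult[symmetric] of_real_power[symmetric] mult_1_right
    by simp
  moreover have cpos: "c > 0"
  proof -
    have "CARD('n) - 1 + CARD('k) > 0" by (simp only: add_gr_0 zero_less_card_finite simp_thms)
    then have "real (CARD('n) - 1 + CARD('k)) > 0" by (simp only: of_nat_0_less_iff)
    then show ?thesis unfolding c_def by (rule mult_pos_pos) simp
  qed
  \<comment> \<open>The scalar of the full kernel over that of the summed-out one: the mean
    probability of finding a further block in the same coherent vector.\<close>
  define r where "r = f / c"
  have fr: "f = r * c" using cpos by (simp add: r_def)
  have "\<kappa>w * c\<^sup>2 - c\<^sup>2 * Re (last_trace X \<rho>) - 2 * \<kappa>a * (c * f) + \<kappa>c * f\<^sup>2
     = c\<^sup>2 * (\<kappa>w - Re (last_trace X \<rho>) - 2 * \<kappa>a * r + \<kappa>c * r\<^sup>2)"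
    unfolding fr by (simp add: algebra_simps power2_eq_square)
  ultimately have "0 \<le> c\<^sup>2 * (\<kappa>w - Re (last_trace X \<rho>) - 2 * \<kappa>a * r + \<kappa>c * r\<^sup>2)" by simp
  then have "Re (last_trace X \<rho>) \<le> \<kappa>w - 2 * \<kappa>a * r + \<kappa>c * r\<^sup>2"
    using cpos by (simp add: zero_le_mult_iff)
  also have "r = 1 - \<epsilon>"
  proof -
    have n: "real (CARD('n) - 1) = real CARD('n) - 1" by (simp add: of_nat_diff Suc_le_eq)
    have ff: "f = real CARD('n) * fact (CARD('n) - 1)" unfolding f_def by (rule fact_reduce) simp
    define d where "d = real CARD('n) - 1 + real CARD('k)"
    have "real CARD('n) \<ge> 1" "real CARD('k) \<ge> 1" by (simp_all add: Suc_le_eq)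
    then have d: "d > 0" unfolding d_def by linarith
    have "r = real CARD('n) / d" unfolding r_def c_def ff of_nat_add n d_def by simp
    also have "\<dots> = (d - (real CARD('k) - 1)) / d" by (simp add: d_def)
    also have "\<dots> = 1 - \<epsilon>" unfolding \<epsilon> d_def[symmetric] using d by (simp add: diff_divide_distrib)
    finally show ?thesis .
  qed
  also have "\<kappa>w - 2 * \<kappa>a * (1 - \<epsilon>) + \<kappa>c * (1 - \<epsilon>)\<^sup>2 = F + 2 * K * (\<eta> + \<epsilon>\<^sup>2 / \<eta> + 6 * \<epsilon>)"
    unfolding \<kappa>w_def \<kappa>a_def \<kappa>c_def using \<eta> by (simp add: field_simps power2_eq_square)
  finally show ?thesis .
qed

section \<open>The channel constraints survive the conditioning\<close>

lemma psd_drop_copies: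
  fixes A :: "('p::finite, 'l::finite) block cop"
  assumes "psd A"
  shows "psd (drop_copies A)"
proof -
  obtain T :: "('p, 'l) block \<Rightarrow> ('p, 'l) block \<Rightarrow> complex" where T: "\<And>i j. A $ i $ j = (\<Sum>k\<in>UNIV. T i k * cnj (T j k))"
    using psd_factor[OF assms] by blast
  have "drop_copies A $ r $ s = (\<Sum>j\<in>UNIV. T (fst r, fst j, snd r, fst (snd j)) (snd (snd j)) * cnj (T (fst s, fst j, snd s, fst (snd j)) (snd (snd j))))" for r s
    unfolding drop_copies_def by (simp add: T sum.cartesian_product case_prod_beta)
  then show ?thesis by (rule psd_factorI)
qed

lemma sum_last_labels:
  fixes f :: "('n::{finite,linorder} \<Rightarrow> 'k::finite) \<times> ('n \<Rightarrow> 'k) \<Rightarrow> complex"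
  shows "(\<Sum>z\<in>UNIV. (if last_labels z = (s, t) then 1 else 0) * f z)
     = (\<Sum>(x, y)\<in>rest_funs last_block \<times> rest_funs last_block. f (x(last_block := s), y(last_block := t)))"
proof -
  let ?L = "last_block :: 'n"
  have "(\<Sum>z\<in>UNIV. (if last_labels z = (s, t) then 1 else 0) * f z)
     = (\<Sum>x\<in>rest_funs ?L. \<Sum>s'\<in>UNIV. \<Sum>y\<in>rest_funs ?L. \<Sum>t'\<in>UNIV. (if s' = s then 1 else 0) * ((if t' = t then 1 else 0) * f (x(?L := s'), y(?L := t'))))"
    unfolding sum_UNIV_prod sum_rest_funs[of _ ?L] last_labels_def by (intro sum.cong refl) simp
  also have "\<dots> = (\<Sum>x\<in>rest_funs ?L. \<Sum>y\<in>rest_funs ?L. f (x(?L := s), y(?L := t)))"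
    unfolding sum_distrib_left[symmetric] sum_mult_if_eq ..
  finally show ?thesis by (simp add: sum.cartesian_product)
qed

text \<open>Separates the labels of the last pair from the others, on which alone the weights
  depend, so that the channel constraints can be applied inside the sum.\<close>

lemma compress_weight_nth:
  fixes \<rho> :: "(('n::{finite,linorder} \<Rightarrow> 'k::finite) \<times> ('n \<Rightarrow> 'k)) cop"
  defines "R \<equiv> rest_funs (last_block :: 'n)"
  shows "compress (weight v u) last_labels \<rho> $ (s, t) $ (s', t') = (\<Sum>(z, z')\<in>(R \<times> R) \<times> (R \<times> R).
     cnj (weight v u z) * weight v u z' * \<rho> $ ((fst z)(last_block := s), (snd z)(last_block := t)) $ ((fst z')(last_block := s'), (snd z')(last_block := t')))"
proof -
  have "compress (weight v u) last_labels \<rho> $ (s, t) $ (s', t') = (\<Sum>z\<in>UNIV. (if last_labels z = (s, t) then 1 else 0) *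
     (\<Sum>z'\<in>UNIV. (if last_labels z' = (s', t') then 1 else 0) * (cnj (weight v u z) * \<rho> $ z $ z' * weight v u z')))"
    unfolding compress_def by (simp add: sum_distrib_left mult.assoc)
  also have "\<dots> = (\<Sum>(x, y)\<in>R \<times> R. \<Sum>(x', y')\<in>R \<times> R. cnj (weight v u (x, y)) * \<rho> $ (x(last_block := s), y(last_block := t)) $ (x'(last_block := s'), y'(last_block := t')) * weight v u (x', y'))"
    unfolding sum_last_labels R_def weight_def fst_conv snd_conv rest_prod_upd ..
  finally show ?thesis by (simp add: sum.cartesian_product case_prod_beta mult_ac)
qed

lemma trace_compress_weight_nth:
  "trace (compress \<gamma> l \<rho>) = (\<Sum>s\<in>UNIV. \<Sum>t\<in>UNIV. compress \<gamma> l \<rho> $ (s, t) $ (s, t))"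
  unfolding trace_nth sum_UNIV_prod ..

lemma sum_triple: "(\<Sum>(a, b, c)\<in>UNIV. f a b c) = (\<Sum>a\<in>UNIV. \<Sum>b\<in>UNIV. \<Sum>c\<in>UNIV. f a b c)"
  for f :: "'a::finite \<Rightarrow> 'b::finite \<Rightarrow> 'c::finite \<Rightarrow> complex"
  by (simp add: sum.cartesian_product case_prod_beta)

text \<open>The constraint holds for any labels of the other blocks on the two sides, equal or not,
  and therefore passes to every linear combination of such slices; the conditioned operator is
  one.\<close>

lemma constraint_a_compress:
  fixes \<rho> :: "('p::finite, 'l::finite, 'n::{finite,linorder}) sys cop"
  assumes a: "constraint_a \<rho>"
  shows "(\<Sum>l\<in>UNIV. drop_copies (ptrB (compress (weight v u) last_labels \<rho>)) $ (p, l) $ (p', l))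
    = (if p = p' then 1 / of_nat CARD('p) else 0) * trace (compress (weight v u) last_labels \<rho>)"
proof -
  let ?L = "last_block :: 'n"
  let ?\<sigma> = "compress (weight v u) last_labels \<rho>"
  let ?Q = "(rest_funs ?L \<times> rest_funs ?L) \<times> (rest_funs ?L \<times> rest_funs ?L) :: ((('n \<Rightarrow> ('p, 'l) block) \<times> ('n \<Rightarrow> ('p, 'l) block)) \<times> (('n \<Rightarrow> ('p, 'l) block) \<times> ('n \<Rightarrow> ('p, 'l) block))) set"
  define W where "W q = cnj (weight v u (fst q)) * weight v u (snd q)" for q :: "('p, 'l, 'n) sys \<times> ('p, 'l, 'n) sys"
  define r where "r q t s s' = \<rho> $ ((fst (fst q))(?L := s), (snd (fst q))(?L := t)) $ ((fst (snd q))(?L := s'), (snd (snd q))(?L := t))" for q t s s'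
  have \<sigma>: "?\<sigma> $ (s, t) $ (s', t) = (\<Sum>q\<in>?Q. W q * r q t s s')" for s s' t
    unfolding compress_weight_nth W_def r_def by (simp add: case_prod_beta)
  have ca: "(\<Sum>(l, pc, lc)\<in>UNIV. r q t (p, pc, l, lc) (p', pc, l, lc)) = (if p = p' then 1 / of_nat CARD('p) else 0) * (\<Sum>s\<in>UNIV. r q t s s)" for q t
  proof -
    have "(\<Sum>(l, pc, lc)\<in>UNIV. r q t (p, pc, l, lc) (p', pc, l, lc)) = (\<Sum>l\<in>UNIV. \<Sum>pc\<in>UNIV. \<Sum>lc\<in>UNIV. r q t (p, pc, l, lc) (p', pc, l, lc))"
      by (rule sum_triple)
    also have "\<dots> = (\<Sum>pc\<in>UNIV. \<Sum>l\<in>UNIV. \<Sum>lc\<in>UNIV. r q t (p, pc, l, lc) (p', pc, l, lc))" by (rule sum.swap)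
    also have "\<dots> = (mat 1 :: 'p cop) $ p $ p' / of_nat CARD('p) * (\<Sum>s\<in>UNIV. r q t s s)"
      using a unfolding constraint_a_def r_def by blast
    finally show ?thesis by (simp add: mat_def)
  qed
  have "(\<Sum>l\<in>UNIV. drop_copies (ptrB ?\<sigma>) $ (p, l) $ (p', l))
    = (\<Sum>(l, pc, lc)\<in>UNIV. \<Sum>t\<in>UNIV. \<Sum>q\<in>?Q. W q * r q t (p, pc, l, lc) (p', pc, l, lc))"
    unfolding sum_triple by (simp add: drop_copies_def ptrB_def \<sigma>)
  also have "\<dots> = (\<Sum>t\<in>UNIV. \<Sum>q\<in>?Q. \<Sum>c\<in>UNIV. W q * r q t (p, fst (snd c), fst c, snd (snd c)) (p', fst (snd c), fst c, snd (snd c)))"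
    unfolding case_prod_beta by (subst sum.swap) (intro sum.cong refl sum.swap)
  also have "\<dots> = (\<Sum>t\<in>UNIV. \<Sum>q\<in>?Q. W q * ((if p = p' then 1 / of_nat CARD('p) else 0) * (\<Sum>s\<in>UNIV. r q t s s)))"
    using ca unfolding case_prod_beta sum_distrib_left[symmetric] by simp
  also have "\<dots> = (if p = p' then 1 / of_nat CARD('p) else 0) * (\<Sum>t\<in>UNIV. \<Sum>q\<in>?Q. \<Sum>s\<in>UNIV. W q * r q t s s)"
    unfolding sum_distrib_left by (intro sum.cong refl) (simp only: mult_ac)
  also have "(\<Sum>t\<in>UNIV. \<Sum>q\<in>?Q. \<Sum>s\<in>UNIV. W q * r q t s s) = (\<Sum>t\<in>UNIV. \<Sum>s\<in>UNIV. \<Sum>q\<in>?Q. W q * r q t s s)"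
    by (rule sum.cong[OF refl], rule sum.swap)
  also have "\<dots> = trace ?\<sigma>"
    unfolding trace_compress_weight_nth \<sigma> by (rule sum.swap)
  finally show ?thesis .
qed

lemma constraint_b_compress:
  fixes \<rho> :: "('p::finite, 'l::finite, 'n::{finite,linorder}) sys cop"
  assumes b: "constraint_b \<rho>"
  shows "(\<Sum>p\<in>UNIV. drop_copies (ptrA (compress (weight v u) last_labels \<rho>)) $ (p, l) $ (p, l'))
    = (if l = l' then 1 / of_nat CARD('l) else 0) * trace (compress (weight v u) last_labels \<rho>)"
proof -
  let ?L = "last_block :: 'n"
  let ?\<sigma> = "compress (weight v u) last_labels \<rho>"
  let ?Q = "(rest_funs ?L \<times> rest_funs ?L) \<times> (rest_funs ?L \<times> rest_funs ?L) :: ((('n \<Rightarrow> ('p, 'l) block) \<times> ('n \<Rightarrow> ('p, 'l) block)) \<times> (('n \<Rightarrow> ('p, 'l) block) \<times> ('n \<Rightarrow> ('p, 'l) block))) set"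
  define W where "W q = cnj (weight v u (fst q)) * weight v u (snd q)" for q :: "('p, 'l, 'n) sys \<times> ('p, 'l, 'n) sys"
  define r where "r q s t t' = \<rho> $ ((fst (fst q))(?L := s), (snd (fst q))(?L := t)) $ ((fst (snd q))(?L := s), (snd (snd q))(?L := t'))" for q s t t'
  have \<sigma>: "?\<sigma> $ (s, t) $ (s, t') = (\<Sum>q\<in>?Q. W q * r q s t t')" for s t t'
    unfolding compress_weight_nth W_def r_def by (simp add: case_prod_beta)
  have cb: "(\<Sum>(p, pc, lc)\<in>UNIV. r q s (p, pc, l, lc) (p, pc, l', lc)) = (if l = l' then 1 / of_nat CARD('l) else 0) * (\<Sum>t\<in>UNIV. r q s t t)" for q s
  proof -
    have "(\<Sum>(p, pc, lc)\<in>UNIV. r q s (p, pc, l, lc) (p, pc, l', lc)) = (\<Sum>p\<in>UNIV. \<Sum>pc\<in>UNIV. \<Sum>lc\<in>UNIV. r q s (p, pc, l, lc) (p, pc, l', lc))"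
      by (rule sum_triple)
    also have "\<dots> = (\<Sum>t\<in>UNIV. r q s t t) * (mat 1 :: 'l cop) $ l $ l' / of_nat CARD('l)"
      using b unfolding constraint_b_def r_def by blast
    finally show ?thesis by (simp add: mat_def)
  qed
  have "(\<Sum>p\<in>UNIV. drop_copies (ptrA ?\<sigma>) $ (p, l) $ (p, l'))
    = (\<Sum>(p, pc, lc)\<in>UNIV. \<Sum>s\<in>UNIV. \<Sum>q\<in>?Q. W q * r q s (p, pc, l, lc) (p, pc, l', lc))"
    unfolding sum_triple by (simp add: drop_copies_def ptrA_def \<sigma>)
  also have "\<dots> = (\<Sum>s\<in>UNIV. \<Sum>q\<in>?Q. \<Sum>c\<in>UNIV. W q * r q s (fst c, fst (snd c), l, snd (snd c)) (fst c, fst (snd c), l', snd (snd c)))"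
    unfolding case_prod_beta by (subst sum.swap) (intro sum.cong refl sum.swap)
  also have "\<dots> = (\<Sum>s\<in>UNIV. \<Sum>q\<in>?Q. W q * ((if l = l' then 1 / of_nat CARD('l) else 0) * (\<Sum>t\<in>UNIV. r q s t t)))"
    using cb unfolding case_prod_beta sum_distrib_left[symmetric] by simp
  also have "\<dots> = (if l = l' then 1 / of_nat CARD('l) else 0) * (\<Sum>s\<in>UNIV. \<Sum>q\<in>?Q. \<Sum>t\<in>UNIV. W q * r q s t t)"
    unfolding sum_distrib_left by (intro sum.cong refl) (simp only: mult_ac)
  also have "(\<Sum>s\<in>UNIV. \<Sum>q\<in>?Q. \<Sum>t\<in>UNIV. W q * r q s t t) = (\<Sum>s\<in>UNIV. \<Sum>t\<in>UNIV. \<Sum>q\<in>?Q. W q * r q s t t)"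
    by (rule sum.cong[OF refl], rule sum.swap)
  also have "\<dots> = trace ?\<sigma>"
    unfolding trace_compress_weight_nth \<sigma> ..
  finally show ?thesis .
qed

section \<open>Feasible states\<close>

lemma perm_a_mult:
  assumes "\<sigma> permutes UNIV"
  shows "(perm_a \<sigma> ** A) $ (x, y) $ z = A $ (x \<circ> \<sigma>, y) $ z"
proof -
  have inv: "inv \<sigma> \<circ> \<sigma> = id" "\<sigma> \<circ> inv \<sigma> = id" using assms by (simp_all add: permutes_inv_o)
  have "((x, y) = (fst s \<circ> inv \<sigma>, snd s)) \<longleftrightarrow> s = (x \<circ> \<sigma>, y)" for s
    using inv by (cases s) (auto simp: comp_assoc)
  then show ?thesis
    by (simp add: matmul_nth perm_a_def sum_mult_if_eq)
qed

lemma perm_b_mult: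
  assumes "\<sigma> permutes UNIV"
  shows "(perm_b \<sigma> ** A) $ (x, y) $ z = A $ (x, y \<circ> \<sigma>) $ z"
proof -
  have inv: "inv \<sigma> \<circ> \<sigma> = id" "\<sigma> \<circ> inv \<sigma> = id" using assms by (simp_all add: permutes_inv_o)
  have "((x, y) = (fst s, snd s \<circ> inv \<sigma>)) \<longleftrightarrow> s = (x, y \<circ> \<sigma>)" for s
    using inv by (cases s) (auto simp: comp_assoc)
  then show ?thesis
    by (simp add: matmul_nth perm_b_def sum_mult_if_eq)
qed

lemma bose_symmetric_iff: "bose_symmetric \<rho> \<longleftrightarrow> sym_under (\<lambda>\<pi>. \<pi> permutes UNIV) \<rho>"
proof -
  have "perm_a \<sigma> ** \<rho> = \<rho> \<longleftrightarrow> (\<forall>x y z. \<rho> $ (x \<circ> \<sigma>, y) $ z = \<rho> $ (x, y) $ z)"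
    "perm_b \<sigma> ** \<rho> = \<rho> \<longleftrightarrow> (\<forall>x y z. \<rho> $ (x, y \<circ> \<sigma>) $ z = \<rho> $ (x, y) $ z)" if "\<sigma> permutes UNIV" for \<sigma>
    using that by (auto simp: vec_eq_iff perm_a_mult perm_b_mult)
  then show ?thesis unfolding bose_symmetric_def sym_under_def by blast
qed

lemma get_set_PL [simp]: "get_P (set_PL p l t) = p" "get_L (set_PL p l t) = l"
  "set_PL p l (set_PL p' l' t) = set_PL p l t" "set_PL (get_P t) (get_L t) t = t"
  by (cases t; simp)+

lemma kept_set_labels [simp]: "kept_labels (set_labels g z) = g"
  by (cases g; cases z; cases "fst g"; cases "snd g") auto

lemma set_labels_set_labels [simp]: "set_labels g (set_labels g' z) = set_labels g z"
  by (cases g; cases g'; cases z; cases "fst g"; cases "snd g"; cases "fst g'"; cases "snd g'") auto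

lemma set_kept_labels [simp]: "set_labels (kept_labels z) z = z"
  by (cases z) auto

lemma sum_block_objective:
  fixes f :: "('p::finite, 'l::finite) block \<times> ('p, 'l) block \<Rightarrow> complex"
  shows "(\<Sum>q\<in>UNIV. block_objective N $ (s, t) $ q * f q)
    = (\<Sum>g\<in>UNIV. kron (choi_op N) max_entangled $ ((get_P s, get_P t), (get_L s, get_L t)) $ g
        * f (set_PL (fst (fst g)) (fst (snd g)) s, set_PL (snd (fst g)) (snd (snd g)) t))"
proof -
  obtain p pc l lc where s: "s = (p, pc, l, lc)" by (cases s)
  obtain q qc m mc where t: "t = (q, qc, m, mc)" by (cases t)
  let ?G = "kron (choi_op N) (max_entangled :: ('l \<times> 'l) cop)"
  have inv: "inv split_blocks (((p, q), (l, m)), ((pc, qc), (lc, mc))) = ((p, pc, l, lc), (q, qc, m, mc))" for p q pc qc :: 'p and l m lc mc :: 'l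
    by (rule inv_f_eq[OF bij_is_inj[OF bij_split_blocks]]) simp
  have "(\<Sum>q\<in>UNIV. block_objective N $ (s, t) $ q * f q)
    = (\<Sum>q\<in>UNIV. (?G $ fst (split_blocks (s, t)) $ fst (split_blocks q) * mat 1 $ snd (split_blocks (s, t)) $ snd (split_blocks q)) * f (inv split_blocks (split_blocks q)))"
    unfolding block_objective_def by (simp add: bij_is_inj[OF bij_split_blocks] inv_f_f del: kron_nth) (simp only: kron_nth)
  also have "\<dots> = (\<Sum>q\<in>UNIV. (?G $ fst (split_blocks (s, t)) $ fst q * mat 1 $ snd (split_blocks (s, t)) $ snd q) * f (inv split_blocks q))"
    by (rule sum.reindex_bij_betw[OF bij_split_blocks])
  also have "\<dots> = (\<Sum>g\<in>UNIV. \<Sum>c\<in>UNIV. if snd (split_blocks (s, t)) = c then ?G $ fst (split_blocks (s, t)) $ g * f (inv split_blocks (g, c)) else 0)"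
    unfolding sum_UNIV_prod[of "\<lambda>q. (?G $ fst (split_blocks (s, t)) $ fst q * mat 1 $ snd (split_blocks (s, t)) $ snd q) * f (inv split_blocks q)"]
    by (intro sum.cong refl) (simp add: mat_def)
  also have "\<dots> = (\<Sum>g\<in>UNIV. ?G $ fst (split_blocks (s, t)) $ g * f (inv split_blocks (g, snd (split_blocks (s, t)))))"
    by simp
  also have "\<dots> = (\<Sum>g\<in>UNIV. ?G $ ((get_P s, get_P t), (get_L s, get_L t)) $ g
        * f (set_PL (fst (fst g)) (fst (snd g)) s, set_PL (snd (fst g)) (snd (snd g)) t))"
  proof (rule sum.cong[OF refl])
    fix g :: "('p \<times> 'p) \<times> ('l \<times> 'l)"
    obtain p' q' l' m' where g: "g = ((p', q'), (l', m'))" by (metis surj_pair)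
    show "?G $ fst (split_blocks (s, t)) $ g * f (inv split_blocks (g, snd (split_blocks (s, t))))
      = ?G $ ((get_P s, get_P t), (get_L s, get_L t)) $ g * f (set_PL (fst (fst g)) (fst (snd g)) s, set_PL (snd (fst g)) (snd (snd g)) t)"
      unfolding s t g by (simp add: inv del: kron_nth)
  qed
  finally show ?thesis .
qed

text \<open>Bridges the marginal in the program and the operator on the last pair of blocks used by
  the estimates.\<close>

lemma sdp_objective_last_trace:
  fixes \<rho> :: "('p::finite, 'l::finite, 'n::{finite,linorder}) sys cop"
  shows "sdp_objective N \<rho> = Re (last_trace (block_objective N) \<rho>)"
proof -
  let ?G = "kron (choi_op N) (max_entangled :: ('l \<times> 'l) cop)"
  let ?L = "last_block :: 'n"
  have "trace (?G ** marginal \<rho>) = (\<Sum>r\<in>UNIV. \<Sum>s\<in>UNIV. \<Sum>z | kept_labels z = s. ?G $ r $ kept_labels z * \<rho> $ z $ set_labels r z)"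
    by (simp add: trace_nth matmul_nth marginal_def sum_distrib_left del: kron_nth)
  also have "\<dots> = (\<Sum>r\<in>UNIV. \<Sum>z\<in>UNIV. ?G $ r $ kept_labels z * \<rho> $ z $ set_labels r z)"
  proof (rule sum.cong[OF refl])
    fix r
    have "(\<Sum>s\<in>UNIV. \<Sum>z | kept_labels z = s. h z) = (\<Sum>z\<in>UNIV. h z)"
      for h :: "('p, 'l, 'n) sys \<Rightarrow> complex"
      using sum.group[of "UNIV :: ('p, 'l, 'n) sys set" UNIV kept_labels h] by simp
    then show "(\<Sum>s\<in>UNIV. \<Sum>z | kept_labels z = s. ?G $ r $ kept_labels z * \<rho> $ z $ set_labels r z)
      = (\<Sum>z\<in>UNIV. ?G $ r $ kept_labels z * \<rho> $ z $ set_labels r z)" .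
  qed
  also have "\<dots> = (\<Sum>(r, z)\<in>UNIV. ?G $ r $ kept_labels z * \<rho> $ z $ set_labels r z)"
    by (simp add: sum.cartesian_product del: kron_nth)
  \<comment> \<open>The label r is exchanged with the kept labels of z. This is a bijection: the
    labels that are overwritten are recorded in g.\<close>
  also have "\<dots> = (\<Sum>(z, g)\<in>UNIV. ?G $ kept_labels z $ g * \<rho> $ set_labels g z $ z)"
    by (rule sum.reindex_bij_witness[of _ "\<lambda>(z, g). (kept_labels z, set_labels g z)" "\<lambda>(r, z). (set_labels r z, kept_labels z)"])
      (auto simp del: kron_nth)
  also have "\<dots> = (\<Sum>z\<in>UNIV. \<Sum>g\<in>UNIV. ?G $ kept_labels z $ g * \<rho> $ set_labels g z $ z)"
    by (simp add: sum.cartesian_product del: kron_nth)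
  also have "\<dots> = (\<Sum>x\<in>UNIV. \<Sum>y\<in>UNIV. \<Sum>g\<in>UNIV. ?G $ kept_labels (x, y) $ g * \<rho> $ set_labels g (x, y) $ (x, y))"
    by (rule sum_UNIV_prod)
  also have "\<dots> = last_trace (block_objective N) \<rho>"
  proof -
    have "(\<Sum>g\<in>UNIV. ?G $ kept_labels (x, y) $ g * \<rho> $ set_labels g (x, y) $ (x, y))
      = (\<Sum>s\<in>UNIV. \<Sum>t\<in>UNIV. block_objective N $ (x ?L, y ?L) $ (s, t) * \<rho> $ (x(?L := s), y(?L := t)) $ (x, y))" for x y
    proof -
      have "set_labels g (x, y) = (x(?L := set_PL (fst (fst g)) (fst (snd g)) (x ?L)), y(?L := set_PL (snd (fst g)) (snd (snd g)) (y ?L)))" for g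
        by (cases g; cases "fst g"; cases "snd g") auto
      then have "(\<Sum>g\<in>UNIV. ?G $ kept_labels (x, y) $ g * \<rho> $ set_labels g (x, y) $ (x, y))
        = (\<Sum>q\<in>UNIV. block_objective N $ (x ?L, y ?L) $ q * \<rho> $ (x(?L := fst q), y(?L := snd q)) $ (x, y))"
        unfolding sum_block_objective by (simp del: kron_nth)
      then show ?thesis
        unfolding sum_UNIV_prod[of "\<lambda>q. block_objective N $ (x ?L, y ?L) $ q * \<rho> $ (x(?L := fst q), y(?L := snd q)) $ (x, y)"] by simp
    qed
    then show ?thesis unfolding last_trace_def by simp
  qed
  finally show ?thesis unfolding sdp_objective_def by simp
qed

lemma pairing_cscale: "pairing N (cscale a \<alpha>) (cscale b \<beta>) = a * b * pairing N \<alpha> \<beta>"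
  unfolding pairing_def cscale_nth by (simp add: case_prod_beta sum_distrib_left mult_ac)

lemma trace_psd_le:
  fixes \<tau> :: "'a::finite cop"
  assumes "\<And>x. Re (ses X x x) \<le> K * nsq x" "psd \<tau>"
  shows "Re (trace (X ** \<tau>)) \<le> K * Re (trace \<tau>)"
proof -
  obtain T :: "'a \<Rightarrow> 'a \<Rightarrow> complex" where T: "\<And>i j. \<tau> $ i $ j = (\<Sum>k\<in>UNIV. T i k * cnj (T j k))"
    using psd_factor[OF assms(2)] by blast
  show ?thesis
    unfolding trace_mult_factor[OF T] trace_factor[OF T] Re_sum Re_complex_of_real sum_distrib_left
    by (intro sum_mono assms(1))
qed

lemma psd_trace_nonneg: "psd A \<Longrightarrow> 0 \<le> Re (trace A)" and psd_trace_real: "psd A \<Longrightarrow> trace A = of_real (Re (trace A))"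
  unfolding trace_nth by (auto intro!: sum_nonneg psd_diag simp: complex_eq_iff psd_diag)

text \<open>Divided by their trace and stripped of the copies, the marginals of a conditioned
  operator are a decoder and an encoder state, so the objective at their product is controlled by
  F.\<close>

lemma sdp_objective_le:
  fixes \<rho> :: "('p::finite, 'l::finite, 'n::{finite,linorder}) sys cop"
  assumes N: "quantum_channel N" and \<rho>: "sdp_feasible \<rho>"
    and F: "\<And>\<alpha> \<beta> :: ('p \<times> 'l) cop. decoder_state \<alpha> \<Longrightarrow> encoder_state \<beta> \<Longrightarrow> Re (pairing N \<alpha> \<beta>) \<le> F"
    and \<eta>: "\<eta> > 0"
    and \<epsilon>: "\<epsilon> = (real CARD(('p, 'l) block) - 1) / (real CARD('n) - 1 + real CARD(('p, 'l) block))"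
  shows "sdp_objective N \<rho> \<le> F + 2 * (real CARD('p))\<^sup>2 * (\<eta> + \<epsilon>\<^sup>2 / \<eta> + 6 * \<epsilon>)"
  unfolding sdp_objective_last_trace
proof (rule de_finetti_last_trace[OF psd_block_objective[OF N] block_objective_le[OF N] _ _ _ \<eta> _ \<epsilon>])
  have feas: "psd \<rho>" "trace \<rho> = 1" "constraint_a \<rho>" "constraint_b \<rho>" "bose_symmetric \<rho>"
    using \<rho> unfolding sdp_feasible_def by auto
  then show "psd \<rho>" "trace \<rho> = 1" "sym_under (\<lambda>\<pi>. \<pi> permutes UNIV) \<rho>" unfolding bose_symmetric_iff by auto
  have lin: "complex_linear_map N" using N unfolding quantum_channel_def by auto
  fix v u
  define \<sigma> where "\<sigma> = compress (weight v u) last_labels \<rho>"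
  have \<sigma>: "psd \<sigma>" unfolding \<sigma>_def by (rule psd_compress[OF feas(1)])
  define w where "w = Re (trace \<sigma>)"
  have trw: "trace \<sigma> = of_real w" unfolding w_def by (rule psd_trace_real[OF \<sigma>])
  let ?A = "ptrB \<sigma>" and ?B = "ptrA \<sigma>"
  show "Re (trace (block_objective N ** kron ?A ?B)) \<le> F * (Re (trace \<sigma>))\<^sup>2"
  \<comment> \<open>If nothing passes the projection there is no state to normalize; the left-hand
    side is then at most 0 by the operator bound and the right-hand side is 0.\<close>
  proof (cases "w = 0")
    case True
    have "Re (trace (block_objective N ** kron ?A ?B)) \<le> (real CARD('p))\<^sup>2 * Re (trace (kron ?A ?B))"
      by (intro trace_psd_le block_objective_le N psd_kron psd_ptrA psd_ptrB \<sigma>)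
    also have "trace (kron ?A ?B) = 0" unfolding trace_kron trace_ptrA trace_ptrB trw True by simp
    finally show ?thesis using True unfolding w_def[symmetric] by simp
  next
    case False
    then have w: "w > 0" using psd_trace_nonneg[OF \<sigma>] unfolding w_def by simp
    define \<alpha> where "\<alpha> = cscale (of_real (1 / w)) (drop_copies ?A)"
    define \<beta> where "\<beta> = cscale (of_real (1 / w)) (drop_copies ?B)"
    have "psd \<alpha>" "psd \<beta>" unfolding \<alpha>_def \<beta>_def using w
      by (auto intro!: psd_cscale psd_drop_copies psd_ptrA psd_ptrB \<sigma> simp del: of_real_divide)
    moreover have "(\<Sum>l\<in>UNIV. \<alpha> $ (p, l) $ (p', l)) = (if p = p' then 1 / of_nat CARD('p) else 0)" for p p'
      unfolding \<alpha>_def cscale_nth sum_distrib_left[symmetric] \<sigma>_def constraint_a_compress[OF feas(3)]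
      unfolding \<sigma>_def[symmetric] trw using w by simp
    moreover have "(\<Sum>p\<in>UNIV. \<beta> $ (p, l) $ (p, l')) = (if l = l' then 1 / of_nat CARD('l) else 0)" for l l'
      unfolding \<beta>_def cscale_nth sum_distrib_left[symmetric] \<sigma>_def constraint_b_compress[OF feas(4)]
      unfolding \<sigma>_def[symmetric] trw using w by simp
    ultimately have "decoder_state \<alpha>" "encoder_state \<beta>" unfolding decoder_state_def encoder_state_def by blast+
    then have "Re (pairing N \<alpha> \<beta>) \<le> F" by (rule F)
    moreover have "trace (block_objective N ** kron ?A ?B) = of_real w * of_real w * pairing N \<alpha> \<beta>"
      unfolding trace_block_objective_kron[OF lin] \<alpha>_def \<beta>_def pairing_cscale using w by simp
    then have "Re (trace (block_objective N ** kron ?A ?B)) = w * w * Re (pairing N \<alpha> \<beta>)"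
      by (simp flip: of_real_mult)
    ultimately show ?thesis using w unfolding w_def[symmetric] by (simp add: power2_eq_square mult.commute mult_left_mono)
  qed
qed

section \<open>Product states built from purifications\<close>

definition product_state :: "(('p::finite, 'l::finite) block \<Rightarrow> complex) \<Rightarrow> (('p, 'l) block \<Rightarrow> complex) \<Rightarrow> ('p, 'l, 'n::{finite,linorder}) sys cop" where
  "product_state a b = outer (\<lambda>z. (\<Prod>i\<in>UNIV. a (fst z i)) * (\<Prod>i\<in>UNIV. b (snd z i)))"

lemma prod_upd_last: "(\<Prod>i\<in>UNIV. a ((x(last_block := s)) i)) = a s * rest_prod a x"
  for x :: "'n::{finite,linorder} \<Rightarrow> 'k"
  unfolding prod_split_last fun_upd_same by (subst rest_prod_upd[of a x s, symmetric]) (simp only: rest_prod_def)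

lemma sum_prod_funs:
  fixes f :: "'k::finite \<Rightarrow> 'c::comm_semiring_1"
  shows "(\<Sum>x\<in>(UNIV :: ('n::finite \<Rightarrow> 'k) set). \<Prod>i\<in>UNIV. f (x i)) = (\<Sum>s\<in>UNIV. f s) ^ CARD('n)"
  using prod_sum_PiE[of "UNIV :: 'n set" "\<lambda>_. UNIV" "\<lambda>_. f"] by (simp add: PiE_UNIV_domain)

lemma sum_mult_cnj: "(\<Sum>s\<in>UNIV. a s * cnj (a s)) = of_real (nsq a)"
  unfolding cnj_mult_self nsq_def of_real_sum ..

lemma sum_rest_prod:
  assumes "nsq a = 1"
  shows "(\<Sum>x\<in>rest_funs (last_block :: 'n::{finite,linorder}). rest_prod a x * cnj (rest_prod a x)) = 1"
proof -
  let ?f = "\<lambda>s. a s * cnj (a s)"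
  have f: "(\<Sum>s\<in>UNIV. ?f s) = 1"
    unfolding sum_mult_cnj assms by simp
  have "1 = (\<Sum>x\<in>(UNIV :: ('n \<Rightarrow> 'a) set). \<Prod>i\<in>UNIV. ?f (x i))"
    unfolding sum_prod_funs[of ?f] f by simp
  also have "\<dots> = (\<Sum>x\<in>rest_funs (last_block :: 'n). \<Sum>s\<in>UNIV. ?f s * rest_prod ?f x)"
    unfolding sum_rest_funs[of _ "last_block :: 'n"] prod_upd_last[of ?f] ..
  also have "\<dots> = (\<Sum>x\<in>rest_funs (last_block :: 'n). rest_prod ?f x)"
    unfolding sum_distrib_right[symmetric] f by simp
  finally show ?thesis by (simp add: rest_prod_def prod.distrib)
qed

lemma nsq_product: "nsq (\<lambda>z :: ('n::finite \<Rightarrow> 'k::finite) \<times> ('n \<Rightarrow> 'k). (\<Prod>i\<in>UNIV. a (fst z i)) * (\<Prod>i\<in>UNIV. b (snd z i))) = nsq a ^ CARD('n) * nsq b ^ CARD('n)"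
  unfolding nsq_def sum_UNIV_prod fst_conv snd_conv norm_mult power_mult_distrib prod_norm[symmetric] prod_power_distrib
  unfolding sum_product[symmetric] sum_prod_funs[of "\<lambda>s. (cmod (a s))\<^sup>2"] sum_prod_funs[of "\<lambda>s. (cmod (b s))\<^sup>2"] ..

lemma product_state_nth_upd:
  "product_state a b $ (x(last_block := s), y(last_block := t)) $ (x'(last_block := s'), y'(last_block := t'))
    = (a s * cnj (a s')) * (b t * cnj (b t')) * ((rest_prod a x * cnj (rest_prod a x')) * (rest_prod b y * cnj (rest_prod b y')))"
  unfolding product_state_def outer_nth fst_conv snd_conv prod_upd_last by (simp add: mult_ac)

lemma sum_sum_mult: "(\<Sum>x\<in>A. \<Sum>y\<in>B. (f x * g y) * c) = (\<Sum>x\<in>A. f x) * (\<Sum>y\<in>B. g y) * (c :: complex)"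
  unfolding sum_product[of f A g B] sum_distrib_right[of "\<lambda>x. \<Sum>y\<in>B. f x * g y"] sum_distrib_right[of "\<lambda>y. f _ * g y"] ..

lemma last_trace_product_state:
  fixes X :: "(('p::finite, 'l::finite) block \<times> ('p, 'l) block) cop"
  assumes a: "nsq a = 1" and b: "nsq b = 1"
  shows "last_trace X (product_state a b :: ('p, 'l, 'n::{finite,linorder}) sys cop) = trace (X ** kron (outer a) (outer b))"
proof -
  let ?L = "last_block :: 'n"
  have "last_trace X (product_state a b :: ('p, 'l, 'n) sys cop)
    = (\<Sum>x\<in>rest_funs ?L. \<Sum>s'\<in>UNIV. \<Sum>y\<in>rest_funs ?L. \<Sum>t'\<in>UNIV. \<Sum>s\<in>UNIV. \<Sum>t\<in>UNIV.
      X $ (s', t') $ (s, t) * ((a s * cnj (a s')) * (b t * cnj (b t')) * ((rest_prod a x * cnj (rest_prod a x)) * (rest_prod b y * cnj (rest_prod b y)))))"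
    unfolding last_trace_def sum_rest_funs[of _ ?L] fun_upd_same fun_upd_upd product_state_nth_upd ..
  also have "\<dots> = (\<Sum>x\<in>rest_funs ?L. \<Sum>y\<in>rest_funs ?L. \<Sum>s'\<in>UNIV. \<Sum>t'\<in>UNIV. \<Sum>s\<in>UNIV. \<Sum>t\<in>UNIV.
      X $ (s', t') $ (s, t) * ((a s * cnj (a s')) * (b t * cnj (b t')) * ((rest_prod a x * cnj (rest_prod a x)) * (rest_prod b y * cnj (rest_prod b y)))))"
    by (rule sum.cong[OF refl], rule sum.swap)
  also have "\<dots> = (\<Sum>x\<in>rest_funs ?L. \<Sum>y\<in>rest_funs ?L. ((rest_prod a x * cnj (rest_prod a x)) * (rest_prod b y * cnj (rest_prod b y)))
      * (\<Sum>s'\<in>UNIV. \<Sum>t'\<in>UNIV. \<Sum>s\<in>UNIV. \<Sum>t\<in>UNIV. X $ (s', t') $ (s, t) * ((a s * cnj (a s')) * (b t * cnj (b t')))))"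
    unfolding sum_distrib_left by (intro sum.cong refl) (simp only: mult_ac)
  also have "\<dots> = (\<Sum>x\<in>rest_funs ?L. rest_prod a x * cnj (rest_prod a x)) * (\<Sum>y\<in>rest_funs ?L. rest_prod b y * cnj (rest_prod b y))
      * (\<Sum>s'\<in>UNIV. \<Sum>t'\<in>UNIV. \<Sum>s\<in>UNIV. \<Sum>t\<in>UNIV. X $ (s', t') $ (s, t) * ((a s * cnj (a s')) * (b t * cnj (b t'))))"
    by (rule sum_sum_mult)
  also have "\<dots> = trace (X ** kron (outer a) (outer b))"
    unfolding sum_rest_prod[OF a] sum_rest_prod[OF b] trace_nth matmul_nth
      sum_UNIV_prod[of "\<lambda>r. \<Sum>k\<in>UNIV. X $ r $ k * kron (outer a) (outer b) $ k $ r"]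
      sum_UNIV_prod[of "\<lambda>k. X $ (_, _) $ k * kron (outer a) (outer b) $ k $ (_, _)"]
    by simp
  finally show ?thesis .
qed

text \<open>Purity is essential for Bose symmetry: a tensor power of a mixed state commutes with the
  permutations, but one-sided multiplication by them does not fix it in general.\<close>

lemma product_state_feasible:
  fixes a b :: "('p::finite, 'l::finite) block \<Rightarrow> complex"
  assumes \<alpha>: "decoder_state (drop_copies (outer a))" and \<beta>: "encoder_state (drop_copies (outer b))"
    and a: "nsq a = 1" and b: "nsq b = 1"
  shows "sdp_feasible (product_state a b :: ('p, 'l, 'n::{finite,linorder}) sys cop)"
proof -
  let ?\<rho> = "product_state a b :: ('p, 'l, 'n) sys cop"
  let ?L = "last_block :: 'n"
  have aa: "(\<Sum>t\<in>UNIV. a t * cnj (a t)) = 1" "(\<Sum>t\<in>UNIV. b t * cnj (b t)) = 1"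
    unfolding sum_mult_cnj a b by simp_all
  have "psd ?\<rho>" unfolding product_state_def by (rule psd_outer)
  moreover have "trace ?\<rho> = 1"
    unfolding product_state_def trace_nth outer_nth ip_self[unfolded ip_def, symmetric] cnj_mult_self of_real_sum[symmetric] nsq_def[symmetric] nsq_product
    by (simp add: a b)
  moreover have "constraint_a ?\<rho>"
    unfolding constraint_a_def
  proof (intro allI)
    fix i i' and x x' y y' :: "'n \<Rightarrow> ('p, 'l) block"
    define C where "C = (rest_prod a x * cnj (rest_prod a x')) * ((\<Prod>i\<in>UNIV. b (y i)) * cnj (\<Prod>i\<in>UNIV. b (y' i)))"
    have nth: "?\<rho> $ (x(?L := s), y) $ (x'(?L := s'), y') = (a s * cnj (a s')) * C" for s s'
      unfolding product_state_def outer_nth fst_conv snd_conv prod_upd_last C_def by (simp add: mult_ac)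
    have "(\<Sum>pc\<in>UNIV. \<Sum>l\<in>UNIV. \<Sum>lc\<in>UNIV. a (i, pc, l, lc) * cnj (a (i', pc, l, lc)))
      = (\<Sum>l\<in>UNIV. drop_copies (outer a) $ (i, l) $ (i', l))"
      unfolding drop_copies_def by (simp, rule sum.swap)
    also have "\<dots> = (mat 1 :: 'p cop) $ i $ i' / of_nat CARD('p)"
      using \<alpha> unfolding decoder_state_def by (simp add: mat_def)
    finally show "(\<Sum>pc\<in>UNIV. \<Sum>l\<in>UNIV. \<Sum>lc\<in>UNIV. ?\<rho> $ (x(?L := (i, pc, l, lc)), y) $ (x'(?L := (i', pc, l, lc)), y'))
      = (mat 1 :: 'p cop) $ i $ i' / of_nat CARD('p) * (\<Sum>t\<in>UNIV. ?\<rho> $ (x(?L := t), y) $ (x'(?L := t), y'))"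
      unfolding nth sum_distrib_right[symmetric] aa by simp
  qed
  moreover have "constraint_b ?\<rho>"
    unfolding constraint_b_def
  proof (intro allI)
    fix l l' and x x' y y' :: "'n \<Rightarrow> ('p, 'l) block"
    define C where "C = ((\<Prod>i\<in>UNIV. a (x i)) * cnj (\<Prod>i\<in>UNIV. a (x' i))) * (rest_prod b y * cnj (rest_prod b y'))"
    have nth: "?\<rho> $ (x, y(?L := s)) $ (x', y'(?L := s')) = (b s * cnj (b s')) * C" for s s'
      unfolding product_state_def outer_nth fst_conv snd_conv prod_upd_last C_def by (simp add: mult_ac)
    have "(\<Sum>p\<in>UNIV. \<Sum>pc\<in>UNIV. \<Sum>lc\<in>UNIV. b (p, pc, l, lc) * cnj (b (p, pc, l', lc)))
      = (\<Sum>p\<in>UNIV. drop_copies (outer b) $ (p, l) $ (p, l'))"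
      unfolding drop_copies_def by simp
    also have "\<dots> = (mat 1 :: 'l cop) $ l $ l' / of_nat CARD('l)"
      using \<beta> unfolding encoder_state_def by (simp add: mat_def)
    finally show "(\<Sum>p\<in>UNIV. \<Sum>pc\<in>UNIV. \<Sum>lc\<in>UNIV. ?\<rho> $ (x, y(?L := (p, pc, l, lc))) $ (x', y'(?L := (p, pc, l', lc))))
      = (\<Sum>t\<in>UNIV. ?\<rho> $ (x, y(?L := t)) $ (x', y'(?L := t))) * (mat 1 :: 'l cop) $ l $ l' / of_nat CARD('l)"
      unfolding nth sum_distrib_right[symmetric] aa by simp
  qed
  moreover have "bose_symmetric ?\<rho>"
  proof -
    have "(\<Prod>i\<in>UNIV. c ((x \<circ> \<pi>) i)) = (\<Prod>i\<in>UNIV. c (x i))" if "\<pi> permutes UNIV"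
      for \<pi> and c :: "('p, 'l) block \<Rightarrow> complex" and x :: "'n \<Rightarrow> ('p, 'l) block"
      using prod.permute[OF that, of "\<lambda>i. c (x i)"] by (simp add: o_def)
    then show ?thesis
      unfolding bose_symmetric_iff sym_under_def product_state_def by simp
  qed
  ultimately show ?thesis unfolding sdp_feasible_def by blast
qed

lemma feasible_of_states:
  fixes \<alpha> \<beta> :: "('p::finite \<times> 'l::finite) cop"
  assumes N: "complex_linear_map N" and \<alpha>: "decoder_state \<alpha>" and \<beta>: "encoder_state \<beta>"
  obtains \<rho> :: "('p, 'l, 'n::{finite,linorder}) sys cop" where "sdp_feasible \<rho>" "sdp_objective N \<rho> = Re (pairing N \<alpha> \<beta>)"
proof -
  have ps: "psd \<alpha>" "psd \<beta>" using \<alpha> \<beta> by (auto simp: decoder_state_def encoder_state_def)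
  obtain A :: "'p \<times> 'l \<Rightarrow> 'p \<times> 'l \<Rightarrow> complex" where A: "\<And>i j. \<alpha> $ i $ j = (\<Sum>k\<in>UNIV. A i k * cnj (A j k))"
    using psd_factor[OF ps(1)] by blast
  obtain B :: "'p \<times> 'l \<Rightarrow> 'p \<times> 'l \<Rightarrow> complex" where B: "\<And>i j. \<beta> $ i $ j = (\<Sum>k\<in>UNIV. B i k * cnj (B j k))"
    using psd_factor[OF ps(2)] by blast
  \<comment> \<open>The factor of a state on P, L has columns indexed by
    \<open>'p \<times> 'l\<close>, just the labels of the two copies, so the copies serve as the
    purifying system.\<close>
  define purify :: "('p \<times> 'l \<Rightarrow> 'p \<times> 'l \<Rightarrow> complex) \<Rightarrow> ('p, 'l) block \<Rightarrow> complex"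
    where "purify T = (\<lambda>(p, pc, l, lc). T (p, l) (pc, lc))" for T
  have dA: "drop_copies (outer (purify A)) = \<alpha>"
    unfolding vec_eq_iff by (simp add: drop_copies_def purify_def A sum_UNIV_prod)
  have dB: "drop_copies (outer (purify B)) = \<beta>"
    unfolding vec_eq_iff by (simp add: drop_copies_def purify_def B sum_UNIV_prod)
  have tr: "trace (drop_copies (outer (purify T))) = of_real (nsq (purify T))" for T
  proof -
    have "trace (drop_copies (outer (purify T))) = (\<Sum>(p, l, pc, lc)\<in>UNIV. purify T (p, pc, l, lc) * cnj (purify T (p, pc, l, lc)))"
      by (simp add: trace_nth drop_copies_def sum_UNIV_prod)
    also have "\<dots> = (\<Sum>j\<in>UNIV. purify T j * cnj (purify T j))"
      by (rule sum.reindex_bij_witness[of _ "\<lambda>(p, pc, l, lc). (p, l, pc, lc)" "\<lambda>(p, l, pc, lc). (p, pc, l, lc)"]) auto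
    finally show ?thesis by (simp add: nsq_def cnj_mult_self)
  qed
  have "trace \<alpha> = 1"
    using \<alpha> unfolding decoder_state_def trace_nth sum_UNIV_prod by simp
  then have a: "nsq (purify A) = 1" using tr[of A] unfolding dA by (metis of_real_eq_1_iff)
  have "trace \<beta> = (\<Sum>l\<in>UNIV. \<Sum>p\<in>UNIV. \<beta> $ (p, l) $ (p, l))"
    unfolding trace_nth sum_UNIV_prod by (rule sum.swap)
  also have "\<dots> = 1" using \<beta> unfolding encoder_state_def by simp
  finally have b: "nsq (purify B) = 1" using tr[of B] unfolding dB by (metis of_real_eq_1_iff)
  show thesis
  proof (rule that)
    show "sdp_feasible (product_state (purify A) (purify B) :: ('p, 'l, 'n) sys cop)"
      by (rule product_state_feasible) (simp_all add: dA dB \<alpha> \<beta> a b)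
    show "sdp_objective N (product_state (purify A) (purify B) :: ('p, 'l, 'n) sys cop) = Re (pairing N \<alpha> \<beta>)"
      unfolding sdp_objective_last_trace last_trace_product_state[OF a b] trace_block_objective_kron[OF N] dA dB ..
  qed
qed

section \<open>Unitary symmetry\<close>

definition cnjm :: "'a::finite cop \<Rightarrow> 'a cop" where
  "cnjm A = (\<chi> i j. cnj (A $ i $ j))"

lemma cnjm_nth [simp]: "cnjm A $ i $ j = cnj (A $ i $ j)"
  by (simp add: cnjm_def)

lemma unitary_cnjm: "unitary U \<Longrightarrow> unitary (cnjm U)"
proof -
  assume U: "unitary U"
  have *: "cnjm A ** cnjm B = cnjm (A ** B)" for A B :: "'a cop"
    by (simp add: vec_eq_iff matmul_nth)
  have "adj (cnjm U) = cnjm (adj U)" "cnjm (mat 1) = (mat 1 :: 'a cop)"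
    by (simp_all add: vec_eq_iff mat_def)
  then show ?thesis using U unfolding unitary_def by (simp add: *)
qed

lemma unitary_adj: "unitary U \<Longrightarrow> unitary (adj U)"
  unfolding unitary_def by simp

lemma kron_mult: "kron A B ** kron C D = kron (A ** C) (B ** D)"
  unfolding vec_eq_iff matmul_nth kron_nth sum_UNIV_prod by (simp add: sum_product mult_ac)

lemma adj_kron: "adj (kron A B) = kron (adj A) (adj B)"
  by (simp add: vec_eq_iff)

lemma kron_mat_1: "kron (mat 1) (mat 1) = mat 1"
  by (auto simp: vec_eq_iff mat_def prod_eq_iff)

lemma unitary_kron: "unitary A \<Longrightarrow> unitary B \<Longrightarrow> unitary (kron A B)"
  by (simp add: unitary_def adj_kron kron_mult kron_mat_1)

lemma block_unitary_kron: "block_unitary U V = kron U (kron (cnjm U) (kron V (cnjm V)))"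
  by (simp add: vec_eq_iff block_unitary_def split: prod.split)

lemma unitary_block_unitary: "unitary U \<Longrightarrow> unitary V \<Longrightarrow> unitary (block_unitary U V)"
  unfolding block_unitary_kron by (intro unitary_kron unitary_cnjm)

text \<open>Testing against matrix units suffices. It is meant for partial traces, which are
  determined by traces against operators that are the identity on the traced factor.\<close>

lemma trace_mult_ext:
  fixes A B :: "'a::finite cop"
  assumes "\<And>Y. trace (Y ** A) = trace (Y ** B)"
  shows "A = B"
proof -
  have "trace (unit_mat j i ** A) = A $ i $ j" for i j and A :: "'a cop"
    unfolding trace_nth matmul_nth by (rule sum_unit_mat_diag[of j i "\<lambda>a b. A $ b $ a"])
  then show ?thesis using assms by (metis vec_eq_iff)
qed

lemma trace_conj: "trace (Y ** (K ** M ** adj K)) = trace ((adj K ** Y ** K) ** M)"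
proof -
  have "trace (Y ** (K ** M ** adj K)) = trace ((Y ** K ** M) ** adj K)" by (simp add: matrix_mul_assoc)
  also have "\<dots> = trace (adj K ** (Y ** K ** M))" by (rule trace_mul_sym)
  finally show ?thesis by (simp add: matrix_mul_assoc)
qed

lemma trace_conj_unitary: "adj K ** K = mat 1 \<Longrightarrow> trace (K ** M ** adj K) = trace M"
  using trace_conj[of "mat 1" K M] by (simp add: matrix_mul_lid matrix_mul_rid)

text \<open>The partial trace is dual to tensoring with the identity, and on the dual side the
  unitary of the traced factor cancels.\<close>

lemma ptrB_conj:
  assumes "adj B ** B = mat 1"
  shows "ptrB (kron A B ** M ** adj (kron A B)) = A ** ptrB M ** adj A"
proof (rule trace_mult_ext)
  fix Y
  have "trace (Y ** ptrB (kron A B ** M ** adj (kron A B))) = trace ((adj (kron A B) ** kron Y (mat 1) ** kron A B) ** M)"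
    unfolding trace_kron_1_right[symmetric] trace_conj ..
  also have "\<dots> = trace (kron (adj A ** Y ** A) (mat 1) ** M)"
    unfolding adj_kron kron_mult matrix_mul_rid assms ..
  also have "\<dots> = trace (Y ** (A ** ptrB M ** adj A))"
    unfolding trace_kron_1_right trace_conj ..
  finally show "trace (Y ** ptrB (kron A B ** M ** adj (kron A B))) = trace (Y ** (A ** ptrB M ** adj A))" .
qed

lemma ptrA_conj:
  assumes "adj A ** A = mat 1"
  shows "ptrA (kron A B ** M ** adj (kron A B)) = B ** ptrA M ** adj B"
proof (rule trace_mult_ext)
  fix Y
  have "trace (Y ** ptrA (kron A B ** M ** adj (kron A B))) = trace ((adj (kron A B) ** kron (mat 1) Y ** kron A B) ** M)"
    unfolding trace_kron_1_left[symmetric] trace_conj ..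
  also have "\<dots> = trace (kron (mat 1) (adj B ** Y ** B) ** M)"
    unfolding adj_kron kron_mult matrix_mul_rid assms ..
  also have "\<dots> = trace (Y ** (B ** ptrA M ** adj B))"
    unfolding trace_kron_1_left trace_conj ..
  finally show "trace (Y ** ptrA (kron A B ** M ** adj (kron A B))) = trace (Y ** (B ** ptrA M ** adj B))" .
qed

section \<open>Invariance of the constraints under the unitaries\<close>

lemma ptr_sum: "ptrB (\<Sum>i\<in>I. f i) = (\<Sum>i\<in>I. ptrB (f i))" "ptrA (\<Sum>i\<in>I. f i) = (\<Sum>i\<in>I. ptrA (f i))"
  unfolding vec_eq_iff ptrB_def ptrA_def by (auto simp: sum_component intro: sum.swap)

lemma ptr_cscale: "ptrB (cscale c A) = cscale c (ptrB A)" "ptrA (cscale c A) = cscale c (ptrA A)"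
  unfolding vec_eq_iff ptrB_def ptrA_def by (simp_all add: sum_distrib_left)

lemma trace_sum: "trace (\<Sum>i\<in>I. f i) = (\<Sum>i\<in>I. trace (f i))"
  unfolding trace_nth by (simp add: sum_component) (rule sum.swap)

lemma conj_nth: "(K ** M ** adj K) $ i $ j = (\<Sum>k\<in>UNIV. \<Sum>l\<in>UNIV. K $ i $ k * M $ k $ l * cnj (K $ j $ l))"
  unfolding matmul_nth adj_nth sum_distrib_right by (rule sum.swap)

text \<open>The block of \<rho> between fixed labels r, r' of all systems but one, where
  \<open>\<beta>\<close> tells how a label of that system is inserted. Both channel constraints are
  conditions on all slices.\<close>

definition slice :: "('r \<Rightarrow> 'k \<Rightarrow> 'z) \<Rightarrow> 'z::finite cop \<Rightarrow> 'r \<Rightarrow> 'r \<Rightarrow> 'k::finite cop" where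
  "slice \<beta> \<rho> r r' = (\<chi> s s'. \<rho> $ \<beta> r s $ \<beta> r' s')"

lemma slice_conj:
  fixes \<beta> :: "'r \<Rightarrow> 'k::finite \<Rightarrow> 'z::finite"
  assumes \<beta>: "bij_betw (\<lambda>(r, t). \<beta> r t) (R \<times> UNIV) UNIV"
    and W: "\<And>r s r' t. W $ \<beta> r s $ \<beta> r' t = B $ s $ t * w r r'"
  shows "slice \<beta> (W ** \<rho> ** adj W) r r' = (\<Sum>a\<in>R. \<Sum>a'\<in>R. cscale (w r a * cnj (w r' a')) (B ** slice \<beta> \<rho> a a' ** adj B))"
proof -
  have sumz: "(\<Sum>z\<in>UNIV. f z) = (\<Sum>a\<in>R. \<Sum>t\<in>UNIV. f (\<beta> a t))" for f :: "'z \<Rightarrow> complex"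
    using sum.reindex_bij_betw[OF \<beta>, of f] by (simp add: sum.cartesian_product case_prod_beta)
  have "slice \<beta> (W ** \<rho> ** adj W) r r' $ s $ s' = (\<Sum>a\<in>R. \<Sum>a'\<in>R. cscale (w r a * cnj (w r' a')) (B ** slice \<beta> \<rho> a a' ** adj B)) $ s $ s'" for s s'
  proof -
    have "slice \<beta> (W ** \<rho> ** adj W) r r' $ s $ s' = (\<Sum>a\<in>R. \<Sum>t\<in>UNIV. \<Sum>a'\<in>R. \<Sum>t'\<in>UNIV.
        (B $ s $ t * w r a) * \<rho> $ \<beta> a t $ \<beta> a' t' * cnj (B $ s' $ t' * w r' a'))"
      unfolding slice_def vec_lambda_beta conj_nth sumz W ..
    also have "\<dots> = (\<Sum>a\<in>R. \<Sum>a'\<in>R. \<Sum>t\<in>UNIV. \<Sum>t'\<in>UNIV.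
        (B $ s $ t * w r a) * \<rho> $ \<beta> a t $ \<beta> a' t' * cnj (B $ s' $ t' * w r' a'))"
      by (rule sum.cong[OF refl], rule sum.swap)
    also have "\<dots> = (\<Sum>a\<in>R. \<Sum>a'\<in>R. cscale (w r a * cnj (w r' a')) (B ** slice \<beta> \<rho> a a' ** adj B)) $ s $ s'"
      unfolding sum_component cscale_nth conj_nth sum_distrib_left slice_def vec_lambda_beta complex_cnj_mult
      by (intro sum.cong refl) (simp only: mult_ac)
    finally show ?thesis .
  qed
  then show ?thesis by (simp add: vec_eq_iff)
qed

text \<open>Conjugation mixes the slices linearly and conjugates each by B. That a reduced slice is
  a fixed multiple of its trace times the identity is stable under both, so one argument covers
  constraints (a) and (b).\<close>

lemma slice_conj_constraint:
  fixes \<beta> :: "'r \<Rightarrow> 'k::finite \<Rightarrow> 'z::finite" and g :: "'k cop \<Rightarrow> 'm::finite cop"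
  assumes \<beta>: "bij_betw (\<lambda>(r, t). \<beta> r t) (R \<times> UNIV) UNIV"
    and W: "\<And>r s r' t. W $ \<beta> r s $ \<beta> r' t = B $ s $ t * w r r'"
    and g_sum: "\<And>(f :: 'r \<Rightarrow> 'k cop) I. g (\<Sum>i\<in>I. f i) = (\<Sum>i\<in>I. g (f i))"
    and g_scale: "\<And>c A. g (cscale c A) = cscale c (g A)"
    and g_conj: "\<And>M. g (B ** M ** adj B) = U ** g M ** adj U"
    and U: "unitary U" and B: "unitary B"
    and \<rho>: "\<And>r r'. g (slice \<beta> \<rho> r r') = cscale (c * trace (slice \<beta> \<rho> r r')) (mat 1)"
  shows "g (slice \<beta> (W ** \<rho> ** adj W) r r') = cscale (c * trace (slice \<beta> (W ** \<rho> ** adj W) r r')) (mat 1)"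
proof -
  have 1: "g (B ** slice \<beta> \<rho> a a' ** adj B) = cscale (c * trace (B ** slice \<beta> \<rho> a a' ** adj B)) (mat 1)" for a a'
    using U B unfolding g_conj \<rho> cscale_matmul_right cscale_matmul_left matrix_mul_rid unitary_def
    by (simp add: trace_conj_unitary)
  have cs: "cscale (\<Sum>i\<in>I. f i) (mat 1 :: 'm cop) = (\<Sum>i\<in>I. cscale (f i) (mat 1))" for f :: "'r \<Rightarrow> complex" and I
    by (simp add: vec_eq_iff sum_component sum_distrib_right)
  show ?thesis
    unfolding slice_conj[OF \<beta> W] g_sum g_scale 1 trace_sum trace_cscale cscale_cscale sum_distrib_left cs
    by (intro sum.cong refl) (simp only: mult_ac)
qed

definition upd_a :: "('n::{finite,linorder} \<Rightarrow> 'k) \<times> ('n \<Rightarrow> 'k) \<Rightarrow> 'k \<Rightarrow> ('n \<Rightarrow> 'k) \<times> ('n \<Rightarrow> 'k)" where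
  "upd_a z s = ((fst z)(last_block := s), snd z)"

definition upd_b :: "('n::{finite,linorder} \<Rightarrow> 'k) \<times> ('n \<Rightarrow> 'k) \<Rightarrow> 'k \<Rightarrow> ('n \<Rightarrow> 'k) \<times> ('n \<Rightarrow> 'k)" where
  "upd_b z t = (fst z, (snd z)(last_block := t))"

lemma bij_upd_a: "bij_betw (\<lambda>(r, t). upd_a r t) ((rest_funs (last_block :: 'n::{finite,linorder}) \<times> UNIV) \<times> UNIV) UNIV"
  by (rule bij_betw_byWitness[where f' = "\<lambda>z. (((fst z)(last_block := undefined), snd z), fst z last_block)"])
    (auto simp: rest_funs_def upd_a_def fun_eq_iff)

lemma bij_upd_b: "bij_betw (\<lambda>(r, t). upd_b r t) ((UNIV \<times> rest_funs (last_block :: 'n::{finite,linorder})) \<times> UNIV) UNIV"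
  by (rule bij_betw_byWitness[where f' = "\<lambda>z. ((fst z, (snd z)(last_block := undefined)), snd z last_block)"])
    (auto simp: rest_funs_def upd_b_def fun_eq_iff)

lemma constraint_a_slice:
  fixes \<rho> :: "('p::finite, 'l::finite, 'n::{finite,linorder}) sys cop"
  shows "constraint_a \<rho> \<longleftrightarrow> (\<forall>r r'. ptrB (slice upd_a \<rho> r r') = cscale (1 / of_nat CARD('p) * trace (slice upd_a \<rho> r r')) (mat 1))"
proof -
  have "(\<Sum>pc\<in>UNIV. \<Sum>l\<in>UNIV. \<Sum>lc\<in>UNIV. \<rho> $ (x(last_block := (i, pc, l, lc)), y) $ (x'(last_block := (i', pc, l, lc)), y'))
      = ptrB (slice upd_a \<rho> (x, y) (x', y')) $ i $ i'"
    "(mat 1 :: 'p cop) $ i $ i' / of_nat CARD('p) * (\<Sum>t\<in>UNIV. \<rho> $ (x(last_block := t), y) $ (x'(last_block := t), y'))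
      = cscale (1 / of_nat CARD('p) * trace (slice upd_a \<rho> (x, y) (x', y'))) (mat 1) $ i $ i'" for x y x' y' i i'
    by (simp_all add: slice_def upd_a_def ptrB_def sum_UNIV_prod trace_nth)
  then show ?thesis unfolding constraint_a_def vec_eq_iff by (simp only: split_paired_All) blast
qed

text \<open>In a block the order is P, its copy, L, its copy: two partial traces over the first
  factor and one over the second isolate L.\<close>

definition marg_L :: "('p::finite, 'l::finite) block cop \<Rightarrow> 'l cop" where
  "marg_L M = ptrB (ptrA (ptrA M))"

lemma constraint_b_slice:
  fixes \<rho> :: "('p::finite, 'l::finite, 'n::{finite,linorder}) sys cop"
  shows "constraint_b \<rho> \<longleftrightarrow> (\<forall>r r'. marg_L (slice upd_b \<rho> r r') = cscale (1 / of_nat CARD('l) * trace (slice upd_b \<rho> r r')) (mat 1))"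
proof -
  have "(\<Sum>p\<in>UNIV. \<Sum>pc\<in>UNIV. \<Sum>lc\<in>UNIV. M $ (p, pc, l, lc) $ (p, pc, l', lc)) = marg_L M $ l $ l'"
    for M :: "('p, 'l) block cop" and l l'
  proof -
    have "(\<Sum>p\<in>UNIV. \<Sum>pc\<in>UNIV. \<Sum>lc\<in>UNIV. M $ (p, pc, l, lc) $ (p, pc, l', lc))
      = (\<Sum>pc\<in>UNIV. \<Sum>p\<in>UNIV. \<Sum>lc\<in>UNIV. M $ (p, pc, l, lc) $ (p, pc, l', lc))" by (rule sum.swap)
    also have "\<dots> = (\<Sum>pc\<in>UNIV. \<Sum>lc\<in>UNIV. \<Sum>p\<in>UNIV. M $ (p, pc, l, lc) $ (p, pc, l', lc))"
      by (rule sum.cong[OF refl], rule sum.swap)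
    also have "\<dots> = (\<Sum>lc\<in>UNIV. \<Sum>pc\<in>UNIV. \<Sum>p\<in>UNIV. M $ (p, pc, l, lc) $ (p, pc, l', lc))" by (rule sum.swap)
    finally show ?thesis by (simp add: marg_L_def ptrA_def ptrB_def)
  qed
  note marg = this
  have "(\<Sum>p\<in>UNIV. \<Sum>pc\<in>UNIV. \<Sum>lc\<in>UNIV. \<rho> $ (x, y(last_block := (p, pc, l, lc))) $ (x', y'(last_block := (p, pc, l', lc))))
      = marg_L (slice upd_b \<rho> (x, y) (x', y')) $ l $ l'"
    "(\<Sum>t\<in>UNIV. \<rho> $ (x, y(last_block := t)) $ (x', y'(last_block := t))) * (mat 1 :: 'l cop) $ l $ l' / of_nat CARD('l)
      = cscale (1 / of_nat CARD('l) * trace (slice upd_b \<rho> (x, y) (x', y'))) (mat 1) $ l $ l'" for x y x' y' l l'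
    by (simp_all add: marg[symmetric] slice_def upd_b_def trace_nth)
  then show ?thesis unfolding constraint_b_def vec_eq_iff by (simp only: split_paired_All) blast
qed

lemma unitary_action_nth:
  "unitary_action U V $ r $ s = (\<Prod>i\<in>UNIV. block_unitary U V $ fst r i $ fst s i) * (\<Prod>i\<in>UNIV. cnj (block_unitary U V $ snd r i $ snd s i))"
  by (simp add: unitary_action_def)

lemma prod_upd_last2: "(\<Prod>i\<in>UNIV. f ((x(last_block := s)) i) ((y(last_block := t)) i)) = f s t * (\<Prod>i\<in>UNIV - {last_block}. f (x i) (y i))"
  for x :: "'n::{finite,linorder} \<Rightarrow> 'k" and f :: "'k \<Rightarrow> 'k \<Rightarrow> complex"
  unfolding prod_split_last fun_upd_same by (intro arg_cong2[where f = "(*)"] prod.cong refl) auto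

lemma constraint_a_conj:
  fixes \<rho> :: "('p::finite, 'l::finite, 'n::{finite,linorder}) sys cop"
  assumes U: "unitary U" and V: "unitary V" and \<rho>: "constraint_a \<rho>"
  shows "constraint_a (unitary_action U V ** \<rho> ** adj (unitary_action U V))"
  unfolding constraint_a_slice
proof (intro allI)
  fix r r' :: "('p, 'l, 'n) sys"
  let ?B = "block_unitary U V"
  show "ptrB (slice upd_a (unitary_action U V ** \<rho> ** adj (unitary_action U V)) r r')
    = cscale (1 / of_nat CARD('p) * trace (slice upd_a (unitary_action U V ** \<rho> ** adj (unitary_action U V)) r r')) (mat 1)"
  proof (rule slice_conj_constraint[OF bij_upd_a _ ptr_sum(1) ptr_cscale(1) _ U unitary_block_unitary[OF U V]])
    show "unitary_action U V $ upd_a r s $ upd_a r' t = ?B $ s $ t *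
        ((\<Prod>i\<in>UNIV - {last_block}. ?B $ fst r i $ fst r' i) * (\<Prod>i\<in>UNIV. cnj (?B $ snd r i $ snd r' i)))" for r s r' t
      unfolding unitary_action_nth upd_a_def fst_conv snd_conv prod_upd_last2[of "\<lambda>s t. ?B $ s $ t"] by (simp only: mult.assoc)
    show "ptrB (?B ** M ** adj ?B) = U ** ptrB M ** adj U" for M
      unfolding block_unitary_kron
      by (rule ptrB_conj) (use unitary_kron[OF unitary_cnjm[OF U] unitary_kron[OF V unitary_cnjm[OF V]]] in \<open>simp add: unitary_def\<close>)
    show "ptrB (slice upd_a \<rho> r r') = cscale (1 / of_nat CARD('p) * trace (slice upd_a \<rho> r r')) (mat 1)" for r r'
      using \<rho> unfolding constraint_a_slice by blast
  qed
qed

text \<open>On a b-block the conjugate of the block unitary acts, so L-bar is transformed by the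
  conjugate of V, which is again unitary.\<close>

lemma constraint_b_conj:
  fixes \<rho> :: "('p::finite, 'l::finite, 'n::{finite,linorder}) sys cop"
  assumes U: "unitary U" and V: "unitary V" and \<rho>: "constraint_b \<rho>"
  shows "constraint_b (unitary_action U V ** \<rho> ** adj (unitary_action U V))"
  unfolding constraint_b_slice
proof (intro allI)
  fix r r' :: "('p, 'l, 'n) sys"
  let ?B = "block_unitary U V"
  let ?C = "cnjm ?B"
  have C: "?C = kron (cnjm U) (kron (cnjm (cnjm U)) (kron (cnjm V) (cnjm (cnjm V))))"
    unfolding block_unitary_kron by (simp add: vec_eq_iff)
  have uU: "unitary (cnjm U)" "unitary (cnjm (cnjm U))" "unitary (cnjm V)" "unitary (cnjm (cnjm V))"
    using U V by (simp_all add: unitary_cnjm)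
  show "marg_L (slice upd_b (unitary_action U V ** \<rho> ** adj (unitary_action U V)) r r')
    = cscale (1 / of_nat CARD('l) * trace (slice upd_b (unitary_action U V ** \<rho> ** adj (unitary_action U V)) r r')) (mat 1)"
  proof (rule slice_conj_constraint[OF bij_upd_b _ _ _ _ uU(3) unitary_cnjm[OF unitary_block_unitary[OF U V]]])
    show "unitary_action U V $ upd_b r s $ upd_b r' t = ?C $ s $ t *
        ((\<Prod>i\<in>UNIV. ?B $ fst r i $ fst r' i) * (\<Prod>i\<in>UNIV - {last_block}. cnj (?B $ snd r i $ snd r' i)))" for r s r' t
      unfolding unitary_action_nth upd_b_def fst_conv snd_conv prod_upd_last2[of "\<lambda>s t. cnj (?B $ s $ t)"] cnjm_nth by (simp only: mult_ac)
    show "marg_L (?C ** M ** adj ?C) = cnjm V ** marg_L M ** adj (cnjm V)" for M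
      unfolding C marg_L_def using uU by (simp add: ptrA_conj ptrB_conj unitary_def)
    show "marg_L (slice upd_b \<rho> r r') = cscale (1 / of_nat CARD('l) * trace (slice upd_b \<rho> r r')) (mat 1)" for r r'
      using \<rho> unfolding constraint_b_slice by blast
  qed (simp_all add: marg_L_def ptr_sum ptr_cscale)
qed

text \<open>Tensor powers multiply factorwise, because a sum over all functions of a product is the
  product of the sums.\<close>

lemma prod_funs_mult:
  fixes A B :: "'k::finite cop"
  shows "(\<Sum>u\<in>(UNIV :: ('n::finite \<Rightarrow> 'k) set). (\<Prod>i\<in>UNIV. A $ x i $ u i) * (\<Prod>i\<in>UNIV. B $ u i $ y i)) = (\<Prod>i\<in>UNIV. (A ** B) $ x i $ y i)"
  using prod_sum_PiE[of "UNIV :: 'n set" "\<lambda>_. UNIV" "\<lambda>i k. A $ x i $ k * B $ k $ y i"]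
  by (simp add: PiE_UNIV_domain matmul_nth prod.distrib)

lemma unitary_action_eq:
  "unitary_action U V $ (x, y) $ (x', y') = (\<Prod>i\<in>UNIV. block_unitary U V $ x i $ x' i) * (\<Prod>i\<in>UNIV. cnjm (block_unitary U V) $ y i $ y' i)"
  by (simp add: unitary_action_nth)

lemma prod_delta:
  fixes x y :: "'n::finite \<Rightarrow> 'k::finite"
  shows "(\<Prod>i\<in>UNIV. (mat 1 :: 'k cop) $ x i $ y i) = (if x = y then 1 else 0)"
proof (cases "x = y")
  case False
  then obtain i where "x i \<noteq> y i" by auto
  then have "(\<Prod>i\<in>UNIV. (mat 1 :: 'k cop) $ x i $ y i) = 0" by (intro prod_zero) (auto simp: mat_def)
  with False show ?thesis by simp
qed (simp add: mat_def)

lemma unitary_unitary_action: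
  assumes "unitary U" "unitary V"
  shows "unitary (unitary_action U V :: ('p::finite, 'l::finite, 'n::finite) sys cop)"
proof -
  let ?W = "unitary_action U V :: ('p, 'l, 'n) sys cop"
  let ?B = "block_unitary U V"
  have B: "adj ?B ** ?B = mat 1" "?B ** adj ?B = mat 1" "adj (cnjm ?B) ** cnjm ?B = mat 1" "cnjm ?B ** adj (cnjm ?B) = mat 1"
    using unitary_block_unitary[OF assms] unitary_cnjm[OF unitary_block_unitary[OF assms]] by (simp_all add: unitary_def)
  have adjW: "adj ?W $ (x, y) $ (x', y') = (\<Prod>i\<in>UNIV. adj ?B $ x i $ x' i) * (\<Prod>i\<in>UNIV. adj (cnjm ?B) $ y i $ y' i)" for x y x' y'
    by (simp add: unitary_action_nth)
  have rearr: "(\<Sum>u\<in>UNIV. \<Sum>v\<in>UNIV. (f u * g v) * (f' u * g' v)) = (\<Sum>u\<in>UNIV. f u * f' u) * (\<Sum>v\<in>UNIV. g v * (g' v :: complex))"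
    for f f' g g' :: "('n \<Rightarrow> ('p, 'l) block) \<Rightarrow> complex"
    unfolding sum_product by (intro sum.cong refl) (simp only: mult_ac)
  have one: "(if x = x' then 1 else 0) * (if y = y' then 1 else 0) = (mat 1 :: ('p, 'l, 'n) sys cop) $ (x, y) $ (x', y')" for x y x' y'
    by (simp add: mat_def)
  have "(adj ?W ** ?W) $ (x, y) $ (x', y') = (mat 1 :: ('p, 'l, 'n) sys cop) $ (x, y) $ (x', y')" for x y x' y'
    unfolding matmul_nth sum_UNIV_prod[of "\<lambda>k. adj ?W $ (x, y) $ k * ?W $ k $ (x', y')"] adjW unitary_action_eq rearr prod_funs_mult B prod_delta one ..
  moreover have "(?W ** adj ?W) $ (x, y) $ (x', y') = (mat 1 :: ('p, 'l, 'n) sys cop) $ (x, y) $ (x', y')" for x y x' y'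
    unfolding matmul_nth sum_UNIV_prod[of "\<lambda>k. ?W $ (x, y) $ k * adj ?W $ k $ (x', y')"] adjW unitary_action_eq rearr prod_funs_mult B prod_delta one ..
  ultimately show ?thesis unfolding unitary_def vec_eq_iff by (simp only: split_paired_All) blast
qed

lemma prod_permute_shift:
  fixes f :: "'k \<Rightarrow> 'k \<Rightarrow> complex" and x x' :: "'n::finite \<Rightarrow> 'k"
  assumes "\<sigma> permutes UNIV"
  shows "(\<Prod>i\<in>UNIV. f ((x \<circ> \<sigma>) i) (x' i)) = (\<Prod>i\<in>UNIV. f (x i) ((x' \<circ> inv \<sigma>) i))"
  using prod.permute[OF assms, of "\<lambda>i. f (x i) ((x' \<circ> inv \<sigma>) i)"] assms
  by (simp add: o_def permutes_inverses)

lemma mult_perm_a: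
  assumes "\<sigma> permutes UNIV"
  shows "(A ** perm_a \<sigma>) $ z $ (x, y) = A $ z $ (x \<circ> inv \<sigma>, y)"
  by (simp add: matmul_nth perm_a_def sum_mult_if_eq)

lemma mult_perm_b:
  assumes "\<sigma> permutes UNIV"
  shows "(A ** perm_b \<sigma>) $ z $ (x, y) = A $ z $ (x, y \<circ> inv \<sigma>)"
  by (simp add: matmul_nth perm_b_def sum_mult_if_eq)

text \<open>All a-blocks carry the same unitary, and so do all b-blocks; a tensor power commutes
  with the permutations of its factors.\<close>

lemma perm_unitary_action:
  assumes \<sigma>: "\<sigma> permutes UNIV"
  shows "perm_a \<sigma> ** unitary_action U V = unitary_action U V ** perm_a \<sigma>"
    and "perm_b \<sigma> ** unitary_action U V = unitary_action U V ** perm_b \<sigma>"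
proof -
  have "(perm_a \<sigma> ** unitary_action U V) $ (x, y) $ (x', y') = (unitary_action U V ** perm_a \<sigma>) $ (x, y) $ (x', y')" for x y x' y'
    unfolding perm_a_mult[OF \<sigma>] mult_perm_a[OF \<sigma>] unitary_action_eq prod_permute_shift[OF \<sigma>, of "\<lambda>s t. block_unitary U V $ s $ t"] ..
  then show "perm_a \<sigma> ** unitary_action U V = unitary_action U V ** perm_a \<sigma>"
    unfolding vec_eq_iff by (simp only: split_paired_All) blast
  have "(perm_b \<sigma> ** unitary_action U V) $ (x, y) $ (x', y') = (unitary_action U V ** perm_b \<sigma>) $ (x, y) $ (x', y')" for x y x' y'
    unfolding perm_b_mult[OF \<sigma>] mult_perm_b[OF \<sigma>] unitary_action_eq prod_permute_shift[OF \<sigma>, of "\<lambda>s t. cnjm (block_unitary U V) $ s $ t"] ..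
  then show "perm_b \<sigma> ** unitary_action U V = unitary_action U V ** perm_b \<sigma>"
    unfolding vec_eq_iff by (simp only: split_paired_All) blast
qed

lemma ses_conj:
  fixes K M :: "'a::finite cop"
  shows "ses (K ** M ** adj K) x x = ses M (\<lambda>i. \<Sum>j\<in>UNIV. cnj (K $ j $ i) * x j) (\<lambda>i. \<Sum>j\<in>UNIV. cnj (K $ j $ i) * x j)"
proof -
  let ?y = "\<lambda>i. \<Sum>j\<in>UNIV. cnj (K $ j $ i) * x j"
  have "ses (K ** M ** adj K) x x = ses (K ** M) x ?y"
    unfolding ses_matmul[of "K ** M"] by simp
  also have "\<dots> = cnj (ses (adj (K ** M)) ?y x)" by (simp add: ses_adj)
  also have "\<dots> = cnj (ses (adj M) ?y ?y)" unfolding adj_matmul ses_matmul by simp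
  also have "\<dots> = ses M ?y ?y" by (simp add: ses_adj)
  finally show ?thesis .
qed

lemma psd_conj: "psd M \<Longrightarrow> psd (K ** M ** adj K)" for K :: "'a::finite cop"
  unfolding psd_iff_ses ses_conj by blast

lemma sdp_feasible_conj:
  fixes \<rho> :: "('p::finite, 'l::finite, 'n::{finite,linorder}) sys cop"
  assumes U: "unitary U" and V: "unitary V" and \<rho>: "sdp_feasible \<rho>"
  shows "sdp_feasible (unitary_action U V ** \<rho> ** adj (unitary_action U V))"
proof -
  let ?W = "unitary_action U V :: ('p, 'l, 'n) sys cop"
  have W: "adj ?W ** ?W = mat 1" using unitary_unitary_action[OF U V, where 'n = 'n] by (simp add: unitary_def)
  have "bose_symmetric (?W ** \<rho> ** adj ?W)"
    unfolding bose_symmetric_def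
  proof (intro allI impI conjI)
    fix \<sigma> :: "'n \<Rightarrow> 'n" assume \<sigma>: "\<sigma> permutes UNIV"
    have "perm_a \<sigma> ** \<rho> = \<rho>" "perm_b \<sigma> ** \<rho> = \<rho>"
      using \<rho> \<sigma> unfolding sdp_feasible_def bose_symmetric_def by blast+
    moreover have "P ** (?W ** \<rho> ** A) = ?W ** \<rho> ** A" if "P ** ?W = ?W ** P" "P ** \<rho> = \<rho>" for P A :: "('p, 'l, 'n) sys cop"
    proof -
      have "P ** (?W ** \<rho> ** A) = (P ** ?W) ** \<rho> ** A" by (simp only: matrix_mul_assoc)
      also have "\<dots> = ?W ** (P ** \<rho>) ** A" unfolding that(1) by (simp only: matrix_mul_assoc)
      finally show ?thesis unfolding that(2) .
    qed
    ultimately show "perm_a \<sigma> ** (?W ** \<rho> ** adj ?W) = ?W ** \<rho> ** adj ?W" "perm_b \<sigma> ** (?W ** \<rho> ** adj ?W) = ?W ** \<rho> ** adj ?W"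
      using perm_unitary_action[OF \<sigma>, of U V] by blast+
  qed
  then show ?thesis
    using \<rho> unfolding sdp_feasible_def
    by (simp add: psd_conj trace_conj_unitary[OF W] constraint_a_conj[OF U V] constraint_b_conj[OF U V])
qed

text \<open>X on the last pair of blocks tensor the identity: the two conditions say that z and z'
  agree off the last block.\<close>

definition lift_last :: "('k \<times> 'k) cop \<Rightarrow> (('n::{finite,linorder} \<Rightarrow> 'k::finite) \<times> ('n \<Rightarrow> 'k)) cop" where
  "lift_last X = (\<chi> z z'. if (fst z')(last_block := fst z last_block) = fst z then
     if (snd z')(last_block := snd z last_block) = snd z then X $ last_labels z $ last_labels z' else 0 else 0)"

lemma sum_same_rest:
  fixes f :: "('n::{finite,linorder} \<Rightarrow> 'k::finite) \<Rightarrow> complex"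
  shows "(\<Sum>x'\<in>UNIV. if x'(last_block := x last_block) = x then f x' else 0) = (\<Sum>s\<in>UNIV. f (x(last_block := s)))"
proof -
  let ?L = "last_block :: 'n"
  let ?r = "x(?L := undefined)"
  have r: "?r \<in> rest_funs ?L" by (simp add: rest_funs_def)
  have iff: "r(?L := x ?L) = x \<longleftrightarrow> r = ?r" if "r \<in> rest_funs ?L" for r
    using that by (auto simp: rest_funs_def fun_eq_iff)
  have "(\<Sum>x'\<in>UNIV. if x'(?L := x ?L) = x then f x' else 0)
    = (\<Sum>r\<in>rest_funs ?L. \<Sum>s\<in>UNIV. if r = ?r then f (r(?L := s)) else 0)"
    unfolding sum_rest_funs[of _ ?L] fun_upd_upd by (intro sum.cong refl) (simp add: iff)
  also have "\<dots> = (\<Sum>r\<in>rest_funs ?L. if r = ?r then \<Sum>s\<in>UNIV. f (r(?L := s)) else 0)"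
    by (intro sum.cong refl) simp
  also have "\<dots> = (\<Sum>s\<in>UNIV. f (?r(?L := s)))"
    using r by (simp add: sum.delta)
  finally show ?thesis by simp
qed

lemma sum_lift_last:
  fixes f :: "('n::{finite,linorder} \<Rightarrow> 'k::finite) \<times> ('n \<Rightarrow> 'k) \<Rightarrow> complex"
  shows "(\<Sum>z\<in>UNIV. lift_last X $ (x, y) $ z * f z)
    = (\<Sum>s\<in>UNIV. \<Sum>t\<in>UNIV. X $ (x last_block, y last_block) $ (s, t) * f (x(last_block := s), y(last_block := t)))"
proof -
  let ?L = "last_block :: 'n"
  have "(\<Sum>z\<in>UNIV. lift_last X $ (x, y) $ z * f z) = (\<Sum>x'\<in>UNIV. if x'(?L := x ?L) = x then
     \<Sum>y'\<in>UNIV. if y'(?L := y ?L) = y then X $ (x ?L, y ?L) $ (x' ?L, y' ?L) * f (x', y') else 0 else 0)"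
    unfolding sum_UNIV_prod by (intro sum.cong refl) (auto simp: lift_last_def last_labels_def intro!: sum.cong)
  then show ?thesis unfolding sum_same_rest[of x] sum_same_rest[of y] by simp
qed

lemma sum_lift_last_right:
  fixes f :: "('n::{finite,linorder} \<Rightarrow> 'k::finite) \<times> ('n \<Rightarrow> 'k) \<Rightarrow> complex"
  shows "(\<Sum>z\<in>UNIV. f z * lift_last X $ z $ (x, y))
    = (\<Sum>s\<in>UNIV. \<Sum>t\<in>UNIV. f (x(last_block := s), y(last_block := t)) * X $ (s, t) $ (x last_block, y last_block))"
proof -
  let ?L = "last_block :: 'n"
  have sw: "x(?L := x' ?L) = x' \<longleftrightarrow> x'(?L := x ?L) = x" for x x' :: "'n \<Rightarrow> 'k"
    by (auto simp: fun_eq_iff)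
  have "(\<Sum>z\<in>UNIV. f z * lift_last X $ z $ (x, y)) = (\<Sum>x'\<in>UNIV. if x'(?L := x ?L) = x then
     \<Sum>y'\<in>UNIV. if y'(?L := y ?L) = y then f (x', y') * X $ (x' ?L, y' ?L) $ (x ?L, y ?L) else 0 else 0)"
    unfolding sum_UNIV_prod by (intro sum.cong refl) (auto simp: lift_last_def last_labels_def sw intro!: sum.cong)
  then show ?thesis unfolding sum_same_rest[of x] sum_same_rest[of y] by simp
qed

lemma last_trace_lift: "last_trace X \<rho> = trace (lift_last X ** \<rho>)"
proof -
  have "trace (lift_last X ** \<rho>) = (\<Sum>x\<in>UNIV. \<Sum>y\<in>UNIV. \<Sum>z\<in>UNIV. lift_last X $ (x, y) $ z * \<rho> $ z $ (x, y))"
    unfolding trace_nth matmul_nth by (rule sum_UNIV_prod)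
  then show ?thesis unfolding sum_lift_last last_trace_def ..
qed

lemma unitary_action_upd:
  fixes U :: "'p::finite cop" and V :: "'l::finite cop" and x y x' y' :: "'n::{finite,linorder} \<Rightarrow> ('p, 'l) block"
  defines "B \<equiv> block_unitary U V"
  defines "w \<equiv> (\<Prod>i\<in>UNIV - {last_block}. B $ x i $ x' i) * (\<Prod>i\<in>UNIV - {last_block}. cnjm B $ y i $ y' i)"
  shows "unitary_action U V $ (x(last_block := s), y(last_block := t)) $ (x'(last_block := s'), y'(last_block := t'))
    = kron B (cnjm B) $ (s, t) $ (s', t') * w"
  unfolding unitary_action_eq B_def[symmetric] prod_upd_last2[of "\<lambda>s t. B $ s $ t"] prod_upd_last2[of "\<lambda>s t. cnjm B $ s $ t"]
    w_def kron_nth fst_conv snd_conv by (simp only: mult_ac)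

text \<open>An entry of the unitary action is an entry of its part on the last pair times a weight
  from the other labels, and the lifted operator touches only the former.\<close>

lemma lift_last_commute:
  fixes U :: "'p::finite cop" and V :: "'l::finite cop"
  assumes X: "X ** kron (block_unitary U V) (cnjm (block_unitary U V)) = kron (block_unitary U V) (cnjm (block_unitary U V)) ** X"
  shows "lift_last X ** unitary_action U V = unitary_action U V ** (lift_last X :: ('p, 'l, 'n::{finite,linorder}) sys cop)"
proof -
  let ?L = "last_block :: 'n"
  let ?B = "block_unitary U V"
  let ?W = "unitary_action U V :: ('p, 'l, 'n) sys cop"
  have "(lift_last X ** ?W) $ (x, y) $ (x', y') = (?W ** lift_last X) $ (x, y) $ (x', y')" for x y x' y'
  proof -
    define w where "w = (\<Prod>i\<in>UNIV - {?L}. ?B $ x i $ x' i) * (\<Prod>i\<in>UNIV - {?L}. cnjm ?B $ y i $ y' i)"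
    have 1: "?W $ (x(?L := s), y(?L := t)) $ (x', y') = kron ?B (cnjm ?B) $ (s, t) $ (x' ?L, y' ?L) * w" for s t
      using unitary_action_upd[of U V x s y t x' "x' ?L" y' "y' ?L"] unfolding fun_upd_triv w_def .
    have 2: "?W $ (x, y) $ (x'(?L := s), y'(?L := t)) = kron ?B (cnjm ?B) $ (x ?L, y ?L) $ (s, t) * w" for s t
      using unitary_action_upd[of U V x "x ?L" y "y ?L" x' s y' t] unfolding fun_upd_triv w_def .
    have "(lift_last X ** ?W) $ (x, y) $ (x', y') = (X ** kron ?B (cnjm ?B)) $ (x ?L, y ?L) $ (x' ?L, y' ?L) * w"
      unfolding matmul_nth sum_lift_last 1 sum_UNIV_prod[of "\<lambda>k. X $ (x ?L, y ?L) $ k * kron ?B (cnjm ?B) $ k $ (x' ?L, y' ?L)"] sum_distrib_right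
      by (simp only: mult.assoc)
    also have "\<dots> = (kron ?B (cnjm ?B) ** X) $ (x ?L, y ?L) $ (x' ?L, y' ?L) * w" unfolding X ..
    also have "\<dots> = (?W ** lift_last X) $ (x, y) $ (x', y')"
      unfolding matmul_nth sum_lift_last_right 2 sum_UNIV_prod[of "\<lambda>k. kron ?B (cnjm ?B) $ (x ?L, y ?L) $ k * X $ k $ (x' ?L, y' ?L)"] sum_distrib_right
      by (simp only: mult_ac)
    finally show ?thesis .
  qed
  then show ?thesis unfolding vec_eq_iff by (simp only: split_paired_All) blast
qed

lemma reindex_mult:
  fixes f :: "'a::finite \<Rightarrow> 'b::finite" and A B :: "'b cop"
  assumes f: "bij f"
  shows "(\<chi> r s. A $ f r $ f s) ** (\<chi> r s. B $ f r $ f s) = (\<chi> r s. (A ** B) $ f r $ f s)"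
proof -
  have "(\<Sum>k\<in>UNIV. A $ f r $ f k * B $ f k $ f s) = (\<Sum>k\<in>UNIV. A $ f r $ k * B $ k $ f s)" for r s
    by (rule sum.reindex_bij_betw[OF f])
  then show ?thesis by (simp add: vec_eq_iff matmul_nth)
qed

text \<open>The double sum against the maximally entangled vector collapses to entries of U times
  its adjoint.\<close>

lemma kron_cnjm_maxvec:
  assumes "unitary (U :: 'l::finite cop)"
  shows "kron U (cnjm U) ** max_entangled = max_entangled"
proof -
  have UU: "(\<Sum>j\<in>UNIV. U $ i $ j * cnj (U $ i' $ j)) = (if i = i' then 1 else 0)" for i i'
  proof -
    have "(U ** adj U) $ i $ i' = (mat 1 :: 'l cop) $ i $ i'" using assms by (simp add: unitary_def)
    then show ?thesis by (simp add: matmul_nth mat_def)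
  qed
  have f: "(\<Sum>k\<in>UNIV. kron U (cnjm U) $ r $ k * maxvec k) = maxvec r" for r
  proof -
    let ?c = "complex_of_real (1 / sqrt (real CARD('l)))"
    have "(\<Sum>k\<in>UNIV. kron U (cnjm U) $ r $ k * maxvec k)
      = (\<Sum>j\<in>UNIV. \<Sum>j'\<in>UNIV. if j = j' then U $ fst r $ j * cnj (U $ snd r $ j') * ?c else 0)"
      unfolding sum_UNIV_prod by (intro sum.cong refl) (simp add: maxvec_def)
    also have "\<dots> = (\<Sum>j\<in>UNIV. U $ fst r $ j * cnj (U $ snd r $ j)) * ?c"
      by (simp add: sum_distrib_right sum_divide_distrib)
    finally show ?thesis unfolding UU maxvec_def by simp
  qed
  have "(kron U (cnjm U) ** outer maxvec) $ r $ s = outer maxvec $ r $ s" for r s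
    unfolding matmul_nth outer_nth mult.assoc[symmetric] sum_distrib_right[symmetric] f ..
  then show ?thesis unfolding max_entangled_outer vec_eq_iff by blast
qed

lemma max_entangled_commute:
  assumes U: "unitary (U :: 'l::finite cop)"
  shows "max_entangled ** kron U (cnjm U) = kron U (cnjm U) ** max_entangled"
proof -
  have "adj (kron U (cnjm U)) = kron (adj U) (cnjm (adj U))" by (simp add: vec_eq_iff)
  then have "adj (kron U (cnjm U)) ** max_entangled = max_entangled"
    using kron_cnjm_maxvec[OF unitary_adj[OF U]] by simp
  then have "adj (adj (kron U (cnjm U)) ** max_entangled) = adj max_entangled" by simp
  then have "max_entangled ** kron U (cnjm U) = max_entangled"
    unfolding adj_matmul adj_adj psd_adj[OF psd_max_entangled] .
  then show ?thesis using kron_cnjm_maxvec[OF U] by simp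
qed

text \<open>Here the shape of the channel provides the symmetry: the Choi operator combines the
  identity and the maximally entangled state, and both commute with U tensor its conjugate.\<close>

lemma choi_op_depolarizing:
  "choi_op (depolarizing p :: 'p::finite cop \<Rightarrow> 'p cop)
    = cscale ((of_nat CARD('p))\<^sup>2 * of_real (1 - p)) max_entangled + cscale (of_real p) (mat 1)"
proof -
  have tr: "trace (unit_mat q q' :: 'p cop) = (if q = q' then 1 else 0)" for q q'
  proof -
    have "trace (unit_mat q q' :: 'p cop) = (\<Sum>i\<in>UNIV. if i = q then if q = q' then 1 else 0 else 0)"
      unfolding trace_nth unit_mat_nth by (intro sum.cong refl) auto
    then show ?thesis by simp
  qed
  have "choi_op (depolarizing p) $ (i, q) $ (i', q') =
    (cscale ((of_nat CARD('p))\<^sup>2 * of_real (1 - p)) max_entangled + cscale (of_real p) (mat 1)) $ (i, q) $ (i', q')"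
    for i q i' q' :: 'p
    unfolding choi_op_nth[OF complex_linear_depolarizing] depolarizing_def tr
    by (simp add: unit_mat_nth max_entangled_def mat_def power2_eq_square field_simps)
  then show ?thesis unfolding vec_eq_iff by (simp only: split_paired_All) blast
qed

text \<open>After regrouping, the objective systems carry U tensor its conjugate and V tensor its
  conjugate, under which each factor of the objective is invariant; on the copies the objective is
  the identity.\<close>

lemma block_objective_commute:
  fixes U :: "'p::finite cop" and V :: "'l::finite cop"
  assumes U: "unitary U" and V: "unitary V"
  shows "block_objective (depolarizing p) ** kron (block_unitary U V) (cnjm (block_unitary U V))
    = kron (block_unitary U V) (cnjm (block_unitary U V)) ** block_objective (depolarizing p)"
proof -
  let ?K = "kron (kron (kron U (cnjm U)) (kron V (cnjm V))) (kron (kron (cnjm U) U) (kron (cnjm V) V))"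
  let ?G = "kron (kron (choi_op (depolarizing p :: 'p cop \<Rightarrow> 'p cop)) (max_entangled :: ('l \<times> 'l) cop)) (mat 1)"
  have K: "kron (block_unitary U V) (cnjm (block_unitary U V)) = (\<chi> r s. ?K $ split_blocks r $ split_blocks s)"
  proof -
    have "kron (block_unitary U V) (cnjm (block_unitary U V)) $ r $ s = ?K $ split_blocks r $ split_blocks s" for r s
    proof -
      obtain p pc l lc q qc m mc where r: "r = ((p, pc, l, lc), (q, qc, m, mc))" by (metis surj_pair)
      obtain p' pc' l' lc' q' qc' m' mc' where s: "s = ((p', pc', l', lc'), (q', qc', m', mc'))" by (metis surj_pair)
      show ?thesis unfolding r s by (simp add: block_unitary_kron)
    qed
    then show ?thesis by (simp add: vec_eq_iff)
  qed
  have "choi_op (depolarizing p) ** kron U (cnjm U) = kron U (cnjm U) ** choi_op (depolarizing p)"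
    unfolding choi_op_depolarizing matrix_add_rdistrib matrix_add_ldistrib cscale_matmul_left cscale_matmul_right
      max_entangled_commute[OF U] matrix_mul_lid matrix_mul_rid ..
  then have "?G ** ?K = ?K ** ?G"
    unfolding kron_mult max_entangled_commute[OF V] matrix_mul_lid matrix_mul_rid by simp
  then show ?thesis
    unfolding K block_objective_def reindex_mult[OF bij_split_blocks] by simp
qed

lemma sdp_objective_conj:
  fixes \<rho> :: "('p::finite, 'l::finite, 'n::{finite,linorder}) sys cop"
  assumes U: "unitary U" and V: "unitary V"
  shows "sdp_objective (depolarizing p) (unitary_action U V ** \<rho> ** adj (unitary_action U V)) = sdp_objective (depolarizing p) \<rho>"
proof -
  let ?W = "unitary_action U V :: ('p, 'l, 'n) sys cop"
  let ?X = "lift_last (block_objective (depolarizing p)) :: ('p, 'l, 'n) sys cop"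
  have W: "adj ?W ** ?W = mat 1" using unitary_unitary_action[OF U V, where 'n = 'n] by (simp add: unitary_def)
  have "adj ?W ** ?X ** ?W = adj ?W ** (?X ** ?W)" by (simp only: matrix_mul_assoc)
  also have "\<dots> = adj ?W ** ?W ** ?X"
    unfolding lift_last_commute[OF block_objective_commute[OF U V]] by (simp only: matrix_mul_assoc)
  also have "\<dots> = ?X" unfolding W by (rule matrix_mul_lid)
  finally show ?thesis
    unfolding sdp_objective_last_trace last_trace_lift trace_conj by simp
qed

section \<open>Compactness, convexity and an invariant optimum\<close>

lemma closed_psd: "closed {A :: 'a::finite cop. psd A}"
proof -
  have "{A :: 'a cop. psd A} = {A. \<forall>x. 0 \<le> Re (ses A x x) \<and> Im (ses A x x) = 0}"
    by (auto simp: psd_iff_ses complex_nonneg_Reals_iff)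
  also have "closed \<dots>"
    unfolding ses_def
    by (intro closed_Collect_all closed_Collect_conj closed_Collect_le closed_Collect_eq continuous_intros)
  finally show ?thesis .
qed

text \<open>Each row of a factor has as squared norm a diagonal entry, hence at most the trace; an
  entry of A is an inner product of two rows.\<close>

lemma psd_entry_le:
  fixes A :: "'a::finite cop"
  assumes A: "psd A" and tr: "trace A = 1"
  shows "cmod (A $ i $ j) \<le> 1"
proof -
  obtain T :: "'a \<Rightarrow> 'a \<Rightarrow> complex" where T: "\<And>i j. A $ i $ j = (\<Sum>k\<in>UNIV. T i k * cnj (T j k))"
    using psd_factor[OF A] by blast
  have d: "(\<Sum>k\<in>UNIV. (cmod (T i k))\<^sup>2) \<le> 1" for i
  proof -
    have "(\<Sum>k\<in>UNIV. (cmod (T i k))\<^sup>2) = Re (A $ i $ i)" unfolding T cnj_mult_self by simp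
    also have "\<dots> \<le> (\<Sum>i\<in>UNIV. Re (A $ i $ i))" by (rule member_le_sum) (auto simp: psd_diag[OF A])
    also have "\<dots> = 1" using tr unfolding trace_nth by (metis Re_sum one_complex.sel(1))
    finally show ?thesis .
  qed
  have "cmod (A $ i $ j) \<le> (\<Sum>k\<in>UNIV. cmod (T i k) * cmod (T j k))"
    unfolding T by (rule order_trans[OF norm_sum]) (simp add: norm_mult)
  also have "\<dots> \<le> (\<Sum>k\<in>UNIV. ((cmod (T i k))\<^sup>2 + (cmod (T j k))\<^sup>2) / 2)"
  proof (rule sum_mono)
    fix k
    have "0 \<le> (cmod (T i k) - cmod (T j k))\<^sup>2" by simp
    then show "cmod (T i k) * cmod (T j k) \<le> ((cmod (T i k))\<^sup>2 + (cmod (T j k))\<^sup>2) / 2"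
      by (simp add: power2_diff)
  qed
  also have "\<dots> \<le> 1" using d[of i] d[of j] by (simp add: sum.distrib flip: sum_divide_distrib)
  finally show ?thesis .
qed

lemma closed_sym_under:
  "closed {\<rho> :: (('n::finite \<Rightarrow> 'k::finite) \<times> ('n \<Rightarrow> 'k)) cop. sym_under P \<rho>}"
proof -
  have "{\<rho> :: (('n \<Rightarrow> 'k) \<times> ('n \<Rightarrow> 'k)) cop. sym_under P \<rho>}
    = (\<Inter>\<pi>\<in>Collect P. {\<rho>. \<forall>x y z. \<rho> $ (x \<circ> \<pi>, y) $ z = \<rho> $ (x, y) $ z \<and> \<rho> $ (x, y \<circ> \<pi>) $ z = \<rho> $ (x, y) $ z})"
    by (auto simp: sym_under_def)
  also have "closed \<dots>"
    by (intro closed_INT ballI closed_Collect_all closed_Collect_conj closed_Collect_eq continuous_intros)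
  finally show ?thesis .
qed

lemma closed_constraints:
  "closed {\<rho> :: ('p::finite, 'l::finite, 'n::{finite,linorder}) sys cop. constraint_a \<rho>}"
  "closed {\<rho> :: ('p::finite, 'l::finite, 'n::{finite,linorder}) sys cop. constraint_b \<rho>}"
  unfolding constraint_a_def constraint_b_def
  by (intro closed_Collect_all closed_Collect_eq continuous_intros; simp)+

text \<open>All conditions are closed and the entries are bounded by 1. It makes the supremum of the
  program a maximum.\<close>

lemma compact_feasible: "compact {\<rho> :: ('p::finite, 'l::finite, 'n::{finite,linorder}) sys cop. sdp_feasible \<rho>}"
  unfolding compact_eq_bounded_closed
proof
  show "bounded {\<rho> :: ('p, 'l, 'n) sys cop. sdp_feasible \<rho>}"
    by (rule bounded_entries[where c = 1]) (auto simp: sdp_feasible_def intro: psd_entry_le)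
  have "closed {\<rho> :: ('p, 'l, 'n) sys cop. trace \<rho> = 1}"
    unfolding trace_nth by (intro closed_Collect_eq continuous_intros)
  then have "closed ({\<rho> :: ('p, 'l, 'n) sys cop. psd \<rho>} \<inter> {\<rho>. trace \<rho> = 1} \<inter> {\<rho>. constraint_a \<rho>} \<inter> {\<rho>. constraint_b \<rho>} \<inter> {\<rho>. bose_symmetric \<rho>})"
    unfolding bose_symmetric_iff by (intro closed_Int closed_psd closed_constraints closed_sym_under)
  also have "({\<rho> :: ('p, 'l, 'n) sys cop. psd \<rho>} \<inter> {\<rho>. trace \<rho> = 1} \<inter> {\<rho>. constraint_a \<rho>} \<inter> {\<rho>. constraint_b \<rho>} \<inter> {\<rho>. bose_symmetric \<rho>}) = {\<rho>. sdp_feasible \<rho>}"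
    by (auto simp: sdp_feasible_def)
  finally show "closed {\<rho> :: ('p, 'l, 'n) sys cop. sdp_feasible \<rho>}" .
qed

lemma continuous_sdp_objective: "continuous_on S (sdp_objective N)"
  unfolding sdp_objective_last_trace[abs_def] last_trace_def by (intro continuous_intros)

lemma scaleR_combination_nth: "(u *\<^sub>R A + v *\<^sub>R B) $ i $ j = of_real u * A $ i $ j + of_real v * (B :: 'a::finite cop) $ i $ j"
  by (simp add: scaleR_conv_of_real[where 'a = complex])

lemma convex_feasible: "convex {\<rho> :: ('p::finite, 'l::finite, 'n::{finite,linorder}) sys cop. sdp_feasible \<rho>}"
  unfolding convex_def
proof (clarify)
  fix A B :: "('p, 'l, 'n) sys cop" and u v :: real
  assume A: "sdp_feasible A" and B: "sdp_feasible B" and uv: "0 \<le> u" "0 \<le> v" "u + v = 1"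
  have comb: "u *\<^sub>R A + v *\<^sub>R B = cscale (of_real u) A + cscale (of_real v) B"
  proof -
    have "(u *\<^sub>R A + v *\<^sub>R B) $ i $ j = (cscale (of_real u) A + cscale (of_real v) B) $ i $ j" for i j
      unfolding scaleR_combination_nth by simp
    then show ?thesis unfolding vec_eq_iff by blast
  qed
  have "psd (u *\<^sub>R A + v *\<^sub>R B)"
    using psd_cscale[of A u] psd_cscale[of B v] A B uv
    unfolding comb psd_iff_ses ses_mat_add sdp_feasible_def by simp
  moreover have "trace (u *\<^sub>R A + v *\<^sub>R B) = 1"
    using A B uv(3) unfolding comb trace_add trace_cscale sdp_feasible_def by (simp flip: of_real_add)
  moreover have "constraint_a (u *\<^sub>R A + v *\<^sub>R B)"
    using A B unfolding sdp_feasible_def constraint_a_def scaleR_combination_nth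
    by (simp add: sum.distrib distrib_left mult.left_commute flip: sum_distrib_left)
  moreover have "constraint_b (u *\<^sub>R A + v *\<^sub>R B)"
    using A B unfolding sdp_feasible_def constraint_b_def scaleR_combination_nth
    by (simp add: sum.distrib distrib_right add_divide_distrib mult.assoc flip: sum_distrib_left times_divide_eq_right)
  moreover have "bose_symmetric (u *\<^sub>R A + v *\<^sub>R B)"
    using A B unfolding sdp_feasible_def bose_symmetric_iff sym_under_def scaleR_combination_nth by simp
  ultimately show "sdp_feasible (u *\<^sub>R A + v *\<^sub>R B)" unfolding sdp_feasible_def by blast
qed

lemma sdp_objective_combination: "sdp_objective N (u *\<^sub>R A + v *\<^sub>R B) = u * sdp_objective N A + v * sdp_objective N B"
proof -
  have "last_trace X (u *\<^sub>R A + v *\<^sub>R B) = of_real u * last_trace X A + of_real v * last_trace X B" for X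
    unfolding last_trace_def scaleR_combination_nth sum_distrib_left sum.distrib[symmetric]
    by (intro sum.cong refl) (simp add: algebra_simps)
  then show ?thesis unfolding sdp_objective_last_trace by simp
qed

text \<open>The norm of the matrix type is the Frobenius norm, and written as a trace it is visibly
  invariant under conjugation by unitaries.\<close>

lemma norm_cop: "(norm A)\<^sup>2 = Re (trace (adj A ** A))" for A :: "'a::finite cop"
proof -
  have "(norm A)\<^sup>2 = (\<Sum>i\<in>UNIV. \<Sum>j\<in>UNIV. (cmod (A $ i $ j))\<^sup>2)"
    unfolding norm_vec_def L2_set_def by (simp add: sum_nonneg)
  also have "\<dots> = (\<Sum>j\<in>UNIV. \<Sum>i\<in>UNIV. (cmod (A $ i $ j))\<^sup>2)" by (rule sum.swap)
  also have "\<dots> = Re (trace (adj A ** A))" unfolding trace_nth matmul_nth adj_nth cnj_mult_self by simp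
  finally show ?thesis .
qed

lemma norm_conj_unitary:
  fixes W A :: "'a::finite cop"
  assumes W: "unitary W"
  shows "norm (W ** A ** adj W) = norm A"
proof -
  have W1: "adj W ** W = mat 1" using W by (simp add: unitary_def)
  have "adj (W ** A ** adj W) ** (W ** A ** adj W) = W ** adj A ** (adj W ** W) ** A ** adj W"
    by (simp add: adj_matmul matrix_mul_assoc)
  also have "\<dots> = W ** (adj A ** A) ** adj W" unfolding W1 by (simp add: matrix_mul_assoc matrix_mul_rid)
  finally have "(norm (W ** A ** adj W))\<^sup>2 = (norm A)\<^sup>2"
    unfolding norm_cop by (simp add: trace_conj_unitary[OF W1])
  then show ?thesis by (simp add: power2_eq_iff_nonneg)
qed

lemma exists_feasible: "\<exists>\<rho> :: ('p::finite, 'l::finite, 'n::{finite,linorder}) sys cop. sdp_feasible \<rho>"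
proof -
  obtain \<alpha> \<beta> :: "('p \<times> 'l) cop" where "decoder_state \<alpha>" "encoder_state \<beta>" using states_exist .
  \<comment> \<open>The parameter 0 is an arbitrary choice: only the feasibility of the constructed
    state is wanted, not its value.\<close>
  from feasible_of_states[OF complex_linear_depolarizing[of 0] this] show ?thesis by metis
qed

text \<open>The set of optimal states is convex, compact and invariant under the unitaries, so its element
  of least Frobenius norm is fixed by them; this replaces averaging over Haar measure.\<close>

lemma sdp_symmetric_optimum:
  obtains \<rho> :: "('p::finite, 'l::finite, 'n::{finite,linorder}) sys cop" where
    "sdp_feasible \<rho>" "sdp_objective (depolarizing p) \<rho> = sdp_value (depolarizing p :: 'p cop \<Rightarrow> 'p cop) TYPE('l) TYPE('n)"
    "\<And>\<rho>' :: ('p, 'l, 'n) sys cop. sdp_feasible \<rho>' \<Longrightarrow> sdp_objective (depolarizing p) \<rho>' \<le> sdp_value (depolarizing p :: 'p cop \<Rightarrow> 'p cop) TYPE('l) TYPE('n)"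
    "\<And>U V. unitary U \<Longrightarrow> unitary V \<Longrightarrow> unitary_action U V ** \<rho> ** adj (unitary_action U V) = \<rho>"
proof -
  let ?F = "{\<rho> :: ('p, 'l, 'n) sys cop. sdp_feasible \<rho>}"
  let ?f = "sdp_objective (depolarizing p) :: ('p, 'l, 'n) sys cop \<Rightarrow> real"
  have "?F \<noteq> {}" using exists_feasible by blast
  then obtain \<rho>0 where \<rho>0: "sdp_feasible \<rho>0" and max: "\<And>\<rho>. sdp_feasible \<rho> \<Longrightarrow> ?f \<rho> \<le> ?f \<rho>0"
    using continuous_attains_sup[OF compact_feasible _ continuous_sdp_objective] by blast
  have val: "sdp_value (depolarizing p :: 'p cop \<Rightarrow> 'p cop) TYPE('l) TYPE('n) = ?f \<rho>0"
    unfolding sdp_value_def by (rule cSup_eq_maximum) (use \<rho>0 max in auto)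
  define S where "S = {\<rho>. sdp_feasible \<rho> \<and> ?f \<rho> = ?f \<rho>0}"
  have S: "S = ?F \<inter> {\<rho>. ?f \<rho> = ?f \<rho>0}" by (auto simp: S_def)
  have "closed {\<rho>. ?f \<rho> = ?f \<rho>0}"
    by (intro closed_Collect_eq continuous_sdp_objective continuous_intros)
  then have closed: "closed S" unfolding S using compact_imp_closed[OF compact_feasible] by (intro closed_Int)
  have "convex {\<rho>. ?f \<rho> = ?f \<rho>0}"
    unfolding convex_def by (auto simp: sdp_objective_combination simp flip: distrib_right)
  then have convex: "convex S" unfolding S by (intro convex_Int convex_feasible)
  have ne: "S \<noteq> {}" using \<rho>0 by (auto simp: S_def)
  obtain \<rho> where \<rho>: "\<rho> \<in> S" and min: "\<And>\<sigma>. \<sigma> \<in> S \<Longrightarrow> dist 0 \<rho> \<le> dist 0 \<sigma>"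
    using closest_point_exists[OF closed ne, of 0] by blast
  show thesis
  proof (rule that)
    show "sdp_feasible \<rho>" "?f \<rho> = sdp_value (depolarizing p :: 'p cop \<Rightarrow> 'p cop) TYPE('l) TYPE('n)"
      using \<rho> unfolding val S_def by auto
    show "?f \<rho>' \<le> sdp_value (depolarizing p :: 'p cop \<Rightarrow> 'p cop) TYPE('l) TYPE('n)" if "sdp_feasible \<rho>'" for \<rho>'
      using max that unfolding val by blast
    fix U :: "'p cop" and V :: "'l cop" assume UV: "unitary U" "unitary V"
    let ?T = "unitary_action U V ** \<rho> ** adj (unitary_action U V)"
    have "?T \<in> S"
      using \<rho> sdp_feasible_conj[OF UV, of \<rho>] sdp_objective_conj[OF UV, of p \<rho>] by (simp add: S_def)
    moreover have "dist 0 ?T = dist 0 \<rho>"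
      using norm_conj_unitary[OF unitary_unitary_action[OF UV]] by simp
    \<comment> \<open>The conjugated state is an optimal state of the same norm, and a closed convex
      set has only one element closest to 0.\<close>
    ultimately show "?T = \<rho>"
      using any_closest_point_unique[OF convex closed, of ?T \<rho> 0] \<rho> min by simp
  qed
qed

section \<open>Membership in the commutant and in the symmetric subspaces\<close>

lemma bose_symmetric_right:
  assumes "psd \<rho>" "bose_symmetric \<rho>" "\<sigma> permutes UNIV"
  shows "\<rho> ** perm_a \<sigma> = \<rho>" "\<rho> ** perm_b \<sigma> = \<rho>"
proof -
  have inv: "inv \<sigma> permutes UNIV" using assms(3) by (rule permutes_inv)
  have s: "\<rho> $ (x \<circ> inv \<sigma>, y) $ z = \<rho> $ (x, y) $ z" "\<rho> $ (x, y \<circ> inv \<sigma>) $ z = \<rho> $ (x, y) $ z" for x y z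
    using assms(2) inv unfolding bose_symmetric_iff sym_under_def by blast+
  have "\<rho> $ z $ (x \<circ> inv \<sigma>, y) = \<rho> $ z $ (x, y)" "\<rho> $ z $ (x, y \<circ> inv \<sigma>) = \<rho> $ z $ (x, y)" for x y z
    using s psd_herm[OF assms(1), of z] by metis+
  then have "(\<rho> ** perm_a \<sigma>) $ z $ (x, y) = \<rho> $ z $ (x, y)" "(\<rho> ** perm_b \<sigma>) $ z $ (x, y) = \<rho> $ z $ (x, y)" for x y z
    unfolding mult_perm_a[OF assms(3)] mult_perm_b[OF assms(3)] by blast+
  then show "\<rho> ** perm_a \<sigma> = \<rho>" "\<rho> ** perm_b \<sigma> = \<rho>"
    unfolding vec_eq_iff by (simp_all only: split_paired_All) blast+
qed

text \<open>Commutation with the generators passes to the generated algebra, through adjoints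
  because \<rho> is Hermitian. The two unitary groups are reached by setting the other unitary to
  the identity.\<close>

lemma mem_symmetry_commutant:
  fixes \<rho> :: "('p::finite, 'l::finite, 'n::{finite,linorder}) sys cop"
  assumes \<rho>: "psd \<rho>" "bose_symmetric \<rho>"
    and inv: "\<And>U V. unitary U \<Longrightarrow> unitary V \<Longrightarrow> unitary_action U V ** \<rho> ** adj (unitary_action U V) = \<rho>"
  shows "\<rho> \<in> symmetry_commutant"
proof -
  have W: "unitary_action U V ** \<rho> = \<rho> ** unitary_action U V" if UV: "unitary U" "unitary V" for U V
  proof -
    let ?W = "unitary_action U V :: ('p, 'l, 'n) sys cop"
    have "adj ?W ** ?W = mat 1" using unitary_unitary_action[OF UV, where 'n = 'n] by (simp add: unitary_def)
    then have "?W ** \<rho> = ?W ** \<rho> ** (adj ?W ** ?W)" by (simp add: matrix_mul_rid)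
    also have "\<dots> = (?W ** \<rho> ** adj ?W) ** ?W" by (simp only: matrix_mul_assoc)
    finally show ?thesis unfolding inv[OF UV] .
  qed
  have "A ** \<rho> = \<rho> ** A" if "A \<in> star_algebra symmetry_unitaries" for A
    using that
  proof induction
    case (gen A)
    then show ?case
      using W unitary_mat_1[where 'a = 'p] unitary_mat_1[where 'a = 'l] \<rho>(2) bose_symmetric_right[OF \<rho>] unfolding symmetry_unitaries_def bose_symmetric_def by auto
  next
    case (adj A)
    then have "adj (A ** \<rho>) = adj (\<rho> ** A)" by simp
    then show ?case unfolding adj_matmul psd_adj[OF \<rho>(1)] by simp
  next
    case (mult A B)
    have "A ** B ** \<rho> = A ** (B ** \<rho>)" by (simp only: matrix_mul_assoc)
    also have "\<dots> = (A ** \<rho>) ** B" unfolding mult.IH(2) by (simp only: matrix_mul_assoc)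
    finally show ?case unfolding mult.IH(1) by (simp only: matrix_mul_assoc)
  qed (simp_all add: matrix_mul_lid matrix_mul_rid matrix_add_rdistrib matrix_add_ldistrib cscale_matmul_left cscale_matmul_right)
  then show ?thesis unfolding symmetry_commutant_def commutant_def by blast
qed

lemma average_fixed:
  assumes "\<And>\<sigma>. \<sigma> permutes (UNIV :: 'n::finite set) \<Longrightarrow> f \<sigma> = A"
  shows "cscale (1 / fact CARD('n)) (\<Sum>\<sigma> | \<sigma> permutes (UNIV :: 'n set). f \<sigma>) = (A :: 'a::finite cop)"
proof -
  have "(\<Sum>\<sigma> | \<sigma> permutes (UNIV :: 'n set). f \<sigma>) = (\<Sum>\<sigma> | \<sigma> permutes (UNIV :: 'n set). A)"
    by (rule sum.cong) (auto simp: assms)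
  also have "\<dots> = cscale (of_nat (card {\<sigma>. \<sigma> permutes (UNIV :: 'n set)})) A"
    unfolding vec_eq_iff sum_component cscale_nth by simp
  also have "card {\<sigma>. \<sigma> permutes (UNIV :: 'n set)} = fact CARD('n)"
    by (rule card_permutations) auto
  finally show ?thesis by (simp add: cscale_cscale)
qed

lemma matmul_sum: "(\<Sum>i\<in>I. f i) ** A = (\<Sum>i\<in>I. f i ** A)" "A ** (\<Sum>i\<in>I. f i) = (\<Sum>i\<in>I. A ** f i)"
  for A :: "'a::finite cop"
  unfolding vec_eq_iff matmul_nth sum_component sum_distrib_left sum_distrib_right
  by (auto intro: sum.swap)

text \<open>Invariance under every permutation gives invariance under their average, on the left by
  Bose symmetry itself and on the right by taking adjoints.\<close>

lemma bose_symmetric_on_symmetric_subspaces: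
  assumes \<rho>: "psd \<rho>" "bose_symmetric \<rho>"
  shows "on_symmetric_subspaces \<rho>"
proof -
  have a: "perm_a \<sigma> ** \<rho> = \<rho>" "perm_b \<sigma> ** \<rho> = \<rho>" if "\<sigma> permutes UNIV" for \<sigma>
    using that \<rho>(2) unfolding bose_symmetric_def by blast+
  have 1: "sym_proj_a ** \<rho> = \<rho>" "sym_proj_b ** \<rho> = \<rho>"
    unfolding sym_proj_a_def sym_proj_b_def cscale_matmul_left matmul_sum by (intro average_fixed a; assumption)+
  have 2: "\<rho> ** sym_proj_a = \<rho>" "\<rho> ** sym_proj_b = \<rho>"
    unfolding sym_proj_a_def sym_proj_b_def cscale_matmul_right matmul_sum
    by (intro average_fixed bose_symmetric_right[OF \<rho>]; assumption)+
  have "(sym_proj_a ** sym_proj_b) ** \<rho> ** (sym_proj_a ** sym_proj_b) = sym_proj_a ** (sym_proj_b ** \<rho>) ** sym_proj_a ** sym_proj_b"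
    by (simp only: matrix_mul_assoc)
  then show ?thesis unfolding on_symmetric_subspaces_def by (simp only: 1 2)
qed

text \<open>The losses are d \<le> D, n - 1 + D \<ge> n, 2 sqrt (D - 1) \<le> D and ln (n + D) \<ge>
  1. The factor \<open>ln 2\<close> of the claim turns its binary logarithm into the natural
  one.\<close>

lemma rate_bound:
  fixes d D n \<epsilon> :: real
  assumes D: "D \<ge> 2" and d: "0 \<le> d" "d \<le> D" and n: "n \<ge> 1" and \<epsilon>: "\<epsilon> = (D - 1) / (n - 1 + D)"
  shows "16 * d * \<epsilon> \<le> 4 * D\<^sup>2 * (sqrt (4 * ln 2 * (D - 1) * log 2 (n + D)) / n)"
proof -
  define s where "s = sqrt (D - 1)"
  have s: "s * s = D - 1" "s \<ge> 0" using D by (simp_all add: s_def)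
  have "0 \<le> (s - 1) * (s - 1)" by simp
  then have sD: "2 * s \<le> D" using s by (simp add: algebra_simps)
  \<comment> \<open>Here n + D \<ge> 3, and 3 exceeds Euler's number.\<close>
  have "exp 1 \<le> n + D" using exp_le D n by linarith
  then have ln1: "1 \<le> ln (n + D)" using D n by (subst ln_ge_iff) auto
  have "4 * ln 2 * (D - 1) * log 2 (n + D) = 4 * (D - 1) * ln (n + D)" by (simp add: log_def)
  moreover have "4 * (D - 1) * 1 \<le> 4 * (D - 1) * ln (n + D)" using ln1 D by (intro mult_left_mono) auto
  ultimately have "sqrt (4 * (D - 1)) \<le> sqrt (4 * ln 2 * (D - 1) * log 2 (n + D))" by simp
  moreover have "sqrt (4 * (D - 1)) = 2 * s" unfolding s_def real_sqrt_mult by simp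
  ultimately have sq: "2 * s \<le> sqrt (4 * ln 2 * (D - 1) * log 2 (n + D))" by (simp only:)
  have "\<epsilon> \<le> (D - 1) / n" unfolding \<epsilon> using D n by (intro divide_left_mono) auto
  then have "16 * d * \<epsilon> \<le> 16 * D * ((D - 1) / n)"
    using d D n \<epsilon> by (intro mult_mono) auto
  also have "\<dots> = 8 * D * s * (2 * s) / n" unfolding s(1)[symmetric] by simp
  also have "\<dots> \<le> 8 * D * s * D / n" using s(2) D n sD by (intro divide_right_mono mult_left_mono) auto
  also have "\<dots> = 4 * D\<^sup>2 * (2 * s / n)" by (simp add: power2_eq_square)
  also have "\<dots> \<le> 4 * D\<^sup>2 * (sqrt (4 * ln 2 * (D - 1) * log 2 (n + D)) / n)"
    using sq n by (intro mult_left_mono divide_right_mono) auto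
  finally show ?thesis .
qed

text \<open>That the program may be restricted to the commutant and to the symmetric subspaces is
  expressed by one feasible state that lies in both and attains the supremum.\<close>

theorem theorem7p2:
  fixes p :: real
  assumes "completely_positive (depolarizing p :: 'p::finite cop \<Rightarrow> 'p cop)"
  shows "let N = (depolarizing p :: 'p cop \<Rightarrow> 'p cop);
             F = channel_fidelity N TYPE('l::finite);
             SDP = sdp_value N TYPE('l) TYPE('n::{finite, linorder});
             dP = real CARD('p); dL = real CARD('l); n = real CARD('n)
         in F \<le> SDP
          \<and> (\<exists>\<rho> :: ('p, 'l, 'n) sys cop. sdp_feasible \<rho> \<and> sdp_objective N \<rho> = SDP
               \<and> \<rho> \<in> symmetry_commutant \<and> on_symmetric_subspaces \<rho>)
          \<and> SDP - F \<le> 4 * dL ^ 4 * dP ^ 4 *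
               (sqrt (4 * ln 2 * (dL\<^sup>2 * dP\<^sup>2 - 1) * log 2 (n + dL\<^sup>2 * dP\<^sup>2)) / n)"
proof -
  define N where "N = (depolarizing p :: 'p cop \<Rightarrow> 'p cop)"
  define F where "F = channel_fidelity N TYPE('l)"
  define SDP where "SDP = sdp_value N TYPE('l) TYPE('n)"
  define dP where "dP = real CARD('p)"
  define dL where "dL = real CARD('l)"
  define n where "n = real CARD('n)"
  have N: "quantum_channel N" unfolding N_def by (rule quantum_channel_depolarizing[OF assms])
  then have lin: "complex_linear_map N" by (simp add: quantum_channel_def)
  obtain \<rho> :: "('p, 'l, 'n) sys cop" where \<rho>: "sdp_feasible \<rho>" "sdp_objective N \<rho> = SDP"
    and max: "\<And>\<rho>' :: ('p, 'l, 'n) sys cop. sdp_feasible \<rho>' \<Longrightarrow> sdp_objective N \<rho>' \<le> SDP"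
    and inv: "\<And>U V. unitary U \<Longrightarrow> unitary V \<Longrightarrow> unitary_action U V ** \<rho> ** adj (unitary_action U V) = \<rho>"
    using sdp_symmetric_optimum[of p, where 'p = 'p and 'l = 'l and 'n = 'n] unfolding N_def SDP_def by metis
  have F: "F = Sup {Re (pairing N \<alpha> \<beta>) | \<alpha> \<beta> :: ('p \<times> 'l) cop. decoder_state \<alpha> \<and> encoder_state \<beta>}"
    unfolding F_def by (rule channel_fidelity_eq[OF N])
  have le_SDP: "Re (pairing N \<alpha> \<beta>) \<le> SDP" if "decoder_state \<alpha>" "encoder_state \<beta>" for \<alpha> \<beta> :: "('p \<times> 'l) cop"
    using feasible_of_states[OF lin that, where 'n = 'n] max by metis
  have F_le: "F \<le> SDP"
    unfolding F
  proof (rule cSup_least)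
    obtain \<alpha> \<beta> :: "('p \<times> 'l) cop" where "decoder_state \<alpha>" "encoder_state \<beta>" using states_exist .
    then show "{Re (pairing N \<alpha> \<beta>) | \<alpha> \<beta> :: ('p \<times> 'l) cop. decoder_state \<alpha> \<and> encoder_state \<beta>} \<noteq> {}" by blast
  qed (auto intro: le_SDP)
  \<comment> \<open>The set defining F is bounded above by SDP, so that its supremum is indeed an
    upper bound.\<close>
  have le_F: "Re (pairing N \<alpha> \<beta>) \<le> F" if "decoder_state \<alpha>" "encoder_state \<beta>" for \<alpha> \<beta> :: "('p \<times> 'l) cop"
    unfolding F using that by (intro cSup_upper bdd_aboveI[of _ SDP]) (auto intro: le_SDP)
  define D where "D = dL\<^sup>2 * dP\<^sup>2"
  define \<epsilon> where "\<epsilon> = (D - 1) / (n - 1 + D)"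
  have card: "real CARD(('p, 'l) block) = D"
    by (simp add: D_def dL_def dP_def power2_eq_square)
  have dim: "dP \<ge> 1" "dL \<ge> 1" "n \<ge> 1" by (simp_all add: dP_def dL_def n_def Suc_le_eq)
  have bound: "SDP \<le> F + 2 * dP\<^sup>2 * (\<eta> + \<epsilon>\<^sup>2 / \<eta> + 6 * \<epsilon>)" if "\<eta> > 0" for \<eta>
    using sdp_objective_le[OF N \<rho>(1) le_F that, of \<epsilon>] unfolding \<rho>(2) card \<epsilon>_def n_def dP_def by simp
  have "SDP - F \<le> 4 * D\<^sup>2 * (sqrt (4 * ln 2 * (D - 1) * log 2 (n + D)) / n)"
  \<comment> \<open>For D = 1 the weight \<eta> = \<epsilon> would be 0, so \<eta> is made
    arbitrarily small instead; the claimed bound is then 0.\<close>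
  proof (cases "D = 1")
    case True
    then have "SDP \<le> F + 2 * dP\<^sup>2 * \<eta>" if "\<eta> > 0" for \<eta> using bound[OF that] by (simp add: \<epsilon>_def)
    from this[of "_ / (2 * dP\<^sup>2)"] have "SDP \<le> F + e" if "e > 0" for e
      using that dim(1) by simp
    then have "SDP \<le> F" by (rule field_le_epsilon)
    then show ?thesis using True by simp
  next
    case False
    have "dP\<^sup>2 \<le> D"
      using dim mult_mono[of 1 "dL\<^sup>2" "dP\<^sup>2" "dP\<^sup>2"] by (simp add: D_def)
    have "real CARD(('p, 'l) block) \<noteq> 1" unfolding card by (rule False)
    moreover have "CARD(('p, 'l) block) > 0" by (rule zero_less_card_finite)
    ultimately have "CARD(('p, 'l) block) \<ge> 2" by linarith
    then have "D \<ge> 2" unfolding card[symmetric] by linarith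
    then have \<epsilon>: "\<epsilon> > 0" using dim(3) by (simp add: \<epsilon>_def)
    \<comment> \<open>The weight \<eta> = \<epsilon> balances the first two terms, and the three
      terms add up to 8 \<epsilon>.\<close>
    have "SDP \<le> F + 2 * dP\<^sup>2 * (\<epsilon> + \<epsilon>\<^sup>2 / \<epsilon> + 6 * \<epsilon>)" by (rule bound[OF \<epsilon>])
    also have "\<dots> = F + 16 * dP\<^sup>2 * \<epsilon>" using \<epsilon> by (simp add: power2_eq_square)
    finally have "SDP - F \<le> 16 * dP\<^sup>2 * \<epsilon>" by simp
    also have "\<dots> \<le> 4 * D\<^sup>2 * (sqrt (4 * ln 2 * (D - 1) * log 2 (n + D)) / n)"
      by (rule rate_bound[OF \<open>D \<ge> 2\<close> _ \<open>dP\<^sup>2 \<le> D\<close> dim(3) \<epsilon>_def]) simp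
    finally show ?thesis .
  qed
  moreover have "4 * D\<^sup>2 = 4 * dL ^ 4 * dP ^ 4" by (simp add: D_def power_mult_distrib flip: power_mult)
  ultimately have rate: "SDP - F \<le> 4 * dL ^ 4 * dP ^ 4 * (sqrt (4 * ln 2 * (dL\<^sup>2 * dP\<^sup>2 - 1) * log 2 (n + dL\<^sup>2 * dP\<^sup>2)) / n)"
    unfolding D_def by simp
  have "psd \<rho>" "bose_symmetric \<rho>" using \<rho>(1) unfolding sdp_feasible_def by auto
  then have "\<rho> \<in> symmetry_commutant" "on_symmetric_subspaces \<rho>"
    using mem_symmetry_commutant[OF _ _ inv] bose_symmetric_on_symmetric_subspaces by blast+
  with \<rho> F_le rate show ?thesis
    unfolding Let_def N_def F_def SDP_def dP_def dL_def n_def by blast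
qed

end
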